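(* Let $M$ be a smooth manifold, let $S$ be a $C^1$ type $(r,s)$ tensor field on $M$, let $Z\in\mathfrak X(M)$ be a smooth vector field and $\nabla$ a smooth covariant derivative on $M$. Then $$\nabla_Z(\iota^r_s(S))\approx\iota^r_s(\nabla_ZS).$$
   Context: $M$ is a smooth (Hausdorff, paracompact) manifold of dimension $n$; $I=(0,1]$. $\mathcal T^r_s(M)$: smooth type $(r,s)$ tensor fields. $\tilde{\mathcal D}^s_r(M)$: smooth compactly supported type $(s,r)$ tensor densities; $\tilde{\mathcal D}(M)=\tilde{\mathcal D}^0_0(M)$; $\mathcal D'^r_s(M)$ is the dual of $\tilde{\mathcal D}^s_r(M)$; locally integrable tensor fields are regarded as elements of it. $\mathrm{TO}(M)=\Gamma(M\times M,TM\boxtimes T^*M)$ (transport operators $\Upsilon^a{}_b(x,y)$); $\Upsilon^*(x,y):T_x^*M\to T_y^*M$, $\alpha_a\mapsto\Upsilon^a{}_b(x,y)\alpha_a$; $\Upsilon_*(x,y):T_xM\to T_yM$, $Y^b\mapsto\Upsilon^a{}_b(y,x)Y^b$. $\mathrm{SK}(M)=C^\infty(M,\tilde{\mathcal D}(M))$ (smoothing kernels $x\mapsto\omega_x$). $\hat{\mathcal E}^r_s(M)$: all maps $\mathrm{TO}(M)\times\mathrm{SK}(M)\to\mathcal T^r_s(M)$ smooth in the sense of convenient calculus. Embedding: $(\iota^r_s(T)(\Upsilon,\omega))(x)(\alpha^1,\dots,\alpha^r,Y_1,\dots,Y_s)=\langle T,\Psi_x\rangle$, $\Psi_x(y)=\Upsilon^*(x,y)\alpha^1\otimes\cdots\otimes\Upsilon^*(x,y)\alpha^r\otimes\Upsilon_*(x,y)Y_1\otimes\cdots\otimes\Upsilon_*(x,y)Y_s\otimes\omega_x(y)$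 for $T\in\mathcal D'^r_s(M)$. Covariant derivative: for $T\in\hat{\mathcal E}^r_s(M)$, $(\nabla_ZT)(\Upsilon,\omega)=\nabla_Z(T(\Upsilon,\omega))$. Delta nets: write $(\mathcal L_X^{\Omega^n}\omega)_x=\mathcal L_X(\omega_x)$ and $\mathcal L^{SK}_X=\mathcal L^{\Omega^n}_X+\mathcal L^{C^\infty}_X$, where $\mathcal L_X^{C^\infty}\omega$ is the directional derivative of $x\mapsto\omega_x$ along $X$. $\tilde{\mathcal A}(M)$ is the set of nets $(\omega_\varepsilon)_\varepsilon\in\mathrm{SK}(M)^I$ such that, for a Riemannian metric $h$ and every compact $K\subset M$: (1) there are $C,\varepsilon_0>0$ with $\operatorname{supp}\omega_{x,\varepsilon}\subseteq B^h_{C\varepsilon}(x)$ for $x\in K$, $\varepsilon<\varepsilon_0$; (2) for all $k,l\in\mathbb N_0$ and smooth vector fields $Y_i,X_j$, $\sup_{x\in K}\int_M|(\mathcal L^{\Omega^n}_{Y_1}\cdots\mathcal L^{\Omega^n}_{Y_k}\mathcal L^{SK}_{X_1}\cdots\mathcal L^{SK}_{X_l}\omega_\varepsilon)_x|=O(\varepsilon^{-k})$; (3) for all $f\in C^\infty(M)$, $m\in\mathbb N$, $\sup_{x\in K}|f(x)-\int_Mf\,\omega_{x,\varepsilon}|=O(\varepsilon^m)$. Admissible nets: $\Upsilon(M)$ is the set of $(\Upsilon_\varepsilon)_\varepsilon\in\mathrm{TO}(M)^I$ such that (i) in each chart all derivatives $\partial_x^k\partial_y^l\Upsilon^a{}_{b,\varepsilon}$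 are bounded uniformly for small $\varepsilon$ in a neighbourhood of each diagonal point $(x,x)$; (ii) $\Upsilon^a{}_{b,\varepsilon}(x,x)=\delta^a_b$ for all $x$. Association: $T\approx0$ iff for each $\Psi\in\tilde{\mathcal D}^s_r(M)$, $(\omega_\varepsilon)\in\tilde{\mathcal A}(M)$ and $(\Upsilon_\varepsilon)\in\Upsilon(M)$, $\lim_{\varepsilon\to0}\int_MT(\Upsilon_\varepsilon,\omega_\varepsilon)\cdot\Psi=0$ (full contraction); $S\approx T$ iff $S-T\approx0$. *)

theory Defs
  imports "HOL-Analysis.Analysis" "HOL-Library.Function_Algebras"
begin

section \<open>Smooth manifolds\<close>

text \<open>
  The manifold is a Hausdorff topological type \<open>'m\<close> together with a maximal smooth atlas \<open>A\<close>; its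
  dimension is the cardinality of the finite type \<open>'n\<close>.  A chart is a pair of a domain and a
  coordinate map; the values of the coordinate map outside the domain are irrelevant.
\<close>

type_synonym ('m, 'n) chart = "'m set \<times> ('m \<Rightarrow> real^'n)"

abbreviation cdom :: "('m, 'n::finite) chart \<Rightarrow> 'm set"
  where "cdom c \<equiv> fst c"

abbreviation cmap :: "('m, 'n::finite) chart \<Rightarrow> 'm \<Rightarrow> real^'n"
  where "cmap c \<equiv> snd c"

definition cimg :: "('m, 'n::finite) chart \<Rightarrow> (real^'n) set"
  where "cimg c = cmap c ` cdom c"

definition cinv :: "('m, 'n::finite) chart \<Rightarrow> real^'n \<Rightarrow> 'm"
  where "cinv c = inv_into (cdom c) (cmap c)"

text \<open>The following are meant for open sets \<open>S\<close>.\<close>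

fun Ck_on :: "nat \<Rightarrow> 'a::euclidean_space set \<Rightarrow> ('a \<Rightarrow> 'b::real_normed_vector) \<Rightarrow> bool"
  where
    "Ck_on 0 S f \<longleftrightarrow> continuous_on S f"
  | "Ck_on (Suc k) S f \<longleftrightarrow>
       f differentiable_on S \<and> (\<forall>b\<in>Basis. Ck_on k S (\<lambda>u. frechet_derivative f (at u) b))"

definition smooth_on :: "'a::euclidean_space set \<Rightarrow> ('a \<Rightarrow> 'b::real_normed_vector) \<Rightarrow> bool"
  where "smooth_on S f \<longleftrightarrow> (\<forall>k. Ck_on k S f)"

text \<open>Iterated partial derivative; a multiindex is given as a list of basis vectors.\<close>

fun iter_partial :: "'a::euclidean_space list \<Rightarrow> ('a \<Rightarrow> 'b::real_normed_vector) \<Rightarrow> 'a \<Rightarrow> 'b"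
  where
    "iter_partial [] f = f"
  | "iter_partial (b # bs) f = (\<lambda>u. frechet_derivative (iter_partial bs f) (at u) b)"

definition is_chart :: "('m::topological_space, 'n::finite) chart \<Rightarrow> bool"
  where "is_chart c \<longleftrightarrow>
    open (cdom c) \<and> open (cimg c) \<and> homeomorphism (cdom c) (cimg c) (cmap c) (cinv c)"

definition compatible_charts :: "('m, 'n::finite) chart \<Rightarrow> ('m, 'n) chart \<Rightarrow> bool"
  where "compatible_charts c d \<longleftrightarrow>
    smooth_on (cmap c ` (cdom c \<inter> cdom d)) (cmap d \<circ> cinv c) \<and>
    smooth_on (cmap d ` (cdom c \<inter> cdom d)) (cmap c \<circ> cinv d)"

definition paracompact_type :: "'m::topological_space itself \<Rightarrow> bool"
  where "paracompact_type _ \<longleftrightarrow>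
    (\<forall>\<U> :: 'm set set. (\<forall>U\<in>\<U>. open U) \<and> \<Union>\<U> = UNIV \<longrightarrow>
      (\<exists>\<V>. (\<forall>V\<in>\<V>. open V \<and> (\<exists>U\<in>\<U>. V \<subseteq> U)) \<and> \<Union>\<V> = UNIV \<and> locally_finite_in euclidean \<V>))"

definition smooth_manifold :: "('m::t2_space, 'n::finite) chart set \<Rightarrow> bool"
  where "smooth_manifold A \<longleftrightarrow>
    paracompact_type TYPE('m) \<and>
    (\<forall>c\<in>A. is_chart c) \<and>
    (\<Union>c\<in>A. cdom c) = UNIV \<and>
    (\<forall>c\<in>A. \<forall>d\<in>A. compatible_charts c d) \<and>
    (\<forall>c. is_chart c \<and> (\<forall>d\<in>A. compatible_charts c d) \<longrightarrow> c \<in> A)"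

text \<open>An auxiliary choice of a chart around a point, used only for chart-independent expressions.\<close>

definition chart_at :: "('m, 'n::finite) chart set \<Rightarrow> 'm \<Rightarrow> ('m, 'n) chart"
  where "chart_at A x = (SOME c. c \<in> A \<and> x \<in> cdom c)"

text \<open>The Jacobian matrix of the change of coordinates from \<open>c\<close> to \<open>c'\<close> at \<open>x\<close>: row \<open>i\<close>, column
  \<open>k\<close> is the partial derivative of the \<open>i\<close>-th coordinate of \<open>c'\<close> by the \<open>k\<close>-th one of \<open>c\<close>.\<close>

definition jac :: "('m, 'n::finite) chart \<Rightarrow> ('m, 'n) chart \<Rightarrow> 'm \<Rightarrow> real^'n^'n"
  where "jac c c' x = matrix (frechet_derivative (cmap c' \<circ> cinv c) (at (cmap c x)))"

definition smooth_functions :: "('m, 'n::finite) chart set \<Rightarrow> ('m \<Rightarrow> real) set"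
  where "smooth_functions A = {f. \<forall>c\<in>A. smooth_on (cimg c) (f \<circ> cinv c)}"


section \<open>Tensor fields and tensor densities\<close>

text \<open>
  A field \<open>T\<close> is given by its components: \<open>T c x is js\<close> is the component at the point \<open>x\<close> with
  respect to the chart \<open>c\<close>, with upper indices \<open>is\<close> and lower indices \<open>js\<close>.  Components for which
  this makes no sense (wrong chart, point, or number of indices) are required to be 0, so that
  fields are determined as functions.  The weight \<open>w\<close> is 0 for tensors and 1 for tensor densities.
\<close>

type_synonym ('m, 'n) tfield = "('m, 'n) chart \<Rightarrow> 'm \<Rightarrow> 'n list \<Rightarrow> 'n list \<Rightarrow> real"

definition is_field ::
    "('m, 'n::finite) chart set \<Rightarrow> nat \<Rightarrow> nat \<Rightarrow> nat \<Rightarrow> ('m, 'n) tfield \<Rightarrow> bool"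
  where "is_field A w r s T \<longleftrightarrow>
    (\<forall>c x is js. T c x is js \<noteq> 0 \<longrightarrow> c \<in> A \<and> x \<in> cdom c \<and> length is = r \<and> length js = s) \<and>
    (\<forall>c\<in>A. \<forall>c'\<in>A. \<forall>x\<in>cdom c \<inter> cdom c'. \<forall>is js. length is = r \<and> length js = s \<longrightarrow>
      T c' x is js =
        \<bar>det (jac c' c x)\<bar> ^ w *
        (\<Sum>ks\<in>{ks. length ks = r}. \<Sum>ls\<in>{ls. length ls = s}.
          (\<Prod>a<r. jac c c' x $ (is ! a) $ (ks ! a)) *
          (\<Prod>b<s. jac c' c x $ (ls ! b) $ (js ! b)) * T c x ks ls))"

definition Ck_fields ::
    "('m, 'n::finite) chart set \<Rightarrow> nat \<Rightarrow> nat \<Rightarrow> nat \<Rightarrow> nat \<Rightarrow> ('m, 'n) tfield set"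
  where "Ck_fields A k w r s =
    {T. is_field A w r s T \<and> (\<forall>c\<in>A. \<forall>is js. Ck_on k (cimg c) (\<lambda>u. T c (cinv c u) is js))}"

abbreviation Ck_tensor_fields ::
    "('m, 'n::finite) chart set \<Rightarrow> nat \<Rightarrow> nat \<Rightarrow> nat \<Rightarrow> ('m, 'n) tfield set"
  where "Ck_tensor_fields A k r s \<equiv> Ck_fields A k 0 r s"

definition tensor_fields :: "('m, 'n::finite) chart set \<Rightarrow> nat \<Rightarrow> nat \<Rightarrow> ('m, 'n) tfield set"
  where "tensor_fields A r s = (\<Inter>k. Ck_fields A k 0 r s)"

abbreviation vector_fields :: "('m, 'n::finite) chart set \<Rightarrow> ('m, 'n) tfield set"
  where "vector_fields A \<equiv> tensor_fields A 1 0"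

definition field_support :: "('m::topological_space, 'n::finite) tfield \<Rightarrow> 'm set"
  where "field_support T = closure {x. \<exists>c is js. T c x is js \<noteq> 0}"

text \<open>Smooth compactly supported tensor densities with \<open>r\<close> upper and \<open>s\<close> lower indices.\<close>

definition test_densities ::
    "('m::topological_space, 'n::finite) chart set \<Rightarrow> nat \<Rightarrow> nat \<Rightarrow> ('m, 'n) tfield set"
  where "test_densities A r s =
    {\<Psi>. (\<forall>k. \<Psi> \<in> Ck_fields A k 1 r s) \<and> compact (field_support \<Psi>)}"

definition fmult :: "('m \<Rightarrow> real) \<Rightarrow> ('m, 'n) tfield \<Rightarrow> ('m, 'n) tfield"
  where "fmult f T = (\<lambda>c x is js. f x * T c x is js)"

text \<open>Full contraction of a type \<open>(r, s)\<close> tensor with a type \<open>(s, r)\<close> tensor density, which is a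
  scalar density.\<close>

definition contraction ::
    "nat \<Rightarrow> nat \<Rightarrow> ('m, 'n::finite) tfield \<Rightarrow> ('m, 'n) tfield \<Rightarrow> ('m, 'n) tfield"
  where "contraction r s T \<Psi> = (\<lambda>c x ks ls.
    if ks = [] \<and> ls = [] then
      \<Sum>is\<in>{is. length is = r}. \<Sum>js\<in>{js. length js = s}. T c x is js * \<Psi> c x js is
    else 0)"

text \<open>Directional derivative of a scalar function along a vector field.\<close>

definition dir_deriv ::
    "('m, 'n::finite) chart set \<Rightarrow> ('m, 'n) tfield \<Rightarrow> ('m \<Rightarrow> real) \<Rightarrow> 'm \<Rightarrow> real"
  where "dir_deriv A X f x = (let c = chart_at A x in
    \<Sum>i\<in>UNIV. X c x [i] [] * frechet_derivative (f \<circ> cinv c) (at (cmap c x)) (axis i 1))"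

text \<open>
  Integral of a scalar density: the carrier is cut into finitely many disjoint Borel pieces, each
  contained in the domain of a chart, and the coordinate integrals over the pieces are added.
  By the transformation rule of densities the result does not depend on the pieces and the charts.
\<close>

definition dens_integral ::
    "('m::topological_space, 'n::finite) chart set \<Rightarrow> ('m, 'n) tfield \<Rightarrow> real"
  where "dens_integral A \<mu> = (THE v. \<exists>N (c :: nat \<Rightarrow> ('m, 'n) chart) B.
    (\<forall>i<N. c i \<in> A \<and> B i \<in> sets borel \<and> B i \<subseteq> cdom (c i)) \<and>
    disjoint_family_on B {..<N} \<and>
    {x. \<exists>d. \<mu> d x [] [] \<noteq> 0} \<subseteq> (\<Union>i<N. B i) \<and>
    (\<forall>i<N. set_integrable lborel (cmap (c i) ` B i) (\<lambda>u. \<mu> (c i) (cinv (c i) u) [] [])) \<and>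
    v = (\<Sum>i<N. set_lebesgue_integral lborel (cmap (c i) ` B i)
          (\<lambda>u. \<mu> (c i) (cinv (c i) u) [] [])))"

definition abs_field :: "('m, 'n) tfield \<Rightarrow> ('m, 'n) tfield"
  where "abs_field \<mu> = (\<lambda>c x is js. \<bar>\<mu> c x is js\<bar>)"

text \<open>Lie derivative of a scalar density, in coordinates the divergence of \<open>X\<^sup>i \<mu>\<close>.\<close>

definition lie_dens ::
    "('m, 'n::finite) chart set \<Rightarrow> ('m, 'n) tfield \<Rightarrow> ('m, 'n) tfield \<Rightarrow> ('m, 'n) tfield"
  where "lie_dens A X \<mu> = (\<lambda>c x is js.
    if c \<in> A \<and> x \<in> cdom c \<and> is = [] \<and> js = [] then
      \<Sum>i\<in>UNIV. frechet_derivative (\<lambda>u. X c (cinv c u) [i] [] * \<mu> c (cinv c u) [] [])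
        (at (cmap c x)) (axis i 1)
    else 0)"


section \<open>Covariant derivatives\<close>

definition covariant_derivative ::
    "('m, 'n::finite) chart set \<Rightarrow>
     (('m, 'n) tfield \<Rightarrow> ('m, 'n) tfield \<Rightarrow> ('m, 'n) tfield) \<Rightarrow> bool"
  where "covariant_derivative A D \<longleftrightarrow>
    (\<forall>X\<in>vector_fields A. \<forall>Y\<in>vector_fields A. D X Y \<in> vector_fields A) \<and>
    (\<forall>X\<in>vector_fields A. \<forall>X'\<in>vector_fields A. \<forall>Y\<in>vector_fields A.
      D (X + X') Y = D X Y + D X' Y) \<and>
    (\<forall>f\<in>smooth_functions A. \<forall>X\<in>vector_fields A. \<forall>Y\<in>vector_fields A.
      D (fmult f X) Y = fmult f (D X Y)) \<and>
    (\<forall>X\<in>vector_fields A. \<forall>Y\<in>vector_fields A. \<forall>Y'\<in>vector_fields A.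
      D X (Y + Y') = D X Y + D X Y') \<and>
    (\<forall>f\<in>smooth_functions A. \<forall>X\<in>vector_fields A. \<forall>Y\<in>vector_fields A.
      D X (fmult f Y) = fmult (dir_deriv A X f) Y + fmult f (D X Y))"

text \<open>Smooth vector fields on the whole manifold that agree near \<open>x\<close> with the coordinate vector
  fields of the chart \<open>c\<close>.\<close>

definition local_frame ::
    "('m::topological_space, 'n::finite) chart set \<Rightarrow> ('m, 'n) chart \<Rightarrow> 'm \<Rightarrow>
     ('n \<Rightarrow> ('m, 'n) tfield) \<Rightarrow> bool"
  where "local_frame A c x E \<longleftrightarrow>
    (\<forall>i. E i \<in> vector_fields A) \<and>
    (\<exists>W. open W \<and> x \<in> W \<and> W \<subseteq> cdom c \<and>
      (\<forall>y\<in>W. \<forall>i k. E i c y [k] [] = (if k = i then 1 else 0)))"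

text \<open>\<open>christoffel A D c x k i j\<close> is the \<open>k\<close>-th component of the covariant derivative of the \<open>j\<close>-th
  coordinate vector field along the \<open>i\<close>-th one.\<close>

definition christoffel ::
    "('m::topological_space, 'n::finite) chart set \<Rightarrow>
     (('m, 'n) tfield \<Rightarrow> ('m, 'n) tfield \<Rightarrow> ('m, 'n) tfield) \<Rightarrow>
     ('m, 'n) chart \<Rightarrow> 'm \<Rightarrow> 'n \<Rightarrow> 'n \<Rightarrow> 'n \<Rightarrow> real"
  where "christoffel A D c x k i j =
    (let E = (SOME E. local_frame A c x E) in D (E i) (E j) c x [k] [])"

text \<open>The usual extension of a covariant derivative to (at least once differentiable) tensor
  fields.\<close>

definition nabla ::
    "('m::topological_space, 'n::finite) chart set \<Rightarrow>
     (('m, 'n) tfield \<Rightarrow> ('m, 'n) tfield \<Rightarrow> ('m, 'n) tfield) \<Rightarrow>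
     ('m, 'n) tfield \<Rightarrow> ('m, 'n) tfield \<Rightarrow> ('m, 'n) tfield"
  where "nabla A D Z T = (\<lambda>c x is js.
    if c \<in> A \<and> x \<in> cdom c then
      \<Sum>i\<in>UNIV. Z c x [i] [] *
        (frechet_derivative (\<lambda>u. T c (cinv c u) is js) (at (cmap c x)) (axis i 1)
         + (\<Sum>a<length is. \<Sum>m\<in>UNIV. christoffel A D c x (is ! a) i m * T c x (is[a := m]) js)
         - (\<Sum>b<length js. \<Sum>m\<in>UNIV. christoffel A D c x m i (js ! b) * T c x is (js[b := m])))
    else 0)"


section \<open>Riemannian distance\<close>

definition riemannian_metric :: "('m, 'n::finite) chart set \<Rightarrow> ('m, 'n) tfield \<Rightarrow> bool"
  where "riemannian_metric A h \<longleftrightarrow>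
    h \<in> tensor_fields A 0 2 \<and>
    (\<forall>c\<in>A. \<forall>x\<in>cdom c.
      (\<forall>i j. h c x [] [i, j] = h c x [] [j, i]) \<and>
      (\<forall>v :: real^'n. v \<noteq> 0 \<longrightarrow> (\<Sum>i\<in>UNIV. \<Sum>j\<in>UNIV. h c x [] [i, j] * v $ i * v $ j) > 0))"

definition piecewise_C1_curve ::
    "('m::topological_space, 'n::finite) chart set \<Rightarrow> (real \<Rightarrow> 'm) \<Rightarrow> bool"
  where "piecewise_C1_curve A \<gamma> \<longleftrightarrow>
    path \<gamma> \<and>
    (\<forall>c\<in>A. \<forall>a b. 0 \<le> a \<and> a \<le> b \<and> b \<le> 1 \<and> \<gamma> ` {a..b} \<subseteq> cdom c \<longrightarrow>
      (cmap c \<circ> \<gamma>) piecewise_C1_differentiable_on {a..b})"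

definition speed ::
    "('m, 'n::finite) chart set \<Rightarrow> ('m, 'n) tfield \<Rightarrow> (real \<Rightarrow> 'm) \<Rightarrow> real \<Rightarrow> real"
  where "speed A h \<gamma> t = (let c = chart_at A (\<gamma> t); v = vector_derivative (cmap c \<circ> \<gamma>) (at t) in
    sqrt (\<Sum>i\<in>UNIV. \<Sum>j\<in>UNIV. h c (\<gamma> t) [] [i, j] * v $ i * v $ j))"

text \<open>The distance is \<open>\<infinity>\<close> for points in different components.\<close>

definition riem_dist ::
    "('m::topological_space, 'n::finite) chart set \<Rightarrow> ('m, 'n) tfield \<Rightarrow> 'm \<Rightarrow> 'm \<Rightarrow> ennreal"
  where "riem_dist A h x y =
    (INF \<gamma>\<in>{\<gamma>. piecewise_C1_curve A \<gamma> \<and> pathstart \<gamma> = x \<and> pathfinish \<gamma> = y}.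
      \<integral>\<^sup>+ t\<in>{0..1}. ennreal (speed A h \<gamma> t) \<partial>lborel)"

definition riem_ball ::
    "('m::topological_space, 'n::finite) chart set \<Rightarrow> ('m, 'n) tfield \<Rightarrow> real \<Rightarrow> 'm \<Rightarrow> 'm set"
  where "riem_ball A h \<rho> x = {y. riem_dist A h x y < ennreal \<rho>}"


section \<open>Transport operators and smoothing kernels\<close>

text \<open>
  \<open>\<Upsilon> c d x y a b\<close> is the component at \<open>(x, y)\<close> with respect to the chart \<open>c\<close> in the first and \<open>d\<close>
  in the second variable, with upper index \<open>a\<close> at \<open>x\<close> and lower index \<open>b\<close> at \<open>y\<close>.
\<close>

type_synonym ('m, 'n) transport =
  "('m, 'n) chart \<Rightarrow> ('m, 'n) chart \<Rightarrow> 'm \<Rightarrow> 'm \<Rightarrow> 'n \<Rightarrow> 'n \<Rightarrow> real"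

definition TO :: "('m, 'n::finite) chart set \<Rightarrow> ('m, 'n) transport set"
  where "TO A = {\<Upsilon>.
    (\<forall>c d x y a b. \<Upsilon> c d x y a b \<noteq> 0 \<longrightarrow> c \<in> A \<and> d \<in> A \<and> x \<in> cdom c \<and> y \<in> cdom d) \<and>
    (\<forall>c\<in>A. \<forall>c'\<in>A. \<forall>d\<in>A. \<forall>d'\<in>A. \<forall>x\<in>cdom c \<inter> cdom c'. \<forall>y\<in>cdom d \<inter> cdom d'. \<forall>a b.
      \<Upsilon> c' d' x y a b =
        (\<Sum>k\<in>UNIV. \<Sum>l\<in>UNIV. jac c c' x $ a $ k * \<Upsilon> c d x y k l * jac d' d y $ l $ b)) \<and>
    (\<forall>c\<in>A. \<forall>d\<in>A. \<forall>a b.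
      smooth_on (cimg c \<times> cimg d) (\<lambda>(u, v). \<Upsilon> c d (cinv c u) (cinv d v) a b))}"

text \<open>The maps \<open>\<Upsilon>\<^sup>*(x, y)\<close> on covectors at \<open>x\<close> and \<open>\<Upsilon>\<^sub>*(x, y)\<close> on vectors at \<open>x\<close>, in components
  with respect to \<open>c\<close> at \<open>x\<close> and \<open>d\<close> at \<open>y\<close>.  The latter uses \<open>\<Upsilon>\<close> at \<open>(y, x)\<close>.\<close>

definition transport_covec ::
    "('m, 'n::finite) transport \<Rightarrow> ('m, 'n) chart \<Rightarrow> ('m, 'n) chart \<Rightarrow> 'm \<Rightarrow> 'm \<Rightarrow>
     real^'n \<Rightarrow> real^'n"
  where "transport_covec \<Upsilon> c d x y \<alpha> = (\<chi> b. \<Sum>a\<in>UNIV. \<Upsilon> c d x y a b * \<alpha> $ a)"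

definition transport_vec ::
    "('m, 'n::finite) transport \<Rightarrow> ('m, 'n) chart \<Rightarrow> ('m, 'n) chart \<Rightarrow> 'm \<Rightarrow> 'm \<Rightarrow>
     real^'n \<Rightarrow> real^'n"
  where "transport_vec \<Upsilon> c d x y Y = (\<chi> a. \<Sum>b\<in>UNIV. \<Upsilon> d c y x a b * Y $ b)"

text \<open>
  Continuous seminorms of the (LF) space of compactly supported smooth scalar densities, i.e. of
  the locally convex inductive limit, over compact sets \<open>K\<close>, of the densities supported in \<open>K\<close>
  with the topology of uniform convergence of all derivatives on compact subsets of charts.
  (The 0 inserted in the supremum of nonnegative numbers only matters for \<open>L = {}\<close>.)
\<close>

definition sup_seminorm ::
    "('m, 'n::finite) chart \<times> 'm set \<times> (real^'n) list \<Rightarrow> ('m, 'n) tfield \<Rightarrow> real"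
  where "sup_seminorm = (\<lambda>(c, L, bs) \<mu>.
    Sup (insert 0 ((\<lambda>y. \<bar>iter_partial bs (\<lambda>u. \<mu> c (cinv c u) [] []) (cmap c y)\<bar>) ` L)))"

definition lf_seminorm ::
    "('m::topological_space, 'n::finite) chart set \<Rightarrow> (('m, 'n) tfield \<Rightarrow> real) \<Rightarrow> bool"
  where "lf_seminorm A p \<longleftrightarrow>
    (\<forall>\<mu>\<in>test_densities A 0 0. \<forall>\<nu>\<in>test_densities A 0 0. p (\<mu> + \<nu>) \<le> p \<mu> + p \<nu>) \<and>
    (\<forall>a. \<forall>\<mu>\<in>test_densities A 0 0. p (fmult (\<lambda>_. a) \<mu>) = \<bar>a\<bar> * p \<mu>) \<and>
    (\<forall>K. compact K \<longrightarrow>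
      (\<exists>F C. finite F \<and>
        F \<subseteq> {(c, L, bs). c \<in> A \<and> compact L \<and> L \<subseteq> cdom c \<and> set bs \<subseteq> Basis} \<and>
        (\<forall>\<mu>\<in>test_densities A 0 0. field_support \<mu> \<subseteq> K \<longrightarrow>
          p \<mu> \<le> C * (\<Sum>q\<in>F. sup_seminorm q \<mu>))))"

text \<open>Smoothness of a map from an open set \<open>S\<close> into that space: all iterated partial derivatives
  \<open>g bs\<close> exist as limits of difference quotients in the space, and are continuous.\<close>

definition smooth_into_densities ::
    "('m::topological_space, 'n::finite) chart set \<Rightarrow> (real^'n) set \<Rightarrow>
     (real^'n \<Rightarrow> ('m, 'n) tfield) \<Rightarrow> bool"
  where "smooth_into_densities A S f \<longleftrightarrow>
    (\<exists>g :: (real^'n) list \<Rightarrow> real^'n \<Rightarrow> ('m, 'n) tfield.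
      (\<forall>u\<in>S. g [] u = f u) \<and>
      (\<forall>bs u. set bs \<subseteq> Basis \<and> u \<in> S \<longrightarrow>
        g bs u \<in> test_densities A 0 0 \<and>
        (\<forall>p. lf_seminorm A p \<longrightarrow>
          ((\<lambda>v. p (g bs v - g bs u)) \<longlongrightarrow> 0) (at u within S) \<and>
          (\<forall>b\<in>Basis.
            ((\<lambda>t. p (fmult (\<lambda>_. 1 / t) (g bs (u + t *\<^sub>R b) - g bs u) - g (b # bs) u)) \<longlongrightarrow> 0)
              (at 0)))))"

type_synonym ('m, 'n) kernel = "'m \<Rightarrow> ('m, 'n) tfield"

definition SK :: "('m::topological_space, 'n::finite) chart set \<Rightarrow> ('m, 'n) kernel set"
  where "SK A = {\<omega>.
    (\<forall>x. \<omega> x \<in> test_densities A 0 0) \<and>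
    (\<forall>c\<in>A. smooth_into_densities A (cimg c) (\<lambda>u. \<omega> (cinv c u)))}"

definition lie_Omega ::
    "('m, 'n::finite) chart set \<Rightarrow> ('m, 'n) tfield \<Rightarrow> ('m, 'n) kernel \<Rightarrow> ('m, 'n) kernel"
  where "lie_Omega A X \<omega> = (\<lambda>x. lie_dens A X (\<omega> x))"

definition lie_Cinf ::
    "('m, 'n::finite) chart set \<Rightarrow> ('m, 'n) tfield \<Rightarrow> ('m, 'n) kernel \<Rightarrow> ('m, 'n) kernel"
  where "lie_Cinf A X \<omega> = (\<lambda>x d y is js. dir_deriv A X (\<lambda>x'. \<omega> x' d y is js) x)"

definition lie_SK ::
    "('m, 'n::finite) chart set \<Rightarrow> ('m, 'n) tfield \<Rightarrow> ('m, 'n) kernel \<Rightarrow> ('m, 'n) kernel"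
  where "lie_SK A X \<omega> = lie_Omega A X \<omega> + lie_Cinf A X \<omega>"


section \<open>Delta nets, admissible nets, embedding and association\<close>

definition delta_nets ::
    "('m::topological_space, 'n::finite) chart set \<Rightarrow> (real \<Rightarrow> ('m, 'n) kernel) set"
  where "delta_nets A = {\<omega>.
    (\<forall>\<epsilon>\<in>{0<..1}. \<omega> \<epsilon> \<in> SK A) \<and>
    (\<exists>h. riemannian_metric A h \<and> (\<forall>K. compact K \<longrightarrow>
      (\<exists>C>0. \<exists>\<epsilon>\<^sub>0>0. \<forall>\<epsilon>\<in>{0<..1}. \<epsilon> < \<epsilon>\<^sub>0 \<longrightarrow>
        (\<forall>x\<in>K. field_support (\<omega> \<epsilon> x) \<subseteq> riem_ball A h (C * \<epsilon>) x)) \<and>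
      (\<forall>Ys Xs. set Ys \<subseteq> vector_fields A \<and> set Xs \<subseteq> vector_fields A \<longrightarrow>
        (\<exists>C. \<exists>\<epsilon>\<^sub>0>0. \<forall>\<epsilon>\<in>{0<..1}. \<epsilon> < \<epsilon>\<^sub>0 \<longrightarrow>
          (\<forall>x\<in>K. dens_integral A
             (abs_field (foldr (lie_Omega A) Ys (foldr (lie_SK A) Xs (\<omega> \<epsilon>)) x))
             \<le> C * (1 / \<epsilon>) ^ length Ys))) \<and>
      (\<forall>f\<in>smooth_functions A. \<forall>m :: nat.
        (\<exists>C. \<exists>\<epsilon>\<^sub>0>0. \<forall>\<epsilon>\<in>{0<..1}. \<epsilon> < \<epsilon>\<^sub>0 \<longrightarrow>
          (\<forall>x\<in>K. \<bar>f x - dens_integral A (fmult f (\<omega> \<epsilon> x))\<bar> \<le> C * \<epsilon> ^ m)))))}"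

definition admissible_nets ::
    "('m::topological_space, 'n::finite) chart set \<Rightarrow> (real \<Rightarrow> ('m, 'n) transport) set"
  where "admissible_nets A = {\<Upsilon>.
    (\<forall>\<epsilon>\<in>{0<..1}. \<Upsilon> \<epsilon> \<in> TO A) \<and>
    (\<forall>c\<in>A. \<forall>x\<in>cdom c. \<forall>a b. \<forall>bs :: ((real^'n) \<times> (real^'n)) list. set bs \<subseteq> Basis \<longrightarrow>
      (\<exists>W. open W \<and> (x, x) \<in> W \<and> W \<subseteq> cdom c \<times> cdom c \<and>
        (\<exists>C. \<exists>\<epsilon>\<^sub>0>0. \<forall>\<epsilon>\<in>{0<..1}. \<epsilon> < \<epsilon>\<^sub>0 \<longrightarrow>
          (\<forall>(y, z)\<in>W.
            \<bar>iter_partial bs (\<lambda>(u, v). \<Upsilon> \<epsilon> c c (cinv c u) (cinv c v) a b)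
              (cmap c y, cmap c z)\<bar> \<le> C)))) \<and>
    (\<forall>\<epsilon>\<in>{0<..1}. \<forall>c\<in>A. \<forall>x\<in>cdom c. \<forall>a b. \<Upsilon> \<epsilon> c c x x a b = (if a = b then 1 else 0))}"

text \<open>Locally integrable type \<open>(r, s)\<close> tensor fields as functionals on type \<open>(s, r)\<close> densities.\<close>

definition dist_of ::
    "('m::topological_space, 'n::finite) chart set \<Rightarrow> nat \<Rightarrow> nat \<Rightarrow> ('m, 'n) tfield \<Rightarrow>
     ('m, 'n) tfield \<Rightarrow> real"
  where "dist_of A r s S \<Psi> = dens_integral A (contraction r s S \<Psi>)"

text \<open>The type \<open>(s, r)\<close> tensor density \<open>\<Psi>\<^sub>x\<close>; the covectors \<open>\<alpha>s\<close> and vectors \<open>Ys\<close> at \<open>x\<close> are given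
  by their components with respect to the chart \<open>c\<close>.\<close>

definition Psi ::
    "('m, 'n::finite) chart set \<Rightarrow> ('m, 'n) transport \<Rightarrow> ('m, 'n) kernel \<Rightarrow>
     ('m, 'n) chart \<Rightarrow> 'm \<Rightarrow> (real^'n) list \<Rightarrow> (real^'n) list \<Rightarrow> ('m, 'n) tfield"
  where "Psi A \<Upsilon> \<omega> c x \<alpha>s Ys = (\<lambda>d y ls ks.
    if d \<in> A \<and> y \<in> cdom d \<and> length ls = length Ys \<and> length ks = length \<alpha>s then
      (\<Prod>a<length \<alpha>s. transport_covec \<Upsilon> c d x y (\<alpha>s ! a) $ (ks ! a)) *
      (\<Prod>b<length Ys. transport_vec \<Upsilon> c d x y (Ys ! b) $ (ls ! b)) *
      \<omega> x d y [] []
    else 0)"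

text \<open>The components of the embedded distribution are its values on the covectors and vectors of
  the coordinate (co)frame.\<close>

definition iota ::
    "('m, 'n::finite) chart set \<Rightarrow> nat \<Rightarrow> nat \<Rightarrow> (('m, 'n) tfield \<Rightarrow> real) \<Rightarrow>
     ('m, 'n) transport \<Rightarrow> ('m, 'n) kernel \<Rightarrow> ('m, 'n) tfield"
  where "iota A r s T \<Upsilon> \<omega> = (\<lambda>c x is js.
    if c \<in> A \<and> x \<in> cdom c \<and> length is = r \<and> length js = s then
      T (Psi A \<Upsilon> \<omega> c x (map (\<lambda>i. axis i 1) is) (map (\<lambda>j. axis j 1) js))
    else 0)"

text \<open>
  Generalised tensor fields are maps from transport operators and smoothing kernels to tensor
  fields.  The operations below only use their values, so they are defined for all such maps,
  whether or not these are smooth in the sense of convenient calculus.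
\<close>

definition gen_nabla ::
    "('m::topological_space, 'n::finite) chart set \<Rightarrow>
     (('m, 'n) tfield \<Rightarrow> ('m, 'n) tfield \<Rightarrow> ('m, 'n) tfield) \<Rightarrow> ('m, 'n) tfield \<Rightarrow>
     (('m, 'n) transport \<Rightarrow> ('m, 'n) kernel \<Rightarrow> ('m, 'n) tfield) \<Rightarrow>
     ('m, 'n) transport \<Rightarrow> ('m, 'n) kernel \<Rightarrow> ('m, 'n) tfield"
  where "gen_nabla A D Z T = (\<lambda>\<Upsilon> \<omega>. nabla A D Z (T \<Upsilon> \<omega>))"

definition assoc_zero ::
    "('m::topological_space, 'n::finite) chart set \<Rightarrow> nat \<Rightarrow> nat \<Rightarrow>
     (('m, 'n) transport \<Rightarrow> ('m, 'n) kernel \<Rightarrow> ('m, 'n) tfield) \<Rightarrow> bool"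
  where "assoc_zero A r s T \<longleftrightarrow>
    (\<forall>\<Psi>\<in>test_densities A s r. \<forall>\<omega>\<in>delta_nets A. \<forall>\<Upsilon>\<in>admissible_nets A.
      ((\<lambda>\<epsilon>. dens_integral A (contraction r s (T (\<Upsilon> \<epsilon>) (\<omega> \<epsilon>)) \<Psi>)) \<longlongrightarrow> 0) (at_right 0))"

definition assoc ::
    "('m::topological_space, 'n::finite) chart set \<Rightarrow> nat \<Rightarrow> nat \<Rightarrow>
     (('m, 'n) transport \<Rightarrow> ('m, 'n) kernel \<Rightarrow> ('m, 'n) tfield) \<Rightarrow>
     (('m, 'n) transport \<Rightarrow> ('m, 'n) kernel \<Rightarrow> ('m, 'n) tfield) \<Rightarrow> bool"
  where "assoc A r s S T \<longleftrightarrow> assoc_zero A r s (S - T)"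

end

theory Submission
  imports Defs
begin

text \<open>
  Fix a test density \<open>\<Psi>\<close>, a delta net \<open>\<omega>\<^sub>\<epsilon>\<close> and an admissible net \<open>\<Upsilon>\<^sub>\<epsilon>\<close>, and let \<open>T\<^sub>\<epsilon>\<close> and \<open>N\<^sub>\<epsilon>\<close> be the
  values of the embeddings of \<open>S\<close> and of \<open>\<nabla>\<^sub>Z S\<close> at \<open>(\<Upsilon>\<^sub>\<epsilon>, \<omega>\<^sub>\<epsilon>)\<close>.  The claim is that the integral of
  \<open>(\<nabla>\<^sub>Z T\<^sub>\<epsilon> - N\<^sub>\<epsilon>) \<cdot> \<Psi>\<close> tends to 0.

  The embedding of a continuous tensor field converges to the field locally uniformly
  (\<open>iota_uniformly_close\<close>): its value at \<open>x\<close> is an average of the values at nearby points,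
  transported to \<open>x\<close>, with a weight whose support shrinks to \<open>x\<close>, whose total mass tends to 1 and
  whose absolute mass stays bounded; the transport operators are the identity on the diagonal and
  have uniformly bounded first derivatives, so that they are close to the identity where the weight
  lives.  Applied to \<open>S\<close> and to \<open>\<nabla>\<^sub>Z S\<close>, which is still continuous, this gives \<open>R\<^sub>\<epsilon> = T\<^sub>\<epsilon> - S \<rightarrow> 0\<close> and
  \<open>N\<^sub>\<epsilon> \<rightarrow> \<nabla>\<^sub>Z S\<close> locally uniformly.  Now \<open>\<nabla>\<^sub>Z T\<^sub>\<epsilon> - N\<^sub>\<epsilon> = \<nabla>\<^sub>Z R\<^sub>\<epsilon> + (\<nabla>\<^sub>Z S - N\<^sub>\<epsilon>)\<close>, the undifferentiated
  terms of \<open>\<nabla>\<^sub>Z R\<^sub>\<epsilon>\<close> are small, and in the remaining term an integration by parts moves the derivative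
  from \<open>R\<^sub>\<epsilon>\<close> to the product of \<open>\<Psi>\<close> and \<open>Z\<close> (\<open>weak_derivative_limit\<close>).  So the derivatives of \<open>R\<^sub>\<epsilon>\<close> need
  not be estimated; they only have to exist and be continuous, which is differentiation under the
  integral sign (\<open>iota_C1\<close>).

  This computation takes place in a coordinate box.  A bump function argument reduces the claim to
  test densities supported in small boxes (\<open>vanishes_weakly_local_to_global\<close>).  For small \<open>\<epsilon>\<close> the kernels
  at the points of a smaller ball are supported in the box, because small Riemannian balls are
  contained in small coordinate balls (\<open>riem_ball_subset_chart_ball\<close>), and then the distribution that defines the
  embedding is an ordinary integral over the box (\<open>iota_in_chart\<close>).

  What remains is to justify working in a single chart.  The integral of a density is independent
  of the pieces and charts by which it is computed, by the change of variables formula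
  (\<open>has_dens_integral_unique\<close>).  The embedded fields obey the transformation law of tensors
  (\<open>iota_is_field\<close>), and so does the covariant derivative of a tensor field (\<open>nabla_transform\<close>), which
  comes from the transformation law of the connection coefficients (\<open>conn_transform\<close>).
\<close>

section \<open>Finitely often differentiable functions\<close>

lemma Ck_on_SucD:
  assumes "Ck_on (Suc k) S f" "open S" "u \<in> S"
  shows "(f has_derivative frechet_derivative f (at u)) (at u)"
  using assms by (simp add: differentiable_on_eq_differentiable_at frechet_derivative_works[symmetric])

lemma Ck_on_continuous: "Ck_on k S f \<Longrightarrow> continuous_on S f"
  by (cases k) (auto intro: differentiable_imp_continuous_on)

lemma Ck_on_mono1: "Ck_on (Suc k) S f \<Longrightarrow> Ck_on k S f"
proof (induction k arbitrary: f)
  case 0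
  then show ?case by (auto intro: differentiable_imp_continuous_on)
next
  case (Suc k)
  from Suc.prems have a: "f differentiable_on S"
    "\<And>b. b \<in> Basis \<Longrightarrow> Ck_on (Suc k) S (\<lambda>u. frechet_derivative f (at u) b)"
    by (simp_all only: Ck_on.simps) blast+
  show ?case unfolding Ck_on.simps(2) using a Suc.IH by blast
qed

lemma Ck_on_subset: "Ck_on k S f \<Longrightarrow> T \<subseteq> S \<Longrightarrow> Ck_on k T f"
  by (induction k arbitrary: f) (auto intro: continuous_on_subset differentiable_on_subset)

lemma Ck_on_cong:
  assumes "open S" "\<And>u. u \<in> S \<Longrightarrow> f u = g u"
  shows "Ck_on k S f \<longleftrightarrow> Ck_on k S g"
proof -
  have imp: "Ck_on k S g" if "Ck_on k S f" "\<And>u. u \<in> S \<Longrightarrow> f u = g u" for k f g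
    using that
  proof (induction k arbitrary: f g)
    case 0 then show ?case using continuous_on_cong by (metis Ck_on.simps(1))
  next
    case (Suc k)
    have d: "f differentiable at u" if "u \<in> S" for u
      using Suc.prems(1) assms(1) that by (simp add: differentiable_on_eq_differentiable_at)
    have e: "frechet_derivative f (at u) = frechet_derivative g (at u)" if "u \<in> S" for u
      by (rule frechet_derivative_transform_within_open[OF d assms(1)]) (use that Suc.prems in auto)
    have d2: "g differentiable at u" if "u \<in> S" for u
      using Suc.prems(2)
      by (metis assms(1) d differentiable_def has_derivative_transform_within_open that)
    show ?case unfolding Ck_on.simps(2)
      using d2 e Suc.IH Suc.prems(1) assms(1) by (auto simp: differentiable_on_eq_differentiable_at)
  qed
  show ?thesis using imp[of k f g] imp[of k g f] assms(2) by auto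
qed

lemma Ck_on_eqI: "open S \<Longrightarrow> Ck_on k S f \<Longrightarrow> (\<And>u. u \<in> S \<Longrightarrow> f u = g u) \<Longrightarrow> Ck_on k S g"
  by (rule Ck_on_cong[THEN iffD1])

lemma Ck_on_SucI:
  assumes "open S" "\<And>u. u \<in> S \<Longrightarrow> (f has_derivative f' u) (at u)"
    and "\<And>b. b \<in> Basis \<Longrightarrow> Ck_on k S (\<lambda>u. f' u b)"
  shows "Ck_on (Suc k) S f"
proof -
  have e: "f' u = frechet_derivative f (at u)" if "u \<in> S" for u
    using assms(2)[OF that] by (rule frechet_derivative_at)
  have "Ck_on k S (\<lambda>u. frechet_derivative f (at u) b)" if "b \<in> Basis" for b
    by (rule Ck_on_cong[OF assms(1), THEN iffD1, OF _ assms(3)[OF that]]) (simp add: e)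
  moreover have "f differentiable_on S"
    using assms(1,2) by (auto simp: differentiable_on_eq_differentiable_at intro: differentiableI)
  ultimately show ?thesis by simp
qed

lemma Ck_on_local:
  assumes "\<And>u. u \<in> S \<Longrightarrow> \<exists>V. open V \<and> u \<in> V \<and> Ck_on k V f"
  shows "Ck_on k S f"
  using assms
proof (induction k arbitrary: f)
  case 0
  have "continuous (at u) f" if "u \<in> S" for u
    using 0[OF that] by (auto simp: continuous_on_eq_continuous_at)
  then show ?case by (simp add: continuous_at_imp_continuous_on)
next
  case (Suc k)
  have "f differentiable at u" if "u \<in> S" for u
    using Suc.prems[OF that] by (auto simp: differentiable_on_eq_differentiable_at)
  then have "f differentiable_on S"
    by (simp add: differentiable_at_imp_differentiable_on)
  moreover have "Ck_on k S (\<lambda>u. frechet_derivative f (at u) b)" if "b \<in> Basis" for b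
  proof (rule Suc.IH)
    fix u assume "u \<in> S"
    from Suc.prems[OF this] that
    show "\<exists>V. open V \<and> u \<in> V \<and> Ck_on k V (\<lambda>u. frechet_derivative f (at u) b)"
      unfolding Ck_on.simps(2) by blast
  qed
  ultimately show ?case by simp
qed

lemma Ck_on_const [simp, intro]: "Ck_on k S (\<lambda>u. c)"
  by (induction k arbitrary: c) auto

lemma Ck_on_linear:
  assumes "bounded_linear f" shows "Ck_on k S f"
proof -
  have "f differentiable at u" for u
    using assms bounded_linear_imp_differentiable by blast
  moreover have "frechet_derivative f (at u) = f" for u
    using frechet_derivative_at[OF bounded_linear_imp_has_derivative[OF assms]] by metis
  ultimately show ?thesis
    by (cases k) (auto simp: differentiable_on_def differentiable_at_withinI linear_continuous_on[OF assms])
qed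

lemma Ck_on_bounded_linear:
  fixes f :: "'a::euclidean_space \<Rightarrow> 'b::real_normed_vector" and L :: "'b \<Rightarrow> 'c::real_normed_vector"
  assumes "bounded_linear L" "open S" "Ck_on k S f"
  shows "Ck_on k S (\<lambda>u. L (f u))"
  using assms(3)
proof (induction k arbitrary: f)
  case 0 then show ?case using assms(1) by (simp add: bounded_linear.continuous_on)
next
  case (Suc k)
  show ?case
  proof (rule Ck_on_SucI[OF assms(2) bounded_linear.has_derivative[OF assms(1) Ck_on_SucD[OF Suc.prems assms(2)]]])
    fix b :: 'a assume "b \<in> Basis"
    with Suc.prems have "Ck_on k S (\<lambda>u. frechet_derivative f (at u) b)" by simp
    then show "Ck_on k S (\<lambda>u. L (frechet_derivative f (at u) b))" by (rule Suc.IH)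
  qed
qed

lemma Ck_on_add:
  fixes f g :: "'a::euclidean_space \<Rightarrow> 'b::real_normed_vector"
  assumes "open S" "Ck_on k S f" "Ck_on k S g"
  shows "Ck_on k S (\<lambda>u. f u + g u)"
  using assms(2,3)
proof (induction k arbitrary: f g)
  case 0 then show ?case unfolding Ck_on.simps by (rule continuous_on_add)
next
  case (Suc k)
  show ?case
  proof (rule Ck_on_SucI[OF assms(1) has_derivative_add[OF Ck_on_SucD[OF Suc.prems(1) assms(1)] Ck_on_SucD[OF Suc.prems(2) assms(1)]]])
    fix b :: 'a assume b: "b \<in> Basis"
    with Suc.prems have "Ck_on k S (\<lambda>u. frechet_derivative f (at u) b)"
      "Ck_on k S (\<lambda>u. frechet_derivative g (at u) b)" by simp_all
    then show "Ck_on k S (\<lambda>u. frechet_derivative f (at u) b + frechet_derivative g (at u) b)"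
      by (rule Suc.IH)
  qed
qed

lemma Ck_on_minus: "open S \<Longrightarrow> Ck_on k S f \<Longrightarrow> Ck_on k S (\<lambda>u. - f u)"
  by (rule Ck_on_bounded_linear[OF bounded_linear_minus[OF bounded_linear_ident]])

lemma Ck_on_diff:
  "open S \<Longrightarrow> Ck_on k S f \<Longrightarrow> Ck_on k S g \<Longrightarrow> Ck_on k S (\<lambda>u. f u - g u)"
  using Ck_on_add[OF _ _ Ck_on_minus, of S k f g] by (simp del: Ck_on.simps)

lemma Ck_on_sum:
  "open S \<Longrightarrow> (\<And>i. i \<in> I \<Longrightarrow> Ck_on k S (f i)) \<Longrightarrow> Ck_on k S (\<lambda>u. \<Sum>i\<in>I. f i u)"
proof (induction I rule: infinite_finite_induct)
  case (insert i I)
  have "Ck_on k S (\<lambda>u. f i u + (\<Sum>i\<in>I. f i u))"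
    by (rule Ck_on_add) (use insert in auto)
  then show ?case using insert by (simp del: Ck_on.simps)
qed (simp_all del: Ck_on.simps)

lemma Ck_on_scaleR:
  fixes f :: "'a::euclidean_space \<Rightarrow> real" and g :: "'a \<Rightarrow> 'b::real_normed_vector"
  assumes "open S" "Ck_on k S f" "Ck_on k S g"
  shows "Ck_on k S (\<lambda>u. f u *\<^sub>R g u)"
  using assms(2,3)
proof (induction k arbitrary: f g)
  case 0 then show ?case unfolding Ck_on.simps by (rule continuous_on_scaleR)
next
  case (Suc k)
  show ?case
  proof (rule Ck_on_SucI[OF assms(1) has_derivative_scaleR[OF Ck_on_SucD[OF Suc.prems(1) assms(1)] Ck_on_SucD[OF Suc.prems(2) assms(1)]]])
    fix b :: 'a assume b: "b \<in> Basis"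
    with Suc.prems have "Ck_on k S (\<lambda>u. frechet_derivative f (at u) b)"
      "Ck_on k S (\<lambda>u. frechet_derivative g (at u) b)" by simp_all
    moreover have "Ck_on k S f" "Ck_on k S g" using Suc.prems Ck_on_mono1 by blast+
    ultimately show "Ck_on k S (\<lambda>u. f u *\<^sub>R frechet_derivative g (at u) b + frechet_derivative f (at u) b *\<^sub>R g u)"
      by (intro Ck_on_add assms(1) Suc.IH)
  qed
qed

lemma Ck_on_mult:
  fixes f g :: "'a::euclidean_space \<Rightarrow> real"
  shows "open S \<Longrightarrow> Ck_on k S f \<Longrightarrow> Ck_on k S g \<Longrightarrow> Ck_on k S (\<lambda>u. f u * g u)"
  using Ck_on_scaleR[of S k f g] by (simp del: Ck_on.simps)

lemma Ck_on_prod: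
  fixes f :: "'i \<Rightarrow> 'a::euclidean_space \<Rightarrow> real"
  shows "open S \<Longrightarrow> (\<And>i. i \<in> I \<Longrightarrow> Ck_on k S (f i)) \<Longrightarrow> Ck_on k S (\<lambda>u. \<Prod>i\<in>I. f i u)"
proof (induction I rule: infinite_finite_induct)
  case (insert i I)
  have "Ck_on k S (\<lambda>u. f i u * (\<Prod>i\<in>I. f i u))"
    by (rule Ck_on_mult) (use insert in auto)
  then show ?case using insert by (simp del: Ck_on.simps)
qed (simp_all del: Ck_on.simps)

text \<open>
  The chain rule expresses the partial derivatives of the composite by products of the partial
  derivatives of \<open>f\<close> with the composites of \<open>f\<close> and the partial derivatives of \<open>g\<close>, to which the
  induction hypothesis applies.
\<close>

lemma Ck_on_compose:
  fixes f :: "'a::euclidean_space \<Rightarrow> 'b::euclidean_space" and g :: "'b \<Rightarrow> 'c::real_normed_vector"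
  assumes "open S" "open T" "f ` S \<subseteq> T" "Ck_on k S f" "Ck_on k T g"
  shows "Ck_on k S (\<lambda>u. g (f u))"
  using assms(4,5)
proof (induction k arbitrary: g)
  case 0 then show ?case using assms(3) continuous_on_compose2 by (metis Ck_on.simps(1))
next
  case (Suc k)
  let ?Df = "\<lambda>u. frechet_derivative f (at u)" and ?Dg = "\<lambda>v. frechet_derivative g (at v)"
  have der: "((\<lambda>u. g (f u)) has_derivative (\<lambda>h. \<Sum>e\<in>Basis. (?Df u h \<bullet> e) *\<^sub>R ?Dg (f u) e)) (at u)"
    if "u \<in> S" for u
  proof -
    have fu: "f u \<in> T" using assms(3) that by auto
    have dg: "(g has_derivative ?Dg (f u)) (at (f u))"
      using Ck_on_SucD[OF Suc.prems(2) assms(2) fu] .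
    have lin: "linear (?Dg (f u))" using dg has_derivative_linear by blast
    have expand: "?Dg (f u) w = (\<Sum>e\<in>Basis. (w \<bullet> e) *\<^sub>R ?Dg (f u) e)" for w
    proof -
      have "?Dg (f u) w = ?Dg (f u) (\<Sum>e\<in>Basis. (w \<bullet> e) *\<^sub>R e)" by (simp add: euclidean_representation)
      also have "\<dots> = (\<Sum>e\<in>Basis. (w \<bullet> e) *\<^sub>R ?Dg (f u) e)"
        by (simp add: linear_sum[OF lin] linear_scale[OF lin])
      finally show ?thesis .
    qed
    have "?Dg (f u) \<circ> ?Df u = (\<lambda>h. \<Sum>e\<in>Basis. (?Df u h \<bullet> e) *\<^sub>R ?Dg (f u) e)"
      unfolding o_def by (rule ext, rule expand)
    then show ?thesis
      using diff_chain_at[OF Ck_on_SucD[OF Suc.prems(1) assms(1) that] dg] unfolding o_def by metis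
  qed
  have f: "Ck_on k S f" using Suc.prems(1) Ck_on_mono1 by blast
  show ?case
  proof (rule Ck_on_SucI[OF assms(1) der])
    fix b :: 'a assume b: "b \<in> Basis"
    show "Ck_on k S (\<lambda>u. \<Sum>e\<in>Basis. (?Df u b \<bullet> e) *\<^sub>R ?Dg (f u) e)"
    proof (intro Ck_on_sum Ck_on_scaleR assms(1))
      fix e :: 'b assume e: "e \<in> Basis"
      have "Ck_on k S (\<lambda>u. ?Df u b)" using Suc.prems(1) b by simp
      then show "Ck_on k S (\<lambda>u. ?Df u b \<bullet> e)"
        by (rule Ck_on_bounded_linear[OF bounded_linear_inner_left assms(1)])
      show "Ck_on k S (\<lambda>u. ?Dg (f u) e)"
        by (rule Suc.IH[OF f]) (use Suc.prems(2) e in simp)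
    qed
  qed
qed

lemma Ck_on_inverse:
  fixes f :: "'a::euclidean_space \<Rightarrow> real"
  assumes "open S" "Ck_on k S f" "\<And>u. u \<in> S \<Longrightarrow> f u \<noteq> 0"
  shows "Ck_on k S (\<lambda>u. inverse (f u))"
  using assms(2)
proof (induction k)
  case 0 then show ?case unfolding Ck_on.simps by (rule continuous_on_inverse) (use assms(3) in blast)
next
  case (Suc k)
  show ?case
  proof (rule Ck_on_SucI[OF assms(1) Deriv.has_derivative_inverse[OF assms(3) Ck_on_SucD[OF Suc.prems assms(1)]]])
    fix b :: 'a assume b: "b \<in> Basis"
    have "Ck_on k S (\<lambda>u. frechet_derivative f (at u) b)" using b Suc.prems by simp
    moreover have "Ck_on k S (\<lambda>u. inverse (f u))" using Suc.IH Suc.prems Ck_on_mono1 by blast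
    ultimately show "Ck_on k S (\<lambda>u. - (inverse (f u) * frechet_derivative f (at u) b * inverse (f u)))"
      by (intro Ck_on_minus Ck_on_mult assms(1))
  qed
qed

section \<open>Smooth bump functions\<close>

text \<open>
  For \<open>m = 0\<close> this is the standard smooth function that is positive exactly on the positive half
  line.  The powers of \<open>1 / t\<close> make the family closed under differentiation up to linear
  combinations, so that all of its members are smooth at once.
\<close>

definition flat :: "nat \<Rightarrow> real \<Rightarrow> real"
  where "flat m t = (if t > 0 then inverse t ^ m * exp (- inverse t) else 0)"

text \<open>
  The exponential beats every power of \<open>1 / t\<close>.
\<close>

lemma flat_tendsto_0: "(flat m \<longlongrightarrow> 0) (at 0)"
proof -
  have "((\<lambda>t. inverse t ^ m / exp (inverse t)) \<longlongrightarrow> (0::real)) (at_right 0)"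
    using filterlim_compose[OF tendsto_power_div_exp_0 filterlim_inverse_at_top_right] .
  then have "(flat m \<longlongrightarrow> 0) (at_right 0)"
    by (rule Lim_transform_eventually)
      (auto simp: flat_def exp_minus divide_inverse eventually_at intro!: exI[of _ 1])
  moreover have "(flat m \<longlongrightarrow> 0) (at_left 0)"
    by (rule tendsto_eventually) (auto simp: flat_def eventually_at intro!: exI[of _ 1])
  ultimately show ?thesis by (simp add: filterlim_split_at)
qed

lemma flat_derivative:
  "(flat m has_real_derivative flat (m + 2) t - real m * flat (m + 1) t) (at t)"
proof -
  consider "t > 0" | "t = 0" | "t < 0" by linarith
  then show ?thesis
  proof cases
    case 1
    have "((\<lambda>t. inverse t ^ m * exp (- inverse t)) has_real_derivative
        flat (m + 2) t - real m * flat (m + 1) t) (at t)"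
      using 1 by (cases m) (auto intro!: derivative_eq_intros simp: flat_def power2_eq_square algebra_simps,
        metis One_nat_def power_eq_if)
    then show ?thesis
      by (rule DERIV_cong_ev[THEN iffD1, rotated -1])
        (use 1 eventually_nhds_in_open[of "{0<..}" t] in \<open>auto simp: flat_def elim!: eventually_mono\<close>)
  next
    case 2
    \<comment> \<open>the difference quotient at 0 is the next function of the family\<close>
    have "((\<lambda>h. (flat m (0 + h) - flat m 0) / h) \<longlongrightarrow> 0) (at 0)"
      by (rule Lim_transform_eventually[OF flat_tendsto_0[of "m + 1"]])
        (auto simp: flat_def eventually_at divide_inverse intro!: exI[of _ 1])
    then have "(flat m has_real_derivative 0) (at 0)" unfolding DERIV_def .
    moreover have "flat k 0 = 0" for k by (simp add: flat_def)
    ultimately show ?thesis using 2 by simp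
  next
    case 3
    have "((\<lambda>t. 0) has_real_derivative flat (m + 2) t - real m * flat (m + 1) t) (at t)"
      using 3 by (simp add: flat_def)
    then show ?thesis
      by (rule DERIV_cong_ev[THEN iffD1, rotated -1])
        (use 3 eventually_nhds_in_open[of "{..<0}" t] in \<open>auto simp: flat_def elim!: eventually_mono\<close>)
  qed
qed

lemma Ck_on_flat: "Ck_on k UNIV (flat m)"
proof (induction k arbitrary: m)
  case 0
  show ?case
    using flat_derivative DERIV_isCont by (fastforce intro: continuous_at_imp_continuous_on)
next
  case (Suc k)
  show ?case
    by (rule Ck_on_SucI[OF _ flat_derivative[unfolded has_field_derivative_def]])
      (auto intro!: Ck_on_mult Ck_on_diff Suc.IH)
qed

text \<open>
  The usual quotient of a function that vanishes far from \<open>u\<^sub>0\<close> by its sum with one that vanishes near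
  \<open>u\<^sub>0\<close>, both obtained from \<open>flat 0\<close> and the square of the distance, which is smooth everywhere.
\<close>

lemma exists_bump:
  fixes u\<^sub>0 :: "'a::euclidean_space"
  assumes "0 < r" "r < R"
  obtains \<beta> :: "'a \<Rightarrow> real" where "\<And>k. Ck_on k UNIV \<beta>"
    "\<And>u. dist u\<^sub>0 u \<le> r \<Longrightarrow> \<beta> u = 1" "\<And>u. R \<le> dist u\<^sub>0 u \<Longrightarrow> \<beta> u = 0"
proof -
  define q where "q u = (u - u\<^sub>0) \<bullet> (u - u\<^sub>0)" for u
  have q: "q u = (dist u\<^sub>0 u)\<^sup>2" for u
    unfolding q_def dist_norm by (metis norm_minus_commute power2_norm_eq_inner)
  define \<beta> where "\<beta> u = flat 0 (R\<^sup>2 - q u) * inverse (flat 0 (R\<^sup>2 - q u) + flat 0 (q u - r\<^sup>2))" for u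
  have qC: "Ck_on k UNIV q" for k
  proof -
    have "Ck_on k UNIV (\<lambda>u. \<Sum>b\<in>Basis. ((u - u\<^sub>0) \<bullet> b) * ((u - u\<^sub>0) \<bullet> b))" for k
      by (intro Ck_on_sum Ck_on_mult Ck_on_bounded_linear[OF bounded_linear_inner_left] Ck_on_diff
        Ck_on_linear bounded_linear_ident Ck_on_const open_UNIV)
    moreover have "q = (\<lambda>u. \<Sum>b\<in>Basis. ((u - u\<^sub>0) \<bullet> b) * ((u - u\<^sub>0) \<bullet> b))"
      unfolding q_def by (rule ext, subst euclidean_inner) simp
    ultimately show ?thesis by simp
  qed
  have rR: "r\<^sup>2 < R\<^sup>2" using assms by (simp add: power_strict_mono)
  have pos: "flat 0 (R\<^sup>2 - q u) + flat 0 (q u - r\<^sup>2) \<noteq> 0" for u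
    using rR by (auto simp: flat_def add_pos_pos less_imp_neq[symmetric])
  have "Ck_on k UNIV \<beta>" for k unfolding \<beta>_def
    by (intro Ck_on_mult Ck_on_inverse Ck_on_add Ck_on_compose[OF open_UNIV open_UNIV _ _ Ck_on_flat] Ck_on_diff qC
      Ck_on_const open_UNIV pos) auto
  moreover have "\<beta> u = 1" if "dist u\<^sub>0 u \<le> r" for u
  proof -
    have "q u \<le> r\<^sup>2" unfolding q using that by (simp add: power_mono)
    then show ?thesis using rR by (simp add: \<beta>_def flat_def)
  qed
  moreover have "\<beta> u = 0" if "R \<le> dist u\<^sub>0 u" for u
  proof -
    have "R\<^sup>2 \<le> q u" unfolding q using that assms by (simp add: power_mono)
    then show ?thesis by (simp add: \<beta>_def flat_def)
  qed
  ultimately show ?thesis using that by blast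
qed

section \<open>Differentiability from partial derivatives\<close>

lemma has_real_derivative_line_shift:
  fixes f :: "'a::real_normed_vector \<Rightarrow> real"
  assumes "((\<lambda>h. f (u + t *\<^sub>R b + h *\<^sub>R b)) has_real_derivative D) (at 0)"
  shows "((\<lambda>h. f (u + h *\<^sub>R b)) has_real_derivative D) (at t)"
proof -
  have "((\<lambda>h. f (u + t *\<^sub>R b + h *\<^sub>R b)) has_real_derivative D) (at (t + - t))"
    using assms by simp
  then have "((\<lambda>h. f (u + t *\<^sub>R b + (h + - t) *\<^sub>R b)) has_real_derivative D) (at t)"
    by (simp only: DERIV_shift)
  then show ?thesis by (simp add: algebra_simps)
qed

text \<open>
  The increment from \<open>u\<close> to \<open>u + h\<close> is split into steps parallel to the coordinate axes.  On each step
  the mean value inequality compares \<open>f\<close> with the linear function given by the partial derivatives at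
  \<open>u\<close>, which are close to those along the path by continuity.
\<close>

lemma has_derivative_from_partials:
  fixes f :: "'a::euclidean_space \<Rightarrow> real"
  assumes "open S" "u \<in> S"
    and g: "\<And>b w. b \<in> Basis \<Longrightarrow> w \<in> S \<Longrightarrow> ((\<lambda>t. f (w + t *\<^sub>R b)) has_real_derivative g b w) (at 0)"
    and cont: "\<And>b. b \<in> Basis \<Longrightarrow> continuous_on S (g b)"
  shows "(f has_derivative (\<lambda>h. \<Sum>b\<in>Basis. (h \<bullet> b) * g b u)) (at u)"
  unfolding has_derivative_at_alt
proof (intro conjI allI impI)
  show "bounded_linear (\<lambda>h. \<Sum>b\<in>Basis. (h \<bullet> b) * g b u)"
    by (intro bounded_linear_sum bounded_linear_mult_const bounded_linear_inner_left)
  fix e :: real assume "e > 0"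
  define e' where "e' = e / DIM('a)"
  have e': "e' > 0" using \<open>e > 0\<close> by (simp add: e'_def)
  obtain d0 where d0: "d0 > 0" "ball u d0 \<subseteq> S" using assms(1,2) openE by blast
  have "\<forall>b\<in>Basis. \<exists>d>0. \<forall>w. dist u w < d \<longrightarrow> \<bar>g b w - g b u\<bar> \<le> e'"
  proof
    fix b :: 'a assume "b \<in> Basis"
    then have "continuous (at u) (g b)"
      using cont assms(1,2) by (simp add: continuous_on_eq_continuous_at)
    then obtain d where "d > 0" "\<And>w. dist w u < d \<Longrightarrow> dist (g b w) (g b u) < e'"
      using e' unfolding continuous_at_eps_delta by (metis dist_norm)
    then show "\<exists>d>0. \<forall>w. dist u w < d \<longrightarrow> \<bar>g b w - g b u\<bar> \<le> e'"
      by (metis dist_commute dist_real_def less_le)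
  qed
  then obtain dd where dd: "\<And>b. b \<in> Basis \<Longrightarrow> dd b > 0"
    "\<And>b w. b \<in> Basis \<Longrightarrow> dist u w < dd b \<Longrightarrow> \<bar>g b w - g b u\<bar> \<le> e'" by metis
  define d where "d = min d0 (Min (dd ` Basis))"
  have d: "d > 0" "ball u d \<subseteq> S" using d0 dd(1) by (auto simp: d_def)
  have gd: "\<bar>g b w - g b u\<bar> \<le> e'" if "b \<in> Basis" "dist u w < d" for b w
  proof (rule dd(2)[OF that(1)])
    have "d \<le> dd b" using that(1) by (auto simp: d_def intro: min.coboundedI2)
    then show "dist u w < dd b" using that(2) by linarith
  qed
  have step: "\<bar>f (w + s *\<^sub>R b) - f w - s * g b u\<bar> \<le> e' * \<bar>s\<bar>"
    if b: "b \<in> Basis" and w: "dist u w + \<bar>s\<bar> < d" for b w s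
  proof -
    have in_d: "dist u (w + t *\<^sub>R b) < d" if "t \<in> closed_segment 0 s" for t
    proof -
      have "\<bar>t\<bar> \<le> \<bar>s\<bar>" using that by (auto simp: closed_segment_eq_real_ivl split: if_splits)
      moreover have "dist u (w + t *\<^sub>R b) \<le> dist u w + \<bar>t\<bar>"
        using dist_triangle[of u "w + t *\<^sub>R b" w] b by (simp add: dist_norm)
      ultimately show ?thesis using w by linarith
    qed
    have "norm ((f (w + s *\<^sub>R b) - s * g b u) - (f (w + 0 *\<^sub>R b) - 0 * g b u)) \<le> e' * norm (s - 0)"
    proof (rule field_differentiable_bound[where S="closed_segment 0 s" and f'="\<lambda>t. g b (w + t *\<^sub>R b) - g b u"])
      fix t assume t: "t \<in> closed_segment 0 s"
      then have S: "w + t *\<^sub>R b \<in> S" using in_d d(2) by auto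
      have "((\<lambda>h. f (w + t *\<^sub>R b + h *\<^sub>R b)) has_real_derivative g b (w + t *\<^sub>R b)) (at (t + - t))"
        using g[OF b S] by simp
      then have "((\<lambda>h. f (w + t *\<^sub>R b + (h + - t) *\<^sub>R b)) has_real_derivative g b (w + t *\<^sub>R b)) (at t)"
        by (simp only: DERIV_shift)
      then have "((\<lambda>h. f (w + h *\<^sub>R b)) has_real_derivative g b (w + t *\<^sub>R b)) (at t)"
        by (simp add: algebra_simps)
      then have "((\<lambda>h. f (w + h *\<^sub>R b) - h * g b u) has_real_derivative g b (w + t *\<^sub>R b) - g b u) (at t)"
        by (auto intro!: derivative_eq_intros)
      then show "((\<lambda>h. f (w + h *\<^sub>R b) - h * g b u) has_real_derivative g b (w + t *\<^sub>R b) - g b u)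
          (at t within closed_segment 0 s)" using has_field_derivative_at_within by blast
      show "norm (g b (w + t *\<^sub>R b) - g b u) \<le> e'" using gd[OF b in_d[OF t]] by simp
    qed auto
    then show ?thesis by (simp add: algebra_simps)
  qed
  have main: "\<bar>f (u + (\<Sum>b\<in>B. (h \<bullet> b) *\<^sub>R b)) - f u - (\<Sum>b\<in>B. (h \<bullet> b) * g b u)\<bar> \<le> e' * (\<Sum>b\<in>B. \<bar>h \<bullet> b\<bar>)"
    if "B \<subseteq> Basis" "(\<Sum>b\<in>Basis. \<bar>h \<bullet> b\<bar>) < d" for h B
    using finite_subset[OF that(1) finite_Basis] that(1)
  proof (induction B rule: finite_induct)
    case empty then show ?case by simp
  next
    case (insert b B)
    let ?w = "u + (\<Sum>b\<in>B. (h \<bullet> b) *\<^sub>R b)"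
    have "dist u ?w = norm (\<Sum>b\<in>B. (h \<bullet> b) *\<^sub>R b)" by (simp add: dist_norm)
    also have "\<dots> \<le> (\<Sum>b\<in>B. \<bar>h \<bullet> b\<bar>)"
      by (rule sum_norm_le) (use insert in auto)
    finally have "dist u ?w + \<bar>h \<bullet> b\<bar> \<le> (\<Sum>b\<in>insert b B. \<bar>h \<bullet> b\<bar>)"
      using insert by simp
    also have "\<dots> \<le> (\<Sum>b\<in>Basis. \<bar>h \<bullet> b\<bar>)"
      by (rule sum_mono2) (use insert in auto)
    finally have "dist u ?w + \<bar>h \<bullet> b\<bar> < d" using that(2) by simp
    from step[OF _ this] insert
    have "\<bar>f (?w + (h \<bullet> b) *\<^sub>R b) - f ?w - (h \<bullet> b) * g b u\<bar> \<le> e' * \<bar>h \<bullet> b\<bar>" by simp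
    moreover have "u + (\<Sum>b\<in>insert b B. (h \<bullet> b) *\<^sub>R b) = ?w + (h \<bullet> b) *\<^sub>R b"
      using insert by (simp add: algebra_simps)
    ultimately show ?case using insert by (simp add: algebra_simps)
  qed
  show "\<exists>d>0. \<forall>y. norm (y - u) < d \<longrightarrow>
      norm (f y - f u - (\<Sum>b\<in>Basis. ((y - u) \<bullet> b) * g b u)) \<le> e * norm (y - u)"
  proof (intro exI[of _ "d / DIM('a)"] conjI allI impI)
    show "d / DIM('a) > 0" using d by simp
    fix y assume y: "norm (y - u) < d / DIM('a)"
    have le: "(\<Sum>b\<in>Basis. \<bar>(y - u) \<bullet> b\<bar>) \<le> DIM('a) * norm (y - u)"
      using sum_bounded_above[of Basis "\<lambda>b. \<bar>(y - u) \<bullet> b\<bar>" "norm (y - u)"] Basis_le_norm by auto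
    also have "\<dots> < d" using y by (simp add: field_simps)
    finally have "\<bar>f (u + (\<Sum>b\<in>Basis. ((y - u) \<bullet> b) *\<^sub>R b)) - f u - (\<Sum>b\<in>Basis. ((y - u) \<bullet> b) * g b u)\<bar>
        \<le> e' * (\<Sum>b\<in>Basis. \<bar>(y - u) \<bullet> b\<bar>)" by (intro main) auto
    also have "\<dots> \<le> e' * (DIM('a) * norm (y - u))"
      using le e' by (intro mult_left_mono) auto
    also have "\<dots> = e * norm (y - u)" by (simp add: e'_def)
    finally show "norm (f y - f u - (\<Sum>b\<in>Basis. ((y - u) \<bullet> b) * g b u)) \<le> e * norm (y - u)"
      by (simp add: euclidean_representation)
  qed
qed

section \<open>The action of matrices on tensor components\<close>

lemma finite_lists_of_length [simp]: "finite {ks :: 'n::finite list. length ks = r}"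
  using finite_lists_length_eq[of "UNIV :: 'n set" r] by simp

lemma sum_lists_Suc:
  fixes f :: "'n::finite list \<Rightarrow> 'a::comm_monoid_add"
  shows "(\<Sum>ks\<in>{ks. length ks = Suc r}. f ks) = (\<Sum>k\<in>UNIV. \<Sum>ks\<in>{ks. length ks = r}. f (k # ks))"
proof -
  have *: "{ks :: 'n list. length ks = Suc r} = (\<lambda>(k, ks). k # ks) ` (UNIV \<times> {ks. length ks = r})"
    by (auto simp: length_Suc_conv image_iff)
  have "inj_on (\<lambda>(k, ks). k # ks) (UNIV \<times> {ks :: 'n list. length ks = r})"
    by (auto simp: inj_on_def)
  then show ?thesis
    unfolding * by (subst sum.reindex) (auto simp: sum.cartesian_product intro!: sum.cong)
qed

lemma sum_lists_1: 
  fixes f :: "'n::finite list \<Rightarrow> 'a::comm_monoid_add"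
  shows "(\<Sum>ks\<in>{ks. length ks = Suc 0}. f ks) = (\<Sum>k\<in>UNIV. f [k])"
  by (simp add: sum_lists_Suc)

lemma sum_lists_prod:
  fixes f :: "nat \<Rightarrow> 'n::finite \<Rightarrow> 'a::comm_semiring_1"
  shows "(\<Sum>ks\<in>{ks. length ks = r}. \<Prod>a<r. f a (ks ! a)) = (\<Prod>a<r. \<Sum>k\<in>UNIV. f a k)"
proof (induction r arbitrary: f)
  case 0 then show ?case by simp
next
  case (Suc r)
  show ?case
    by (simp add: sum_lists_Suc prod.lessThan_Suc_shift Suc.IH[of "\<lambda>a. f (Suc a)"]
      sum_distrib_left[symmetric] sum_distrib_right[symmetric] del: prod.lessThan_Suc)
qed

text \<open>
  The matrix \<open>P\<close> acts on each of the \<open>r\<close> indices of a tensor with contravariant indices only; \<open>act\<close> below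
  lets in addition \<open>Q\<close> act on the lower indices, from the other side.  With the Jacobian matrix of a
  change of charts and its inverse, \<open>act\<close> is the transformation law of tensors; with the matrices of the
  transport operators it is the integrand of the embedding.
\<close>

definition vact :: "nat \<Rightarrow> real^'n^'n \<Rightarrow> ('n::finite list \<Rightarrow> real) \<Rightarrow> 'n list \<Rightarrow> real"
  where "vact r P t is = (\<Sum>ks\<in>{ks. length ks = r}. (\<Prod>a<r. P $ (is ! a) $ (ks ! a)) * t ks)"

lemma vact_cong: "(\<And>ks. length ks = r \<Longrightarrow> t ks = t' ks) \<Longrightarrow> vact r P t is = vact r P t' is"
  unfolding vact_def by (rule sum.cong) auto

lemma vact_vact: "vact r P (vact r Q t) is = vact r (P ** Q) t is"
proof -
  let ?L = "{ks :: 'n list. length ks = r}"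
  have "vact r P (vact r Q t) is =
      (\<Sum>ks\<in>?L. \<Sum>ls\<in>?L. (\<Prod>a<r. P $ (is ! a) $ (ks ! a) * Q $ (ks ! a) $ (ls ! a)) * t ls)"
    by (simp add: vact_def sum_distrib_left prod.distrib mult.assoc)
  also have "\<dots> = (\<Sum>ls\<in>?L. (\<Sum>ks\<in>?L. \<Prod>a<r. P $ (is ! a) $ (ks ! a) * Q $ (ks ! a) $ (ls ! a)) * t ls)"
    by (subst sum.swap) (simp add: sum_distrib_right)
  also have "\<dots> = vact r (P ** Q) t is"
    by (simp add: sum_lists_prod[where f="\<lambda>a k. P $ (is ! a) $ k * Q $ k $ (l ! a)" for l] vact_def matrix_matrix_mult_def)
  finally show ?thesis .
qed

lemma prod_mat_1:
  assumes "length is = r" "length ks = r"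
  shows "(\<Prod>a<r. (mat 1 :: real^'n^'n) $ (is ! a) $ (ks ! a)) = (if ks = is then 1 else 0)"
proof (cases "ks = is")
  case False
  then obtain a where "a < r" "is ! a \<noteq> ks ! a" using assms nth_equalityI by metis
  then have "(\<Prod>a<r. (mat 1 :: real^'n^'n) $ (is ! a) $ (ks ! a)) = 0"
    by (intro prod_zero) (auto simp: mat_def)
  then show ?thesis using False by simp
qed (simp add: mat_def)

lemma vact_id:
  assumes "length is = r"
  shows "vact r (mat 1) t is = t is"
proof -
  have "vact r (mat 1) t is = (\<Sum>ks\<in>{ks. length ks = r}. if ks = is then t ks else 0)"
    unfolding vact_def by (rule sum.cong) (auto simp: prod_mat_1 assms)
  also have "\<dots> = t is" using assms by (simp add: sum.delta')
  finally show ?thesis .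
qed

lemma vact_pair:
  "(\<Sum>is\<in>{is. length is = r}. vact r P t is * u is) = (\<Sum>ks\<in>{ks. length ks = r}. t ks * vact r (transpose P) u ks)"
  unfolding vact_def sum_distrib_left sum_distrib_right
  by (subst sum.swap) (simp add: transpose_def mult_ac)

lemma vact_swap:
  "vact s R (\<lambda>ls. vact r P (\<lambda>ks. t ks ls) is) js = vact r P (\<lambda>ks. vact s R (t ks) js) is"
  unfolding vact_def sum_distrib_left by (subst sum.swap) (simp add: mult_ac)

lemma vact_add: "vact r P (\<lambda>ks. t ks + u ks) is = vact r P t is + vact r P u is"
  by (simp add: vact_def distrib_left sum.distrib)

lemma vact_diff: "vact r P (\<lambda>ks. t ks - u ks) is = vact r P t is - vact r P u is"
  by (simp add: vact_def right_diff_distrib sum_subtractf)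

lemma vact_cmult: "vact r P (\<lambda>ks. a * t ks) is = a * vact r P t is"
  by (simp add: vact_def sum_distrib_left mult_ac)

definition act :: "nat \<Rightarrow> nat \<Rightarrow> real^'n^'n \<Rightarrow> real^'n^'n \<Rightarrow> ('n::finite list \<Rightarrow> 'n list \<Rightarrow> real) \<Rightarrow>
    'n list \<Rightarrow> 'n list \<Rightarrow> real"
  where "act r s P Q t is js = vact r P (\<lambda>ks. vact s (transpose Q) (t ks) js) is"

lemma act_expand:
  "act r s P Q t is js = (\<Sum>ks\<in>{ks. length ks = r}. \<Sum>ls\<in>{ls. length ls = s}.
     (\<Prod>a<r. P $ (is ! a) $ (ks ! a)) * (\<Prod>b<s. Q $ (ls ! b) $ (js ! b)) * t ks ls)"
  by (simp add: act_def vact_def transpose_def sum_distrib_left mult.assoc)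

lemma act_cong:
  "(\<And>ks ls. length ks = r \<Longrightarrow> length ls = s \<Longrightarrow> t ks ls = t' ks ls) \<Longrightarrow> act r s P Q t is js = act r s P Q t' is js"
  unfolding act_def by (intro vact_cong) auto

lemma act_1_0 [simp]: "act (Suc 0) 0 P Q t [i] [] = (\<Sum>k\<in>UNIV. P $ i $ k * t [k] [])"
  by (simp add: act_expand sum_lists_1)

lemma act_0_0 [simp]: "act 0 0 P Q t [] [] = t [] []"
  by (simp add: act_expand)

lemma act_act: "act r s P Q (act r s P' Q' t) is js = act r s (P ** P') (Q' ** Q) t is js"
proof -
  have "vact s (transpose Q) (\<lambda>ls. vact r P' (\<lambda>ks'. vact s (transpose Q') (t ks') ls) ks) js
      = vact r P' (\<lambda>ks'. vact s (transpose Q) (vact s (transpose Q') (t ks')) js) ks" for ks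
    using vact_swap[of s "transpose Q" r P' "\<lambda>ks'. vact s (transpose Q') (t ks')" ks js] by simp
  then show ?thesis
    by (simp only: act_def[abs_def] vact_vact matrix_transpose_mul)
qed

lemma act_id: "length is = r \<Longrightarrow> length js = s \<Longrightarrow> act r s (mat 1) (mat 1) t is js = t is js"
  by (simp add: act_def vact_id)

lemma act_add: "act r s P Q (\<lambda>ks ls. t ks ls + u ks ls) is js = act r s P Q t is js + act r s P Q u is js"
  by (simp add: act_def vact_add)

lemma act_diff: "act r s P Q (\<lambda>ks ls. t ks ls - u ks ls) is js = act r s P Q t is js - act r s P Q u is js"
  by (simp add: act_def vact_diff)

lemma act_cmult: "act r s P Q (\<lambda>ks ls. a * t ks ls) is js = a * act r s P Q t is js"
  by (simp add: act_def vact_cmult)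

definition pairing :: "nat \<Rightarrow> nat \<Rightarrow> ('n::finite list \<Rightarrow> 'n list \<Rightarrow> real) \<Rightarrow> ('n list \<Rightarrow> 'n list \<Rightarrow> real) \<Rightarrow> real"
  where "pairing r s t \<psi> = (\<Sum>is\<in>{is. length is = r}. \<Sum>js\<in>{js. length js = s}. t is js * \<psi> js is)"

lemma pairing_act: "pairing r s (act r s P Q t) \<psi> = pairing r s t (act s r Q P \<psi>)"
proof -
  let ?I = "{is :: 'n list. length is = r}" and ?J = "{js :: 'n list. length js = s}"
  have "pairing r s (act r s P Q t) \<psi> =
      (\<Sum>js\<in>?J. \<Sum>is\<in>?I. vact r P (\<lambda>ks. vact s (transpose Q) (t ks) js) is * \<psi> js is)"
    unfolding pairing_def act_def by (rule sum.swap)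
  also have "\<dots> = (\<Sum>ks\<in>?I. \<Sum>js\<in>?J. vact s (transpose Q) (t ks) js * vact r (transpose P) (\<psi> js) ks)"
    by (subst sum.swap) (rule sum.cong[OF refl], rule vact_pair)
  also have "\<dots> = pairing r s t (act s r Q P \<psi>)"
    unfolding pairing_def act_def
    by (rule sum.cong[OF refl], subst vact_pair) (simp only: transpose_transpose)
  finally show ?thesis .
qed

lemma pairing_cong:
  "(\<And>is js. length is = r \<Longrightarrow> length js = s \<Longrightarrow> t is js = t' is js) \<Longrightarrow>
   (\<And>is js. length is = r \<Longrightarrow> length js = s \<Longrightarrow> \<psi> js is = \<psi>' js is) \<Longrightarrow> pairing r s t \<psi> = pairing r s t' \<psi>'"
  unfolding pairing_def by (intro sum.cong) auto

lemma pairing_inverse_act: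
  assumes "Q ** P = mat 1"
  shows "pairing r s (act r s P Q t) (act s r P Q \<psi>) = pairing r s t \<psi>"
  unfolding pairing_act by (rule pairing_cong) (simp_all add: act_act assms act_id)

text \<open>
  The product rule at the identity matrix: in the term that differentiates the \<open>a\<close>-th factor the other
  factors are entries of the identity matrix, which leave only the multiindices that differ from \<open>is\<close>
  at most in place \<open>a\<close>.
\<close>

lemma vact_has_derivative:
  fixes P :: "real \<Rightarrow> real^'n^'n"
  assumes P: "\<And>i k. ((\<lambda>x. P x $ i $ k) has_real_derivative P' $ i $ k) (at 0)" "P 0 = mat 1"
    and T: "\<And>ks. length ks = r \<Longrightarrow> ((\<lambda>x. T x ks) has_real_derivative T' ks) (at 0)"
    and len: "length is = r"
  shows "((\<lambda>x. vact r (P x) (T x) is) has_real_derivative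
    T' is + (\<Sum>a<r. \<Sum>m\<in>UNIV. P' $ (is ! a) $ m * T 0 (is[a := m]))) (at 0)"
proof -
  let ?L = "{ks :: 'n list. length ks = r}"
  define d where "d ks a = P' $ (is ! a) $ (ks ! a) * (\<Prod>b\<in>{..<r} - {a}. (mat 1 :: real^'n^'n) $ (is ! b) $ (ks ! b))" for ks a
  have prod: "((\<lambda>x. \<Prod>a<r. P x $ (is ! a) $ (ks ! a)) has_real_derivative (\<Sum>a<r. d ks a)) (at 0)" for ks
    using has_derivative_prod[of "{..<r}" "\<lambda>a x. P x $ (is ! a) $ (ks ! a)" "\<lambda>a. (*) (P' $ (is ! a) $ (ks ! a))" 0 UNIV]
      P(1)[unfolded has_field_derivative_def]
    by (simp add: has_field_derivative_def P(2) d_def sum_distrib_right mult_ac fun_eq_iff)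
      (erule has_derivative_eq_rhs, simp add: fun_eq_iff sum_distrib_left mult_ac)
  have single: "(\<Sum>ks\<in>?L. d ks a * T 0 ks) = (\<Sum>m\<in>UNIV. P' $ (is ! a) $ m * T 0 (is[a := m]))" if a: "a < r" for a
  proof -
    have inj: "inj (\<lambda>m. is[a := m])"
      using a len by (auto simp: inj_def) (metis nth_list_update_eq)
    have zero: "d ks a = 0" if "ks \<in> ?L - range (\<lambda>m. is[a := m])" for ks
    proof -
      have "is[a := ks ! a] \<noteq> ks" using that by (metis DiffD2 rangeI)
      moreover have "length ks = r" using that by simp
      ultimately obtain b where "b < r" "is[a := ks ! a] ! b \<noteq> ks ! b"
        using len nth_equalityI[of "is[a := ks ! a]" ks] by auto
      moreover then have "b \<noteq> a" using a len by auto
      ultimately have "b \<in> {..<r} - {a}" "is ! b \<noteq> ks ! b" by auto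
      then show ?thesis unfolding d_def
        by (intro mult_eq_0_iff[THEN iffD2] disjI2 prod_zero) (auto simp: mat_def)
    qed
    have "(\<Sum>ks\<in>?L. d ks a * T 0 ks) = (\<Sum>ks\<in>range (\<lambda>m. is[a := m]). d ks a * T 0 ks)"
    proof (rule sum.mono_neutral_right)
      show "range (\<lambda>m. is[a := m]) \<subseteq> ?L" using len by auto
      show "\<forall>ks\<in>?L - range (\<lambda>m. is[a := m]). d ks a * T 0 ks = 0"
        using zero by (metis mult_zero_left)
    qed simp
    also have "\<dots> = (\<Sum>m\<in>UNIV. d (is[a := m]) a * T 0 (is[a := m]))"
      using inj by (simp add: sum.reindex)
    also have "\<dots> = (\<Sum>m\<in>UNIV. P' $ (is ! a) $ m * T 0 (is[a := m]))"
      using a len by (intro sum.cong) (auto simp: d_def mat_def intro!: prod.neutral)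
    finally show ?thesis .
  qed
  have "((\<lambda>x. vact r (P x) (T x) is) has_real_derivative
      (\<Sum>ks\<in>?L. (\<Sum>a<r. d ks a) * T 0 ks + T' ks * (\<Prod>a<r. P 0 $ (is ! a) $ (ks ! a)))) (at 0)"
    unfolding vact_def
    by (intro DERIV_sum DERIV_mult prod T) auto
  moreover have "(\<Sum>ks\<in>?L. (\<Sum>a<r. d ks a) * T 0 ks + T' ks * (\<Prod>a<r. P 0 $ (is ! a) $ (ks ! a))) =
      (\<Sum>a<r. \<Sum>ks\<in>?L. d ks a * T 0 ks) + vact r (mat 1) T' is"
    unfolding sum.distrib vact_def P(2) sum_distrib_right by (subst sum.swap) (simp add: mult_ac)
  ultimately show ?thesis
    by (simp add: single vact_id[OF len] add.commute)
qed

text \<open>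
  With \<open>P' = G\<close> and \<open>Q' = - G\<close> for the matrix \<open>G\<close> of connection coefficients, the right-hand side is the
  coordinate expression of the covariant derivative.
\<close>

lemma act_has_derivative:
  fixes P Q :: "real \<Rightarrow> real^'n^'n"
  assumes P: "\<And>i k. ((\<lambda>x. P x $ i $ k) has_real_derivative P' $ i $ k) (at 0)" "P 0 = mat 1"
    and Q: "\<And>i k. ((\<lambda>x. Q x $ i $ k) has_real_derivative Q' $ i $ k) (at 0)" "Q 0 = mat 1"
    and T: "\<And>ks ls. length ks = r \<Longrightarrow> length ls = s \<Longrightarrow> ((\<lambda>x. T x ks ls) has_real_derivative T' ks ls) (at 0)"
    and len: "length is = r" "length js = s"
  shows "((\<lambda>x. act r s (P x) (Q x) (T x) is js) has_real_derivative
    T' is js + (\<Sum>a<r. \<Sum>m\<in>UNIV. P' $ (is ! a) $ m * T 0 (is[a := m]) js)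
     + (\<Sum>b<s. \<Sum>m\<in>UNIV. Q' $ m $ (js ! b) * T 0 is (js[b := m]))) (at 0)"
proof -
  have Qt: "((\<lambda>x. transpose (Q x) $ i $ k) has_real_derivative transpose Q' $ i $ k) (at 0)" for i k
    using Q(1) by (simp add: transpose_def)
  have in1: "((\<lambda>x. vact s (transpose (Q x)) (T x ks) js) has_real_derivative
      T' ks js + (\<Sum>b<s. \<Sum>m\<in>UNIV. transpose Q' $ (js ! b) $ m * T 0 ks (js[b := m]))) (at 0)"
    if "length ks = r" for ks
    by (rule vact_has_derivative[OF Qt _ T len(2)]) (use that Q(2) in \<open>auto simp: transpose_mat\<close>)
  have "((\<lambda>x. act r s (P x) (Q x) (T x) is js) has_real_derivative
      (T' is js + (\<Sum>b<s. \<Sum>m\<in>UNIV. transpose Q' $ (js ! b) $ m * T 0 is (js[b := m])))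
      + (\<Sum>a<r. \<Sum>m\<in>UNIV. P' $ (is ! a) $ m * vact s (transpose (Q 0)) (T 0 (is[a := m])) js)) (at 0)"
    unfolding act_def by (rule vact_has_derivative[OF P in1 len(1)]) 
  moreover have "transpose Q' $ i $ k = Q' $ k $ i" for i k by (simp add: transpose_def)
  ultimately show ?thesis
    by (simp add: Q(2) transpose_mat vact_id len add_ac)
qed

lemma Ck_on_act:
  assumes "open S" "\<And>i k. Ck_on n S (\<lambda>u. P u $ i $ k)" "\<And>i k. Ck_on n S (\<lambda>u. Q u $ i $ k)"
    "\<And>ks ls. length ks = r \<Longrightarrow> length ls = s \<Longrightarrow> Ck_on n S (\<lambda>u. T u ks ls)"
  shows "Ck_on n S (\<lambda>u. act r s (P u) (Q u) (T u) is js)"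
  unfolding act_expand by (intro Ck_on_sum Ck_on_mult Ck_on_prod assms) auto

lemma continuous_on_act:
  assumes "\<And>i k. continuous_on S (\<lambda>u. P u $ i $ k)" "\<And>i k. continuous_on S (\<lambda>u. Q u $ i $ k)"
    "\<And>ks ls. length ks = r \<Longrightarrow> length ls = s \<Longrightarrow> continuous_on S (\<lambda>u. T u ks ls)"
  shows "continuous_on S (\<lambda>u. act r s (P u) (Q u) (T u) is js)"
  unfolding act_expand by (intro continuous_intros assms) auto

lemma differentiable_act:
  assumes "\<And>i k. (\<lambda>u. P u $ i $ k) differentiable (at x)" "\<And>i k. (\<lambda>u. Q u $ i $ k) differentiable (at x)"
    "\<And>ks ls. length ks = r \<Longrightarrow> length ls = s \<Longrightarrow> (\<lambda>u. T u ks ls) differentiable (at x)"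
  shows "(\<lambda>u. act r s (P u) (Q u) (T u) is js) differentiable (at x)"
proof -
  have prod: "(\<lambda>u. \<Prod>a\<in>I. f a u) differentiable (at x)" if "\<And>a. (\<lambda>u. f a u) differentiable (at x)"
    for I :: "nat set" and f :: "nat \<Rightarrow> _ \<Rightarrow> real"
    by (induction I rule: infinite_finite_induct) (auto intro!: differentiable_mult that)
  show ?thesis
    unfolding act_expand by (intro differentiable_sum differentiable_mult prod assms ballI) auto
qed

section \<open>Charts and fields\<close>

lemma matrix_works_euclidean:
  fixes f :: "real^'n \<Rightarrow> real^'m"
  assumes "bounded_linear f" shows "(*v) (matrix f) = f"
  using matrix_works assms bounded_linear.linear by (auto simp: linear_def fun_eq_iff)

locale manifold =
  fixes A :: "('m::t2_space, 'n::finite) chart set"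
  assumes smooth_manifold: "smooth_manifold A"
begin

lemma is_chartD: "c \<in> A \<Longrightarrow> is_chart c"
  using smooth_manifold by (simp add: smooth_manifold_def)

lemma open_cdom: "c \<in> A \<Longrightarrow> open (cdom c)" and open_cimg: "c \<in> A \<Longrightarrow> open (cimg c)"
  using is_chartD by (auto simp: is_chart_def)

lemma continuous_on_cmap: "c \<in> A \<Longrightarrow> continuous_on (cdom c) (cmap c)"
  and continuous_on_cinv: "c \<in> A \<Longrightarrow> continuous_on (cimg c) (cinv c)"
  and cinv_cmap: "c \<in> A \<Longrightarrow> x \<in> cdom c \<Longrightarrow> cinv c (cmap c x) = x"
  and cmap_cinv: "c \<in> A \<Longrightarrow> u \<in> cimg c \<Longrightarrow> cmap c (cinv c u) = u"
  and cinv_in: "c \<in> A \<Longrightarrow> u \<in> cimg c \<Longrightarrow> cinv c u \<in> cdom c"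
  using is_chartD[of c] by (auto simp: is_chart_def homeomorphism_def)

lemma cmap_in: "x \<in> cdom c \<Longrightarrow> cmap c x \<in> cimg c"
  by (simp add: cimg_def)

lemma cmap_image_cinv: "c \<in> A \<Longrightarrow> V \<subseteq> cimg c \<Longrightarrow> cmap c ` cinv c ` V = V"
  by (force simp: image_image cmap_cinv subset_iff)

lemma open_cmap_image:
  assumes "c \<in> A" "open W" "W \<subseteq> cdom c"
  shows "open (cmap c ` W)"
proof -
  have "cmap c ` W = cimg c \<inter> cinv c -` W"
  proof (intro equalityI subsetI)
    fix u assume "u \<in> cmap c ` W"
    then obtain x where "x \<in> W" "u = cmap c x" by blast
    then show "u \<in> cimg c \<inter> cinv c -` W" using assms cinv_cmap[of c x] cmap_in[of x c] by auto
  next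
    fix u assume "u \<in> cimg c \<inter> cinv c -` W"
    then show "u \<in> cmap c ` W" using cmap_cinv[OF assms(1), of u] by (metis IntD1 IntD2 image_eqI vimageD)
  qed
  then show ?thesis
    using continuous_open_preimage[OF continuous_on_cinv open_cimg] assms by simp
qed

lemma open_cinv_image:
  assumes "c \<in> A" "open V" "V \<subseteq> cimg c"
  shows "open (cinv c ` V)"
proof -
  have "cinv c ` V = cdom c \<inter> cmap c -` V"
  proof (intro equalityI subsetI)
    fix x assume "x \<in> cinv c ` V"
    then obtain u where "u \<in> V" "x = cinv c u" by blast
    then show "x \<in> cdom c \<inter> cmap c -` V" using assms cmap_cinv[of c u] cinv_in[of c u] by auto
  next
    fix x assume "x \<in> cdom c \<inter> cmap c -` V"
    then show "x \<in> cinv c ` V" using cinv_cmap[OF assms(1), of x] by (metis IntD1 IntD2 image_eqI vimageD)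
  qed
  then show ?thesis
    using continuous_open_preimage[OF continuous_on_cmap open_cdom] assms by simp
qed

lemma compact_cinv_image: "c \<in> A \<Longrightarrow> compact L \<Longrightarrow> L \<subseteq> cimg c \<Longrightarrow> compact (cinv c ` L)"
  using compact_continuous_image continuous_on_cinv continuous_on_subset by blast

lemma ex_chart: "\<exists>c\<in>A. x \<in> cdom c"
proof -
  have "(\<Union>c\<in>A. cdom c) = UNIV" using smooth_manifold unfolding smooth_manifold_def by (elim conjE)
  then show ?thesis by blast
qed

lemma chart_at: "chart_at A x \<in> A" "x \<in> cdom (chart_at A x)"
proof -
  have "\<exists>c. c \<in> A \<and> x \<in> cdom c" using ex_chart by blast
  from someI_ex[OF this] show "chart_at A x \<in> A" "x \<in> cdom (chart_at A x)" unfolding chart_at_def by simp_all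
qed

lemma Ck_on_transition:
  assumes "c \<in> A" "d \<in> A"
  shows "Ck_on k (cmap c ` (cdom c \<inter> cdom d)) (\<lambda>u. cmap d (cinv c u))"
proof -
  have "compatible_charts c d" using smooth_manifold assms by (simp add: smooth_manifold_def)
  then show ?thesis by (simp add: compatible_charts_def smooth_on_def o_def)
qed

lemma open_overlap: "c \<in> A \<Longrightarrow> d \<in> A \<Longrightarrow> open (cmap c ` (cdom c \<inter> cdom d))"
  by (intro open_cmap_image open_Int open_cdom) simp_all

lemma jac_has_derivative:
  assumes "c \<in> A" "d \<in> A" "x \<in> cdom c" "x \<in> cdom d"
  shows "((\<lambda>u. cmap d (cinv c u)) has_derivative (*v) (jac c d x)) (at (cmap c x))"
proof -
  have "((\<lambda>u. cmap d (cinv c u)) has_derivative frechet_derivative (\<lambda>u. cmap d (cinv c u)) (at (cmap c x))) (at (cmap c x))"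
    by (rule Ck_on_SucD[OF Ck_on_transition[of c d "Suc 0"] open_overlap]) (use assms in auto)
  moreover from this have "(*v) (jac c d x) = frechet_derivative (\<lambda>u. cmap d (cinv c u)) (at (cmap c x))"
    unfolding jac_def o_def by (intro matrix_works_euclidean has_derivative_bounded_linear)
  ultimately show ?thesis by simp
qed

lemma has_derivative_chart_change:
  assumes cd: "c \<in> A" "d \<in> A" "x \<in> cdom c" "x \<in> cdom d"
    and f: "((\<lambda>u. f (cinv c u)) has_derivative F) (at (cmap c x))"
  shows "((\<lambda>u. f (cinv d u)) has_derivative (\<lambda>h. F (jac d c x *v h))) (at (cmap d x))"
proof -
  have "((\<lambda>u. f (cinv c u)) has_derivative F) (at (cmap c (cinv d (cmap d x))))"
    using f cd by (simp add: cinv_cmap)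
  from diff_chain_at[OF jac_has_derivative[OF cd(2,1,4,3)] this]
  have "((\<lambda>u. f (cinv c (cmap c (cinv d u)))) has_derivative (\<lambda>h. F (jac d c x *v h))) (at (cmap d x))"
    by (simp add: o_def)
  then show ?thesis
    by (rule has_derivative_transform_within_open[OF _ open_overlap[OF cd(2,1)]])
      (use cd in \<open>auto simp: cinv_cmap\<close>)
qed

lemma jac_comp:
  assumes "c \<in> A" "d \<in> A" "e \<in> A" "x \<in> cdom c" "x \<in> cdom d" "x \<in> cdom e"
  shows "jac d e x ** jac c d x = jac c e x"
proof -
  have "((\<lambda>u. cmap e (cinv c u)) has_derivative (\<lambda>h. jac d e x *v (jac c d x *v h))) (at (cmap c x))"
    using has_derivative_chart_change[of d c x "cmap e"] jac_has_derivative[of d e x] assms by blast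
  then have "(\<lambda>h. jac d e x *v (jac c d x *v h)) = (*v) (jac c e x)"
    using has_derivative_unique jac_has_derivative assms by blast
  then show ?thesis
    by (simp add: matrix_vector_mul_assoc fun_eq_iff matrix_eq)
qed

lemma jac_same:
  assumes "c \<in> A" "x \<in> cdom c"
  shows "jac c c x = mat 1"
proof -
  have "((\<lambda>u. cmap c (cinv c u)) has_derivative (\<lambda>h. h)) (at (cmap c x))"
    by (rule has_derivative_transform_within_open[OF has_derivative_ident open_cimg[OF assms(1)]])
      (use assms in \<open>auto simp: cmap_cinv cmap_in\<close>)
  then have "(*v) (jac c c x) = (\<lambda>h. h)"
    using has_derivative_unique jac_has_derivative assms by blast
  then show ?thesis by (simp add: matrix_eq fun_eq_iff)
qed

lemma jac_inverse:
  assumes "c \<in> A" "d \<in> A" "x \<in> cdom c" "x \<in> cdom d"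
  shows "jac d c x ** jac c d x = mat 1"
  using jac_comp[of c d c x] jac_same assms by simp

lemma Ck_on_chart_change:
  assumes "c \<in> A" "d \<in> A" "open W" "W \<subseteq> cdom c \<inter> cdom d"
    and f: "Ck_on k (cmap c ` W) (\<lambda>u. f (cinv c u))"
  shows "Ck_on k (cmap d ` W) (\<lambda>u. f (cinv d u))"
proof -
  have op: "open (cmap d ` W)" "open (cmap c ` W)" using assms by (auto intro!: open_cmap_image)
  have "Ck_on k (cmap d ` W) (\<lambda>u. f (cinv c (cmap c (cinv d u))))"
  proof (rule Ck_on_compose[OF op _ _ f])
    show "(\<lambda>u. cmap c (cinv d u)) ` cmap d ` W \<subseteq> cmap c ` W"
      using assms by (auto simp: cinv_cmap subset_iff)
    show "Ck_on k (cmap d ` W) (\<lambda>u. cmap c (cinv d u))"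
      by (rule Ck_on_subset[OF Ck_on_transition]) (use assms in auto)
  qed
  moreover have "f (cinv c (cmap c (cinv d u))) = f (cinv d u)" if "u \<in> cmap d ` W" for u
    using that assms by (auto simp: cinv_cmap subset_iff)
  ultimately show ?thesis by (rule Ck_on_eqI[OF op(1)])
qed

text \<open>
  Since transition maps are smooth, regularity may be verified near each point in whichever chart is
  convenient there.
\<close>

lemma Ck_on_chart_local:
  assumes "d \<in> A"
    and loc: "\<And>x. x \<in> cdom d \<Longrightarrow> \<exists>c\<in>A. \<exists>W. open W \<and> x \<in> W \<and> W \<subseteq> cdom c \<and> Ck_on k (cmap c ` W) (\<lambda>u. f (cinv c u))"
  shows "Ck_on k (cimg d) (\<lambda>u. f (cinv d u))"
proof (rule Ck_on_local)
  fix u assume u: "u \<in> cimg d"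
  then have "cinv d u \<in> cdom d" using assms cinv_in by blast
  from loc[OF this] obtain c W where c: "c \<in> A" "open W" "cinv d u \<in> W" "W \<subseteq> cdom c"
    "Ck_on k (cmap c ` W) (\<lambda>u. f (cinv c u))" by blast
  have W: "open (W \<inter> cdom d)" using c(2) open_cdom[OF assms(1)] by (rule open_Int)
  have "Ck_on k (cmap d ` (W \<inter> cdom d)) (\<lambda>u. f (cinv d u))"
    by (rule Ck_on_chart_change[OF c(1) assms(1) W _ Ck_on_subset[OF c(5)]]) (use c in auto)
  moreover have "open (cmap d ` (W \<inter> cdom d))" using open_cmap_image[OF assms(1) W] by simp
  moreover have "u \<in> cmap d ` (W \<inter> cdom d)"
    using c(3) \<open>cinv d u \<in> cdom d\<close> cmap_cinv[OF assms(1) u] by force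
  ultimately show "\<exists>V. open V \<and> u \<in> V \<and> Ck_on k V (\<lambda>u. f (cinv d u))" by blast
qed

text \<open>
  The entries of the Jacobian matrix are partial derivatives of the transition map, which is of one
  order of differentiability more.
\<close>

lemma Ck_on_jac:
  assumes "c \<in> A" "d \<in> A"
  shows "Ck_on k (cmap c ` (cdom c \<inter> cdom d)) (\<lambda>u. jac c d (cinv c u) $ i $ j)"
proof -
  let ?O = "cmap c ` (cdom c \<inter> cdom d)"
  have op: "open ?O" using open_overlap assms by simp
  have D: "Ck_on k ?O (\<lambda>u. frechet_derivative (\<lambda>u. cmap d (cinv c u)) (at u) (axis j 1))"
    using Ck_on_transition[OF assms, of "Suc k"] by (simp add: axis_in_Basis_iff)
  have "Ck_on k ?O (\<lambda>u. frechet_derivative (\<lambda>u. cmap d (cinv c u)) (at u) (axis j 1) $ i)"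
    by (rule Ck_on_bounded_linear[OF bounded_linear_vec_nth op D])
  moreover have "frechet_derivative (\<lambda>u. cmap d (cinv c u)) (at u) (axis j 1) $ i = jac c d (cinv c u) $ i $ j"
    if "u \<in> ?O" for u
    using that assms by (auto simp: jac_def matrix_def cinv_cmap o_def)
  ultimately show ?thesis by (rule Ck_on_eqI[OF op])
qed

lemma Ck_on_jac':
  assumes "c \<in> A" "d \<in> A" "e \<in> A" "open W" "W \<subseteq> cdom c \<inter> cdom d \<inter> cdom e"
  shows "Ck_on k (cmap e ` W) (\<lambda>u. jac c d (cinv e u) $ i $ j)"
  by (rule Ck_on_chart_change[OF assms(1,3,4) _ Ck_on_subset[OF Ck_on_jac[OF assms(1,2)]]])
    (use assms(5) in auto)

lemma is_field_act:
  assumes "is_field A w r s T" "c \<in> A" "d \<in> A" "x \<in> cdom c" "x \<in> cdom d" "length is = r" "length js = s"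
  shows "T d x is js = \<bar>det (jac d c x)\<bar> ^ w * act r s (jac c d x) (jac d c x) (T c x) is js"
  using assms unfolding is_field_def act_expand by blast

lemma is_fieldI:
  assumes "\<And>c x is js. T c x is js \<noteq> 0 \<Longrightarrow> c \<in> A \<and> x \<in> cdom c \<and> length is = r \<and> length js = s"
    and "\<And>c d x is js. c \<in> A \<Longrightarrow> d \<in> A \<Longrightarrow> x \<in> cdom c \<Longrightarrow> x \<in> cdom d \<Longrightarrow> length is = r \<Longrightarrow> length js = s \<Longrightarrow>
       T d x is js = \<bar>det (jac d c x)\<bar> ^ w * act r s (jac c d x) (jac d c x) (T c x) is js"
  shows "is_field A w r s T"
  using assms unfolding is_field_def act_expand by blast

lemma is_field_zero:
  "is_field A w r s T \<Longrightarrow> \<not> (c \<in> A \<and> x \<in> cdom c \<and> length is = r \<and> length js = s) \<Longrightarrow> T c x is js = 0"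
  unfolding is_field_def by blast

lemma Ck_field_local:
  assumes T: "is_field A 0 r s T" "d \<in> A"
    and loc: "\<And>x. x \<in> cdom d \<Longrightarrow> \<exists>c\<in>A. \<exists>W. open W \<and> x \<in> W \<and> W \<subseteq> cdom c \<and>
      (\<forall>is js. length is = r \<longrightarrow> length js = s \<longrightarrow> Ck_on k (cmap c ` W) (\<lambda>u. T c (cinv c u) is js))"
  shows "Ck_on k (cimg d) (\<lambda>u. T d (cinv d u) is js)"
proof (cases "length is = r \<and> length js = s")
  case False
  then have "(\<lambda>u. T d (cinv d u) is js) = (\<lambda>u. 0)" using T is_field_zero by blast
  then show ?thesis by simp
next
  case True
  show ?thesis
  proof (rule Ck_on_chart_local[OF T(2)])
    fix x assume x: "x \<in> cdom d"
    from loc[OF x] obtain c W where c: "c \<in> A" "open W" "x \<in> W" "W \<subseteq> cdom c"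
      "\<And>is js. length is = r \<Longrightarrow> length js = s \<Longrightarrow> Ck_on k (cmap c ` W) (\<lambda>u. T c (cinv c u) is js)" by blast
    define V where "V = W \<inter> cdom d"
    have V: "open V" "x \<in> V" "V \<subseteq> cdom c" "V \<subseteq> cdom d" "V \<subseteq> W" using c(2-4) x open_cdom[OF T(2)] by (auto simp: V_def)
    have op: "open (cmap c ` V)" using open_cmap_image c V by blast
    have "Ck_on k (cmap c ` V) (\<lambda>u. act r s (jac c d (cinv c u)) (jac d c (cinv c u)) (T c (cinv c u)) is js)"
      by (intro Ck_on_act op Ck_on_jac' c(1) T(2) V Ck_on_subset[OF c(5)]) (use V in auto)
    moreover have "act r s (jac c d (cinv c u)) (jac d c (cinv c u)) (T c (cinv c u)) is js = T d (cinv c u) is js"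
      if "u \<in> cmap c ` V" for u
      using is_field_act[OF T(1) c(1) T(2), of "cinv c u" "is" js] True that V c by (auto simp: cinv_cmap subset_iff)
    ultimately have "Ck_on k (cmap c ` V) (\<lambda>u. T d (cinv c u) is js)"
      by (rule Ck_on_eqI[OF op])
    then show "\<exists>c\<in>A. \<exists>W. open W \<and> x \<in> W \<and> W \<subseteq> cdom c \<and> Ck_on k (cmap c ` W) (\<lambda>u. T d (cinv c u) is js)"
      using c V by blast
  qed
qed

lemma smooth_functionsD: "f \<in> smooth_functions A \<Longrightarrow> c \<in> A \<Longrightarrow> Ck_on k (cimg c) (\<lambda>u. f (cinv c u))"
  by (simp add: smooth_functions_def smooth_on_def o_def)

lemma smooth_functionsI: "(\<And>c k. c \<in> A \<Longrightarrow> Ck_on k (cimg c) (\<lambda>u. f (cinv c u))) \<Longrightarrow> f \<in> smooth_functions A"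
  by (simp add: smooth_functions_def smooth_on_def o_def)

text \<open>
  The open set \<open>W\<close> and the complement of \<open>L\<close> cover the manifold, and \<open>f\<close> is smooth on each of them.
\<close>

lemma smooth_functions_extend:
  assumes c: "c \<in> A" and W: "open W" "W \<subseteq> cdom c" and L: "closed L" "L \<subseteq> W"
    and f: "\<And>k. Ck_on k (cmap c ` W) (\<lambda>u. f (cinv c u))" and zero: "\<And>x. x \<notin> L \<Longrightarrow> f x = 0"
  shows "f \<in> smooth_functions A"
proof (rule smooth_functionsI, rule Ck_on_chart_local)
  fix d :: "('m, 'n) chart" and k x assume d: "d \<in> A" "x \<in> cdom d"
  show "\<exists>c\<in>A. \<exists>W. open W \<and> x \<in> W \<and> W \<subseteq> cdom c \<and> Ck_on k (cmap c ` W) (\<lambda>u. f (cinv c u))"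
  proof (cases "x \<in> W")
    case True then show ?thesis using c W f by blast
  next
    case False
    define V where "V = cdom d - L"
    have V: "open V" "x \<in> V" "V \<subseteq> cdom d" using open_cdom[OF d(1)] L False d(2) by (auto simp: V_def)
    have z: "f (cinv d u) = 0" if "u \<in> cmap d ` V" for u
      using that zero d by (auto simp: V_def cinv_cmap)
    have "Ck_on k (cmap d ` V) (\<lambda>u. f (cinv d u))"
      by (rule Ck_on_eqI[OF open_cmap_image[OF d(1) V(1,3)] Ck_on_const[of k _ "0 :: real"]]) (simp add: z)
    then show ?thesis using d(1) V by blast
  qed
qed

text \<open>
  A bump function in the image of the chart, supported in a closed ball there.  The preimage of that
  ball is compact, hence closed in the Hausdorff space, which makes the extension by zero smooth.
\<close>

lemma exists_chart_bump:
  assumes c: "c \<in> A" and R: "0 < r" "r < R" "cball u\<^sub>0 R \<subseteq> cimg c"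
  obtains \<eta> where "\<eta> \<in> smooth_functions A"
    "\<And>y. y \<in> cdom c \<Longrightarrow> dist u\<^sub>0 (cmap c y) \<le> r \<Longrightarrow> \<eta> y = 1"
    "\<And>y. \<not> (y \<in> cdom c \<and> dist u\<^sub>0 (cmap c y) < R) \<Longrightarrow> \<eta> y = 0"
proof -
  obtain \<beta> :: "real^'n \<Rightarrow> real" where \<beta>: "\<And>k. Ck_on k UNIV \<beta>"
    "\<And>u. dist u\<^sub>0 u \<le> r \<Longrightarrow> \<beta> u = 1" "\<And>u. R \<le> dist u\<^sub>0 u \<Longrightarrow> \<beta> u = 0"
    using exists_bump[OF R(1,2), of u\<^sub>0] by blast
  define \<eta> where "\<eta> y = (if y \<in> cdom c then \<beta> (cmap c y) else 0)" for y
  have eq: "\<beta> u = \<eta> (cinv c u)" if "u \<in> cimg c" for u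
    using that c by (simp add: \<eta>_def cinv_in cmap_cinv)
  have "\<eta> \<in> smooth_functions A"
  proof (rule smooth_functions_extend[OF c open_cdom[OF c] order.refl])
    show "closed (cinv c ` cball u\<^sub>0 R)"
      by (intro compact_imp_closed compact_cinv_image c compact_cball R)
    show "cinv c ` cball u\<^sub>0 R \<subseteq> cdom c" using R(3) cinv_in[OF c] by blast
    show "Ck_on k (cmap c ` cdom c) (\<lambda>u. \<eta> (cinv c u))" for k
      unfolding cimg_def[symmetric]
      by (rule Ck_on_eqI[OF open_cimg[OF c] Ck_on_subset[OF \<beta>(1)] eq]) auto
    show "\<eta> x = 0" if "x \<notin> cinv c ` cball u\<^sub>0 R" for x
    proof (cases "x \<in> cdom c")
      case True
      then have "cmap c x \<notin> cball u\<^sub>0 R" using that cinv_cmap[OF c True] by force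
      then show ?thesis using \<beta>(3) by (simp add: \<eta>_def)
    qed (simp add: \<eta>_def)
  qed
  then show ?thesis using that[of \<eta>] \<beta> by (auto simp: \<eta>_def not_less)
qed

lemma exists_bump_at:
  assumes x: "open W" "x \<in> W"
  obtains \<eta> V L where "\<eta> \<in> smooth_functions A" "open V" "x \<in> V" "V \<subseteq> L" "closed L" "L \<subseteq> W"
    "\<And>y. y \<in> V \<Longrightarrow> \<eta> y = 1" "\<And>y. y \<notin> L \<Longrightarrow> \<eta> y = 0"
proof -
  obtain c where c: "c \<in> A" "x \<in> cdom c" using ex_chart by blast
  have op: "open (cmap c ` (W \<inter> cdom c))" by (rule open_cmap_image) (use c x open_cdom[OF c(1)] in auto)
  then obtain R where R: "R > 0" "cball (cmap c x) R \<subseteq> cmap c ` (W \<inter> cdom c)"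
    using open_contains_cball[THEN iffD1, OF op] c x by blast
  have sub: "cball (cmap c x) R \<subseteq> cimg c" using R by (auto simp: cimg_def)
  obtain \<eta> where \<eta>: "\<eta> \<in> smooth_functions A"
    "\<And>y. y \<in> cdom c \<Longrightarrow> dist (cmap c x) (cmap c y) \<le> R/2 \<Longrightarrow> \<eta> y = 1"
    "\<And>y. \<not> (y \<in> cdom c \<and> dist (cmap c x) (cmap c y) < R) \<Longrightarrow> \<eta> y = 0"
    using exists_chart_bump[OF c(1) _ _ sub, of "R/2"] R(1) by auto
  show ?thesis
  proof (rule that[OF \<eta>(1), of "cinv c ` ball (cmap c x) (R/2)" "cinv c ` cball (cmap c x) R"])
    have b: "ball (cmap c x) (R/2) \<subseteq> cball (cmap c x) R"
      by (rule order.trans[OF subset_ball ball_subset_cball]) (use R in simp)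
    show "open (cinv c ` ball (cmap c x) (R/2))"
      by (rule open_cinv_image[OF c(1)]) (use sub b in auto)
    show "x \<in> cinv c ` ball (cmap c x) (R/2)" using R(1) cinv_cmap[OF c] by (auto simp: image_iff intro!: bexI[of _ "cmap c x"])
    show "cinv c ` ball (cmap c x) (R/2) \<subseteq> cinv c ` cball (cmap c x) R" using b by blast
    show "closed (cinv c ` cball (cmap c x) R)"
      by (intro compact_imp_closed compact_cinv_image c compact_cball sub)
    show "cinv c ` cball (cmap c x) R \<subseteq> W" using R(2) cinv_cmap[OF c(1)] by (fastforce simp: subset_iff image_iff)
    show "\<eta> y = 1" if "y \<in> cinv c ` ball (cmap c x) (R/2)" for y
      using that b sub by (auto intro!: \<eta>(2) cinv_in[OF c(1)] simp: cmap_cinv[OF c(1)] subset_iff)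
    show "\<eta> y = 0" if "y \<notin> cinv c ` cball (cmap c x) R" for y
      by (rule \<eta>(3)) (use that cinv_cmap[OF c(1), of y] in \<open>metis image_eqI less_imp_le mem_cball\<close>)
  qed
qed

end

section \<open>Change of variables\<close>

text \<open>
  The change of variables formula for \<open>real^'k\<close> refers to a well-order of the index type \<open>'k\<close>.  Every finite
  index type is in bijection with this well-ordered type of the same size, and relabelling the coordinates
  preserves determinants and the Lebesgue measure.
\<close>

typedef 'n idx = "{..<CARD('n::finite)}"
  by (rule exI[of _ 0]) simp

instance idx :: (finite) finite
proof
  show "finite (UNIV :: 'a idx set)"
    unfolding type_definition.univ[OF type_definition_idx] by simp
qed

instantiation idx :: (finite) linorder
begin
definition "a < b \<longleftrightarrow> Rep_idx a < Rep_idx b"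
definition "a \<le> b \<longleftrightarrow> Rep_idx a \<le> Rep_idx b"
instance
  by intro_classes (auto simp: less_eq_idx_def less_idx_def Rep_idx_inject)
end

instance idx :: (finite) wellorder
proof (rule wf_wellorderI)
  have "{(x :: 'a idx, y). x < y} = inv_image {(x, y). x < y} Rep_idx"
    by (auto simp: inv_image_def less_idx_def)
  then show "wf {(x :: 'a idx, y). x < y}" by (simp add: wf)
qed intro_classes

lemma exists_bij_idx: "\<exists>b :: 'n::finite idx \<Rightarrow> 'n. bij b"
proof -
  have "CARD('n idx) = CARD('n)"
    using type_definition.card[OF type_definition_idx] by simp
  then show ?thesis using finite_same_card_bij[of "UNIV :: 'n idx set" "UNIV :: 'n set"] by auto
qed

lemma sign_conjugate:
  fixes b :: "'k::finite \<Rightarrow> 'n::finite"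
  assumes b: "bij b" and q: "q permutes UNIV"
  shows "sign (b \<circ> q \<circ> inv b) = sign q"
  using q finite[of UNIV]
proof (induction rule: permutes_induct)
  case id
  have "b \<circ> id \<circ> inv b = id" using b by (simp add: fun_eq_iff bij_is_surj surj_f_inv_f)
  then show ?case by (simp add: sign_id)
next
  case (swap x y p)
  have inj: "b u = b v \<longleftrightarrow> u = v" for u v using b by (auto simp: bij_def inj_def)
  have "b \<circ> (Transposition.transpose x y \<circ> p) \<circ> inv b = Transposition.transpose (b x) (b y) \<circ> (b \<circ> p \<circ> inv b)"
    by (auto simp: fun_eq_iff Transposition.transpose_def inj)
  moreover have "bij (b \<circ> p \<circ> inv b)"
    using b permutes_bij[OF swap(4)] by (intro bij_comp bij_imp_bij_inv)
  then have "permutation (b \<circ> p \<circ> inv b)" unfolding permutation by simp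
  moreover have "permutation p" "permutation (Transposition.transpose x y)" "permutation (Transposition.transpose (b x) (b y))"
    using swap(4) by (auto simp: permutation permutes_bij permutation_swap_id)
  ultimately show ?case using swap by (simp only: sign_compose sign_swap_id inj)
qed

lemma det_reindex:
  fixes b :: "'k::finite \<Rightarrow> 'n::finite" and M :: "real^'n^'n"
  assumes b: "bij b"
  shows "det (\<chi> i j. M $ b i $ b j) = det M"
proof -
  have bi: "b (inv b j) = j" "inv b (b i) = i" for i j
    using b by (auto simp: bij_is_surj surj_f_inv_f bij_is_inj)
  have "det M = (\<Sum>q\<in>{q. q permutes (UNIV :: 'k set)}. of_int (sign (b \<circ> q \<circ> inv b)) * (\<Prod>i\<in>UNIV. M $ i $ (b \<circ> q \<circ> inv b) i))"
    unfolding det_def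
  proof (rule sum.reindex_bij_witness[of _ "\<lambda>q. b \<circ> q \<circ> inv b" "\<lambda>p. inv b \<circ> p \<circ> b"])
    fix p assume "p \<in> {p. p permutes (UNIV :: 'n set)}"
    then have "bij p" by (simp add: permutes_bij)
    then have "bij (inv b \<circ> p \<circ> b)" using b by (intro bij_comp bij_imp_bij_inv)
    then show "inv b \<circ> p \<circ> b \<in> {q. q permutes UNIV}" by (auto intro: bij_imp_permutes)
    show "b \<circ> (inv b \<circ> p \<circ> b) \<circ> inv b = p" by (simp add: fun_eq_iff bi)
    then show "of_int (sign (b \<circ> (inv b \<circ> p \<circ> b) \<circ> inv b)) * (\<Prod>i\<in>UNIV. M $ i $ (b \<circ> (inv b \<circ> p \<circ> b) \<circ> inv b) i)
      = of_int (sign p) * (\<Prod>i\<in>UNIV. M $ i $ p i)" by simp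
  next
    fix q assume "q \<in> {q. q permutes (UNIV :: 'k set)}"
    then have "bij q" by (simp add: permutes_bij)
    then have "bij (b \<circ> q \<circ> inv b)" using b by (intro bij_comp bij_imp_bij_inv)
    then show "b \<circ> q \<circ> inv b \<in> {q. q permutes UNIV}" by (auto intro: bij_imp_permutes)
    show "inv b \<circ> (b \<circ> q \<circ> inv b) \<circ> b = q" by (simp add: fun_eq_iff bi)
  qed
  also have "\<dots> = (\<Sum>q\<in>{q. q permutes (UNIV :: 'k set)}. of_int (sign q) * (\<Prod>i\<in>UNIV. M $ b i $ b (q i)))"
  proof (rule sum.cong[OF refl])
    fix q assume "q \<in> {q. q permutes (UNIV :: 'k set)}"
    moreover have "(\<Prod>i\<in>UNIV. M $ i $ (b \<circ> q \<circ> inv b) i) = (\<Prod>i\<in>UNIV. M $ b i $ b (q i))"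
      using prod.reindex_bij_betw[of b UNIV UNIV "\<lambda>i. M $ i $ (b \<circ> q \<circ> inv b) i"] b by (simp add: bi)
    ultimately show "of_int (sign (b \<circ> q \<circ> inv b)) * (\<Prod>i\<in>UNIV. M $ i $ (b \<circ> q \<circ> inv b) i)
        = of_int (sign q) * (\<Prod>i\<in>UNIV. M $ b i $ b (q i))"
      using sign_conjugate[OF b] by simp
  qed
  also have "\<dots> = det (\<chi> i j. M $ b i $ b j)" by (simp add: det_def)
  finally show ?thesis ..
qed

definition relabel :: "('k \<Rightarrow> 'n) \<Rightarrow> real^'n \<Rightarrow> real^'k::finite"
  where "relabel b x = (\<chi> i. x $ b i)"

lemma relabel_inv:
  assumes "bij b" shows "relabel (inv b) (relabel b x) = x" "relabel b (relabel (inv b) y) = y"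
  using assms by (auto simp: relabel_def vec_eq_iff bij_is_surj surj_f_inv_f bij_is_inj)

lemma linear_relabel: "linear (relabel b :: real^'n \<Rightarrow> real^'k::finite)"
  by (auto simp: relabel_def vec_eq_iff intro!: linearI)

lemma prod_Basis_cart:
  fixes v :: "real^'n::finite"
  shows "(\<Prod>i\<in>Basis. v \<bullet> i) = (\<Prod>i\<in>UNIV. v $ i)"
proof -
  have B: "(Basis :: (real^'n) set) = (\<lambda>i. axis i 1) ` UNIV" by (auto simp: Basis_vec_def)
  have "inj (\<lambda>i :: 'n. axis i (1 :: real))" by (auto simp: inj_def axis_eq_axis)
  then show ?thesis unfolding B by (simp add: prod.reindex inner_axis)
qed

lemma distr_relabel:
  fixes b :: "'k::finite \<Rightarrow> 'n::finite"
  assumes b: "bij b"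
  shows "distr lborel borel (relabel b) = lborel"
proof (rule lborel_eqI[symmetric])
  show "sets (distr lborel borel (relabel b)) = sets borel" by simp
  fix l u :: "real^'k" assume lu: "\<And>i. i \<in> Basis \<Longrightarrow> l \<bullet> i \<le> u \<bullet> i"
  have lu': "l $ i \<le> u $ i" for i using lu[of "axis i 1"] by (simp add: inner_axis axis_in_Basis_iff)
  have meas: "relabel b \<in> borel_measurable lborel"
    using linear_continuous_on[OF linear_conv_bounded_linear[THEN iffD1, OF linear_relabel[of b]]]
    by (simp add: borel_measurable_continuous_onI)
  have vim: "relabel b -` box l u = box (relabel (inv b) l) (relabel (inv b) u)"
  proof (intro set_eqI iffI)
    fix x assume "x \<in> relabel b -` box l u"
    then have "l $ i < x $ b i \<and> x $ b i < u $ i" for i by (simp add: mem_box_cart relabel_def)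
    from this[of "inv b _"] show "x \<in> box (relabel (inv b) l) (relabel (inv b) u)"
      using b by (simp add: mem_box_cart relabel_def bij_is_surj surj_f_inv_f)
  next
    fix x assume "x \<in> box (relabel (inv b) l) (relabel (inv b) u)"
    then have "l $ inv b j < x $ j \<and> x $ j < u $ inv b j" for j by (simp add: mem_box_cart relabel_def)
    from this[of "b _"] show "x \<in> relabel b -` box l u"
      using b by (simp add: mem_box_cart relabel_def bij_is_inj)
  qed
  have "emeasure (distr lborel borel (relabel b)) (box l u) = emeasure lborel (box (relabel (inv b) l) (relabel (inv b) u))"
    using meas by (simp add: emeasure_distr vim)
  also have "\<dots> = (\<Prod>i\<in>Basis. (relabel (inv b) u - relabel (inv b) l) \<bullet> i)"
    by (rule emeasure_lborel_box) (auto simp: Basis_vec_def inner_axis relabel_def lu')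
  also have "\<dots> = (\<Prod>i\<in>Basis. (u - l) \<bullet> i)"
    unfolding prod_Basis_cart using prod.reindex_bij_betw[OF bij_imp_bij_inv[OF b], of "\<lambda>i. u $ i - l $ i"]
    by (simp add: relabel_def)
  finally show "emeasure (distr lborel borel (relabel b)) (box l u) = (\<Prod>i\<in>Basis. (u - l) \<bullet> i)" .
qed

lemma integral_relabel:
  fixes b :: "'k::finite \<Rightarrow> 'n::finite" and f :: "real^'k \<Rightarrow> real"
  assumes b: "bij b" and f: "set_integrable lborel T f"
  shows "set_integrable lborel (relabel (inv b) ` T) (\<lambda>y. f (relabel b y))"
    and "(LINT y : relabel (inv b) ` T | lborel. f (relabel b y)) = (LINT x : T | lborel. f x)"
proof -
  have meas: "relabel b \<in> measurable lborel borel"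
    using linear_continuous_on[OF linear_conv_bounded_linear[THEN iffD1, OF linear_relabel[of b]]]
    by (simp add: borel_measurable_continuous_onI)
  have ind: "indicator (relabel (inv b) ` T) y = (indicator T (relabel b y) :: real)" for y
    by (auto simp: indicator_def image_iff relabel_inv[OF b]) (metis relabel_inv(1)[OF b])
  have int: "integrable (distr lborel borel (relabel b)) (\<lambda>x. indicator T x *\<^sub>R f x)"
    using f by (simp add: set_integrable_def distr_relabel[OF b])
  have fm: "(\<lambda>x. indicator T x *\<^sub>R f x) \<in> borel_measurable borel"
    using borel_measurable_integrable[OF f[unfolded set_integrable_def]] by simp
  show "set_integrable lborel (relabel (inv b) ` T) (\<lambda>y. f (relabel b y))"
    using integrable_distr[OF meas int] by (simp add: set_integrable_def ind)
  show "(LINT y : relabel (inv b) ` T | lborel. f (relabel b y)) = (LINT x : T | lborel. f x)"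
    using integral_distr[OF meas fm] by (simp add: set_lebesgue_integral_def ind distr_relabel[OF b])
qed

lemma matrix_relabel:
  fixes b :: "'k::finite \<Rightarrow> 'n::finite"
  assumes b: "bij b"
  shows "matrix (\<lambda>h. relabel b (G (relabel (inv b) h))) = (\<chi> i j. matrix G $ b i $ b j)"
proof -
  have "inv b i = j \<longleftrightarrow> i = b j" for i j using b by (metis bij_inv_eq_iff)
  then have "relabel (inv b) (axis j 1 :: real^'k) = axis (b j) 1" for j
    by (simp add: relabel_def axis_def vec_eq_iff)
  then show ?thesis by (simp add: matrix_def relabel_def vec_eq_iff)
qed

text \<open>
  Conjugation by a relabelling of the coordinates reduces this to the formula for a well-ordered index
  type; the latter is stated for vector valued functions, whence the values in \<open>real^1\<close>.
\<close>

lemma change_of_variables_lborel: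
  fixes g :: "real^'n::finite \<Rightarrow> real^'n" and f :: "real^'n \<Rightarrow> real"
  assumes S: "S \<in> sets borel"
    and g: "\<And>x. x \<in> S \<Longrightarrow> (g has_derivative g' x) (at x)" "inj_on g S"
    and f: "set_integrable lborel (g ` S) f" "set_integrable lborel S (\<lambda>x. \<bar>det (matrix (g' x))\<bar> * f (g x))"
  shows "(LINT x : S | lborel. \<bar>det (matrix (g' x))\<bar> * f (g x)) = (LINT y : g ` S | lborel. f y)"
proof -
  obtain b :: "'n idx \<Rightarrow> 'n" where b: "bij b" using exists_bij_idx by blast
  let ?L = "relabel b" and ?M = "relabel (inv b)"
  have bl: "bounded_linear ?L" "bounded_linear ?M"
    using linear_relabel linear_conv_bounded_linear by blast+
  have ii: "inv (inv b) = b" using b by (simp add: inv_inv_eq)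
  have bi: "bij (inv b)" using b by (rule bij_imp_bij_inv)
  define gg where "gg y = ?L (g (?M y))" for y
  define gg' where "gg' y h = ?L (g' (?M y) (?M h))" for y h
  have rL[simp]: "?M (?L x) = x" "?L (?M y) = y" for x y using relabel_inv[OF b] by auto
  have tr: "set_integrable lborel (?L ` T) (\<lambda>y. h (?M y))"
     "(LINT y : ?L ` T | lborel. h (?M y)) = (LINT x : T | lborel. h x)"
    if "set_integrable lborel T h" for T and h :: "real^'n \<Rightarrow> real"
    using integral_relabel[OF bi that] by (simp_all add: ii)
  have im: "gg ` (?L ` S) = ?L ` (g ` S)" by (auto simp: gg_def image_image)
  have LS: "?L ` S \<in> sets borel"
  proof -
    have "?L ` S = ?M -` S" by (auto simp: image_iff) (metis rL(2))
    moreover have "?M \<in> borel_measurable borel"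
      using linear_continuous_on[OF bl(2)] by (simp add: borel_measurable_continuous_onI)
    ultimately show ?thesis using measurable_sets[OF _ S] by (metis inf_top.right_neutral space_borel)
  qed
  have der: "(gg has_derivative gg' y) (at y within ?L ` S)" if "y \<in> ?L ` S" for y
  proof -
    have "?M y \<in> S" using that by auto
    note d = bounded_linear.has_derivative[OF bl(1) diff_chain_at[OF bounded_linear_imp_has_derivative[OF bl(2)] g(1)[OF this]]]
    have "(gg has_derivative gg' y) (at y)"
      using d by (simp add: gg_def[abs_def] gg'_def[abs_def] o_def)
    then show ?thesis by (rule has_derivative_at_withinI)
  qed
  have inj: "inj_on gg (?L ` S)"
    using g(2) by (auto simp: inj_on_def gg_def) (metis rL(1))
  have det: "det (matrix (gg' y)) = det (matrix (g' (?M y)))" for y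
    unfolding gg'_def[abs_def] by (simp add: matrix_relabel[OF b] det_reindex[OF b])
  have "integrable lborel (\<lambda>y. indicator (gg ` ?L ` S) y *\<^sub>R f (?M y))"
    using tr(1)[OF f(1)] unfolding im set_integrable_def .
  then have "(\<lambda>y. f (?M y)) absolutely_integrable_on gg ` ?L ` S"
    unfolding set_integrable_def
    by (subst integrable_completion) (auto dest: borel_measurable_integrable)
  then have "(\<lambda>y. vec (f (?M y)) :: real^1) absolutely_integrable_on gg ` ?L ` S"
    by (simp add: absolutely_integrable_on_1_iff)
  then have "integral (?L ` S) (\<lambda>y. \<bar>det (matrix (gg' y))\<bar> *\<^sub>R (vec (f (?M (gg y))) :: real^1))
      = integral (gg ` ?L ` S) (\<lambda>y. vec (f (?M y)))"
    using has_absolute_integral_change_of_variables[OF sets_completionI_sets[of "?L ` S" lborel] der inj,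
      of "\<lambda>y. vec (f (?M y)) :: real^1" "integral (gg ` ?L ` S) (\<lambda>y. vec (f (?M y)))"] LS by simp
  then have "integral (?L ` S) (\<lambda>y. \<bar>det (matrix (gg' y))\<bar> * f (?M (gg y))) = integral (gg ` ?L ` S) (\<lambda>y. f (?M y))"
    by (simp add: integral_on_1_eq vec_eq_iff)
  then have "integral (?L ` S) (\<lambda>y. \<bar>det (matrix (g' (?M y)))\<bar> * f (g (?M y))) = integral (?L ` g ` S) (\<lambda>y. f (?M y))"
    unfolding im det by (simp add: gg_def)
  then show ?thesis
    using set_borel_integral_eq_integral(2)[OF tr(1)[OF f(1)]] set_borel_integral_eq_integral(2)[OF tr(1)[OF f(2)]]
      tr(2)[OF f(1)] tr(2)[OF f(2)] by simp
qed

section \<open>Integrals of scalar densities\<close>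

definition coord :: "('m, 'n::finite) tfield \<Rightarrow> ('m, 'n) chart \<Rightarrow> real^'n \<Rightarrow> real"
  where "coord \<mu> c u = \<mu> c (cinv c u) [] []"

definition has_dens_integral ::
    "('m::topological_space, 'n::finite) chart set \<Rightarrow> ('m, 'n) tfield \<Rightarrow> real \<Rightarrow> bool"
  where "has_dens_integral A \<mu> v \<longleftrightarrow> (\<exists>N (c :: nat \<Rightarrow> ('m, 'n) chart) B.
    (\<forall>i<N. c i \<in> A \<and> B i \<in> sets borel \<and> B i \<subseteq> cdom (c i)) \<and>
    disjoint_family_on B {..<N} \<and>
    {x. \<exists>d. \<mu> d x [] [] \<noteq> 0} \<subseteq> (\<Union>i<N. B i) \<and>
    (\<forall>i<N. set_integrable lborel (cmap (c i) ` B i) (coord \<mu> (c i))) \<and>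
    v = (\<Sum>i<N. set_lebesgue_integral lborel (cmap (c i) ` B i) (coord \<mu> (c i))))"

lemma dens_integral_eq: "dens_integral A \<mu> = (THE v. has_dens_integral A \<mu> v)"
  unfolding dens_integral_def has_dens_integral_def coord_def ..

context manifold begin

text \<open>
  These are the properties that make \<open>dens_integral\<close> independent of all choices: support in \<open>K\<close>, the
  transformation law, and continuity.  Contractions of tensor fields with test densities are of this
  kind without being smooth.
\<close>

definition scalar_density :: "'m set \<Rightarrow> ('m, 'n) tfield \<Rightarrow> bool"
  where "scalar_density K \<mu> \<longleftrightarrow>
    (\<forall>d x. \<mu> d x [] [] \<noteq> 0 \<longrightarrow> d \<in> A \<and> x \<in> cdom d \<and> x \<in> K) \<and>
    (\<forall>c\<in>A. \<forall>d\<in>A. \<forall>x\<in>cdom c \<inter> cdom d. \<mu> d x [] [] = \<bar>det (jac d c x)\<bar> * \<mu> c x [] []) \<and>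
    (\<forall>c\<in>A. continuous_on (cimg c) (coord \<mu> c))"

lemma scalar_densityD:
  assumes "scalar_density K \<mu>"
  shows "\<mu> d x [] [] \<noteq> 0 \<Longrightarrow> d \<in> A \<and> x \<in> cdom d \<and> x \<in> K"
    and "c \<in> A \<Longrightarrow> d \<in> A \<Longrightarrow> x \<in> cdom c \<Longrightarrow> x \<in> cdom d \<Longrightarrow> \<mu> d x [] [] = \<bar>det (jac d c x)\<bar> * \<mu> c x [] []"
    and "c \<in> A \<Longrightarrow> continuous_on (cimg c) (coord \<mu> c)"
  using assms unfolding scalar_density_def by blast+

lemma borel_cmap_image:
  assumes "c \<in> A" "B \<in> sets borel" "B \<subseteq> cdom c"
  shows "cmap c ` B \<in> sets borel"
proof -
  have "cmap c ` B = cinv c -` B \<inter> cimg c"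
  proof (intro equalityI subsetI)
    fix u assume "u \<in> cmap c ` B"
    then obtain x where "x \<in> B" "u = cmap c x" by blast
    then show "u \<in> cinv c -` B \<inter> cimg c" using assms cinv_cmap[of c x] cmap_in[of x c] by auto
  next
    fix u assume "u \<in> cinv c -` B \<inter> cimg c"
    then show "u \<in> cmap c ` B" using cmap_cinv[OF assms(1), of u] by (metis IntD1 IntD2 image_eqI vimageD)
  qed
  moreover have "cinv c -` B \<inter> space (restrict_space borel (cimg c)) \<in> sets (restrict_space borel (cimg c))"
    by (rule measurable_sets[OF borel_measurable_continuous_on_restrict[OF continuous_on_cinv[OF assms(1)]] assms(2)])
  ultimately show ?thesis
    using borel_open[OF open_cimg[OF assms(1)]]
    by (simp add: space_restrict_space sets_restrict_space_iff)
qed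

text \<open>
  The determinant in the transformation law of densities is the one in the change of variables formula
  for the transition map.
\<close>

lemma integral_piece_eq:
  assumes \<mu>: "scalar_density K \<mu>" and cd: "c \<in> A" "d \<in> A" and B: "B \<in> sets borel" "B \<subseteq> cdom c" "B \<subseteq> cdom d"
    and int: "set_integrable lborel (cmap c ` B) (coord \<mu> c)" "set_integrable lborel (cmap d ` B) (coord \<mu> d)"
  shows "(LINT u : cmap c ` B | lborel. coord \<mu> c u) = (LINT u : cmap d ` B | lborel. coord \<mu> d u)"
proof -
  define g where "g u = cmap d (cinv c u)" for u
  define g' where "g' u = (*v) (jac c d (cinv c u))" for u
  have im: "g ` cmap c ` B = cmap d ` B"
    using B(2) cd(1) by (auto simp: g_def image_image cinv_cmap subset_iff intro!: image_cong)
  have der: "(g has_derivative g' u) (at u)" if "u \<in> cmap c ` B" for u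
  proof -
    obtain x where x: "x \<in> B" "u = cmap c x" using \<open>u \<in> cmap c ` B\<close> by blast
    then have "x \<in> cdom c" "x \<in> cdom d" using B by auto
    then show ?thesis using jac_has_derivative[OF cd] x by (simp add: g_def[abs_def] g'_def cinv_cmap cd)
  qed
  have inj: "inj_on g (cmap c ` B)"
  proof (rule inj_onI)
    fix u v assume uv: "u \<in> cmap c ` B" "v \<in> cmap c ` B" "g u = g v"
    obtain x y where xy: "x \<in> B" "u = cmap c x" "y \<in> B" "v = cmap c y" using uv by blast
    then have "x \<in> cdom c" "x \<in> cdom d" "y \<in> cdom c" "y \<in> cdom d" using B by auto
    then show "u = v" using uv(3) xy cinv_cmap[OF cd(1)] cinv_cmap[OF cd(2)] by (metis g_def)
  qed
  have eq: "\<bar>det (matrix (g' u))\<bar> * coord \<mu> d (g u) = coord \<mu> c u" if "u \<in> cmap c ` B" for u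
  proof -
    obtain x where x: "x \<in> B" "u = cmap c x" using \<open>u \<in> cmap c ` B\<close> by blast
    then have x': "x \<in> cdom c" "x \<in> cdom d" using B by auto
    show ?thesis using scalar_densityD(2)[OF \<mu> cd(2,1) x'(2,1)] x x'
      by (simp add: coord_def g_def g'_def cinv_cmap cd)
  qed
  have int': "set_integrable lborel (cmap c ` B) (\<lambda>u. \<bar>det (matrix (g' u))\<bar> * coord \<mu> d (g u))"
    using int(1) by (rule set_integrable_cong[THEN iffD1, OF refl refl, rotated]) (simp add: eq)
  have meas: "cmap c ` B \<in> sets borel" using borel_cmap_image cd B by blast
  have "(LINT u : cmap c ` B | lborel. coord \<mu> c u) = (LINT u : cmap c ` B | lborel. \<bar>det (matrix (g' u))\<bar> * coord \<mu> d (g u))"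
    using meas by (intro set_lebesgue_integral_cong) (auto simp: eq)
  also have "\<dots> = (LINT u : g ` cmap c ` B | lborel. coord \<mu> d u)"
    by (rule change_of_variables_lborel[OF meas der inj int(2)[folded im] int'])
  finally show ?thesis using im by simp
qed

lemma integral_split_pieces:
  fixes M :: nat
  assumes c: "c \<in> A" and B: "B \<subseteq> cdom c" "B \<in> sets borel" and B': "\<And>j. j < M \<Longrightarrow> B' j \<in> sets borel" "disjoint_family_on B' {..<M}"
    and cov: "{x. \<exists>d. \<mu> d x [] [] \<noteq> 0} \<subseteq> (\<Union>j<M. B' j)"
    and int: "set_integrable lborel (cmap c ` B) (coord \<mu> c)"
  shows "(LINT u : cmap c ` B | lborel. coord \<mu> c u) = (\<Sum>j<M. LINT u : cmap c ` (B \<inter> B' j) | lborel. coord \<mu> c u)"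
    and "j < M \<Longrightarrow> set_integrable lborel (cmap c ` (B \<inter> B' j)) (coord \<mu> c)"
proof -
  show i: "set_integrable lborel (cmap c ` (B \<inter> B' j)) (coord \<mu> c)" if "j < M" for j
    by (rule set_integrable_subset[OF int]) (use that B B' borel_cmap_image[OF c, of "B \<inter> B' j"] in auto)
  have pt: "indicator (cmap c ` B) u *\<^sub>R coord \<mu> c u = (\<Sum>j<M. indicator (cmap c ` (B \<inter> B' j)) u *\<^sub>R coord \<mu> c u)" for u
  proof (cases "u \<in> cmap c ` B")
    case False
    then have "u \<notin> cmap c ` (B \<inter> B' j)" for j by blast
    then show ?thesis using False by simp
  next
    case True
    then obtain x where x: "x \<in> B" "u = cmap c x" by blast
    have mem: "u \<in> cmap c ` (B \<inter> B' j) \<longleftrightarrow> x \<in> B' j" for j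
    proof
      assume "u \<in> cmap c ` (B \<inter> B' j)"
      then obtain y where "y \<in> B" "y \<in> B' j" "u = cmap c y" by blast
      then show "x \<in> B' j" using x B(1) cinv_cmap[OF c] by (metis subsetD)
    qed (use x in blast)
    show ?thesis
    proof (cases "coord \<mu> c u = 0")
      case False
      then have "\<mu> c x [] [] \<noteq> 0" using x B(1) cinv_cmap[OF c, of x] by (auto simp: coord_def)
      then obtain j where j: "j < M" "x \<in> B' j" using cov by blast
      have "indicator (cmap c ` (B \<inter> B' k)) u = (if k = j then 1 else 0 :: real)" if "k < M" for k
        using j that mem disjoint_family_onD[OF B'(2), of k j] by (auto simp: indicator_def)
      then have "(\<Sum>k<M. indicator (cmap c ` (B \<inter> B' k)) u *\<^sub>R coord \<mu> c u) = (\<Sum>k<M. if k = j then coord \<mu> c u else 0)"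
        by (intro sum.cong) auto
      then show ?thesis using True j by simp
    qed simp
  qed
  show "(LINT u : cmap c ` B | lborel. coord \<mu> c u) = (\<Sum>j<M. LINT u : cmap c ` (B \<inter> B' j) | lborel. coord \<mu> c u)"
    unfolding set_lebesgue_integral_def pt
    by (rule Bochner_Integration.integral_sum) (use i in \<open>simp add: set_integrable_def\<close>)
qed

text \<open>
  Both decompositions are replaced by the common refinement into the sets \<open>B i \<inter> C j\<close>, on which the two
  charts give the same integral.
\<close>

lemma has_dens_integral_unique:
  assumes \<mu>: "scalar_density K \<mu>" and v: "has_dens_integral A \<mu> v" "has_dens_integral A \<mu> w"
  shows "v = w"
proof -
  obtain N and c :: "nat \<Rightarrow> ('m, 'n) chart" and B where D1:
    "(\<forall>i<N. c i \<in> A \<and> B i \<in> sets borel \<and> B i \<subseteq> cdom (c i)) \<and>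
    disjoint_family_on B {..<N} \<and>
    {x. \<exists>d. \<mu> d x [] [] \<noteq> 0} \<subseteq> (\<Union>i<N. B i) \<and>
    (\<forall>i<N. set_integrable lborel (cmap (c i) ` B i) (coord \<mu> (c i))) \<and>
    v = (\<Sum>i<N. LINT u : cmap (c i) ` B i | lborel. coord \<mu> (c i) u)"
    using v(1) unfolding has_dens_integral_def by (elim exE) (rule that)
  have 1: "\<And>i. i < N \<Longrightarrow> c i \<in> A" "\<And>i. i < N \<Longrightarrow> B i \<in> sets borel" "\<And>i. i < N \<Longrightarrow> B i \<subseteq> cdom (c i)"
    "disjoint_family_on B {..<N}" "{x. \<exists>d. \<mu> d x [] [] \<noteq> 0} \<subseteq> (\<Union>i<N. B i)"
    "\<And>i. i < N \<Longrightarrow> set_integrable lborel (cmap (c i) ` B i) (coord \<mu> (c i))"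
    "v = (\<Sum>i<N. LINT u : cmap (c i) ` B i | lborel. coord \<mu> (c i) u)"
    using D1 by blast+
  obtain M and d :: "nat \<Rightarrow> ('m, 'n) chart" and C where D2:
    "(\<forall>i<M. d i \<in> A \<and> C i \<in> sets borel \<and> C i \<subseteq> cdom (d i)) \<and>
    disjoint_family_on C {..<M} \<and>
    {x. \<exists>d. \<mu> d x [] [] \<noteq> 0} \<subseteq> (\<Union>i<M. C i) \<and>
    (\<forall>i<M. set_integrable lborel (cmap (d i) ` C i) (coord \<mu> (d i))) \<and>
    w = (\<Sum>i<M. LINT u : cmap (d i) ` C i | lborel. coord \<mu> (d i) u)"
    using v(2) unfolding has_dens_integral_def by (elim exE) (rule that)
  have 2: "\<And>i. i < M \<Longrightarrow> d i \<in> A" "\<And>i. i < M \<Longrightarrow> C i \<in> sets borel" "\<And>i. i < M \<Longrightarrow> C i \<subseteq> cdom (d i)"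
    "disjoint_family_on C {..<M}" "{x. \<exists>d. \<mu> d x [] [] \<noteq> 0} \<subseteq> (\<Union>i<M. C i)"
    "\<And>i. i < M \<Longrightarrow> set_integrable lborel (cmap (d i) ` C i) (coord \<mu> (d i))"
    "w = (\<Sum>i<M. LINT u : cmap (d i) ` C i | lborel. coord \<mu> (d i) u)"
    using D2 by blast+
  have "v = (\<Sum>i<N. \<Sum>j<M. LINT u : cmap (c i) ` (B i \<inter> C j) | lborel. coord \<mu> (c i) u)"
    unfolding 1(7)
    by (intro sum.cong refl, drule lessThan_iff[THEN iffD1])
      (rule integral_split_pieces(1)[OF 1(1) 1(3) 1(2) 2(2) 2(4) 2(5) 1(6)])
  also have "\<dots> = (\<Sum>i<N. \<Sum>j<M. LINT u : cmap (d j) ` (C j \<inter> B i) | lborel. coord \<mu> (d j) u)"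
  proof (intro sum.cong refl)
    fix i j assume "i \<in> {..<N}" "j \<in> {..<M}"
    then have ij: "i < N" "j < M" by auto
    have "set_integrable lborel (cmap (c i) ` (B i \<inter> C j)) (coord \<mu> (c i))"
      by (rule integral_split_pieces(2)[OF 1(1)[OF ij(1)] 1(3)[OF ij(1)] 1(2)[OF ij(1)] 2(2) 2(4) 2(5) 1(6)[OF ij(1)] ij(2)])
    moreover have "set_integrable lborel (cmap (d j) ` (C j \<inter> B i)) (coord \<mu> (d j))"
      by (rule integral_split_pieces(2)[OF 2(1)[OF ij(2)] 2(3)[OF ij(2)] 2(2)[OF ij(2)] 1(2) 1(4) 1(5) 2(6)[OF ij(2)] ij(1)])
    ultimately show "(LINT u : cmap (c i) ` (B i \<inter> C j) | lborel. coord \<mu> (c i) u) =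
        (LINT u : cmap (d j) ` (C j \<inter> B i) | lborel. coord \<mu> (d j) u)"
      unfolding Int_commute[of "C j"]
      by (intro integral_piece_eq[OF \<mu> 1(1)[OF ij(1)] 2(1)[OF ij(2)]] sets.Int 1(2)[OF ij(1)] 2(2)[OF ij(2)])
        (use 1(3)[OF ij(1)] 2(3)[OF ij(2)] in auto)
  qed
  also have "\<dots> = (\<Sum>j<M. \<Sum>i<N. LINT u : cmap (d j) ` (C j \<inter> B i) | lborel. coord \<mu> (d j) u)"
    by (rule sum.swap)
  also have "\<dots> = w"
    unfolding 2(7)
    by (intro sum.cong refl, drule lessThan_iff[THEN iffD1])
      (rule integral_split_pieces(1)[OF 2(1) 2(3) 2(2) 1(2) 1(4) 1(5) 2(6), symmetric])
  finally show ?thesis .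
qed

lemma dens_integral_eqI: "scalar_density K \<mu> \<Longrightarrow> has_dens_integral A \<mu> v \<Longrightarrow> dens_integral A \<mu> = v"
  unfolding dens_integral_eq using has_dens_integral_unique by (intro the_equality) blast+

lemma set_integrable_continuous:
  fixes f :: "real^'n \<Rightarrow> real"
  assumes "continuous_on S f" "compact L" "L \<subseteq> S" "B \<in> sets borel" "B \<subseteq> L"
  shows "set_integrable lborel B f"
proof (rule set_integrable_subset)
  show "set_integrable lborel L f" unfolding set_integrable_def
    by (rule borel_integrable_compact) (use assms continuous_on_subset in blast)+
qed (use assms in auto)

text \<open>
  A compact set is covered by finitely many coordinate balls, from which disjoint Borel pieces are
  obtained by removing the earlier ones.  The pieces do not depend on the density, as is needed for the
  linearity of the integral.
\<close>

lemma exists_common_pieces: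
  assumes "compact K"
  shows "\<exists>N (c :: nat \<Rightarrow> ('m, 'n) chart) B. \<forall>\<mu>. scalar_density K \<mu> \<longrightarrow>
    (\<forall>i<N. set_integrable lborel (cmap (c i) ` B i) (coord \<mu> (c i))) \<and>
    dens_integral A \<mu> = (\<Sum>i<N. LINT u : cmap (c i) ` B i | lborel. coord \<mu> (c i) u)"
proof -
  have "\<exists>c R. c \<in> A \<and> x \<in> cdom c \<and> R > 0 \<and> cball (cmap c x) R \<subseteq> cimg c" for x
  proof -
    obtain c where c: "c \<in> A" "x \<in> cdom c" using ex_chart by blast
    from open_contains_cball[THEN iffD1, OF open_cimg[OF c(1)], rule_format, OF cmap_in[OF c(2)]]
    obtain R where "R > 0" "cball (cmap c x) R \<subseteq> cimg c" by blast
    with c show ?thesis by blast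
  qed
  then obtain ch R where ch: "\<And>x. ch x \<in> A" "\<And>x. x \<in> cdom (ch x)" "\<And>x. R x > 0"
    "\<And>x. cball (cmap (ch x) x) (R x) \<subseteq> cimg (ch x)" by metis
  define L where "L x = cball (cmap (ch x) x) (R x)" for x
  define V where "V x = cinv (ch x) ` ball (cmap (ch x) x) (R x)" for x
  have V: "open (V x)" "x \<in> V x" "V x \<subseteq> cdom (ch x)" "cmap (ch x) ` V x \<subseteq> L x" for x
  proof -
    have sub: "ball (cmap (ch x) x) (R x) \<subseteq> cimg (ch x)" using ch(4)[of x] ball_subset_cball by blast
    show "open (V x)" unfolding V_def by (rule open_cinv_image[OF ch(1) open_ball sub])
    show "x \<in> V x" unfolding V_def using cinv_cmap[OF ch(1,2)] ch(3) by (metis centre_in_ball image_eqI)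
    show "V x \<subseteq> cdom (ch x)" unfolding V_def using sub cinv_in[OF ch(1)] by blast
    show "cmap (ch x) ` V x \<subseteq> L x" unfolding V_def L_def cmap_image_cinv[OF ch(1) sub] by (rule ball_subset_cball)
  qed
  have "K \<subseteq> \<Union> (range V)" using V(2) by blast
  then obtain \<V> where \<V>: "\<V> \<subseteq> range V" "finite \<V>" "K \<subseteq> \<Union> \<V>"
    using compactE[OF assms] V(1) by (metis (no_types, lifting) rangeE)
  obtain X where X: "finite X" "\<V> = V ` X" using finite_subset_image[OF \<V>(2,1)] by blast
  obtain xs where xs: "set xs = X" using finite_list[OF X(1)] by blast
  define N where "N = length xs"
  define c where "c i = ch (xs ! i)" for i
  define B where "B i = V (xs ! i) - (\<Union>j<i. V (xs ! j))" for i
  have cov: "K \<subseteq> (\<Union>i<N. B i)"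
  proof
    fix x assume "x \<in> K"
    then obtain y where "y \<in> set xs" "x \<in> V y" using \<V>(3) X(2) xs by blast
    then obtain i0 where i0: "i0 < N" "x \<in> V (xs ! i0)" by (metis N_def in_set_conv_nth)
    define i where "i = (LEAST i. x \<in> V (xs ! i))"
    have "x \<in> V (xs ! i)" unfolding i_def by (rule LeastI[of _ i0]) (use i0 in auto)
    moreover have "i \<le> i0" unfolding i_def by (rule Least_le) (use i0 in auto)
    moreover have "x \<notin> V (xs ! j)" if "j < i" for j using not_less_Least that unfolding i_def by blast
    ultimately show "x \<in> (\<Union>i<N. B i)" using i0 by (auto simp: B_def intro!: bexI[of _ i])
  qed
  have disj: "disjoint_family_on B {..<N}"
    unfolding disjoint_family_on_def
  proof (intro ballI impI)
    fix m n :: nat assume "m \<noteq> n"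
    then consider "m < n" | "n < m" by linarith
    then show "B m \<inter> B n = {}" by cases (auto simp: B_def)
  qed
  have Bi: "c i \<in> A" "B i \<in> sets borel" "B i \<subseteq> cdom (c i)" for i
    using V(1,3) ch(1) by (auto simp: B_def c_def intro!: sets.Diff sets.finite_UN borel_open)
  have im: "cmap (c i) ` B i \<subseteq> L (xs ! i)" for i using V(4)[of "xs ! i"] by (auto simp: B_def c_def)
  have "(\<forall>i<N. set_integrable lborel (cmap (c i) ` B i) (coord \<mu> (c i))) \<and>
    dens_integral A \<mu> = (\<Sum>i<N. LINT u : cmap (c i) ` B i | lborel. coord \<mu> (c i) u)"
    if \<mu>: "scalar_density K \<mu>" for \<mu>
  proof -
    have int: "set_integrable lborel (cmap (c i) ` B i) (coord \<mu> (c i))" for i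
      by (rule set_integrable_continuous[OF scalar_densityD(3)[OF \<mu> Bi(1)] _ _ borel_cmap_image[OF Bi(1,2,3)] im])
        (use ch(4)[of "xs ! i"] in \<open>auto simp: L_def c_def\<close>)
    have "{x. \<exists>d. \<mu> d x [] [] \<noteq> 0} \<subseteq> K" using scalar_densityD(1)[OF \<mu>] by blast
    then have "has_dens_integral A \<mu> (\<Sum>i<N. LINT u : cmap (c i) ` B i | lborel. coord \<mu> (c i) u)"
      unfolding has_dens_integral_def
      by (intro exI[of _ N] exI[of _ c] exI[of _ B]) (use Bi disj cov int in blast)
    then show ?thesis using int dens_integral_eqI[OF \<mu>] by blast
  qed
  then show ?thesis by blast
qed

lemma scalar_density_lincomb:
  assumes "finite I" "\<And>i. i \<in> I \<Longrightarrow> scalar_density K (\<mu> i)"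
    and eq: "\<And>c x. \<nu> c x [] [] = (\<Sum>i\<in>I. a i * \<mu> i c x [] [])"
  shows "scalar_density K \<nu>"
  unfolding scalar_density_def
proof (intro conjI allI impI ballI)
  fix d x assume nz: "\<nu> d x [] [] \<noteq> 0"
  have "\<exists>i\<in>I. \<mu> i d x [] [] \<noteq> 0"
  proof (rule ccontr)
    assume "\<not> ?thesis"
    then have "\<nu> d x [] [] = 0" unfolding eq by simp
    then show False using nz by simp
  qed
  then obtain i where "i \<in> I" "\<mu> i d x [] [] \<noteq> 0" by blast
  then show "d \<in> A" "x \<in> cdom d" "x \<in> K" using scalar_densityD(1)[OF assms(2)] by blast+
next
  fix c d x assume "c \<in> A" "d \<in> A" "x \<in> cdom c \<inter> cdom d"
  then have "\<mu> i d x [] [] = \<bar>det (jac d c x)\<bar> * \<mu> i c x [] []" if "i \<in> I" for i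
    using scalar_densityD(2)[OF assms(2)[OF that]] by blast
  then show "\<nu> d x [] [] = \<bar>det (jac d c x)\<bar> * \<nu> c x [] []"
    unfolding eq by (simp add: sum_distrib_left mult_ac)
next
  fix c assume "c \<in> A"
  then have "continuous_on (cimg c) (\<lambda>u. \<Sum>i\<in>I. a i * coord (\<mu> i) c u)"
    by (intro continuous_on_sum continuous_on_mult_left scalar_densityD(3)[OF assms(2)])
  then show "continuous_on (cimg c) (coord \<nu> c)" by (simp add: coord_def[abs_def] eq)
qed

lemma dens_integral_lincomb:
  assumes "finite I" "compact K" "\<And>i. i \<in> I \<Longrightarrow> scalar_density K (\<mu> i)"
    and eq: "\<And>c x. \<nu> c x [] [] = (\<Sum>i\<in>I. a i * \<mu> i c x [] [])"
  shows "dens_integral A \<nu> = (\<Sum>i\<in>I. a i * dens_integral A (\<mu> i))"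
proof -
  obtain N and c :: "nat \<Rightarrow> ('m, 'n) chart" and B where "\<forall>\<mu>. scalar_density K \<mu> \<longrightarrow>
    (\<forall>i<N. set_integrable lborel (cmap (c i) ` B i) (coord \<mu> (c i))) \<and>
    dens_integral A \<mu> = (\<Sum>i<N. LINT u : cmap (c i) ` B i | lborel. coord \<mu> (c i) u)"
    using exists_common_pieces[OF assms(2)] by (elim exE) (rule that)
  note NcB = this[rule_format, THEN conjunct1, rule_format] this[rule_format, THEN conjunct2]
  have \<nu>: "scalar_density K \<nu>" using assms(1,3) eq by (rule scalar_density_lincomb)
  have piece: "(LINT u : cmap (c k) ` B k | lborel. coord \<nu> (c k) u) = (\<Sum>i\<in>I. a i * (LINT u : cmap (c k) ` B k | lborel. coord (\<mu> i) (c k) u))"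
    if "k < N" for k
  proof -
    have "integrable lborel (\<lambda>u. indicator (cmap (c k) ` B k) u *\<^sub>R coord (\<mu> i) (c k) u)" if "i \<in> I" for i
      using NcB(1)[OF assms(3)[OF that] \<open>k < N\<close>] unfolding set_integrable_def .
    then have "(LINT u | lborel. (\<Sum>i\<in>I. a i * (indicator (cmap (c k) ` B k) u *\<^sub>R coord (\<mu> i) (c k) u)))
      = (\<Sum>i\<in>I. a i * (LINT u | lborel. indicator (cmap (c k) ` B k) u *\<^sub>R coord (\<mu> i) (c k) u))"
      by (subst Bochner_Integration.integral_sum) auto
    then show ?thesis
      by (simp add: set_lebesgue_integral_def coord_def eq sum_distrib_left mult_ac)
  qed
  have "dens_integral A \<nu> = (\<Sum>k<N. \<Sum>i\<in>I. a i * (LINT u : cmap (c k) ` B k | lborel. coord (\<mu> i) (c k) u))"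
    unfolding NcB(2)[OF \<nu>] by (intro sum.cong refl piece) simp
  also have "\<dots> = (\<Sum>i\<in>I. a i * (\<Sum>k<N. LINT u : cmap (c k) ` B k | lborel. coord (\<mu> i) (c k) u))"
    by (subst sum.swap) (simp add: sum_distrib_left)
  also have "\<dots> = (\<Sum>i\<in>I. a i * dens_integral A (\<mu> i))"
    by (intro sum.cong refl) (simp only: NcB(2)[OF assms(3)])
  finally show ?thesis .
qed

lemma dens_integral_chart:
  assumes \<mu>: "scalar_density K \<mu>" and c: "c \<in> A" and K: "K \<subseteq> cinv c ` cbox a b" "cbox a b \<subseteq> cimg c"
  shows "dens_integral A \<mu> = integral (cbox a b) (coord \<mu> c)"
proof -
  define B where "B = cinv c ` cbox a b"
  have im: "cmap c ` B = cbox a b" unfolding B_def by (rule cmap_image_cinv[OF c K(2)])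
  have int: "set_integrable lborel (cbox a b) (coord \<mu> c)"
    by (rule set_integrable_continuous[OF scalar_densityD(3)[OF \<mu> c] compact_cbox K(2)]) auto
  have B: "B \<in> sets borel" "B \<subseteq> cdom c"
    using compact_imp_closed[OF compact_cinv_image[OF c compact_cbox K(2)]] cinv_in[OF c] K(2) by (auto simp: B_def)
  have cov: "{x. \<exists>d. \<mu> d x [] [] \<noteq> 0} \<subseteq> (\<Union>i<(1::nat). B)"
    using scalar_densityD(1)[OF \<mu>] K(1) by (auto simp: B_def)
  have "has_dens_integral A \<mu> (\<Sum>i<(1::nat). LINT u : cmap c ` B | lborel. coord \<mu> c u)"
    unfolding has_dens_integral_def
    by (intro exI[of _ "1 :: nat"] exI[of _ "\<lambda>_. c"] exI[of _ "\<lambda>_. B"] conjI cov refl)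
      (use c B int im in \<open>auto simp: disjoint_family_on_def\<close>)
  from dens_integral_eqI[OF \<mu> this] show ?thesis
    using set_borel_integral_eq_integral(2)[OF int] im by simp
qed

end

section \<open>Connection coefficients\<close>

lemma linear_vec_expand:
  fixes F :: "real^'n \<Rightarrow> real"
  assumes "linear F" shows "F v = (\<Sum>i\<in>UNIV. v $ i * F (axis i 1))"
proof -
  have "F v = F (\<Sum>i\<in>UNIV. v $ i *\<^sub>R axis i 1)"
    by (rule arg_cong[of _ _ F]) (simp add: vec_eq_iff axis_def if_distrib[where f="\<lambda>x. _ * x"] cong: if_cong)
  then show ?thesis by (simp add: linear_sum[OF assms] linear_scale[OF assms])
qed

lemma has_derivative_along_line:
  fixes f :: "'a::real_normed_vector \<Rightarrow> real"
  assumes "(f has_derivative F) (at u)"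
  shows "((\<lambda>t. f (u + t *\<^sub>R v)) has_real_derivative F v) (at 0)"
proof -
  have "((\<lambda>t. u + t *\<^sub>R v) has_derivative (\<lambda>t. t *\<^sub>R v)) (at 0)"
    by (auto intro!: derivative_eq_intros)
  moreover have "(f has_derivative F) (at (u + 0 *\<^sub>R v))" using assms by simp
  ultimately have "((\<lambda>t. f (u + t *\<^sub>R v)) has_derivative (\<lambda>t. F (t *\<^sub>R v))) (at 0)"
    using diff_chain_at[of "\<lambda>t. u + t *\<^sub>R v" "\<lambda>t. t *\<^sub>R v" 0 f F] by (simp add: o_def)
  then show ?thesis
    by (simp add: has_field_derivative_def linear_scale[OF has_derivative_linear[OF assms]] mult.commute[of _ "F v"])
qed

lemma matrix_mult_has_derivative:
  fixes X Y :: "real \<Rightarrow> real^'n^'n"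
  assumes "\<And>i k. ((\<lambda>t. X t $ i $ k) has_real_derivative X' $ i $ k) (at 0)"
    "\<And>i k. ((\<lambda>t. Y t $ i $ k) has_real_derivative Y' $ i $ k) (at 0)"
  shows "((\<lambda>t. (X t ** Y t) $ i $ k) has_real_derivative (X' ** Y 0 + X 0 ** Y') $ i $ k) (at 0)"
proof -
  have "((\<lambda>t. \<Sum>m\<in>UNIV. X t $ i $ m * Y t $ m $ k) has_real_derivative
      (\<Sum>m\<in>UNIV. X' $ i $ m * Y 0 $ m $ k + Y' $ m $ k * X 0 $ i $ m)) (at 0)"
    by (intro DERIV_sum DERIV_mult assms)
  then show ?thesis by (simp add: matrix_matrix_mult_def sum.distrib mult.commute)
qed

lemma sum_tfield_apply:
  fixes X :: "'i \<Rightarrow> ('m, 'n) tfield"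
  shows "(\<Sum>i\<in>I. X i) c x is js = (\<Sum>i\<in>I. X i c x is js)"
  by (induction I rule: infinite_finite_induct) auto

context manifold begin

lemma vector_fieldsD:
  assumes "X \<in> vector_fields A"
  shows "is_field A 0 (Suc 0) 0 X" "c \<in> A \<Longrightarrow> Ck_on k (cimg c) (\<lambda>u. X c (cinv c u) is js)"
  using assms unfolding tensor_fields_def Ck_fields_def by auto

lemma vector_fieldsI:
  assumes "is_field A 0 (Suc 0) 0 X" "\<And>c k is js. c \<in> A \<Longrightarrow> Ck_on k (cimg c) (\<lambda>u. X c (cinv c u) is js)"
  shows "X \<in> vector_fields A"
  using assms unfolding tensor_fields_def Ck_fields_def by auto

lemma vector_field_transform:
  assumes "X \<in> vector_fields A" "c \<in> A" "d \<in> A" "x \<in> cdom c" "x \<in> cdom d"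
  shows "X d x [i] [] = (\<Sum>k\<in>UNIV. jac c d x $ i $ k * X c x [k] [])"
  using is_field_act[OF vector_fieldsD(1)[OF assms(1)] assms(2-5), of "[i]" "[]"] by simp

lemma vector_field_eqI:
  assumes X: "X \<in> vector_fields A" "Y \<in> vector_fields A" and c: "c \<in> A" "x \<in> cdom c"
    and eq: "\<And>k. X c x [k] [] = Y c x [k] []"
  shows "X d x is js = Y d x is js"
proof (cases "d \<in> A \<and> x \<in> cdom d \<and> length is = Suc 0 \<and> length js = 0")
  case True
  then obtain i where "is = [i]" "js = []" by (auto simp: length_Suc_conv)
  then show ?thesis
    using vector_field_transform[OF X(1) c(1) _ c(2)] vector_field_transform[OF X(2) c(1) _ c(2)] True eq by simp
next
  case False
  then show ?thesis using is_field_zero[OF vector_fieldsD(1)[OF X(1)]] is_field_zero[OF vector_fieldsD(1)[OF X(2)]] by metis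
qed

lemma vector_fields_zero: "0 \<in> vector_fields A"
  by (rule vector_fieldsI) (auto intro!: is_fieldI simp: act_expand)

lemma vector_fields_add: "X \<in> vector_fields A \<Longrightarrow> Y \<in> vector_fields A \<Longrightarrow> X + Y \<in> vector_fields A"
proof (rule vector_fieldsI)
  assume X: "X \<in> vector_fields A" and Y: "Y \<in> vector_fields A"
  show "is_field A 0 (Suc 0) 0 (X + Y)"
  proof (rule is_fieldI)
    fix c x "is" js assume "(X + Y) c x is js \<noteq> 0"
    then have "X c x is js \<noteq> 0 \<or> Y c x is js \<noteq> 0" by auto
    then show "c \<in> A \<and> x \<in> cdom c \<and> length is = Suc 0 \<and> length js = 0"
      using is_field_zero[OF vector_fieldsD(1)[OF X]] is_field_zero[OF vector_fieldsD(1)[OF Y]] by blast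
  next
    fix c d x and "is" js :: "'n list"
    assume "c \<in> A" "d \<in> A" "x \<in> cdom c" "x \<in> cdom d" "length is = Suc 0" "length js = 0"
    note t = this
    have "(\<lambda>ks ls. X c x ks ls + Y c x ks ls) = (X + Y) c x" by (simp add: fun_eq_iff)
    with act_add[of "Suc 0" 0 "jac c d x" "jac d c x" "X c x" "Y c x" "is" js]
    show "(X + Y) d x is js = \<bar>det (jac d c x)\<bar> ^ 0 * act (Suc 0) 0 (jac c d x) (jac d c x) ((X + Y) c x) is js"
      using is_field_act[OF vector_fieldsD(1)[OF X] t] is_field_act[OF vector_fieldsD(1)[OF Y] t] by simp
  qed
  show "Ck_on k (cimg c) (\<lambda>u. (X + Y) c (cinv c u) is js)" if "c \<in> A" for c k "is" js
    unfolding plus_fun_def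
    by (intro Ck_on_add open_cimg that vector_fieldsD(2)[OF X] vector_fieldsD(2)[OF Y])
qed

lemma vector_fields_fmult: "f \<in> smooth_functions A \<Longrightarrow> X \<in> vector_fields A \<Longrightarrow> fmult f X \<in> vector_fields A"
proof (rule vector_fieldsI)
  assume f: "f \<in> smooth_functions A" and X: "X \<in> vector_fields A"
  show "is_field A 0 (Suc 0) 0 (fmult f X)"
  proof (rule is_fieldI)
    fix c x "is" js assume "fmult f X c x is js \<noteq> 0"
    then have "X c x is js \<noteq> 0" by (auto simp: fmult_def)
    then show "c \<in> A \<and> x \<in> cdom c \<and> length is = Suc 0 \<and> length js = 0"
      using is_field_zero[OF vector_fieldsD(1)[OF X]] by blast
  next
    fix c d x and "is" js :: "'n list"
    assume "c \<in> A" "d \<in> A" "x \<in> cdom c" "x \<in> cdom d" "length is = Suc 0" "length js = 0"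
    then have "X d x is js = act (Suc 0) 0 (jac c d x) (jac d c x) (X c x) is js"
      using is_field_act[OF vector_fieldsD(1)[OF X]] by fastforce
    then show "fmult f X d x is js = \<bar>det (jac d c x)\<bar> ^ 0 * act (Suc 0) 0 (jac c d x) (jac d c x) (fmult f X c x) is js"
      using act_cmult[of "Suc 0" 0 "jac c d x" "jac d c x" "f x" "X c x" "is" js] by (simp add: fmult_def)
  qed
  show "Ck_on k (cimg c) (\<lambda>u. fmult f X c (cinv c u) is js)" if "c \<in> A" for c k "is" js
    unfolding fmult_def
    by (intro Ck_on_mult open_cimg that vector_fieldsD(2)[OF X] smooth_functionsD[OF f])
qed

lemma vector_fields_sum: "(\<And>i. i \<in> I \<Longrightarrow> X i \<in> vector_fields A) \<Longrightarrow> (\<Sum>i\<in>I. X i) \<in> vector_fields A"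
  by (induction I rule: infinite_finite_induct) (auto intro: vector_fields_add vector_fields_zero simp del: One_nat_def)

text \<open>
  The coordinate vector fields of \<open>c\<close> multiplied by a bump function.
\<close>

lemma exists_local_frame:
  assumes c: "c \<in> A" "x \<in> cdom c"
  shows "\<exists>E. local_frame A c x E"
proof -
  obtain \<eta> V L where \<eta>: "\<eta> \<in> smooth_functions A" "open V" "x \<in> V" "V \<subseteq> L" "closed L" "L \<subseteq> cdom c"
    "\<And>y. y \<in> V \<Longrightarrow> \<eta> y = 1" "\<And>y. y \<notin> L \<Longrightarrow> \<eta> y = 0"
    using exists_bump_at[OF open_cdom[OF c(1)] c(2)] by blast
  define E :: "'n \<Rightarrow> ('m, 'n) tfield" where "E i d y is js = (if d \<in> A \<and> y \<in> cdom d \<and> y \<in> cdom c \<and> length is = Suc 0 \<and> js = []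
    then \<eta> y * jac c d y $ (is ! 0) $ i else 0)" for i d y "is" js
  have field: "is_field A 0 (Suc 0) 0 (E i)" for i
  proof (rule is_fieldI)
    fix d x "is" js assume "E i d x is js \<noteq> 0"
    then show "d \<in> A \<and> x \<in> cdom d \<and> length is = Suc 0 \<and> length js = 0" by (auto simp: E_def split: if_splits)
  next
    fix d e y and "is" js :: "'n list"
    assume t: "d \<in> A" "e \<in> A" "y \<in> cdom d" "y \<in> cdom e" "length is = Suc 0" "length js = 0"
    obtain k where k: "is = [k]" "js = []" using t(5,6) by (auto simp: length_Suc_conv)
    show "E i e y is js = \<bar>det (jac e d y)\<bar> ^ 0 * act (Suc 0) 0 (jac d e y) (jac e d y) (E i d y) is js"
    proof (cases "y \<in> cdom c")
      case True
      have "jac c e y $ k $ i = (\<Sum>m\<in>UNIV. jac d e y $ k $ m * jac c d y $ m $ i)"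
        using jac_comp[OF c(1) t(1,2) True t(3,4)] by (simp add: matrix_matrix_mult_def vec_eq_iff)
      then show ?thesis using t True k by (simp add: E_def sum_distrib_left mult_ac)
    qed (simp add: E_def k)
  qed
  have Ec: "E i c y [k] [] = \<eta> y * (if k = i then 1 else 0)" if "y \<in> cdom c" for i k y
    using that c by (simp add: E_def jac_same mat_def)
  have "E i \<in> vector_fields A" for i
  proof (rule vector_fieldsI[OF field], rule Ck_field_local[OF field])
    fix d :: "('m, 'n) chart" and k y assume d: "d \<in> A" "y \<in> cdom d"
    show "\<exists>c\<in>A. \<exists>W. open W \<and> y \<in> W \<and> W \<subseteq> cdom c \<and>
        (\<forall>is js. length is = Suc 0 \<longrightarrow> length js = 0 \<longrightarrow> Ck_on k (cmap c ` W) (\<lambda>u. E i c (cinv c u) is js))"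
    proof (cases "y \<in> cdom c")
      case True
      have "Ck_on k (cmap c ` cdom c) (\<lambda>u. E i c (cinv c u) is js)" if l: "length is = Suc 0" "length js = 0" for "is" js
      proof -
        obtain m where m: "is = [m]" "js = []" using l by (auto simp: length_Suc_conv)
        have "Ck_on k (cimg c) (\<lambda>u. \<eta> (cinv c u) * (if m = i then 1 else 0))"
          by (intro Ck_on_mult open_cimg c smooth_functionsD[OF \<eta>(1)] Ck_on_const)
        then show ?thesis unfolding cimg_def[symmetric]
          by (rule Ck_on_eqI[OF open_cimg[OF c(1)]]) (simp add: m Ec cinv_in c)
      qed
      then show ?thesis using c(1) True open_cdom[OF c(1)] by blast
    next
      case False
      define V' where "V' = cdom d - L"
      have V': "open V'" "y \<in> V'" "V' \<subseteq> cdom d" using \<eta>(5,6) False d open_cdom[OF d(1)] by (auto simp: V'_def)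
      have z: "E i d (cinv d u) is js = 0" if u: "u \<in> cmap d ` V'" for u "is" js
      proof -
        obtain y where "y \<in> V'" "u = cmap d y" using u by blast
        then show ?thesis using \<eta>(8) d(1) V'(3) by (auto simp: E_def V'_def cinv_cmap)
      qed
      have "Ck_on k (cmap d ` V') (\<lambda>u. E i d (cinv d u) is js)" for "is" js
        by (rule Ck_on_eqI[OF open_cmap_image[OF d(1) V'(1,3)] Ck_on_const[of k _ "0::real"]]) (simp add: z)
      then show ?thesis using d(1) V' by blast
    qed
  qed
  moreover have "V \<subseteq> cdom c" using \<eta> by blast
  moreover have "\<forall>y\<in>V. \<forall>i k. E i c y [k] [] = (if k = i then 1 else 0)"
    using Ec \<eta>(7) \<open>V \<subseteq> cdom c\<close> by auto
  ultimately have "local_frame A c x E"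
    unfolding local_frame_def using \<eta>(2,3) by (intro conjI allI exI[of _ V]) auto
  then show ?thesis by blast
qed

definition vcomp :: "('m, 'n) tfield \<Rightarrow> ('m, 'n) chart \<Rightarrow> 'm \<Rightarrow> real^'n"
  where "vcomp Z c x = (\<chi> i. Z c x [i] [])"

lemma vcomp_transform:
  assumes "Z \<in> vector_fields A" "c \<in> A" "d \<in> A" "x \<in> cdom c" "x \<in> cdom d"
  shows "vcomp Z d x = jac c d x *v vcomp Z c x"
  using vector_field_transform[OF assms] by (simp add: vcomp_def matrix_vector_mult_def vec_eq_iff)

text \<open>
  The directional derivative is defined by means of an arbitrarily chosen chart; by the chain rule any
  other chart gives the same.
\<close>

lemma dir_deriv_chart:
  assumes Z: "Z \<in> vector_fields A" and c: "c \<in> A" "x \<in> cdom c"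
    and f: "((\<lambda>u. f (cinv c u)) has_derivative F) (at (cmap c x))"
  shows "dir_deriv A Z f x = F (vcomp Z c x)"
proof -
  let ?d = "chart_at A x"
  have d: "?d \<in> A" "x \<in> cdom ?d" using chart_at by auto
  have der: "((\<lambda>u. f (cinv ?d u)) has_derivative (\<lambda>h. F (jac ?d c x *v h))) (at (cmap ?d x))"
    by (rule has_derivative_chart_change[OF c(1) d(1) c(2) d(2) f])
  have "dir_deriv A Z f x = (\<Sum>i\<in>UNIV. vcomp Z ?d x $ i * F (jac ?d c x *v axis i 1))"
    using frechet_derivative_at[OF der] by (simp add: dir_deriv_def Let_def vcomp_def o_def) metis
  also have "\<dots> = F (jac ?d c x *v vcomp Z ?d x)"
    using linear_vec_expand[OF has_derivative_linear[OF der], of "vcomp Z ?d x"] by simp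
  also have "jac ?d c x *v vcomp Z ?d x = vcomp Z c x"
    using vcomp_transform[OF Z d(1) c(1) d(2) c(2)] by simp
  finally show ?thesis .
qed

end

locale connection = manifold A for A :: "('m::t2_space, 'n::finite) chart set" +
  fixes D :: "('m, 'n) tfield \<Rightarrow> ('m, 'n) tfield \<Rightarrow> ('m, 'n) tfield"
  assumes covariant_derivative: "covariant_derivative A D"
begin

lemma D_closed: "X \<in> vector_fields A \<Longrightarrow> Y \<in> vector_fields A \<Longrightarrow> D X Y \<in> vector_fields A"
  and D_add_left: "X \<in> vector_fields A \<Longrightarrow> X' \<in> vector_fields A \<Longrightarrow> Y \<in> vector_fields A \<Longrightarrow> D (X + X') Y = D X Y + D X' Y"
  and D_fmult_left: "f \<in> smooth_functions A \<Longrightarrow> X \<in> vector_fields A \<Longrightarrow> Y \<in> vector_fields A \<Longrightarrow> D (fmult f X) Y = fmult f (D X Y)"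
  and D_add_right: "X \<in> vector_fields A \<Longrightarrow> Y \<in> vector_fields A \<Longrightarrow> Y' \<in> vector_fields A \<Longrightarrow> D X (Y + Y') = D X Y + D X Y'"
  and D_fmult_right: "f \<in> smooth_functions A \<Longrightarrow> X \<in> vector_fields A \<Longrightarrow> Y \<in> vector_fields A \<Longrightarrow>
    D X (fmult f Y) = fmult (dir_deriv A X f) Y + fmult f (D X Y)"
  using covariant_derivative unfolding covariant_derivative_def by (elim conjE; blast)+

lemma D_sum_left:
  assumes Y: "Y \<in> vector_fields A" and X: "\<And>i. i \<in> I \<Longrightarrow> X i \<in> vector_fields A"
  shows "D (\<Sum>i\<in>I. X i) Y = (\<Sum>i\<in>I. D (X i) Y)"
proof -
  have "D (0 + 0) Y = D 0 Y + D 0 Y" by (intro D_add_left vector_fields_zero Y)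
  then have z: "D 0 Y = 0" by simp
  show ?thesis using X
    by (induction I rule: infinite_finite_induct) (simp_all add: z D_add_left Y vector_fields_sum del: One_nat_def)
qed

lemma D_sum_right:
  assumes X: "X \<in> vector_fields A" and Y: "\<And>i. i \<in> I \<Longrightarrow> Y i \<in> vector_fields A"
  shows "D X (\<Sum>i\<in>I. Y i) = (\<Sum>i\<in>I. D X (Y i))"
proof -
  have "D X (0 + 0) = D X 0 + D X 0" by (intro D_add_right vector_fields_zero X)
  then have z: "D X 0 = 0" by simp
  show ?thesis using Y
    by (induction I rule: infinite_finite_induct) (simp_all add: z D_add_right X vector_fields_sum del: One_nat_def)
qed

text \<open>
  If \<open>\<eta>\<close> is a bump function at \<open>x\<close> supported in \<open>W\<close>, then \<open>\<eta> Y = \<eta> Y'\<close>.  By the product rule \<open>D X (\<eta> Y)\<close> at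
  \<open>x\<close> differs from \<open>D X Y\<close> by a term that contains \<open>Y\<close> only through its value at \<open>x\<close>.
\<close>

lemma D_local_right:
  assumes X: "X \<in> vector_fields A" and Y: "Y \<in> vector_fields A" "Y' \<in> vector_fields A"
    and W: "open W" "x \<in> W" and eq: "\<And>y d is js. y \<in> W \<Longrightarrow> Y d y is js = Y' d y is js"
  shows "D X Y d x is js = D X Y' d x is js"
proof -
  obtain \<eta> V L where \<eta>: "\<eta> \<in> smooth_functions A" "open V" "x \<in> V" "V \<subseteq> L" "closed L" "L \<subseteq> W"
    "\<And>y. y \<in> V \<Longrightarrow> \<eta> y = 1" "\<And>y. y \<notin> L \<Longrightarrow> \<eta> y = 0"
    using exists_bump_at[OF W] by blast
  have "fmult \<eta> Y d y is js = fmult \<eta> Y' d y is js" for d y "is" js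
    using eq[of y d "is" js] \<eta>(6) \<eta>(8)[of y] by (cases "y \<in> L") (auto simp: fmult_def)
  then have "fmult \<eta> Y = fmult \<eta> Y'" by (simp add: fun_eq_iff)
  then have "D X (fmult \<eta> Y) d x is js = D X (fmult \<eta> Y') d x is js" by simp
  then show ?thesis
    using D_fmult_right[OF \<eta>(1) X Y(1)] D_fmult_right[OF \<eta>(1) X Y(2)] eq[OF W(2)] \<eta>(7)[OF \<eta>(3)]
    by (simp add: fmult_def)
qed

text \<open>
  The matrix by which \<open>D\<close> along \<open>Z\<close> differs from the derivative of components: the Christoffel symbols
  contracted with \<open>Z\<close>.
\<close>

definition conn :: "('m, 'n) tfield \<Rightarrow> ('m, 'n) chart \<Rightarrow> 'm \<Rightarrow> real^'n^'n"
  where "conn Z c x = (\<chi> k j. \<Sum>i\<in>UNIV. Z c x [i] [] * christoffel A D c x k i j)"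

lemma local_frameD:
  assumes "local_frame A c x E"
  obtains W where "open W" "x \<in> W" "W \<subseteq> cdom c" "\<And>y i k. y \<in> W \<Longrightarrow> E i c y [k] [] = (if k = i then 1 else 0)"
    "\<And>i. E i \<in> vector_fields A"
  using assms unfolding local_frame_def by blast

text \<open>
  Near \<open>x\<close> the field \<open>Z\<close> is a combination of the frame with smooth coefficients, and \<open>D\<close> is linear over
  smooth functions in its first argument.  The frame used to define the Christoffel symbols can be
  replaced by any other one because \<open>D\<close> is local in the second argument.
\<close>

lemma conn_eq_frame:
  assumes Z: "Z \<in> vector_fields A" and c: "c \<in> A" "x \<in> cdom c" and E: "local_frame A c x E"
  shows "conn Z c x $ k $ j = D Z (E j) c x [k] []"
proof -
  define E0 where "E0 = (SOME E. local_frame A c x E)"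
  have E0: "local_frame A c x E0" unfolding E0_def by (rule someI[of "local_frame A c x", OF E])
  obtain W where W: "open W" "x \<in> W" "W \<subseteq> cdom c" "\<And>y i k. y \<in> W \<Longrightarrow> E i c y [k] [] = (if k = i then 1 else 0)"
    "\<And>i. E i \<in> vector_fields A" by (rule local_frameD[OF E]) blast
  obtain W0 where W0: "open W0" "x \<in> W0" "W0 \<subseteq> cdom c" "\<And>y i k. y \<in> W0 \<Longrightarrow> E0 i c y [k] [] = (if k = i then 1 else 0)"
    "\<And>i. E0 i \<in> vector_fields A" by (rule local_frameD[OF E0]) blast
  obtain \<eta> V L where \<eta>: "\<eta> \<in> smooth_functions A" "open V" "x \<in> V" "V \<subseteq> L" "closed L" "L \<subseteq> W0"
    "\<And>y. y \<in> V \<Longrightarrow> \<eta> y = 1" "\<And>y. y \<notin> L \<Longrightarrow> \<eta> y = 0"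
    using exists_bump_at[OF W0(1,2)] by blast
  \<comment> \<open>the components of \<open>Z\<close>, cut off so that they become smooth functions on the manifold\<close>
  define g where "g i y = (if y \<in> cdom c then \<eta> y * Z c y [i] [] else 0)" for i y
  have g: "g i \<in> smooth_functions A" for i
  proof (rule smooth_functions_extend[OF c(1) open_cdom[OF c(1)] order.refl \<eta>(5)])
    show "L \<subseteq> cdom c" using \<eta>(6) W0(3) by blast
    show "Ck_on k (cmap c ` cdom c) (\<lambda>u. g i (cinv c u))" for k
      unfolding cimg_def[symmetric]
      by (rule Ck_on_eqI[OF open_cimg[OF c(1)] Ck_on_mult[OF open_cimg[OF c(1)] smooth_functionsD[OF \<eta>(1) c(1)] vector_fieldsD(2)[OF Z c(1), of _ "[i]" "[]"]]])
        (simp add: g_def cinv_in c)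
    show "g i y = 0" if "y \<notin> L" for y using \<eta>(8)[OF that] by (simp add: g_def)
  qed
  have vf: "fmult \<eta> Z \<in> vector_fields A" "fmult (g i) (E0 i) \<in> vector_fields A" for i
    by (intro vector_fields_fmult \<eta>(1) Z g W0(5))+
  have "fmult \<eta> Z d y is js = (\<Sum>i\<in>UNIV. fmult (g i) (E0 i)) d y is js" for d y "is" js
  proof (cases "y \<in> L")
    case False
    then have "g i y = 0" for i using \<eta>(8)[OF False] by (simp add: g_def)
    then show ?thesis using \<eta>(8)[OF False] by (simp add: fmult_def sum_tfield_apply)
  next
    case True
    then have y: "y \<in> W0" "y \<in> cdom c" using \<eta>(6) W0(3) by blast+
    show ?thesis
      by (rule vector_field_eqI[OF vf(1) vector_fields_sum[OF vf(2)] c(1) y(2)])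
        (simp add: fmult_def sum_tfield_apply g_def W0(4)[OF y(1)] y if_distrib[where f="\<lambda>x. _ * x"] cong: if_cong)
  qed
  then have eq: "fmult \<eta> Z = (\<Sum>i\<in>UNIV. fmult (g i) (E0 i))" by (simp add: fun_eq_iff)
  have "D Z (E j) c x [k] [] = D Z (E0 j) c x [k] []"
  proof (rule D_local_right[OF Z W(5) W0(5) open_Int[OF W(1) W0(1)]])
    show "E j d y is js = E0 j d y is js" if "y \<in> W \<inter> W0" for y d "is" js
      by (rule vector_field_eqI[OF W(5) W0(5) c(1)]) (use that W W0 in auto)
  qed (use W W0 in auto)
  also have "\<dots> = D (fmult \<eta> Z) (E0 j) c x [k] []"
    unfolding D_fmult_left[OF \<eta>(1) Z W0(5)] by (simp add: fmult_def \<eta>(7)[OF \<eta>(3)])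
  also have "\<dots> = (\<Sum>i\<in>UNIV. g i x * D (E0 i) (E0 j) c x [k] [])"
    unfolding eq D_sum_left[OF W0(5) vf(2)] sum_tfield_apply D_fmult_left[OF g W0(5) W0(5)] by (simp add: fmult_def)
  also have "\<dots> = conn Z c x $ k $ j"
    by (simp add: conn_def christoffel_def E0_def[symmetric] Let_def g_def c \<eta>(7)[OF \<eta>(3)])
  finally show ?thesis ..
qed

text \<open>
  The frame of \<open>d\<close> is, near \<open>x\<close>, the frame of \<open>c\<close> multiplied by the Jacobian matrix \<open>K\<close> from \<open>d\<close> to \<open>c\<close>.
  Differentiating this product along \<open>Z\<close> yields the derivative of \<open>K\<close> along \<open>Z\<close> plus the connection matrix
  of \<open>c\<close> times \<open>K\<close>; these are components with respect to \<open>c\<close>, and the Jacobian matrix from \<open>c\<close> to \<open>d\<close>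
  turns them into components with respect to \<open>d\<close>.
\<close>

lemma conn_transform:
  assumes Z: "Z \<in> vector_fields A" and cd: "c \<in> A" "d \<in> A" "x \<in> cdom c" "x \<in> cdom d"
    and K': "\<And>l j. ((\<lambda>u. jac d c (cinv c u) $ l $ j) has_derivative dK l j) (at (cmap c x))"
  shows "conn Z d x = jac c d x ** ((\<chi> l j. dK l j (vcomp Z c x)) + conn Z c x ** jac d c x)"
proof -
  obtain E where E: "local_frame A c x E" using exists_local_frame cd by blast
  obtain E' where E': "local_frame A d x E'" using exists_local_frame cd by blast
  obtain W where W: "open W" "x \<in> W" "W \<subseteq> cdom c" "\<And>y i k. y \<in> W \<Longrightarrow> E i c y [k] [] = (if k = i then 1 else 0)"
    "\<And>i. E i \<in> vector_fields A" by (rule local_frameD[OF E]) blast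
  obtain W' where W': "open W'" "x \<in> W'" "W' \<subseteq> cdom d" "\<And>y i k. y \<in> W' \<Longrightarrow> E' i d y [k] [] = (if k = i then 1 else 0)"
    "\<And>i. E' i \<in> vector_fields A" by (rule local_frameD[OF E']) blast
  have WW: "open (W \<inter> W')" "x \<in> W \<inter> W'" using W W' by auto
  obtain \<eta> V L where \<eta>: "\<eta> \<in> smooth_functions A" "open V" "x \<in> V" "V \<subseteq> L" "closed L" "L \<subseteq> W \<inter> W'"
    "\<And>y. y \<in> V \<Longrightarrow> \<eta> y = 1" "\<And>y. y \<notin> L \<Longrightarrow> \<eta> y = 0"
    using exists_bump_at[OF WW] by blast
  have VW: "V \<subseteq> W" "V \<subseteq> W'" "V \<subseteq> cdom c" "V \<subseteq> cdom d" using \<eta>(4,6) W(3) W'(3) by blast+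
  define O' where "O' = cdom c \<inter> cdom d"
  have O': "open O'" "O' \<subseteq> cdom c" unfolding O'_def using open_Int[OF open_cdom[OF cd(1)] open_cdom[OF cd(2)]] by auto
  \<comment> \<open>the coefficients of the frame of \<open>d\<close> with respect to the one of \<open>c\<close>, cut off\<close>
  define g where "g j l y = (if y \<in> O' then \<eta> y * jac d c y $ l $ j else 0)" for j l y
  have g: "g j l \<in> smooth_functions A" for j l
  proof (rule smooth_functions_extend[OF cd(1) O' \<eta>(5)])
    show "L \<subseteq> O'" using \<eta>(6) W(3) W'(3) by (auto simp: O'_def)
    have op: "open (cmap c ` O')" by (rule open_cmap_image[OF cd(1) O'])
    show "Ck_on k (cmap c ` O') (\<lambda>u. g j l (cinv c u))" for k
    proof (rule Ck_on_eqI[OF op Ck_on_mult[OF op]])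
      show "Ck_on k (cmap c ` O') (\<lambda>u. \<eta> (cinv c u))"
        by (rule Ck_on_subset[OF smooth_functionsD[OF \<eta>(1) cd(1)]]) (use O' in \<open>auto simp: cimg_def\<close>)
      show "Ck_on k (cmap c ` O') (\<lambda>u. jac d c (cinv c u) $ l $ j)"
        by (rule Ck_on_jac'[OF cd(2,1,1) O'(1)]) (auto simp: O'_def)
      fix u assume "u \<in> cmap c ` O'"
      then obtain y where "y \<in> O'" "u = cmap c y" by blast
      then show "\<eta> (cinv c u) * jac d c (cinv c u) $ l $ j = g j l (cinv c u)"
        using cinv_cmap[OF cd(1), of y] O'(2) by (auto simp: g_def)
    qed
    show "g j l y = 0" if "y \<notin> L" for y using \<eta>(8)[OF that] by (simp add: g_def)
  qed
  have vf: "fmult (g j l) (E l) \<in> vector_fields A" for j l by (intro vector_fields_fmult g W(5))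
  have dg: "dir_deriv A Z (g j l) x = dK l j (vcomp Z c x)" for j l
  proof (rule dir_deriv_chart[OF Z cd(1,3)])
    show "((\<lambda>u. g j l (cinv c u)) has_derivative dK l j) (at (cmap c x))"
    proof (rule has_derivative_transform_within_open[OF K' open_cmap_image[OF cd(1) \<eta>(2) VW(3)]])
      show "cmap c x \<in> cmap c ` V" using \<eta>(3) by blast
      fix u assume "u \<in> cmap c ` V"
      then obtain y where "y \<in> V" "u = cmap c y" by blast
      moreover then have "y \<in> cdom c" "y \<in> cdom d" using VW by blast+
      ultimately show "jac d c (cinv c u) $ l $ j = g j l (cinv c u)"
        using cinv_cmap[OF cd(1), of y] \<eta>(7)[of y] by (simp add: g_def O'_def)
    qed
  qed
  have DE: "D Z (E' j) c x [m] [] = dK m j (vcomp Z c x) + (conn Z c x ** jac d c x) $ m $ j" for m j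
  proof -
    have "D Z (E' j) c x [m] [] = D Z (\<Sum>l\<in>UNIV. fmult (g j l) (E l)) c x [m] []"
    proof (rule D_local_right[OF Z W'(5) vector_fields_sum[OF vf] \<eta>(2,3)])
      fix y e "is" js assume y: "y \<in> V"
      then have y': "y \<in> W" "y \<in> W'" "y \<in> cdom c" "y \<in> cdom d" using VW by blast+
      show "E' j e y is js = (\<Sum>l\<in>UNIV. fmult (g j l) (E l)) e y is js"
      proof (rule vector_field_eqI[OF W'(5) vector_fields_sum[OF vf] cd(1) y'(3)])
        fix k
        have "E' j c y [k] [] = jac d c y $ k $ j"
          using vector_field_transform[OF W'(5) cd(2,1) y'(4,3)] W'(4)[OF y'(2)]
          by (simp add: if_distrib[where f="\<lambda>x. _ * x"] cong: if_cong)
        moreover have "(\<Sum>l\<in>UNIV. fmult (g j l) (E l)) c y [k] [] = g j k y"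
          by (simp add: fmult_def sum_tfield_apply W(4)[OF y'(1)] if_distrib[where f="\<lambda>x. _ * x"] cong: if_cong)
        ultimately show "E' j c y [k] [] = (\<Sum>l\<in>UNIV. fmult (g j l) (E l)) c y [k] []"
          using y' \<eta>(7)[OF y] by (simp add: g_def O'_def)
      qed
    qed
    also have "\<dots> = (\<Sum>l\<in>UNIV. dir_deriv A Z (g j l) x * E l c x [m] [] + g j l x * D Z (E l) c x [m] [])"
      unfolding D_sum_right[OF Z vf] sum_tfield_apply D_fmult_right[OF g Z W(5)] by (simp add: fmult_def)
    also have "\<dots> = dir_deriv A Z (g j m) x + (\<Sum>l\<in>UNIV. conn Z c x $ m $ l * jac d c x $ l $ j)"
      using W(2) cd \<eta>(7)[OF \<eta>(3)]
      by (simp add: sum.distrib W(4) conn_eq_frame[OF Z cd(1,3) E] g_def O'_def mult.commute if_distrib[where f="\<lambda>x. _ * x"]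
          if_distrib[where f="\<lambda>x. x * _"] cong: if_cong)
    finally show ?thesis by (simp add: dg matrix_matrix_mult_def)
  qed
  have "conn Z d x $ k $ j = (\<Sum>m\<in>UNIV. jac c d x $ k $ m * D Z (E' j) c x [m] [])" for k j
    unfolding conn_eq_frame[OF Z cd(2,4) E']
    by (rule vector_field_transform[OF D_closed[OF Z W'(5)] cd])
  then show ?thesis
    by (simp add: DE vec_eq_iff matrix_matrix_mult_def[of "jac c d x"])
qed

text \<open>
  A local frame at \<open>x\<close> is one at all nearby points, so that there the connection matrix is given by the
  components of fixed smooth vector fields.
\<close>

lemma Ck_on_conn:
  assumes Z: "Z \<in> vector_fields A" and c: "c \<in> A"
  shows "Ck_on k (cimg c) (\<lambda>u. conn Z c (cinv c u) $ m $ j)"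
proof (rule Ck_on_chart_local[OF c])
  fix x assume x: "x \<in> cdom c"
  obtain E where E: "local_frame A c x E" using exists_local_frame c x by blast
  obtain W where W: "open W" "x \<in> W" "W \<subseteq> cdom c" "\<And>y i k. y \<in> W \<Longrightarrow> E i c y [k] [] = (if k = i then 1 else 0)"
    "\<And>i. E i \<in> vector_fields A" by (rule local_frameD[OF E]) blast
  have fr: "local_frame A c y E" if "y \<in> W" for y
    unfolding local_frame_def using W that by blast
  have "Ck_on k (cmap c ` W) (\<lambda>u. D Z (E j) c (cinv c u) [m] [])"
    by (rule Ck_on_subset[OF vector_fieldsD(2)[OF D_closed[OF Z W(5)] c]]) (use W(3) in \<open>auto simp: cimg_def\<close>)
  then have "Ck_on k (cmap c ` W) (\<lambda>u. conn Z c (cinv c u) $ m $ j)"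
  proof (rule Ck_on_eqI[OF open_cmap_image[OF c W(1,3)]])
    fix u assume "u \<in> cmap c ` W"
    then obtain y where y: "y \<in> W" "u = cmap c y" by blast
    then have "cinv c u = y" "y \<in> cdom c" using cinv_cmap[OF c, of y] W(3) by auto
    then show "D Z (E j) c (cinv c u) [m] [] = conn Z c (cinv c u) $ m $ j"
      using conn_eq_frame[OF Z c _ fr[OF y(1)]] by simp
  qed
  then show "\<exists>c'\<in>A. \<exists>W. open W \<and> x \<in> W \<and> W \<subseteq> cdom c' \<and> Ck_on k (cmap c' ` W) (\<lambda>u. conn Z c (cinv c' u) $ m $ j)"
    using c W(1-3) by blast
qed

end

section \<open>The covariant derivative of tensor fields\<close>

lemma sum_contract_middle:
  fixes z :: "'i \<Rightarrow> real"
  shows "(\<Sum>i\<in>I. z i * (\<Sum>a\<in>J. \<Sum>m\<in>M. g i a m * t a m)) = (\<Sum>a\<in>J. \<Sum>m\<in>M. (\<Sum>i\<in>I. z i * g i a m) * t a m)"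
proof -
  have "(\<Sum>i\<in>I. z i * (\<Sum>a\<in>J. \<Sum>m\<in>M. g i a m * t a m)) = (\<Sum>i\<in>I. \<Sum>a\<in>J. \<Sum>m\<in>M. z i * g i a m * t a m)"
    by (simp add: sum_distrib_left mult.assoc)
  also have "\<dots> = (\<Sum>a\<in>J. \<Sum>i\<in>I. \<Sum>m\<in>M. z i * g i a m * t a m)" by (rule sum.swap)
  also have "\<dots> = (\<Sum>a\<in>J. \<Sum>m\<in>M. \<Sum>i\<in>I. z i * g i a m * t a m)" by (intro sum.cong refl sum.swap)
  finally show ?thesis by (simp add: sum_distrib_right)
qed

context manifold begin

text \<open>
  The components with a wrong number of indices or outside the charts are left free here, so that this
  covers \<open>nabla A D Z S\<close>, whose definition does not inspect the number of indices.
\<close>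

definition continuous_tensor :: "nat \<Rightarrow> nat \<Rightarrow> ('m, 'n) tfield \<Rightarrow> bool"
  where "continuous_tensor r s T \<longleftrightarrow> (\<forall>c\<in>A. \<forall>is js. length is = r \<longrightarrow> length js = s \<longrightarrow>
    (\<forall>d\<in>A. \<forall>x\<in>cdom c \<inter> cdom d. T d x is js = act r s (jac c d x) (jac d c x) (T c x) is js) \<and>
    continuous_on (cimg c) (\<lambda>u. T c (cinv c u) is js))"

lemma continuous_tensorD:
  assumes "continuous_tensor r s T" "c \<in> A" "length is = r" "length js = s"
  shows "d \<in> A \<Longrightarrow> x \<in> cdom c \<Longrightarrow> x \<in> cdom d \<Longrightarrow> T d x is js = act r s (jac c d x) (jac d c x) (T c x) is js"
    and "continuous_on (cimg c) (\<lambda>u. T c (cinv c u) is js)"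
  using assms unfolding continuous_tensor_def by blast+

lemma Ck_fields_continuous_tensor:
  assumes "T \<in> Ck_fields A k 0 r s" shows "continuous_tensor r s T"
  unfolding continuous_tensor_def
proof (intro ballI allI impI conjI)
  fix c and "is" js :: "'n list" assume c: "c \<in> A" "length is = r" "length js = s"
  have T: "is_field A 0 r s T" "Ck_on k (cimg c) (\<lambda>u. T c (cinv c u) is js)"
    using assms c(1) unfolding Ck_fields_def by auto
  show "continuous_on (cimg c) (\<lambda>u. T c (cinv c u) is js)" by (rule Ck_on_continuous[OF T(2)])
  fix d x assume "d \<in> A" "x \<in> cdom c \<inter> cdom d"
  then show "T d x is js = act r s (jac c d x) (jac d c x) (T c x) is js"
    using is_field_act[OF T(1) c(1) _ _ _ c(2,3)] by auto
qed

end

context connection begin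

lemma nabla_expand:
  assumes c: "c \<in> A" "x \<in> cdom c" and len: "length is = r" "length js = s"
    and F: "((\<lambda>u. T c (cinv c u) is js) has_derivative F) (at (cmap c x))"
  shows "nabla A D Z T c x is js = F (vcomp Z c x)
    + (\<Sum>a<r. \<Sum>m\<in>UNIV. conn Z c x $ (is ! a) $ m * T c x (is[a := m]) js)
    - (\<Sum>b<s. \<Sum>m\<in>UNIV. conn Z c x $ m $ (js ! b) * T c x is (js[b := m]))"
proof -
  have "nabla A D Z T c x is js = (\<Sum>i\<in>UNIV. vcomp Z c x $ i * F (axis i 1))
    + (\<Sum>i\<in>UNIV. Z c x [i] [] * (\<Sum>a<r. \<Sum>m\<in>UNIV. christoffel A D c x (is ! a) i m * T c x (is[a := m]) js))
    - (\<Sum>i\<in>UNIV. Z c x [i] [] * (\<Sum>b<s. \<Sum>m\<in>UNIV. christoffel A D c x m i (js ! b) * T c x is (js[b := m])))"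
    using c len by (simp add: nabla_def frechet_derivative_at[OF F, symmetric] vcomp_def
      sum.distrib sum_subtractf ring_distribs)
  then show ?thesis
    by (simp add: sum_contract_middle conn_def linear_vec_expand[OF has_derivative_linear[OF F], of "vcomp Z c x"])
qed

text \<open>
  In every chart the covariant derivative at \<open>x\<close> is the derivative at \<open>t = 0\<close> of
  \<open>act (1 + t G) (1 - t G) (T (x + t z))\<close>, where \<open>z\<close> are the components of \<open>Z\<close> and \<open>G\<close> is the connection
  matrix (\<open>act_has_derivative\<close>); only the first order part of the two matrices matters.  In \<open>d\<close> they may
  therefore be chosen such that applying them after the transformation law of \<open>T\<close> at \<open>x + t z\<close> is the same
  as applying the matrices of \<open>c\<close> first and the transformation law at \<open>x\<close> afterwards.  That these
  matrices have the right derivative is the transformation law of the connection matrix.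
\<close>

lemma nabla_transform:
  assumes Z: "Z \<in> vector_fields A" and T: "is_field A 0 r s T"
    and cd: "c \<in> A" "d \<in> A" "x \<in> cdom c" "x \<in> cdom d"
    and diff: "\<And>is js. length is = r \<Longrightarrow> length js = s \<Longrightarrow> (\<lambda>u. T c (cinv c u) is js) differentiable (at (cmap c x))"
    and len: "length is = r" "length js = s"
  shows "nabla A D Z T d x is js = act r s (jac c d x) (jac d c x) (nabla A D Z T c x) is js"
proof -
  define u0 where "u0 = cmap c x"
  define z where "z = vcomp Z c x"
  define U where "U = cmap c ` (cdom c \<inter> cdom d)"
  have U: "open U" "u0 \<in> U" unfolding U_def u0_def using open_overlap cd by auto
  have Ucdom: "cinv c u \<in> cdom c" "cinv c u \<in> cdom d" if "u \<in> U" for u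
  proof -
    obtain y where "y \<in> cdom c" "y \<in> cdom d" "u = cmap c y" using \<open>u \<in> U\<close> unfolding U_def by blast
    then show "cinv c u \<in> cdom c" "cinv c u \<in> cdom d" using cinv_cmap[OF cd(1)] by auto
  qed
  have x: "cinv c u0 = x" unfolding u0_def by (rule cinv_cmap[OF cd(1,3)])
  define l where "l t = u0 + t *\<^sub>R z" for t :: real
  have l0: "l 0 = u0" by (simp add: l_def)
  have evU: "eventually (\<lambda>t. l t \<in> U) (nhds 0)"
  proof -
    have "isCont l 0" unfolding l_def by (intro continuous_intros)
    then have "(l \<longlongrightarrow> u0) (nhds 0)" using l0 by (metis isCont_def tendsto_at_iff_tendsto_nhds)
    then show ?thesis using topological_tendstoD[OF _ U] by blast
  qed
  define J where "J t = jac c d (cinv c (l t))" for t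
  define K where "K t = jac d c (cinv c (l t))" for t
  define J0 where "J0 = jac c d x"
  define K0 where "K0 = jac d c x"
  have JK0: "J 0 = J0" "K 0 = K0" by (simp_all add: J_def K_def J0_def K0_def l0 x)
  have KJ: "K t ** J t = mat 1" "J t ** K t = mat 1" if "l t \<in> U" for t
    unfolding J_def K_def using jac_inverse cd Ucdom[OF that] by blast+
  have KJ0: "K0 ** J0 = mat 1" "J0 ** K0 = mat 1"
    using KJ[of 0] U(2) by (simp_all add: l0 JK0)
  have jac_diff: "((\<lambda>u. jac e f (cinv c u) $ i $ k) has_derivative
      frechet_derivative (\<lambda>u. jac e f (cinv c u) $ i $ k) (at u0)) (at u0)"
    if "e = c \<and> f = d \<or> e = d \<and> f = c" for e f i k
  proof (rule Ck_on_SucD[OF _ U])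
    have "open (cdom c \<inter> cdom d)" by (intro open_Int open_cdom cd)
    then show "Ck_on (Suc 0) U (\<lambda>u. jac e f (cinv c u) $ i $ k)"
      unfolding U_def by (intro Ck_on_jac') (use that cd in auto)
  qed
  define dJ where "dJ i k = frechet_derivative (\<lambda>u. jac c d (cinv c u) $ i $ k) (at u0)" for i k
  define dK where "dK i k = frechet_derivative (\<lambda>u. jac d c (cinv c u) $ i $ k) (at u0)" for i k
  define J' where "J' = (\<chi> i k. dJ i k z)"
  define K' where "K' = (\<chi> i k. dK i k z)"
  have hJ: "((\<lambda>t. J t $ i $ k) has_real_derivative J' $ i $ k) (at 0)" for i k
    using has_derivative_along_line[OF jac_diff[of c d i k]] by (simp add: J_def l_def J'_def dJ_def)
  have hK: "((\<lambda>t. K t $ i $ k) has_real_derivative K' $ i $ k) (at 0)" for i k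
    using has_derivative_along_line[OF jac_diff[of d c i k]] by (simp add: K_def l_def K'_def dK_def)
  define G where "G = conn Z c x"
  have Gd: "conn Z d x = J0 ** (K' + G ** K0)"
    unfolding J0_def K0_def G_def K'_def z_def
    by (rule conn_transform[OF Z cd]) (use jac_diff[of d c] in \<open>simp add: dK_def u0_def\<close>)
  \<comment> \<open>differentiate \<open>J ** K = 1\<close>\<close>
  have JK': "J' ** K0 + J0 ** K' = 0"
  proof -
    have "(J' ** K0 + J0 ** K') $ i $ k = 0" for i k
    proof -
      have "((\<lambda>t. (J t ** K t) $ i $ k) has_real_derivative (J' ** K0 + J0 ** K') $ i $ k) (at 0)"
        using matrix_mult_has_derivative[OF hJ hK] by (simp add: JK0)
      moreover have "((\<lambda>t. (J t ** K t) $ i $ k) has_real_derivative 0) (at 0)"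
        by (rule DERIV_cong_ev[THEN iffD2, OF refl _ refl DERIV_const[of "mat 1 $ i $ k"]])
          (use evU in \<open>eventually_elim, simp add: KJ(2)\<close>)
      ultimately show ?thesis by (rule DERIV_unique)
    qed
    then show ?thesis by (simp add: vec_eq_iff)
  qed
  define P where "P t = mat 1 + t *\<^sub>R G" for t :: real
  define Q where "Q t = mat 1 - t *\<^sub>R G" for t :: real
  have P0: "P 0 = mat 1" "Q 0 = mat 1" by (simp_all add: P_def Q_def)
  have hP: "((\<lambda>t. P t $ i $ k) has_real_derivative G $ i $ k) (at 0)"
    "((\<lambda>t. Q t $ i $ k) has_real_derivative (- G) $ i $ k) (at 0)" for i k
    by (auto simp: P_def Q_def intro!: derivative_eq_intros)
  define F where "F is js = frechet_derivative (\<lambda>u. T c (cinv c u) is js) (at u0)" for "is" js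
  have F: "((\<lambda>u. T c (cinv c u) is js) has_derivative F is js) (at u0)" if "length is = r" "length js = s" for "is" js
    using diff[OF that] unfolding F_def u0_def frechet_derivative_works .
  have hT: "((\<lambda>t. T c (cinv c (l t)) is js) has_real_derivative F is js z) (at 0)" if "length is = r" "length js = s" for "is" js
    using has_derivative_along_line[OF F[OF that]] by (simp add: l_def)
  have hc: "((\<lambda>t. act r s (P t) (Q t) (T c (cinv c (l t))) is js) has_real_derivative nabla A D Z T c x is js) (at 0)"
    if len: "length is = r" "length js = s" for "is" js
  proof -
    have "((\<lambda>t. act r s (P t) (Q t) (T c (cinv c (l t))) is js) has_real_derivative
      F is js z + (\<Sum>a<r. \<Sum>m\<in>UNIV. G $ (is ! a) $ m * T c (cinv c (l 0)) (is[a := m]) js)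
      + (\<Sum>b<s. \<Sum>m\<in>UNIV. (- G) $ m $ (js ! b) * T c (cinv c (l 0)) is (js[b := m]))) (at 0)"
      by (rule act_has_derivative[OF hP(1) P0(1) hP(2) P0(2) hT len])
    moreover have "nabla A D Z T c x is js = F is js z + (\<Sum>a<r. \<Sum>m\<in>UNIV. G $ (is ! a) $ m * T c x (is[a := m]) js)
      - (\<Sum>b<s. \<Sum>m\<in>UNIV. G $ m $ (js ! b) * T c x is (js[b := m]))"
      unfolding G_def z_def by (rule nabla_expand[where T=T, OF cd(1,3) len F[OF len, unfolded u0_def]])
    ultimately show ?thesis by (simp add: l0 x sum_negf)
  qed
  \<comment> \<open>the matrices for \<open>d\<close>: conjugates of those for \<open>c\<close>, with the Jacobian matrix at \<open>x\<close> on one side and the one at \<open>x + t z\<close> on the other\<close>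
  define P' where "P' t = J0 ** P t ** K t" for t
  define Q' where "Q' t = J t ** (Q t ** K0)" for t
  have P'0: "P' 0 = mat 1" "Q' 0 = mat 1" by (simp_all add: P'_def Q'_def P0 JK0 KJ0)
  have hP': "((\<lambda>t. P' t $ i $ k) has_real_derivative conn Z d x $ i $ k) (at 0)" for i k
  proof -
    have "((\<lambda>t. (J0 ** (P t ** K t)) $ i $ k) has_real_derivative (0 ** (P 0 ** K 0) + J0 ** (G ** K 0 + P 0 ** K')) $ i $ k) (at 0)"
      by (rule matrix_mult_has_derivative[OF _ matrix_mult_has_derivative[OF hP(1) hK]]) simp
    then show ?thesis by (simp add: P'_def Gd JK0 P0 matrix_mul_assoc add.commute)
  qed
  have hQ': "((\<lambda>t. Q' t $ i $ k) has_real_derivative (- conn Z d x) $ i $ k) (at 0)" for i k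
  proof -
    have h: "((\<lambda>t. (J t ** (Q t ** K0)) $ i $ k) has_real_derivative (J' ** (Q 0 ** K0) + J 0 ** ((- G) ** K0 + Q 0 ** 0)) $ i $ k) (at 0)"
      by (rule matrix_mult_has_derivative[OF hJ matrix_mult_has_derivative[OF hP(2)]]) simp
    have "J' ** (Q 0 ** K0) + J 0 ** ((- G) ** K0 + Q 0 ** 0) = J' ** K0 - J0 ** (G ** K0)"
    proof -
      have "(- X) ** Y = - (X ** Y)" "X ** (- Y) = - (X ** Y)" "X ** 0 = 0" for X Y :: "real^'n^'n"
        by (simp_all add: matrix_matrix_mult_def vec_eq_iff sum_negf)
      then show ?thesis by (simp add: P0 JK0)
    qed
    also have "\<dots> = - conn Z d x"
    proof -
      have "J' ** K0 = - (J0 ** K')" using JK' by (simp add: add_eq_0_iff2)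
      then show ?thesis by (simp add: Gd matrix_add_ldistrib)
    qed
    finally show ?thesis using h by (simp only: Q'_def)
  qed
  have Td: "T d (cinv c u) is js = act r s (jac c d (cinv c u)) (jac d c (cinv c u)) (T c (cinv c u)) is js"
    if "u \<in> U" "length is = r" "length js = s" for u "is" js
    using is_field_act[OF T cd(1,2) Ucdom[OF that(1)] that(2,3)] by simp
  define Fd where "Fd is js = frechet_derivative (\<lambda>u. T d (cinv c u) is js) (at u0)" for "is" js
  have Fd: "((\<lambda>u. T d (cinv c u) is js) has_derivative Fd is js) (at u0)" if len: "length is = r" "length js = s" for "is" js
  proof -
    have "(\<lambda>u. act r s (jac c d (cinv c u)) (jac d c (cinv c u)) (T c (cinv c u)) is js) differentiable (at u0)"
      by (intro differentiable_act differentiableI[OF F] differentiableI[OF jac_diff[of c d]] differentiableI[OF jac_diff[of d c]]) auto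
    then obtain F' where "((\<lambda>u. act r s (jac c d (cinv c u)) (jac d c (cinv c u)) (T c (cinv c u)) is js) has_derivative F') (at u0)"
      unfolding differentiable_def by blast
    then have "((\<lambda>u. T d (cinv c u) is js) has_derivative F') (at u0)"
      by (rule has_derivative_transform_within_open[OF _ U]) (simp add: Td len)
    then show ?thesis unfolding Fd_def frechet_derivative_works[symmetric] by (rule differentiableI)
  qed
  have hTd: "((\<lambda>t. T d (cinv c (l t)) is js) has_real_derivative Fd is js z) (at 0)" if "length is = r" "length js = s" for "is" js
    using has_derivative_along_line[OF Fd[OF that]] by (simp add: l_def)
  have hd: "((\<lambda>t. act r s (P' t) (Q' t) (T d (cinv c (l t))) is js) has_real_derivative nabla A D Z T d x is js) (at 0)"
  proof -
    have "((\<lambda>t. act r s (P' t) (Q' t) (T d (cinv c (l t))) is js) has_real_derivative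
      Fd is js z + (\<Sum>a<r. \<Sum>m\<in>UNIV. conn Z d x $ (is ! a) $ m * T d (cinv c (l 0)) (is[a := m]) js)
      + (\<Sum>b<s. \<Sum>m\<in>UNIV. (- conn Z d x) $ m $ (js ! b) * T d (cinv c (l 0)) is (js[b := m]))) (at 0)"
      by (rule act_has_derivative[OF hP' P'0(1) hQ' P'0(2) hTd len])
    moreover have "nabla A D Z T d x is js = Fd is js (jac d c x *v vcomp Z d x)
      + (\<Sum>a<r. \<Sum>m\<in>UNIV. conn Z d x $ (is ! a) $ m * T d x (is[a := m]) js)
      - (\<Sum>b<s. \<Sum>m\<in>UNIV. conn Z d x $ m $ (js ! b) * T d x is (js[b := m]))"
      by (rule nabla_expand[where T=T, OF cd(2,4) len has_derivative_chart_change[OF cd Fd[OF len, unfolded u0_def]]])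
    moreover have "jac d c x *v vcomp Z d x = z"
      unfolding z_def by (rule vcomp_transform[OF Z cd(2,1,4,3), symmetric])
    ultimately show ?thesis by (simp add: l0 x sum_negf)
  qed
  have "((\<lambda>t. act r s J0 K0 (act r s (P t) (Q t) (T c (cinv c (l t)))) is js) has_real_derivative
      act r s J0 K0 (nabla A D Z T c x) is js) (at 0)"
    unfolding act_expand[of r s J0 K0] by (intro DERIV_sum DERIV_cmult hc) auto
  moreover have "eventually (\<lambda>t. act r s (P' t) (Q' t) (T d (cinv c (l t))) is js =
      act r s J0 K0 (act r s (P t) (Q t) (T c (cinv c (l t)))) is js) (nhds 0)"
    using evU
  proof eventually_elim
    case (elim t)
    have "act r s (P' t) (Q' t) (T d (cinv c (l t))) is js = act r s (P' t) (Q' t) (act r s (J t) (K t) (T c (cinv c (l t)))) is js"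
      unfolding J_def K_def by (rule act_cong) (rule Td[OF elim])
    also have "\<dots> = act r s (P' t ** J t) (K t ** Q' t) (T c (cinv c (l t))) is js" by (rule act_act)
    also have "P' t ** J t = J0 ** P t"
      unfolding P'_def matrix_mul_assoc[symmetric] by (simp add: KJ[OF elim])
    also have "K t ** Q' t = Q t ** K0"
      unfolding Q'_def matrix_mul_assoc by (simp add: KJ[OF elim])
    finally show ?case by (simp add: act_act)
  qed
  ultimately have "((\<lambda>t. act r s (P' t) (Q' t) (T d (cinv c (l t))) is js) has_real_derivative
      act r s J0 K0 (nabla A D Z T c x) is js) (at 0)"
    using DERIV_cong_ev[OF refl, where f="\<lambda>t. act r s (P' t) (Q' t) (T d (cinv c (l t))) is js"
      and g="\<lambda>t. act r s J0 K0 (act r s (P t) (Q t) (T c (cinv c (l t)))) is js" and x=0] by simp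
  from DERIV_unique[OF hd this] show ?thesis by (simp only: J0_def K0_def)
qed

lemma nabla_continuous_on:
  assumes Z: "Z \<in> vector_fields A" and c: "c \<in> A" and U: "open U" "U \<subseteq> cimg c"
    and T: "\<And>is js. length is = r \<Longrightarrow> length js = s \<Longrightarrow> Ck_on (Suc 0) U (\<lambda>u. T c (cinv c u) is js)"
    and len: "length is = r" "length js = s"
  shows "continuous_on U (\<lambda>u. nabla A D Z T c (cinv c u) is js)"
proof -
  have eq: "nabla A D Z T c (cinv c u) is js =
    (\<Sum>i\<in>UNIV. Z c (cinv c u) [i] [] * frechet_derivative (\<lambda>u. T c (cinv c u) is js) (at u) (axis i 1))
    + (\<Sum>a<r. \<Sum>m\<in>UNIV. conn Z c (cinv c u) $ (is ! a) $ m * T c (cinv c u) (is[a := m]) js)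
    - (\<Sum>b<s. \<Sum>m\<in>UNIV. conn Z c (cinv c u) $ m $ (js ! b) * T c (cinv c u) is (js[b := m]))"
    if u: "u \<in> U" for u
  proof -
    have x: "cinv c u \<in> cdom c" "cmap c (cinv c u) = u" using cinv_in[OF c, of u] cmap_cinv[OF c, of u] u U(2) by blast+
    have der: "((\<lambda>u. T c (cinv c u) is js) has_derivative frechet_derivative (\<lambda>u. T c (cinv c u) is js) (at u)) (at u)"
      by (rule Ck_on_SucD[OF T[OF len] U(1) u])
    show ?thesis
      using nabla_expand[where T=T and Z=Z, OF c x(1) len, unfolded x, OF der]
        linear_vec_expand[OF has_derivative_linear[OF der], of "vcomp Z c (cinv c u)"]
      by (simp add: vcomp_def)
  qed
  have "continuous_on U (\<lambda>u.
    (\<Sum>i\<in>UNIV. Z c (cinv c u) [i] [] * frechet_derivative (\<lambda>u. T c (cinv c u) is js) (at u) (axis i 1))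
    + (\<Sum>a<r. \<Sum>m\<in>UNIV. conn Z c (cinv c u) $ (is ! a) $ m * T c (cinv c u) (is[a := m]) js)
    - (\<Sum>b<s. \<Sum>m\<in>UNIV. conn Z c (cinv c u) $ m $ (js ! b) * T c (cinv c u) is (js[b := m])))"
  proof (intro continuous_on_add continuous_on_diff continuous_on_sum continuous_on_mult)
    show "continuous_on U (\<lambda>u. Z c (cinv c u) [i] [])" for i
      by (rule continuous_on_subset[OF Ck_on_continuous[OF vector_fieldsD(2)[OF Z c]] U(2)])
    show "continuous_on U (\<lambda>u. frechet_derivative (\<lambda>u. T c (cinv c u) is js) (at u) (axis i 1))" for i
      using T[OF len] by (simp add: axis_in_Basis_iff)
    show "continuous_on U (\<lambda>u. conn Z c (cinv c u) $ i $ j)" for i j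
      by (rule continuous_on_subset[OF Ck_on_continuous[OF Ck_on_conn[OF Z c]] U(2)])
    then show "continuous_on U (\<lambda>u. conn Z c (cinv c u) $ i $ j)" for i j .
    show "continuous_on U (\<lambda>u. T c (cinv c u) (is[a := m]) js)" for a m
      by (rule Ck_on_continuous[OF T]) (simp_all add: len)
    show "continuous_on U (\<lambda>u. T c (cinv c u) is (js[b := m]))" for b m
      by (rule Ck_on_continuous[OF T]) (simp_all add: len)
  qed
  then show ?thesis
    by (rule continuous_on_cong[THEN iffD1, OF refl, rotated]) (simp add: eq)
qed

lemma nabla_continuous_tensor:
  assumes Z: "Z \<in> vector_fields A" and S: "S \<in> Ck_tensor_fields A 1 r s"
  shows "continuous_tensor r s (nabla A D Z S)"
proof -
  have f: "is_field A 0 r s S" and Ck: "\<And>c is js. c \<in> A \<Longrightarrow> Ck_on (Suc 0) (cimg c) (\<lambda>u. S c (cinv c u) is js)"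
    using S unfolding Ck_fields_def by auto
  note der = Ck_on_SucD[OF Ck open_cimg cmap_in]
  show ?thesis unfolding continuous_tensor_def
  proof (intro ballI allI impI conjI)
    fix c and "is" js :: "'n list" and d x
    assume c: "c \<in> A" and len: "length is = r" "length js = s" and d: "d \<in> A" "x \<in> cdom c \<inter> cdom d"
    show "nabla A D Z S d x is js = act r s (jac c d x) (jac d c x) (nabla A D Z S c x) is js"
      by (rule nabla_transform[OF Z f c d(1) _ _ _ len]) (use d differentiableI[OF der[OF c c]] in auto)
  next
    fix c and "is" js :: "'n list" assume c: "c \<in> A" and len: "length is = r" "length js = s"
    show "continuous_on (cimg c) (\<lambda>u. nabla A D Z S c (cinv c u) is js)"
      by (rule nabla_continuous_on[where T=S, OF Z c open_cimg[OF c] order.refl Ck[OF c] len])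
  qed
qed

end

section \<open>Riemannian balls in charts\<close>

context manifold begin

lemma metric_chart_change:
  assumes h: "is_field A 0 0 2 h" and cd: "c \<in> A" "d \<in> A" "x \<in> cdom c" "x \<in> cdom d"
  shows "(\<Sum>i\<in>UNIV. \<Sum>j\<in>UNIV. h d x [] [i, j] * (jac c d x *v v) $ i * (jac c d x *v v) $ j)
    = (\<Sum>i\<in>UNIV. \<Sum>j\<in>UNIV. h c x [] [i, j] * v $ i * v $ j)"
proof -
  have quad: "(\<Sum>i\<in>UNIV. \<Sum>j\<in>UNIV. t [i, j] * w $ i * w $ j) = (\<Sum>js\<in>{js. length js = 2}. t js * (\<Prod>b<2. w $ (js ! b)))"
    for t and w :: "real^'n"
    by (simp add: numeral_2_eq_2 sum_lists_Suc mult.assoc)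
  let ?w = "jac c d x *v v" and ?K = "jac d c x"
  have Kw: "?K *v ?w = v" using jac_inverse[OF cd] by (simp add: matrix_vector_mul_assoc)
  have "(\<Sum>js\<in>{js. length js = 2}. h d x [] js * (\<Prod>b<2. ?w $ (js ! b)))
      = (\<Sum>js\<in>{js. length js = 2}. vact 2 (transpose ?K) (h c x []) js * (\<Prod>b<2. ?w $ (js ! b)))"
  proof (rule sum.cong[OF refl])
    fix js :: "'n list" assume "js \<in> {js. length js = 2}"
    then have "h d x [] js = act 0 2 (jac c d x) ?K (h c x) [] js"
      using is_field_act[OF h cd, of "[]" js] by simp
    then show "h d x [] js * (\<Prod>b<2. ?w $ (js ! b)) = vact 2 (transpose ?K) (h c x []) js * (\<Prod>b<2. ?w $ (js ! b))"
      by (simp add: act_def vact_def[of 0])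
  qed
  also have "\<dots> = (\<Sum>ls\<in>{ls. length ls = 2}. h c x [] ls * vact 2 ?K (\<lambda>js. \<Prod>b<2. ?w $ (js ! b)) ls)"
    by (simp only: vact_pair transpose_transpose)
  also have "\<dots> = (\<Sum>ls\<in>{ls. length ls = 2}. h c x [] ls * (\<Prod>b<2. v $ (ls ! b)))"
  proof (rule sum.cong[OF refl])
    fix ls :: "'n list"
    have "vact 2 ?K (\<lambda>js. \<Prod>b<2. ?w $ (js ! b)) ls = (\<Sum>js\<in>{js. length js = 2}. \<Prod>b<2. ?K $ (ls ! b) $ (js ! b) * ?w $ (js ! b))"
      by (simp only: vact_def prod.distrib)
    also have "\<dots> = (\<Prod>b<2. \<Sum>k\<in>UNIV. ?K $ (ls ! b) $ k * ?w $ k)"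
      by (rule sum_lists_prod)
    also have "\<dots> = (\<Prod>b<2. (?K *v ?w) $ (ls ! b))"
      by (simp only: matrix_vector_mult_def vec_lambda_beta)
    finally show "h c x [] ls * vact 2 ?K (\<lambda>js. \<Prod>b<2. ?w $ (js ! b)) ls = h c x [] ls * (\<Prod>b<2. v $ (ls ! b))"
      by (simp only: Kw)
  qed
  finally show ?thesis by (simp only: quad)
qed

lemma speed_in_chart:
  assumes h: "is_field A 0 0 2 h" and c: "c \<in> A"
    and \<gamma>: "continuous_on {a..b} \<gamma>" "a < t" "t < b" "\<gamma> ` {a..b} \<subseteq> cdom c"
    and v: "((\<lambda>s. cmap c (\<gamma> s)) has_vector_derivative v) (at t)"
  shows "speed A h \<gamma> t = sqrt (\<Sum>i\<in>UNIV. \<Sum>j\<in>UNIV. h c (\<gamma> t) [] [i, j] * v $ i * v $ j)"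
proof -
  define d where "d = chart_at A (\<gamma> t)"
  have d: "d \<in> A" "\<gamma> t \<in> cdom d" using chart_at by (auto simp: d_def)
  have ct: "\<gamma> t \<in> cdom c" using \<gamma> by auto
  let ?J = "jac c d (\<gamma> t)"
  have "((\<lambda>s. cmap d (cinv c (cmap c (\<gamma> s)))) has_derivative (\<lambda>s. ?J *v (s *\<^sub>R v))) (at t)"
    using diff_chain_at[OF v[unfolded has_vector_derivative_def] jac_has_derivative[OF c d(1) ct d(2)]]
    by (simp add: o_def)
  then have "((\<lambda>s. cmap d (cinv c (cmap c (\<gamma> s)))) has_vector_derivative ?J *v v) (at t)"
    by (simp add: has_vector_derivative_def matrix_vector_mult_scaleR)
  moreover define N where "N = {a<..<b} \<inter> \<gamma> -` cdom d"
  have "open N" unfolding N_def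
    by (rule continuous_open_preimage[OF continuous_on_subset[OF \<gamma>(1)]]) (use open_cdom[OF d(1)] in auto)
  ultimately have "((\<lambda>s. cmap d (\<gamma> s)) has_vector_derivative ?J *v v) (at t)"
  proof (rule has_vector_derivative_transform_within_open)
    show "t \<in> N" using \<gamma> d by (auto simp: N_def)
    fix s assume "s \<in> N"
    then have "\<gamma> s \<in> cdom c" using \<gamma>(4) by (auto simp: N_def)
    then show "cmap d (cinv c (cmap c (\<gamma> s))) = cmap d (\<gamma> s)" by (simp add: cinv_cmap[OF c])
  qed
  then have "vector_derivative (cmap d \<circ> \<gamma>) (at t) = ?J *v v"
    by (simp add: o_def vector_derivative_at)
  then show ?thesis
    unfolding speed_def Let_def d_def[symmetric] using metric_chart_change[OF h c d(1) ct d(2), of v] by simp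
qed

text \<open>
  The quadratic form of the metric attains a positive minimum on the compact product of \<open>L\<close> and the unit
  sphere.
\<close>

lemma metric_lower_bound:
  assumes h: "riemannian_metric A h" and c: "c \<in> A" and L: "compact L" "L \<subseteq> cimg c"
  shows "\<exists>\<kappa>>0. \<forall>u\<in>L. \<forall>v. \<kappa> * norm v \<le> sqrt (\<Sum>i\<in>UNIV. \<Sum>j\<in>UNIV. h c (cinv c u) [] [i, j] * v $ i * v $ j)"
proof (cases "L = {}")
  case True then show ?thesis by (intro exI[of _ 1]) auto
next
  case False
  define q where "q p = (\<Sum>i\<in>UNIV. \<Sum>j\<in>UNIV. h c (cinv c (fst p)) [] [i, j] * snd p $ i * snd p $ j)" for p :: "(real^'n) \<times> (real^'n)"
  have hc: "continuous_on L (\<lambda>u. h c (cinv c u) [] js)" for js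
  proof -
    have "h \<in> Ck_fields A 0 0 0 2" using h unfolding riemannian_metric_def tensor_fields_def by blast
    then have "Ck_on 0 (cimg c) (\<lambda>u. h c (cinv c u) [] js)" using c unfolding Ck_fields_def by blast
    then show ?thesis using L(2) continuous_on_subset by (simp, blast)
  qed
  have cq: "continuous_on (L \<times> sphere 0 1) q" unfolding q_def
    by (intro continuous_intros continuous_on_compose2[OF hc continuous_on_fst[OF continuous_on_id]]) auto
  have "compact (L \<times> (sphere 0 1 :: (real^'n) set))" using L by (intro compact_Times compact_sphere)
  moreover have "L \<times> (sphere 0 1 :: (real^'n) set) \<noteq> {}" using False by (simp add: Times_empty)
  ultimately obtain p where p: "p \<in> L \<times> sphere 0 1" "\<And>p'. p' \<in> L \<times> sphere 0 1 \<Longrightarrow> q p \<le> q p'"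
    using continuous_attains_inf[OF _ _ cq] by blast
  have "q p > 0"
  proof -
    have "cinv c (fst p) \<in> cdom c" using p(1) L(2) cinv_in[OF c, of "fst p"] by auto
    moreover have "snd p \<noteq> 0" using p(1) by auto
    ultimately show ?thesis using h c unfolding riemannian_metric_def q_def by blast
  qed
  show ?thesis
  proof (intro exI[of _ "sqrt (q p)"] conjI ballI allI)
    show "sqrt (q p) > 0" using \<open>q p > 0\<close> by simp
    fix u v assume u: "u \<in> L"
    show "sqrt (q p) * norm v \<le> sqrt (\<Sum>i\<in>UNIV. \<Sum>j\<in>UNIV. h c (cinv c u) [] [i, j] * v $ i * v $ j)"
    proof (cases "v = 0")
      case False
      let ?e = "v /\<^sub>R norm v"
      have "q p \<le> q (u, ?e)" by (rule p(2)) (use u False in auto)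
      moreover have "q (u, v) = (norm v)\<^sup>2 * q (u, ?e)"
        using False by (simp add: q_def sum_distrib_left power2_eq_square field_simps)
      ultimately have "(norm v)\<^sup>2 * q p \<le> q (u, v)" by (simp add: mult_left_mono)
      then have "sqrt ((norm v)\<^sup>2 * q p) \<le> sqrt (q (u, v))" by (rule real_sqrt_le_mono)
      then show ?thesis by (simp add: q_def real_sqrt_mult mult.commute)
    qed simp
  qed
qed

text \<open>
  The speed is at least \<open>\<kappa>\<close> times the coordinate speed, which is at least the component of the coordinate
  velocity in the direction \<open>e\<close> of the segment between the end points; that component integrates to the
  coordinate distance.
\<close>

lemma length_lower_bound:
  assumes h: "riemannian_metric A h" and c: "c \<in> A" and L: "L \<subseteq> cimg c"
    and \<kappa>: "\<kappa> > 0" "\<And>u v. u \<in> L \<Longrightarrow> \<kappa> * norm v \<le> sqrt (\<Sum>i\<in>UNIV. \<Sum>j\<in>UNIV. h c (cinv c u) [] [i, j] * v $ i * v $ j)"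
    and \<gamma>: "piecewise_C1_curve A \<gamma>" and b: "0 < b" "b \<le> 1" and im: "\<gamma> ` {0..b} \<subseteq> cinv c ` L"
  shows "ennreal (\<kappa> * dist (cmap c (\<gamma> 0)) (cmap c (\<gamma> b))) \<le> (\<integral>\<^sup>+ t\<in>{0..1}. ennreal (speed A h \<gamma> t) \<partial>lborel)"
proof -
  define \<alpha> where "\<alpha> t = cmap c (\<gamma> t)" for t
  have "cinv c ` L \<subseteq> cdom c" by (rule image_subsetI, rule cinv_in[OF c]) (use L in blast)
  with im have imc: "\<gamma> ` {0..b} \<subseteq> cdom c" by (rule order.trans)
  have \<gamma>c: "continuous_on {0..b} \<gamma>"
    using \<gamma> b unfolding piecewise_C1_curve_def path_def by (auto intro: continuous_on_subset)
  have field: "is_field A 0 0 2 h" using h unfolding riemannian_metric_def tensor_fields_def Ck_fields_def by blast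
  have "(cmap c \<circ> \<gamma>) piecewise_C1_differentiable_on {0..b}"
    using \<gamma>[unfolded piecewise_C1_curve_def, THEN conjunct2, rule_format, OF c, of 0 b] b imc by simp
  then have \<alpha>c: "continuous_on {0..b} \<alpha>" and "\<exists>F. finite F \<and> (cmap c \<circ> \<gamma>) C1_differentiable_on ({0..b} - F)"
    unfolding piecewise_C1_differentiable_on_def by (auto simp: \<alpha>_def[abs_def] o_def)
  then obtain F V where F: "finite F" "continuous_on ({0..b} - F) V"
    "\<And>t. t \<in> {0..b} - F \<Longrightarrow> (\<alpha> has_vector_derivative V t) (at t)"
    unfolding C1_differentiable_on_def by (auto simp: \<alpha>_def[abs_def] o_def)
  define w where "w = \<alpha> b - \<alpha> 0"
  define e where "e = w /\<^sub>R norm w"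
  have e: "norm e \<le> 1" by (cases "w = 0") (simp_all add: e_def)
  have we: "w \<bullet> e = norm w"
    by (cases "w = 0") (simp_all add: e_def power2_norm_eq_inner[symmetric] power2_eq_square)
  define G where "G t = indicator ({0..b} - F) t *\<^sub>R (V t \<bullet> e)" for t
  have B: "{0..b} - F \<in> sets borel"
    by (rule sets.Diff[OF _ borel_closed[OF finite_imp_closed[OF F(1)]]]) simp
  have Gm: "G \<in> borel_measurable borel" unfolding G_def
    by (rule borel_measurable_continuous_on_indicator[OF B]) (intro continuous_intros F)
  have "((\<lambda>t. V t \<bullet> e) has_integral \<alpha> b \<bullet> e - \<alpha> 0 \<bullet> e) {0..b}"
  proof (rule fundamental_theorem_of_calculus_interior_strong[OF F(1)])
    show "0 \<le> b" using b by simp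
    show "((\<lambda>t. \<alpha> t \<bullet> e) has_vector_derivative V t \<bullet> e) (at t)" if "t \<in> {0<..<b} - F" for t
      by (rule bounded_linear.has_vector_derivative[OF bounded_linear_inner_left F(3)]) (use that in auto)
    show "continuous_on {0..b} (\<lambda>t. \<alpha> t \<bullet> e)" by (intro continuous_intros \<alpha>c)
  qed
  then have "((\<lambda>t. V t \<bullet> e) has_integral norm w) {0..b}"
    using we by (simp add: w_def inner_diff_left)
  then have "((\<lambda>t. if t \<in> {0..b} then G t else 0) has_integral norm w) UNIV"
    unfolding has_integral_restrict_UNIV
    by (rule has_integral_spike_finite[OF F(1), rotated]) (auto simp: G_def)
  moreover have "(\<lambda>t. if t \<in> {0..b} then G t else 0) = G" by (rule ext) (auto simp: G_def indicator_def)
  ultimately have Gint: "(G has_integral norm w) UNIV" by simp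
  have low: "ennreal (norm w) \<le> (\<integral>\<^sup>+ t. ennreal (norm (G t)) \<partial>lborel)"
  proof (cases "(\<integral>\<^sup>+ t. ennreal (norm (G t)) \<partial>lborel) < \<infinity>")
    case True
    then have int: "integrable lborel G" using Gm by (simp add: integrable_iff_bounded)
    have "integral\<^sup>L lborel G = norm w"
      using has_integral_unique[OF has_integral_integral_lborel[OF int] Gint] .
    then show ?thesis using integral_norm_bound_ennreal[OF int] by simp
  next
    case False
    then show ?thesis by (simp add: not_less top_unique)
  qed
  have "ennreal (\<kappa> * norm w) = ennreal \<kappa> * ennreal (norm w)" using \<kappa>(1) by (simp add: ennreal_mult)
  also have "\<dots> \<le> ennreal \<kappa> * (\<integral>\<^sup>+ t. ennreal (norm (G t)) \<partial>lborel)" by (rule mult_left_mono[OF low]) simp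
  also have "\<dots> = (\<integral>\<^sup>+ t. ennreal (\<kappa> * norm (G t)) \<partial>lborel)"
    using Gm \<kappa>(1) by (subst nn_integral_cmult[symmetric]) (auto simp: ennreal_mult)
  also have "\<dots> \<le> (\<integral>\<^sup>+ t\<in>{0..1}. ennreal (speed A h \<gamma> t) \<partial>lborel)"
  proof (rule nn_integral_mono_AE)
    have "F \<union> {0, b} \<in> null_sets lborel" by (rule finite_imp_null_set_lborel) (use F in simp)
    then have "AE t in lborel. t \<notin> F \<union> {0, b}" by (rule AE_not_in)
    then show "AE t in lborel. ennreal (\<kappa> * norm (G t)) \<le> ennreal (speed A h \<gamma> t) * indicator {0..1} t"
    proof eventually_elim
      case (elim t)
      show ?case
      proof (cases "t \<in> {0..b}")
        case False
        then have "G t = 0" by (auto simp: G_def indicator_def)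
        then show ?thesis by simp
      next
        case True
        then have t: "0 < t" "t < b" "t \<in> {0..b} - F" using elim by auto
        have "\<gamma> t \<in> cinv c ` L" using im True by blast
        then obtain u where u: "u \<in> L" "\<gamma> t = cinv c u" by blast
        have sp: "speed A h \<gamma> t = sqrt (\<Sum>i\<in>UNIV. \<Sum>j\<in>UNIV. h c (\<gamma> t) [] [i, j] * V t $ i * V t $ j)"
          by (rule speed_in_chart[OF field c \<gamma>c t(1,2) imc]) (use F(3)[OF t(3)] in \<open>simp add: \<alpha>_def[abs_def]\<close>)
        have "norm (G t) \<le> norm (V t)"
          using Cauchy_Schwarz_ineq2[of "V t" e] e t(3) mult_left_mono[OF e, of "norm (V t)"] by (simp add: G_def)
        then have "\<kappa> * norm (G t) \<le> \<kappa> * norm (V t)" using \<kappa>(1) by simp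
        also have "\<dots> \<le> speed A h \<gamma> t" unfolding sp u(2) by (rule \<kappa>(2)[OF u(1)])
        finally show ?thesis using t b by (simp add: ennreal_leI)
      qed
    qed
  qed
  finally show ?thesis by (simp add: w_def \<alpha>_def dist_norm norm_minus_commute)
qed

text \<open>
  A curve from \<open>x\<close> that leaves the coordinate ball of radius \<open>\<delta>\<close> stays in the closed ball until it first
  reaches the boundary, and that part alone has length at least \<open>\<kappa> \<delta>\<close>.  This applies also to end points
  outside of the chart.
\<close>

lemma riem_ball_subset_chart_ball:
  assumes h: "riemannian_metric A h" and c: "c \<in> A" and L: "compact L" "L \<subseteq> cimg c" and "\<delta> > 0"
  shows "\<exists>\<rho>>0. \<forall>x\<in>cdom c. cball (cmap c x) \<delta> \<subseteq> L \<longrightarrow> riem_ball A h \<rho> x \<subseteq> cinv c ` ball (cmap c x) \<delta>"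
proof -
  obtain \<kappa> where \<kappa>: "\<kappa> > 0" "\<And>u v. u \<in> L \<Longrightarrow> \<kappa> * norm v \<le> sqrt (\<Sum>i\<in>UNIV. \<Sum>j\<in>UNIV. h c (cinv c u) [] [i, j] * v $ i * v $ j)"
    using metric_lower_bound[OF h c L] by blast
  have "riem_ball A h (\<kappa> * \<delta>) x \<subseteq> cinv c ` ball (cmap c x) \<delta>" if x: "x \<in> cdom c" "cball (cmap c x) \<delta> \<subseteq> L" for x
  proof (rule ccontr)
    define u where "u = cmap c x"
    define V where "V = cinv c ` ball u \<delta>"
    define C where "C = cinv c ` cball u \<delta>"
    have sub1: "cball u \<delta> \<subseteq> L" using x(2) by (simp add: u_def)
    have sub2: "cball u \<delta> \<subseteq> cimg c" using sub1 L(2) by (rule order.trans)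
    have sub3: "ball u \<delta> \<subseteq> cimg c" using ball_subset_cball sub2 by (rule order.trans)
    note sub = sub1 sub2 sub3
    have V: "open V" unfolding V_def by (rule open_cinv_image[OF c open_ball sub(3)])
    have C: "closed C" unfolding C_def
      by (intro compact_imp_closed compact_cinv_image c compact_cball sub)
    have VC: "V \<subseteq> C" unfolding V_def C_def using ball_subset_cball by blast
    assume "\<not> riem_ball A h (\<kappa> * \<delta>) x \<subseteq> cinv c ` ball (cmap c x) \<delta>"
    then obtain y where y: "y \<notin> V" "riem_dist A h x y < ennreal (\<kappa> * \<delta>)"
      unfolding riem_ball_def V_def u_def by blast
    then obtain \<gamma> where \<gamma>: "piecewise_C1_curve A \<gamma>" "pathstart \<gamma> = x" "pathfinish \<gamma> = y"
      "(\<integral>\<^sup>+ t\<in>{0..1}. ennreal (speed A h \<gamma> t) \<partial>lborel) < ennreal (\<kappa> * \<delta>)"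
      unfolding riem_dist_def INF_less_iff by blast
    have \<gamma>c: "continuous_on {0..1} \<gamma>" using \<gamma>(1) unfolding piecewise_C1_curve_def path_def by simp
    \<comment> \<open>the times at which the curve is outside of the ball, and the first of them\<close>
    define T where "T = {0..1} \<inter> \<gamma> -` (- V)"
    have T: "closed T" unfolding T_def by (rule continuous_closed_preimage[OF \<gamma>c]) (use V in auto)
    have "1 \<in> T" using \<gamma>(3) y(1) by (simp add: T_def pathfinish_def)
    define b where "b = Inf T"
    have bdd: "bdd_below T" by (rule bdd_belowI[of _ 0]) (simp add: T_def)
    have bT: "b \<in> T" unfolding b_def by (rule closed_contains_Inf[OF _ bdd T]) (use \<open>1 \<in> T\<close> in blast)
    have before: "\<gamma> t \<in> V" if "0 \<le> t" "t < b" for t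
    proof (rule ccontr)
      assume "\<gamma> t \<notin> V"
      then have "t \<in> T" using that bT by (auto simp: T_def)
      then show False using cInf_lower[OF _ bdd] that(2) unfolding b_def by fastforce
    qed
    have "x \<in> V" unfolding V_def by (rule image_eqI[where x=u]) (simp_all add: u_def cinv_cmap[OF c x(1)] \<open>\<delta> > 0\<close>)
    then have "b \<noteq> 0" using bT \<gamma>(2) by (auto simp: T_def pathstart_def)
    then have b: "0 < b" "b \<le> 1" using bT by (auto simp: T_def)
    have "\<gamma> ` closure {0..<b} \<subseteq> C"
      by (rule image_closure_subset[OF continuous_on_subset[OF \<gamma>c] C]) (use before VC b in auto)
    then have im: "\<gamma> ` {0..b} \<subseteq> C" using b by simp
    have \<kappa>': "\<kappa> * norm v \<le> sqrt (\<Sum>i\<in>UNIV. \<Sum>j\<in>UNIV. h c (cinv c w) [] [i, j] * v $ i * v $ j)"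
      if "w \<in> cball u \<delta>" for w v
      by (rule \<kappa>(2)) (rule subsetD[OF sub1 that])
    have "ennreal (\<kappa> * dist (cmap c (\<gamma> 0)) (cmap c (\<gamma> b))) \<le> (\<integral>\<^sup>+ t\<in>{0..1}. ennreal (speed A h \<gamma> t) \<partial>lborel)"
      by (rule length_lower_bound[OF h c sub2 \<kappa>(1) \<kappa>' \<gamma>(1) b im[unfolded C_def]])
    also note \<gamma>(4)
    finally have "\<kappa> * dist (cmap c (\<gamma> 0)) (cmap c (\<gamma> b)) < \<kappa> * \<delta>"
      using \<kappa>(1) \<open>\<delta> > 0\<close> by (simp add: ennreal_less_iff)
    then have "dist u (cmap c (\<gamma> b)) < \<delta>" using \<kappa>(1) \<gamma>(2) by (simp add: u_def pathstart_def)
    moreover have "C \<subseteq> cdom c" unfolding C_def by (rule image_subsetI, rule cinv_in[OF c]) (use sub2 in blast)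
    then have "\<gamma> b \<in> cdom c" using im b by (meson atLeastAtMost_iff image_subset_iff less_imp_le order.refl subsetD)
    ultimately have "\<gamma> b \<in> V" unfolding V_def
      by (intro image_eqI[where x="cmap c (\<gamma> b)"]) (simp_all add: cinv_cmap[OF c])
    then show False using bT by (simp add: T_def)
  qed
  then show ?thesis using \<kappa>(1) \<open>\<delta> > 0\<close> by (intro exI[of _ "\<kappa> * \<delta>"]) auto
qed

end

section \<open>The embedding\<close>

context manifold begin

definition umat :: "('m, 'n) transport \<Rightarrow> ('m, 'n) chart \<Rightarrow> ('m, 'n) chart \<Rightarrow> 'm \<Rightarrow> 'm \<Rightarrow> real^'n^'n"
  where "umat \<Upsilon> c d x y = (\<chi> a b. \<Upsilon> c d x y a b)"

lemma umat_transform: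
  assumes "\<Upsilon> \<in> TO A" "c \<in> A" "c' \<in> A" "d \<in> A" "d' \<in> A" "x \<in> cdom c" "x \<in> cdom c'" "y \<in> cdom d" "y \<in> cdom d'"
  shows "umat \<Upsilon> c' d' x y = jac c c' x ** umat \<Upsilon> c d x y ** jac d' d y"
proof -
  have "\<Upsilon> c' d' x y a b = (\<Sum>k\<in>UNIV. \<Sum>l\<in>UNIV. jac c c' x $ a $ k * \<Upsilon> c d x y k l * jac d' d y $ l $ b)" for a b
    using assms unfolding TO_def by blast
  moreover have "(jac c c' x ** umat \<Upsilon> c d x y ** jac d' d y) $ a $ b
     = (\<Sum>k\<in>UNIV. \<Sum>l\<in>UNIV. jac c c' x $ a $ k * \<Upsilon> c d x y k l * jac d' d y $ l $ b)" for a b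
    unfolding matrix_matrix_mult_def umat_def
    by (simp add: sum_distrib_right) (rule sum.swap)
  ultimately show ?thesis by (simp add: vec_eq_iff umat_def)
qed

lemma test_densitiesD:
  assumes "\<mu> \<in> test_densities A r s"
  shows "is_field A 1 r s \<mu>" "c \<in> A \<Longrightarrow> Ck_on k (cimg c) (\<lambda>u. \<mu> c (cinv c u) is js)" "compact (field_support \<mu>)"
  using assms unfolding test_densities_def Ck_fields_def by auto

lemma field_support_subset: "\<mu> c x is js \<noteq> 0 \<Longrightarrow> x \<in> field_support \<mu>"
  unfolding field_support_def by (rule subsetD[OF closure_subset]) blast

lemma test_density_scalar:
  assumes "\<mu> \<in> test_densities A 0 0"
  shows "scalar_density (field_support \<mu>) \<mu>"
  unfolding scalar_density_def
proof (intro conjI allI impI ballI)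
  note f = test_densitiesD(1)[OF assms]
  fix d x assume nz: "\<mu> d x [] [] \<noteq> 0"
  show "d \<in> A" "x \<in> cdom d" using is_field_zero[OF f, of d x "[]" "[]"] nz by auto
  show "x \<in> field_support \<mu>" by (rule field_support_subset[of \<mu> d x "[]" "[]", OF nz])
next
  note f = test_densitiesD(1)[OF assms]
  fix c d x assume "c \<in> A" "d \<in> A" "x \<in> cdom c \<inter> cdom d"
  then show "\<mu> d x [] [] = \<bar>det (jac d c x)\<bar> * \<mu> c x [] []"
    using is_field_act[OF f, of c d x "[]" "[]"] by simp
next
  fix c assume "c \<in> A"
  from test_densitiesD(2)[OF assms this, of 0]
  show "continuous_on (cimg c) (coord \<mu> c)" by (simp add: coord_def[abs_def])
qed

lemma contraction_pairing: "contraction r s T \<Psi> c x [] [] = pairing r s (T c x) (\<Psi> c x)"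
  by (simp add: contraction_def pairing_def)

definition axes :: "'n list \<Rightarrow> (real^'n) list"
  where "axes is = map (\<lambda>i. axis i 1) is"

text \<open>
  The integrand of the embedding: the value of \<open>T\<close> at \<open>y\<close> is carried to \<open>x\<close> by the transport operators and
  weighted with the kernel at \<open>x\<close>.
\<close>

lemma contraction_Psi:
  assumes \<omega>: "\<omega> x \<in> test_densities A 0 0" and len: "length is = r" "length js = s"
  shows "contraction r s T (Psi A \<Upsilon> \<omega> c x (axes is) (axes js)) d y [] [] =
    act r s (umat \<Upsilon> c d x y) (umat \<Upsilon> d c y x) (T d y) is js * \<omega> x d y [] []"
proof (cases "d \<in> A \<and> y \<in> cdom d")
  case False
  then have z: "\<omega> x d y [] [] = 0" using is_field_zero[OF test_densitiesD(1)[OF \<omega>], of d y "[]" "[]"] by auto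
  have "Psi A \<Upsilon> \<omega> c x (axes is) (axes js) d y ls ks = 0" for ls ks
    unfolding Psi_def using False by auto
  then show ?thesis by (simp add: z contraction_pairing pairing_def)
next
  case True
  have co: "transport_covec \<Upsilon> c d x y (axis i 1) $ k = umat \<Upsilon> c d x y $ i $ k" for i k
    by (simp add: transport_covec_def umat_def axis_def if_distrib[where f="\<lambda>x. _ * x"] cong: if_cong)
  have ve: "transport_vec \<Upsilon> c d x y (axis j 1) $ l = umat \<Upsilon> d c y x $ l $ j" for j l
    by (simp add: transport_vec_def umat_def axis_def if_distrib[where f="\<lambda>x. _ * x"] cong: if_cong)
  have P: "Psi A \<Upsilon> \<omega> c x (axes is) (axes js) d y ls ks =
      (\<Prod>a<r. umat \<Upsilon> c d x y $ (is ! a) $ (ks ! a)) * (\<Prod>b<s. umat \<Upsilon> d c y x $ (ls ! b) $ (js ! b)) * \<omega> x d y [] []"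
    if "length ks = r" "length ls = s" for ks ls
    using True that len by (simp add: Psi_def axes_def co ve)
  show ?thesis
    unfolding contraction_pairing pairing_def act_expand sum_distrib_right
    by (intro sum.cong refl) (simp add: P mult_ac)
qed

lemma Ck_on_transport:
  assumes \<Upsilon>: "\<Upsilon> \<in> TO A" and cd: "c \<in> A" "d \<in> A"
  shows "Ck_on k (cimg c \<times> cimg d) (\<lambda>p. umat \<Upsilon> c d (cinv c (fst p)) (cinv d (snd p)) $ a $ b)"
proof -
  have "smooth_on (cimg c \<times> cimg d) (\<lambda>(u, v). \<Upsilon> c d (cinv c u) (cinv d v) a b)"
    using \<Upsilon> cd unfolding TO_def by blast
  then show ?thesis unfolding smooth_on_def umat_def by (simp add: case_prod_unfold)
qed

text \<open>
  The transport matrices take values in the tensors at \<open>x\<close>; as functions of \<open>y\<close> they transform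
  contragrediently to \<open>T\<close>, and only the factor \<open>\<omega> x\<close> transforms, as a density.
\<close>

lemma embedding_density:
  assumes T: "continuous_tensor r s T" and \<Upsilon>: "\<Upsilon> \<in> TO A" and \<omega>: "\<omega> x \<in> test_densities A 0 0"
    and c: "c \<in> A" "x \<in> cdom c" and len: "length is = r" "length js = s"
  shows "scalar_density (field_support (\<omega> x)) (contraction r s T (Psi A \<Upsilon> \<omega> c x (axes is) (axes js)))"
  unfolding scalar_density_def contraction_Psi[where \<omega>=\<omega> and x=x, OF \<omega> len]
proof (intro conjI allI impI ballI)
  note sd = test_density_scalar[OF \<omega>]
  fix d y assume "act r s (umat \<Upsilon> c d x y) (umat \<Upsilon> d c y x) (T d y) is js * \<omega> x d y [] [] \<noteq> 0"
  then have "\<omega> x d y [] [] \<noteq> 0" by auto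
  then show "d \<in> A" "y \<in> cdom d" "y \<in> field_support (\<omega> x)" using scalar_densityD(1)[OF sd] by blast+
next
  note sd = test_density_scalar[OF \<omega>]
  fix d e y assume d: "d \<in> A" and e: "e \<in> A" and "y \<in> cdom d \<inter> cdom e"
  then have y: "y \<in> cdom d" "y \<in> cdom e" by auto
  let ?J = "jac d e y" and ?K = "jac e d y"
  have "act r s (umat \<Upsilon> c e x y) (umat \<Upsilon> e c y x) (T e y) is js
      = act r s (umat \<Upsilon> c e x y) (umat \<Upsilon> e c y x) (act r s ?J ?K (T d y)) is js"
    by (rule act_cong) (rule continuous_tensorD(1)[OF T d _ _ e y])
  also have "\<dots> = act r s (umat \<Upsilon> c e x y ** ?J) (?K ** umat \<Upsilon> e c y x) (T d y) is js" by (rule act_act)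
  also have "umat \<Upsilon> c e x y ** ?J = umat \<Upsilon> c d x y"
    using umat_transform[OF \<Upsilon> c(1) c(1) e d c(2) c(2) y(2,1)] jac_same[OF c] by simp
  also have "?K ** umat \<Upsilon> e c y x = umat \<Upsilon> d c y x"
    using umat_transform[OF \<Upsilon> e d c(1) c(1) y(2,1) c(2) c(2)] jac_same[OF c] by simp
  finally show "act r s (umat \<Upsilon> c e x y) (umat \<Upsilon> e c y x) (T e y) is js * \<omega> x e y [] [] =
      \<bar>det (jac e d y)\<bar> * (act r s (umat \<Upsilon> c d x y) (umat \<Upsilon> d c y x) (T d y) is js * \<omega> x d y [] [])"
    using scalar_densityD(2)[OF sd d e y] by simp
next
  note sd = test_density_scalar[OF \<omega>]
  fix d assume d: "d \<in> A"
  have cx: "cmap c x \<in> cimg c" "cinv c (cmap c x) = x" using cmap_in[OF c(2)] cinv_cmap[OF c] by auto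
  have "continuous_on (cimg d) (\<lambda>v. umat \<Upsilon> c d x (cinv d v) $ i $ k)" for i k
  proof -
    have "continuous_on (cimg d) (\<lambda>v. umat \<Upsilon> c d (cinv c (fst (cmap c x, v))) (cinv d (snd (cmap c x, v))) $ i $ k)"
      by (rule continuous_on_compose2[OF Ck_on_continuous[OF Ck_on_transport[OF \<Upsilon> c(1) d, of 0 i k]]])
        (use cx in \<open>auto intro!: continuous_on_Pair continuous_on_const continuous_on_id\<close>)
    then show ?thesis by (simp add: cx)
  qed
  moreover have "continuous_on (cimg d) (\<lambda>v. umat \<Upsilon> d c (cinv d v) x $ i $ k)" for i k
  proof -
    have "continuous_on (cimg d) (\<lambda>v. umat \<Upsilon> d c (cinv d (fst (v, cmap c x))) (cinv c (snd (v, cmap c x))) $ i $ k)"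
      by (rule continuous_on_compose2[OF Ck_on_continuous[OF Ck_on_transport[OF \<Upsilon> d c(1), of 0 i k]]])
        (use cx in \<open>auto intro!: continuous_on_Pair continuous_on_const continuous_on_id\<close>)
    then show ?thesis by (simp add: cx)
  qed
  ultimately have "continuous_on (cimg d) (\<lambda>v. act r s (umat \<Upsilon> c d x (cinv d v)) (umat \<Upsilon> d c (cinv d v) x) (T d (cinv d v)) is js)"
    by (intro continuous_on_act continuous_tensorD(2)[OF T d])
  from continuous_on_mult[OF this scalar_densityD(3)[OF sd d]]
  show "continuous_on (cimg d) (coord (contraction r s T (Psi A \<Upsilon> \<omega> c x (axes is) (axes js))) d)"
    unfolding coord_def[abs_def] contraction_Psi[where \<omega>=\<omega> and x=x, OF \<omega> len] .
qed

lemma iota_eq: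
  assumes "c \<in> A" "x \<in> cdom c" "length is = r" "length js = s"
  shows "iota A r s (dist_of A r s T) \<Upsilon> \<omega> c x is js
    = dens_integral A (contraction r s T (Psi A \<Upsilon> \<omega> c x (axes is) (axes js)))"
  using assms by (simp add: iota_def dist_of_def axes_def)

text \<open>
  A change of the chart at \<open>x\<close> multiplies the integrand by Jacobian matrices that do not depend on the
  variable of integration and can be taken out of the integral.
\<close>

lemma iota_is_field:
  assumes T: "continuous_tensor r s T" and \<Upsilon>: "\<Upsilon> \<in> TO A" and \<omega>: "\<And>x. \<omega> x \<in> test_densities A 0 0"
  shows "is_field A 0 r s (iota A r s (dist_of A r s T) \<Upsilon> \<omega>)"
proof (rule is_fieldI)
  fix c x "is" js assume "iota A r s (dist_of A r s T) \<Upsilon> \<omega> c x is js \<noteq> 0"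
  then show "c \<in> A \<and> x \<in> cdom c \<and> length is = r \<and> length js = s" unfolding iota_def by presburger
next
  fix c d x and "is" js :: "'n list"
  assume c: "c \<in> A" and d: "d \<in> A" and x: "x \<in> cdom c" "x \<in> cdom d" and len: "length is = r" "length js = s"
  define I where "I = {ks :: 'n list. length ks = r} \<times> {ls :: 'n list. length ls = s}"
  let ?J = "jac c d x" and ?K = "jac d c x"
  define a where "a p = (\<Prod>i<r. ?J $ (is ! i) $ (fst p ! i)) * (\<Prod>j<s. ?K $ (snd p ! j) $ (js ! j))" for p :: "'n list \<times> 'n list"
  have act_I: "act r s ?J ?K t is js = (\<Sum>p\<in>I. a p * t (fst p) (snd p))" for t
    unfolding act_expand I_def a_def by (simp add: sum.cartesian_product case_prod_unfold)
  have I: "length (fst p) = r" "length (snd p) = s" if "p \<in> I" for p using that by (auto simp: I_def)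
  have "contraction r s T (Psi A \<Upsilon> \<omega> d x (axes is) (axes js)) e y [] [] =
     (\<Sum>p\<in>I. a p * contraction r s T (Psi A \<Upsilon> \<omega> c x (axes (fst p)) (axes (snd p))) e y [] [])" for e y
  proof (cases "\<omega> x e y [] [] = 0")
    case True then show ?thesis by (simp add: contraction_Psi[where \<omega>=\<omega> and x=x, OF \<omega>] len I)
  next
    case False
    then have e: "e \<in> A" "y \<in> cdom e" using scalar_densityD(1)[OF test_density_scalar[OF \<omega>]] by blast+
    have "umat \<Upsilon> d e x y = ?J ** umat \<Upsilon> c e x y"
      using umat_transform[OF \<Upsilon> c d e(1) e(1) x e(2) e(2)] jac_same[OF e] by simp
    moreover have "umat \<Upsilon> e d y x = umat \<Upsilon> e c y x ** ?K"
      using umat_transform[OF \<Upsilon> e(1) e(1) c d e(2) e(2) x] jac_same[OF e] by simp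
    ultimately have "act r s (umat \<Upsilon> d e x y) (umat \<Upsilon> e d y x) (T e y) is js
        = act r s ?J ?K (act r s (umat \<Upsilon> c e x y) (umat \<Upsilon> e c y x) (T e y)) is js"
      by (simp add: act_act)
    then show ?thesis
      by (simp add: contraction_Psi[where \<omega>=\<omega> and x=x, OF \<omega>] len I act_I sum_distrib_right mult.assoc)
  qed
  then have "dens_integral A (contraction r s T (Psi A \<Upsilon> \<omega> d x (axes is) (axes js)))
     = (\<Sum>p\<in>I. a p * dens_integral A (contraction r s T (Psi A \<Upsilon> \<omega> c x (axes (fst p)) (axes (snd p)))))"
  proof (intro dens_integral_lincomb[where K="field_support (\<omega> x)"])
    show "finite I" by (simp add: I_def)
    show "compact (field_support (\<omega> x))" by (rule test_densitiesD(3)[OF \<omega>])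
    show "scalar_density (field_support (\<omega> x)) (contraction r s T (Psi A \<Upsilon> \<omega> c x (axes (fst p)) (axes (snd p))))"
      if "p \<in> I" for p
      by (rule embedding_density[where \<omega>=\<omega> and x=x, OF T \<Upsilon> \<omega> c x(1) I[OF that]])
  qed
  then show "iota A r s (dist_of A r s T) \<Upsilon> \<omega> d x is js = \<bar>det ?K\<bar> ^ 0 *
      act r s ?J ?K (iota A r s (dist_of A r s T) \<Upsilon> \<omega> c x) is js"
    unfolding act_I iota_eq[OF d x(2) len] by (simp add: iota_eq[OF c x(1)] I)
qed

section \<open>Smoothing kernels\<close>

lemma SK_test_density: "\<omega> \<in> SK A \<Longrightarrow> \<omega> x \<in> test_densities A 0 0"
  by (simp add: SK_def)

lemma sup_seminorm_bound:
  assumes c: "c \<in> A" and L: "compact L" "L \<subseteq> cdom c" and \<mu>: "continuous_on (cimg c) (coord \<mu> c)" and y: "y \<in> L"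
  shows "\<bar>\<mu> c y [] []\<bar> \<le> sup_seminorm (c, L, []) \<mu>"
proof -
  let ?S = "(\<lambda>y. \<bar>coord \<mu> c (cmap c y)\<bar>) ` L"
  have "continuous_on L (\<lambda>y. coord \<mu> c (cmap c y))"
    by (rule continuous_on_compose2[OF \<mu> continuous_on_subset[OF continuous_on_cmap[OF c] L(2)]])
      (use L(2) in \<open>auto simp: cimg_def\<close>)
  then have "continuous_on L (\<lambda>y. \<bar>coord \<mu> c (cmap c y)\<bar>)" by (intro continuous_intros)
  then have "bounded ?S" using compact_continuous_image[OF _ L(1)] compact_imp_bounded by blast
  then have bdd: "bdd_above (insert 0 ?S)" using bounded_imp_bdd_above by simp
  have "\<bar>coord \<mu> c (cmap c y)\<bar> \<le> Sup (insert 0 ?S)"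
    by (rule cSup_upper[OF _ bdd]) (use y in blast)
  moreover have "coord \<mu> c (cmap c y) = \<mu> c y [] []"
    using cinv_cmap[OF c, of y] y L(2) by (auto simp: coord_def)
  ultimately show ?thesis by (simp add: sup_seminorm_def coord_def)
qed

lemma sup_seminorm_least:
  assumes c: "c \<in> A" and L: "L \<subseteq> cdom c" and "0 \<le> B" and le: "\<And>y. y \<in> L \<Longrightarrow> \<bar>\<mu> c y [] []\<bar> \<le> B"
  shows "sup_seminorm (c, L, []) \<mu> \<le> B"
proof -
  have "\<bar>coord \<mu> c (cmap c y)\<bar> \<le> B" if "y \<in> L" for y
    using le[OF that] cinv_cmap[OF c, of y] that L by (auto simp: coord_def)
  then have "Sup (insert 0 ((\<lambda>y. \<bar>coord \<mu> c (cmap c y)\<bar>) ` L)) \<le> B"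
    by (intro cSup_least) (use \<open>0 \<le> B\<close> in auto)
  then show ?thesis by (simp add: sup_seminorm_def coord_def)
qed

lemma sup_seminorm_nonneg:
  assumes c: "c \<in> A" and L: "compact L" "L \<subseteq> cdom c" and \<mu>: "continuous_on (cimg c) (coord \<mu> c)"
  shows "0 \<le> sup_seminorm (c, L, []) \<mu>"
proof (cases "L = {}")
  case False
  then obtain y where "y \<in> L" by blast
  from sup_seminorm_bound[OF c L \<mu> this] show ?thesis by linarith
qed (simp add: sup_seminorm_def)

text \<open>
  Smoothness of kernels is tested by the continuous seminorms of the space of test densities.  The
  supremum over a compact subset of a chart is the only one used below.
\<close>

lemma lf_seminorm_sup:
  assumes c: "c \<in> A" and L: "compact L" "L \<subseteq> cdom c"
  shows "lf_seminorm A (sup_seminorm (c, L, []))"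
  unfolding lf_seminorm_def
proof (intro conjI ballI allI impI)
  note cont = scalar_densityD(3)[OF test_density_scalar c]
  note bd = sup_seminorm_bound[OF c L cont]
  note nn = sup_seminorm_nonneg[OF c L cont]
  fix \<mu> \<nu> assume \<mu>: "\<mu> \<in> test_densities A 0 0" and \<nu>: "\<nu> \<in> test_densities A 0 0"
  show "sup_seminorm (c, L, []) (\<mu> + \<nu>) \<le> sup_seminorm (c, L, []) \<mu> + sup_seminorm (c, L, []) \<nu>"
  proof (rule sup_seminorm_least[OF c L(2)])
    show "0 \<le> sup_seminorm (c, L, []) \<mu> + sup_seminorm (c, L, []) \<nu>" using nn[OF \<mu>] nn[OF \<nu>] by simp
    fix y assume "y \<in> L"
    from bd[OF \<mu> this] bd[OF \<nu> this]
    show "\<bar>(\<mu> + \<nu>) c y [] []\<bar> \<le> sup_seminorm (c, L, []) \<mu> + sup_seminorm (c, L, []) \<nu>" by simp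
  qed
next
  note cont = scalar_densityD(3)[OF test_density_scalar c]
  fix a :: real and \<mu> assume \<mu>: "\<mu> \<in> test_densities A 0 0"
  have le: "sup_seminorm (c, L, []) (fmult (\<lambda>_. b) \<nu>) \<le> \<bar>b\<bar> * sup_seminorm (c, L, []) \<nu>"
    if "continuous_on (cimg c) (coord \<nu> c)" for b \<nu>
  proof (rule sup_seminorm_least[OF c L(2)])
    show "0 \<le> \<bar>b\<bar> * sup_seminorm (c, L, []) \<nu>" using sup_seminorm_nonneg[OF c L that] by simp
    show "\<bar>fmult (\<lambda>_. b) \<nu> c y [] []\<bar> \<le> \<bar>b\<bar> * sup_seminorm (c, L, []) \<nu>" if "y \<in> L" for y
      using sup_seminorm_bound[OF c L \<open>continuous_on (cimg c) (coord \<nu> c)\<close> that] by (simp add: fmult_def abs_mult mult_left_mono)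
  qed
  show "sup_seminorm (c, L, []) (fmult (\<lambda>_. a) \<mu>) = \<bar>a\<bar> * sup_seminorm (c, L, []) \<mu>"
  proof (cases "a = 0")
    case True
    have "continuous_on (cimg c) (coord (fmult (\<lambda>_. a) \<mu>) c)" using True by (simp add: coord_def[abs_def] fmult_def)
    from sup_seminorm_nonneg[OF c L this] le[OF cont[OF \<mu>], of a] True show ?thesis by simp
  next
    case False
    have "continuous_on (cimg c) (\<lambda>u. a * coord \<mu> c u)" by (intro continuous_intros cont[OF \<mu>])
    then have "continuous_on (cimg c) (coord (fmult (\<lambda>_. a) \<mu>) c)" by (simp add: coord_def[abs_def] fmult_def)
    from le[OF this, of "inverse a"] have "sup_seminorm (c, L, []) \<mu> \<le> \<bar>inverse a\<bar> * sup_seminorm (c, L, []) (fmult (\<lambda>_. a) \<mu>)"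
      using False by (simp add: fmult_def mult.assoc[symmetric])
    then have "\<bar>a\<bar> * sup_seminorm (c, L, []) \<mu> \<le> sup_seminorm (c, L, []) (fmult (\<lambda>_. a) \<mu>)"
      using False by (simp add: abs_inverse field_simps)
    with le[OF cont[OF \<mu>], of a] show ?thesis by linarith
  qed
next
  fix K :: "'m set"
  show "\<exists>F C. finite F \<and> F \<subseteq> {(c, L, bs). c \<in> A \<and> compact L \<and> L \<subseteq> cdom c \<and> set bs \<subseteq> Basis} \<and>
    (\<forall>\<mu>\<in>test_densities A 0 0. field_support \<mu> \<subseteq> K \<longrightarrow> sup_seminorm (c, L, []) \<mu> \<le> C * (\<Sum>q\<in>F. sup_seminorm q \<mu>))"
    by (intro exI[of _ "{(c, L, [])}"] exI[of _ 1]) (use c L in auto)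
qed

text \<open>
  Used for kernels: seminorms control their dependence on the first variable uniformly in the second.
\<close>

lemma continuous_on_Times_uniform:
  fixes f :: "'a::metric_space \<times> 'b::metric_space \<Rightarrow> real"
  assumes f: "\<And>u. u \<in> U \<Longrightarrow> continuous_on V (\<lambda>v. f (u, v))"
    and e: "\<And>u0. u0 \<in> U \<Longrightarrow> (e u0 \<longlongrightarrow> 0) (at u0 within U)"
    and le: "\<And>u0 u v. u0 \<in> U \<Longrightarrow> u \<in> U \<Longrightarrow> v \<in> V \<Longrightarrow> \<bar>f (u, v) - f (u0, v)\<bar> \<le> e u0 u"
  shows "continuous_on (U \<times> V) f"
  unfolding continuous_on_iff
proof (intro ballI allI impI)
  fix p and \<eta> :: real assume p: "p \<in> U \<times> V" and "\<eta> > 0"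
  obtain u0 v0 where p0: "p = (u0, v0)" "u0 \<in> U" "v0 \<in> V" using p by blast
  have "\<eta> / 2 > 0" using \<open>\<eta> > 0\<close> by simp
  from tendstoD[OF e[OF p0(2)] this] obtain d1 where d1: "d1 > 0"
    "\<And>u. u \<in> U \<Longrightarrow> u \<noteq> u0 \<Longrightarrow> dist u u0 < d1 \<Longrightarrow> dist (e u0 u) 0 < \<eta> / 2"
    unfolding eventually_at by blast
  from f[OF p0(2), unfolded continuous_on_iff, rule_format, OF p0(3) \<open>\<eta> / 2 > 0\<close>]
  obtain d2 where d2: "d2 > 0" "\<And>v. v \<in> V \<Longrightarrow> dist v v0 < d2 \<Longrightarrow> dist (f (u0, v)) (f (u0, v0)) < \<eta> / 2" by blast
  show "\<exists>d>0. \<forall>p'\<in>U \<times> V. dist p' p < d \<longrightarrow> dist (f p') (f p) < \<eta>"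
  proof (intro exI[of _ "min d1 d2"] conjI ballI impI)
    show "min d1 d2 > 0" using d1 d2 by simp
    fix p' assume "p' \<in> U \<times> V" and dist: "dist p' p < min d1 d2"
    then obtain u v where uv: "p' = (u, v)" "u \<in> U" "v \<in> V" by blast
    have "dist u u0 < d1" "dist v v0 < d2"
      using dist_fst_le[of p' p] dist_snd_le[of p' p] dist by (simp_all add: uv p0)
    have "\<bar>f (u, v) - f (u0, v)\<bar> < \<eta> / 2"
    proof (cases "u = u0")
      case True then show ?thesis using \<open>\<eta> / 2 > 0\<close> by simp
    next
      case False
      have "\<bar>f (u, v) - f (u0, v)\<bar> \<le> e u0 u" by (rule le[OF p0(2) uv(2,3)])
      also have "\<dots> < \<eta> / 2" using d1(2)[OF uv(2) False \<open>dist u u0 < d1\<close>] by simp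
      finally show ?thesis .
    qed
    moreover have "\<bar>f (u0, v) - f (u0, v0)\<bar> < \<eta> / 2"
      using d2(2)[OF uv(3) \<open>dist v v0 < d2\<close>] by (simp add: dist_real_def)
    ultimately have "\<bar>f (u, v) - f (u0, v0)\<bar> < \<eta>" by linarith
    then show "dist (f p') (f p) < \<eta>" by (simp add: uv p0 dist_real_def)
  qed
qed

text \<open>
  Difference quotients that converge in the space of densities converge in particular uniformly on
  compact subsets of a chart, so that smoothness of \<open>u \<mapsto> \<omega> (cinv c u)\<close> as a map into that space gives
  partial derivatives in \<open>u\<close> that are jointly continuous.
\<close>

lemma kernel_C1:
  assumes \<omega>: "\<omega> \<in> SK A" and c: "c \<in> A" and Q: "compact Q" "Q \<subseteq> cimg c"
  obtains wb where
    "continuous_on (cimg c \<times> Q) (\<lambda>p. coord (\<omega> (cinv c (fst p))) c (snd p))"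
    "\<And>b. b \<in> Basis \<Longrightarrow> continuous_on (cimg c \<times> Q) (wb b)"
    "\<And>b u v. b \<in> Basis \<Longrightarrow> u \<in> cimg c \<Longrightarrow> v \<in> Q \<Longrightarrow>
      ((\<lambda>t. coord (\<omega> (cinv c (u + t *\<^sub>R b))) c v) has_real_derivative wb b (u, v)) (at 0)"
proof -
  define L where "L = cinv c ` Q"
  define p where "p = sup_seminorm (c, L, [])"
  have L: "compact L" "L \<subseteq> cdom c"
    unfolding L_def using compact_cinv_image[OF c Q] cinv_in[OF c] Q(2) by blast+
  have p: "lf_seminorm A p" unfolding p_def by (rule lf_seminorm_sup[OF c L])
  have "smooth_into_densities A (cimg c) (\<lambda>u. \<omega> (cinv c u))" using \<omega> c by (simp add: SK_def)
  then obtain g where g0: "\<forall>u\<in>cimg c. g [] u = \<omega> (cinv c u)" and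
    g: "\<forall>bs u. set bs \<subseteq> Basis \<and> u \<in> cimg c \<longrightarrow> g bs u \<in> test_densities A 0 0 \<and>
        (\<forall>p. lf_seminorm A p \<longrightarrow> ((\<lambda>v. p (g bs v - g bs u)) \<longlongrightarrow> 0) (at u within cimg c) \<and>
          (\<forall>b\<in>Basis. ((\<lambda>t. p (fmult (\<lambda>_. 1 / t) (g bs (u + t *\<^sub>R b) - g bs u) - g (b # bs) u)) \<longlongrightarrow> 0) (at 0)))"
    unfolding smooth_into_densities_def by (elim exE conjE) (rule that)
  have gt: "g bs u \<in> test_densities A 0 0" if "set bs \<subseteq> Basis" "u \<in> cimg c" for bs u
    using g that by blast
  have gcont: "((\<lambda>v. p (g bs v - g bs u)) \<longlongrightarrow> 0) (at u within cimg c)" if "set bs \<subseteq> Basis" "u \<in> cimg c" for bs u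
    using g that p by blast
  have gder: "((\<lambda>t. p (fmult (\<lambda>_. 1 / t) (g [] (u + t *\<^sub>R b) - g [] u) - g [b] u)) \<longlongrightarrow> 0) (at 0)"
    if "u \<in> cimg c" "b \<in> Basis" for b u
    using g[rule_format, of "[]" u] that p by simp
  have cg: "continuous_on (cimg c) (coord (g bs u) c)" if "set bs \<subseteq> Basis" "u \<in> cimg c" for bs u
    by (rule scalar_densityD(3)[OF test_density_scalar[OF gt[OF that]] c])
  have bound: "\<bar>coord \<mu> c v\<bar> \<le> p \<mu>" if "continuous_on (cimg c) (coord \<mu> c)" "v \<in> Q" for \<mu> v
    using sup_seminorm_bound[OF c L that(1), of "cinv c v"] that(2) by (simp add: p_def coord_def L_def)
  have joint: "continuous_on (cimg c \<times> Q) (\<lambda>q. coord (g bs (fst q)) c (snd q))" if bs: "set bs \<subseteq> Basis" for bs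
  proof (rule continuous_on_Times_uniform[where e="\<lambda>u0 u. p (g bs u - g bs u0)"])
    show "continuous_on Q (\<lambda>v. coord (g bs (fst (u, v))) c (snd (u, v)))" if "u \<in> cimg c" for u
      using continuous_on_subset[OF cg[OF bs that] Q(2)] by simp
    show "((\<lambda>u. p (g bs u - g bs u0)) \<longlongrightarrow> 0) (at u0 within cimg c)" if "u0 \<in> cimg c" for u0
      by (rule gcont[OF bs that])
    fix u0 u v assume uv: "u0 \<in> cimg c" "u \<in> cimg c" "v \<in> Q"
    have "continuous_on (cimg c) (\<lambda>v. coord (g bs u) c v - coord (g bs u0) c v)"
      by (intro continuous_intros cg bs uv)
    then have "continuous_on (cimg c) (coord (g bs u - g bs u0) c)" by (simp add: coord_def[abs_def])
    from bound[OF this uv(3)]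
    show "\<bar>coord (g bs (fst (u, v))) c (snd (u, v)) - coord (g bs (fst (u0, v))) c (snd (u0, v))\<bar> \<le> p (g bs u - g bs u0)"
      by (simp add: coord_def)
  qed
  show ?thesis
  proof (rule that[of "\<lambda>b q. coord (g [b] (fst q)) c (snd q)"])
    show "continuous_on (cimg c \<times> Q) (\<lambda>q. coord (\<omega> (cinv c (fst q))) c (snd q))"
      by (rule continuous_on_cong[THEN iffD1, OF refl _ joint[of "[]"]]) (use g0 in auto)
    show "continuous_on (cimg c \<times> Q) (\<lambda>q. coord (g [b] (fst q)) c (snd q))" if "b \<in> Basis" for b
      by (rule joint) (use that in simp)
    fix b u v assume b: "(b :: real^'n) \<in> Basis" and u: "u \<in> cimg c" and v: "v \<in> Q"
    have ev: "eventually (\<lambda>t. u + t *\<^sub>R b \<in> cimg c) (at 0)"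
    proof -
      have "((\<lambda>t. u + t *\<^sub>R b) \<longlongrightarrow> u + 0 *\<^sub>R b) (at 0)" by (intro tendsto_intros)
      then show ?thesis using topological_tendstoD[OF _ open_cimg[OF c]] u by simp
    qed
    have "((\<lambda>t. (coord (g [] (u + t *\<^sub>R b)) c v - coord (g [] u) c v) / t - coord (g [b] u) c v) \<longlongrightarrow> 0) (at 0)"
    proof (rule Lim_null_comparison[OF _ gder[OF u b]])
      show "eventually (\<lambda>t. norm ((coord (g [] (u + t *\<^sub>R b)) c v - coord (g [] u) c v) / t - coord (g [b] u) c v)
        \<le> p (fmult (\<lambda>_. 1 / t) (g [] (u + t *\<^sub>R b) - g [] u) - g [b] u)) (at 0)"
        using ev
      proof eventually_elim
        case (elim t)
        have "continuous_on (cimg c) (\<lambda>v. 1 / t * (coord (g [] (u + t *\<^sub>R b)) c v - coord (g [] u) c v) - coord (g [b] u) c v)"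
          by (intro continuous_intros cg) (use elim u b in auto)
        then have "continuous_on (cimg c) (coord (fmult (\<lambda>_. 1 / t) (g [] (u + t *\<^sub>R b) - g [] u) - g [b] u) c)"
          by (simp add: coord_def[abs_def] fmult_def)
        from bound[OF this v] show ?case by (simp add: coord_def fmult_def)
      qed
    qed
    then have lim: "((\<lambda>t. (coord (g [] (u + t *\<^sub>R b)) c v - coord (g [] u) c v) / t) \<longlongrightarrow> coord (g [b] u) c v) (at 0)"
      using Lim_null by blast
    have "((\<lambda>t. (coord (\<omega> (cinv c (u + t *\<^sub>R b))) c v - coord (\<omega> (cinv c u)) c v) / t) \<longlongrightarrow> coord (g [b] u) c v) (at 0)"
      by (rule Lim_transform_eventually[OF lim]) (use ev g0 u in \<open>auto elim!: eventually_mono\<close>)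
    then show "((\<lambda>t. coord (\<omega> (cinv c (u + t *\<^sub>R b))) c v) has_real_derivative coord (g [b] (fst (u, v))) c (snd (u, v))) (at 0)"
      by (simp add: DERIV_def)
  qed
qed

end

section \<open>Convergence of the embedding in a chart\<close>

lemma Ck_on_1_parametric_integral:
  fixes k :: "'a::euclidean_space \<times> 'b::euclidean_space \<Rightarrow> real"
  assumes U: "open U" and k: "continuous_on (U \<times> cbox a b) k"
    and kb: "\<And>e. e \<in> Basis \<Longrightarrow> continuous_on (U \<times> cbox a b) (kb e)"
    and der: "\<And>e u v. e \<in> Basis \<Longrightarrow> u \<in> U \<Longrightarrow> v \<in> cbox a b \<Longrightarrow>
      ((\<lambda>t. k (u + t *\<^sub>R e, v)) has_real_derivative kb e (u, v)) (at 0)"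
  shows "Ck_on (Suc 0) U (\<lambda>u. integral (cbox a b) (\<lambda>v. k (u, v)))"
proof -
  define F where "F u = integral (cbox a b) (\<lambda>v. k (u, v))" for u
  define G where "G e u = integral (cbox a b) (\<lambda>v. kb e (u, v))" for e u
  have slice: "continuous_on (cbox a b) (\<lambda>v. f (u, v))"
    if "continuous_on (U \<times> cbox a b) f" "u \<in> U" for f :: "'a \<times> 'b \<Rightarrow> real" and u
    by (rule continuous_on_compose2[OF that(1)])
      (use that(2) in \<open>auto intro!: continuous_on_Pair continuous_on_const continuous_on_id\<close>)
  have Gc: "continuous_on U (G e)" if "e \<in> Basis" for e
    unfolding G_def by (rule integral_continuous_on_param) (use kb[OF that] in simp)
  have partial: "((\<lambda>t. F (u + t *\<^sub>R e)) has_real_derivative G e u) (at 0)" if e: "e \<in> Basis" and u: "u \<in> U" for e u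
  proof -
    obtain d where d: "d > 0" "ball u d \<subseteq> U" using U u openE by blast
    define J where "J = {- d<..<d}"
    have inU: "u + t *\<^sub>R e \<in> U" if "t \<in> J" for t
      using d(2) that e by (auto simp: J_def dist_norm subset_iff)
    have "((\<lambda>t. integral (cbox a b) (\<lambda>v. k (u + t *\<^sub>R e, v))) has_real_derivative
        integral (cbox a b) (\<lambda>v. kb e (u + 0 *\<^sub>R e, v))) (at 0 within J)"
    proof (rule leibniz_rule_field_derivative)
      fix t v assume t: "t \<in> J" and v: "v \<in> cbox a b"
      show "((\<lambda>t. k (u + t *\<^sub>R e, v)) has_real_derivative kb e (u + t *\<^sub>R e, v)) (at t within J)"
        by (rule has_field_derivative_at_within, rule has_real_derivative_line_shift[where f="\<lambda>u. k (u, v)"])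
          (rule der[OF e inU[OF t] v])
    next
      fix t assume t: "t \<in> J"
      show "(\<lambda>v. k (u + t *\<^sub>R e, v)) integrable_on cbox a b"
        by (rule integrable_continuous[OF slice[OF k inU[OF t]]])
    next
      have "continuous_on (J \<times> cbox a b) (\<lambda>p. kb e (u + fst p *\<^sub>R e, snd p))"
        by (rule continuous_on_compose2[OF kb[OF e]])
          (use inU in \<open>auto intro!: continuous_intros\<close>)
      then show "continuous_on (J \<times> cbox a b) (\<lambda>(t, v). kb e (u + t *\<^sub>R e, v))"
        by (simp add: case_prod_unfold)
    qed (use d in \<open>auto simp: J_def\<close>)
    then show ?thesis
      using at_within_open[of 0 J] d(1) by (simp add: F_def G_def J_def)
  qed
  have "(F has_derivative (\<lambda>h. \<Sum>e\<in>Basis. (h \<bullet> e) * G e u)) (at u)" if "u \<in> U" for u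
    by (rule has_derivative_from_partials[OF U that partial Gc])
  then have "Ck_on (Suc 0) U F"
  proof (rule Ck_on_SucI[OF U])
    fix b :: 'a assume b: "b \<in> Basis"
    have "(\<Sum>e\<in>Basis. (b \<bullet> e) * G e u) = (\<Sum>e\<in>Basis. if e = b then G e u else 0)" for u
      by (rule sum.cong) (auto simp: inner_Basis b)
    then show "Ck_on 0 U (\<lambda>u. \<Sum>e\<in>Basis. (b \<bullet> e) * G e u)"
      using Gc[OF b] b by simp
  qed
  then show ?thesis by (simp add: F_def[abs_def])
qed

lemma norm_matrix_le_entries:
  fixes M :: "real^'n^'m"
  assumes "\<And>i j. \<bar>M $ i $ j\<bar> \<le> d"
  shows "norm M \<le> real (CARD('m)) * (real (CARD('n)) * d)"
proof -
  have "norm M \<le> (\<Sum>i\<in>UNIV. norm (M $ i))"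
    unfolding norm_vec_def by (rule L2_set_le_sum) simp
  also have "\<dots> \<le> (\<Sum>i\<in>(UNIV :: 'm set). real (CARD('n)) * d)"
  proof (rule sum_mono)
    fix i
    have "norm (M $ i) \<le> (\<Sum>j\<in>UNIV. \<bar>M $ i $ j\<bar>)" by (rule norm_le_l1_cart)
    also have "\<dots> \<le> (\<Sum>j\<in>(UNIV :: 'n set). d)" by (rule sum_mono) (rule assms)
    finally show "norm (M $ i) \<le> real (CARD('n)) * d" by simp
  qed
  finally show ?thesis by simp
qed

text \<open>
  \<open>act\<close> is uniformly continuous on a compact neighbourhood of the identity matrices.
\<close>

lemma act_near_identity:
  fixes \<tau> :: "real^'n \<Rightarrow> 'n::finite list \<Rightarrow> 'n list \<Rightarrow> real"
  assumes V: "compact V" and \<tau>: "\<And>ks ls. length ks = r \<Longrightarrow> length ls = s \<Longrightarrow> continuous_on V (\<lambda>v. \<tau> v ks ls)"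
    and len: "length is = r" "length js = s" and "e > 0"
  shows "\<exists>d>0. \<forall>P Q u v. u \<in> V \<longrightarrow> v \<in> V \<longrightarrow> dist u v < d \<longrightarrow>
    (\<forall>i j. \<bar>P $ i $ j - mat 1 $ i $ j\<bar> < d) \<longrightarrow> (\<forall>i j. \<bar>Q $ i $ j - mat 1 $ i $ j\<bar> < d) \<longrightarrow>
    \<bar>act r s P Q (\<tau> v) is js - \<tau> u is js\<bar> < e"
proof -
  define X where "X = cball (mat 1 :: real^'n^'n) 1 \<times> cball (mat 1 :: real^'n^'n) 1 \<times> V"
  define \<Phi> where "\<Phi> p = act r s (fst p) (fst (snd p)) (\<tau> (snd (snd p))) is js" for p
  have "compact X" unfolding X_def by (intro compact_Times compact_cball V)
  moreover have "continuous_on X \<Phi>" unfolding \<Phi>_def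
  proof (rule continuous_on_act)
    show "continuous_on X (\<lambda>p. fst p $ i $ k)" "continuous_on X (\<lambda>p. fst (snd p) $ i $ k)" for i k
      by (intro continuous_intros)+
    show "continuous_on X (\<lambda>p. \<tau> (snd (snd p)) ks ls)" if "length ks = r" "length ls = s" for ks ls
      by (rule continuous_on_compose2[OF \<tau>[OF that]]) (auto simp: X_def intro!: continuous_intros)
  qed
  ultimately have "uniformly_continuous_on X \<Phi>" by (rule compact_uniformly_continuous[rotated])
  then obtain d0 where d0: "d0 > 0" "\<And>p q. p \<in> X \<Longrightarrow> q \<in> X \<Longrightarrow> dist q p < d0 \<Longrightarrow> dist (\<Phi> q) (\<Phi> p) < e"
    unfolding uniformly_continuous_on_def using \<open>e > 0\<close> by blast
  define n where "n = real (CARD('n)) * real (CARD('n))"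
  have n: "n \<ge> 1" unfolding n_def
    using mult_mono[of 1 "real (CARD('n))" 1 "real (CARD('n))"] by (simp add: Suc_le_eq)
  \<comment> \<open>entrywise distances less than \<open>d\<close> make each matrix \<open>min 1 (d0 / 4)\<close>-close to the identity in norm\<close>
  define d where "d = min 1 (d0 / 4) / n"
  have d: "d > 0" using n d0(1) by (simp add: d_def)
  have nd: "n * d \<le> 1" "n * d \<le> d0 / 4" using n by (simp_all add: d_def)
  have "d \<le> n * d" using n d by simp
  have close: "norm (P - mat 1) \<le> n * d" if "\<forall>i j. \<bar>P $ i $ j - mat 1 $ i $ j\<bar> < d" for P :: "real^'n^'n"
    using norm_matrix_le_entries[of "P - mat 1" d] that by (simp add: n_def less_imp_le mult.assoc)
  show ?thesis
  proof (intro exI[of _ d] conjI d allI impI)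
    fix P Q :: "real^'n^'n" and u v
    assume u: "u \<in> V" and v: "v \<in> V" and uv: "dist u v < d"
      and P: "\<forall>i j. \<bar>P $ i $ j - mat 1 $ i $ j\<bar> < d" and Q: "\<forall>i j. \<bar>Q $ i $ j - mat 1 $ i $ j\<bar> < d"
    have "(mat 1, mat 1, u) \<in> X" using u by (simp add: X_def)
    moreover have "(P, Q, v) \<in> X"
      using v close[OF P] close[OF Q] nd(1) by (simp add: X_def dist_norm norm_minus_commute)
    moreover have "dist (P, Q, v) (mat 1, mat 1, u) < d0"
    proof -
      have "dist (P, Q, v) (mat 1, mat 1, u) \<le> dist P (mat 1) + (dist Q (mat 1) + dist v u)"
        unfolding dist_prod_def fst_conv snd_conv
        by (intro order.trans[OF sqrt_sum_squares_le_sum] add_mono order.refl) simp_all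
      also have "\<dots> \<le> n * d + (n * d + n * d)"
        using close[OF P] close[OF Q] uv \<open>d \<le> n * d\<close> by (intro add_mono) (simp_all add: dist_norm norm_minus_commute)
      also have "\<dots> < d0" using nd(2) d0(1) by linarith
      finally show ?thesis .
    qed
    ultimately have "dist (\<Phi> (P, Q, v)) (\<Phi> (mat 1, mat 1, u)) < e" by (intro d0(2))
    then show "\<bar>act r s P Q (\<tau> v) is js - \<tau> u is js\<bar> < e"
      by (simp add: \<Phi>_def dist_real_def act_id len)
  qed
qed

lemma eventually_small: "\<epsilon>\<^sub>0 > 0 \<Longrightarrow> eventually (\<lambda>\<epsilon>::real. \<epsilon> \<in> {0<..1} \<and> \<epsilon> < \<epsilon>\<^sub>0) (at_right 0)"
  unfolding eventually_at_right_field by (intro exI[of _ "min 1 \<epsilon>\<^sub>0"]) auto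

context manifold begin

lemma iota_in_chart:
  assumes T: "continuous_tensor r s T" and \<Upsilon>: "\<Upsilon> \<in> TO A" and \<omega>: "\<omega> \<in> SK A"
    and c: "c \<in> A" "cbox a b \<subseteq> cimg c" and u: "u \<in> cimg c"
    and supp: "field_support (\<omega> (cinv c u)) \<subseteq> cinv c ` cbox a b" and len: "length is = r" "length js = s"
  shows "iota A r s (dist_of A r s T) \<Upsilon> \<omega> c (cinv c u) is js = integral (cbox a b) (\<lambda>v.
    act r s (umat \<Upsilon> c c (cinv c u) (cinv c v)) (umat \<Upsilon> c c (cinv c v) (cinv c u)) (T c (cinv c v)) is js
      * coord (\<omega> (cinv c u)) c v)"
proof -
  have x: "cinv c u \<in> cdom c" by (rule cinv_in[OF c(1) u])
  note td = SK_test_density[OF \<omega>]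
  show ?thesis
    unfolding iota_eq[OF c(1) x len] dens_integral_chart[OF embedding_density[where \<omega>=\<omega> and x="cinv c u", OF T \<Upsilon> td c(1) x len] c(1) supp c(2)]
    unfolding coord_def contraction_Psi[where \<omega>=\<omega> and x="cinv c u", OF td len] ..
qed

text \<open>
  Differentiation under the integral sign over the fixed box \<open>cbox a b\<close>.  The field \<open>T\<close> occurs only at the
  variable of integration and need not be differentiable; the derivatives fall on the transport
  operators and on the kernel.
\<close>

lemma iota_C1:
  assumes T: "continuous_tensor r s T" and \<Upsilon>: "\<Upsilon> \<in> TO A" and \<omega>: "\<omega> \<in> SK A"
    and c: "c \<in> A" "cbox a b \<subseteq> cimg c" and U: "open U" "U \<subseteq> cimg c"
    and supp: "\<And>u. u \<in> U \<Longrightarrow> field_support (\<omega> (cinv c u)) \<subseteq> cinv c ` cbox a b" and len: "length is = r" "length js = s"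
  shows "Ck_on (Suc 0) U (\<lambda>u. iota A r s (dist_of A r s T) \<Upsilon> \<omega> c (cinv c u) is js)"
proof -
  define X where "X = cimg c \<times> cimg c"
  have X: "open X" unfolding X_def by (intro open_Times open_cimg c)
  define p where "p ks ls q = (\<Prod>i<r. umat \<Upsilon> c c (cinv c (fst q)) (cinv c (snd q)) $ (is ! i) $ (ks ! i)) *
     (\<Prod>j<s. umat \<Upsilon> c c (cinv c (snd q)) (cinv c (fst q)) $ (ls ! j) $ (js ! j))" for ks ls and q :: "(real^'n) \<times> (real^'n)"
  have C1: "Ck_on (Suc 0) X (\<lambda>q. umat \<Upsilon> c c (cinv c (fst q)) (cinv c (snd q)) $ i $ k)" for i k
    unfolding X_def by (rule Ck_on_transport[OF \<Upsilon> c(1) c(1)])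
  have C2: "Ck_on (Suc 0) X (\<lambda>q. umat \<Upsilon> c c (cinv c (snd q)) (cinv c (fst q)) $ i $ k)" for i k
  proof -
    have "bounded_linear (\<lambda>q :: (real^'n) \<times> (real^'n). (snd q, fst q))"
      by (intro bounded_linear_Pair bounded_linear_fst bounded_linear_snd)
    then have "Ck_on (Suc 0) X (\<lambda>q. umat \<Upsilon> c c (cinv c (fst (snd q, fst q))) (cinv c (snd (snd q, fst q))) $ i $ k)"
      by (intro Ck_on_compose[OF X X _ _ C1[of i k]] Ck_on_linear) (auto simp: X_def)
    then show ?thesis by (simp del: Ck_on.simps)
  qed
  have p: "Ck_on (Suc 0) X (p ks ls)" for ks ls
    unfolding p_def[abs_def] by (intro Ck_on_mult Ck_on_prod X C1 C2)
  define dp where "dp ks ls e q = frechet_derivative (p ks ls) (at q) (e, 0)" for ks ls and e :: "real^'n" and q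
  have dp: "((\<lambda>t. p ks ls (u + t *\<^sub>R e, v)) has_real_derivative dp ks ls e (u, v)) (at 0)"
    if "u \<in> cimg c" "v \<in> cimg c" for ks ls e u v
    using has_derivative_along_line[OF Ck_on_SucD[OF p X, of "(u, v)" ks ls], of "(e, 0)"] that
    by (simp add: dp_def X_def)
  have dpc: "continuous_on X (dp ks ls e)" if "e \<in> Basis" for ks ls e
    using p[of ks ls] that unfolding dp_def[abs_def] by (simp add: Basis_prod_def)
  have pc: "continuous_on X (p ks ls)" for ks ls by (rule Ck_on_continuous[OF p])
  define K where "K = {ks :: 'n list. length ks = r}"
  define L where "L = {ls :: 'n list. length ls = s}"
  define m where "m q = (\<Sum>ks\<in>K. \<Sum>ls\<in>L. p ks ls q * T c (cinv c (snd q)) ks ls)" for q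
  define md where "md e q = (\<Sum>ks\<in>K. \<Sum>ls\<in>L. dp ks ls e q * T c (cinv c (snd q)) ks ls)" for e q
  have Tc: "continuous_on (U \<times> cbox a b) (\<lambda>q. T c (cinv c (snd q)) ks ls)" if "ks \<in> K" "ls \<in> L" for ks ls
    by (rule continuous_on_compose2[OF continuous_tensorD(2)[OF T c(1)]])
      (use that c(2) in \<open>auto simp: K_def L_def intro!: continuous_intros\<close>)
  have sub: "U \<times> cbox a b \<subseteq> X" using U(2) c(2) by (auto simp: X_def)
  have mc: "continuous_on (U \<times> cbox a b) m" unfolding m_def
    by (intro continuous_on_sum continuous_on_mult Tc continuous_on_subset[OF pc sub])
  have mdc: "continuous_on (U \<times> cbox a b) (md e)" if "e \<in> Basis" for e unfolding md_def
    by (intro continuous_on_sum continuous_on_mult Tc continuous_on_subset[OF dpc[OF that] sub])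
  have md: "((\<lambda>t. m (u + t *\<^sub>R e, v)) has_real_derivative md e (u, v)) (at 0)"
    if "u \<in> U" "v \<in> cbox a b" for u v e
  proof -
    have "u \<in> cimg c" "v \<in> cimg c" using that U(2) c(2) by auto
    then show ?thesis unfolding m_def md_def snd_conv
      by (intro DERIV_sum DERIV_cmult_right dp)
  qed
  obtain wb where w: "continuous_on (cimg c \<times> cbox a b) (\<lambda>q. coord (\<omega> (cinv c (fst q))) c (snd q))"
    "\<And>e. e \<in> Basis \<Longrightarrow> continuous_on (cimg c \<times> cbox a b) (wb e)"
    "\<And>e u v. e \<in> Basis \<Longrightarrow> u \<in> cimg c \<Longrightarrow> v \<in> cbox a b \<Longrightarrow>
      ((\<lambda>t. coord (\<omega> (cinv c (u + t *\<^sub>R e))) c v) has_real_derivative wb e (u, v)) (at 0)"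
    using kernel_C1[OF \<omega> c(1) compact_cbox c(2)] by blast
  have sub2: "U \<times> cbox a b \<subseteq> cimg c \<times> cbox a b" using U(2) by auto
  define w0 where "w0 q = coord (\<omega> (cinv c (fst q))) c (snd q)" for q
  have "Ck_on (Suc 0) U (\<lambda>u. integral (cbox a b) (\<lambda>v. m (u, v) * w0 (u, v)))"
  proof (rule Ck_on_1_parametric_integral[OF U(1), where kb="\<lambda>e q. md e q * w0 q + wb e q * m q"])
    have w0c: "continuous_on (U \<times> cbox a b) w0"
      unfolding w0_def[abs_def] by (rule continuous_on_subset[OF w(1) sub2])
    show "continuous_on (U \<times> cbox a b) (\<lambda>q. m q * w0 q)"
      by (intro continuous_on_mult mc w0c)
    show "continuous_on (U \<times> cbox a b) (\<lambda>q. md e q * w0 q + wb e q * m q)" if "e \<in> Basis" for e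
      by (intro continuous_on_add continuous_on_mult mc mdc[OF that] w0c continuous_on_subset[OF w(2)[OF that] sub2])
    fix e :: "real^'n" and u v assume e: "e \<in> Basis" and u: "u \<in> U" and v: "v \<in> cbox a b"
    have "((\<lambda>t. w0 (u + t *\<^sub>R e, v)) has_real_derivative wb e (u, v)) (at 0)"
      using w(3)[OF e _ v, of u] u U(2) by (auto simp: w0_def)
    from DERIV_mult[OF md[OF u v, of e] this]
    show "((\<lambda>t. m (u + t *\<^sub>R e, v) * w0 (u + t *\<^sub>R e, v)) has_real_derivative
        md e (u, v) * w0 (u, v) + wb e (u, v) * m (u, v)) (at 0)" by simp
  qed
  then show ?thesis
  proof (rule Ck_on_eqI[OF U(1)])
    fix u assume u: "u \<in> U"
    show "integral (cbox a b) (\<lambda>v. m (u, v) * w0 (u, v)) = iota A r s (dist_of A r s T) \<Upsilon> \<omega> c (cinv c u) is js"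
      using iota_in_chart[OF T \<Upsilon> \<omega> c _ supp[OF u] len] u U(2)
      by (auto simp: m_def p_def w0_def act_expand K_def L_def)
  qed
qed

text \<open>
  On the diagonal the matrix is the identity.  The first derivatives are bounded, uniformly for small
  \<open>\<epsilon>\<close>, near \<open>(x, x)\<close>, and the mean value inequality applies on the convex set \<open>cbox a b \<times> cbox a b\<close>.
\<close>

lemma transport_near_diagonal:
  assumes \<Upsilon>: "\<Upsilon> \<in> admissible_nets A" and c: "c \<in> A" "x \<in> cdom c"
  obtains N C where "open N" "cmap c x \<in> N" "N \<subseteq> cimg c" "C \<ge> 0"
    "eventually (\<lambda>\<epsilon>. \<forall>a b u v i j. cbox a b \<subseteq> N \<longrightarrow> u \<in> cbox a b \<longrightarrow> v \<in> cbox a b \<longrightarrow>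
      \<bar>umat (\<Upsilon> \<epsilon>) c c (cinv c u) (cinv c v) $ i $ j - mat 1 $ i $ j\<bar> \<le> C * dist u v) (at_right 0)"
proof -
  define f where "f \<epsilon> i j = (\<lambda>(u, v). \<Upsilon> \<epsilon> c c (cinv c u) (cinv c v) i j)" for \<epsilon> i j
  define I where "I = (Basis :: ((real^'n) \<times> (real^'n)) set) \<times> (UNIV :: ('n \<times> 'n) set)"
  \<comment> \<open>\<open>q\<close> consists of a basis vector and the indices of a matrix entry; \<open>t\<close> consists of a
    neighbourhood, a bound, and a bound for \<open>\<epsilon>\<close> for the respective derivative\<close>
  define P where "P q t \<longleftrightarrow> open (fst t) \<and> (x, x) \<in> fst t \<and> fst t \<subseteq> cdom c \<times> cdom c \<and> snd (snd t) > (0 :: real) \<and>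
    (\<forall>\<epsilon>\<in>{0<..1}. \<epsilon> < snd (snd t) \<longrightarrow> (\<forall>y z. (y, z) \<in> fst t \<longrightarrow>
      \<bar>frechet_derivative (f \<epsilon> (fst (snd q)) (snd (snd q))) (at (cmap c y, cmap c z)) (fst q)\<bar> \<le> fst (snd t)))" for q t
  have "\<forall>q\<in>I. \<exists>t. P q t"
  proof
    fix q assume "q \<in> I"
    then have bs: "set [fst q] \<subseteq> Basis" by (auto simp: I_def)
    obtain W where W: "open W \<and> (x, x) \<in> W \<and> W \<subseteq> cdom c \<times> cdom c \<and>
        (\<exists>C. \<exists>\<epsilon>\<^sub>0>0. \<forall>\<epsilon>\<in>{0<..1}. \<epsilon> < \<epsilon>\<^sub>0 \<longrightarrow> (\<forall>(y, z)\<in>W.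
            \<bar>iter_partial [fst q] (\<lambda>(u, v). \<Upsilon> \<epsilon> c c (cinv c u) (cinv c v) (fst (snd q)) (snd (snd q)))
              (cmap c y, cmap c z)\<bar> \<le> C))"
      using \<Upsilon>[unfolded admissible_nets_def mem_Collect_eq, THEN conjunct2, THEN conjunct1, rule_format, OF c bs,
        where a="fst (snd q)" and b="snd (snd q)"] by (elim exE) (rule that)
    then obtain C \<epsilon>\<^sub>0 where "\<epsilon>\<^sub>0 > 0" "\<forall>\<epsilon>\<in>{0<..1}. \<epsilon> < \<epsilon>\<^sub>0 \<longrightarrow> (\<forall>(y, z)\<in>W.
            \<bar>iter_partial [fst q] (\<lambda>(u, v). \<Upsilon> \<epsilon> c c (cinv c u) (cinv c v) (fst (snd q)) (snd (snd q)))
              (cmap c y, cmap c z)\<bar> \<le> C)" by blast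
    with W have "P q (W, C, \<epsilon>\<^sub>0)" by (auto simp: P_def f_def)
    then show "\<exists>t. P q t" by blast
  qed
  then obtain t where t: "\<forall>q\<in>I. P q (t q)" using bchoice by blast
  have I: "finite I" unfolding I_def by simp
  define W where "W = (\<Inter>q\<in>I. fst (t q)) \<inter> cdom c \<times> cdom c"
  have W: "open W" "(x, x) \<in> W"
    using t c I by (auto simp: W_def P_def intro!: open_Int open_INT open_Times open_cdom)
  obtain A1 A2 where A12: "open A1" "open A2" "(x, x) \<in> A1 \<times> A2" "A1 \<times> A2 \<subseteq> W"
    using open_prod_elim[OF W] by blast
  define N0 where "N0 = A1 \<inter> A2 \<inter> cdom c"
  have N0: "open N0" "x \<in> N0" "N0 \<subseteq> cdom c" "N0 \<times> N0 \<subseteq> W"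
    using A12 c open_cdom[OF c(1)] by (auto simp: N0_def intro!: open_Int)
  define N where "N = cmap c ` N0"
  have N: "open N" "cmap c x \<in> N" "N \<subseteq> cimg c"
    unfolding N_def using open_cmap_image[OF c(1) N0(1,3)] N0 by (auto simp: cimg_def)
  define B where "B = (\<Sum>q\<in>I. \<bar>fst (snd (t q))\<bar>)"
  have B: "\<bar>fst (snd (t q))\<bar> \<le> B" if "q \<in> I" for q
    unfolding B_def by (rule member_le_sum[OF that _ I]) simp
  define e0 where "e0 = Min (insert 1 ((\<lambda>q. snd (snd (t q))) ` I))"
  have e0: "e0 > 0" "\<And>q. q \<in> I \<Longrightarrow> e0 \<le> snd (snd (t q))"
    using I t by (auto simp: e0_def P_def)
  define C where "C = real DIM((real^'n) \<times> (real^'n)) * B"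
  have "B \<ge> 0" by (simp add: B_def sum_nonneg)
  then have C: "C \<ge> 0" unfolding C_def by (intro mult_nonneg_nonneg) simp_all
  have "eventually (\<lambda>\<epsilon>. \<forall>a b u v i j. cbox a b \<subseteq> N \<longrightarrow> u \<in> cbox a b \<longrightarrow> v \<in> cbox a b \<longrightarrow>
      \<bar>umat (\<Upsilon> \<epsilon>) c c (cinv c u) (cinv c v) $ i $ j - mat 1 $ i $ j\<bar> \<le> C * dist u v) (at_right 0)"
    using eventually_small[OF e0(1)]
  proof eventually_elim
    case (elim \<epsilon>)
    show ?case
    proof (intro allI impI)
      fix a b u v :: "real^'n" and i j :: 'n
      assume box: "cbox a b \<subseteq> N" and u: "u \<in> cbox a b" and v: "v \<in> cbox a b"
      define S where "S = cbox a b \<times> cbox a b"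
      let ?f = "f \<epsilon> i j"
      let ?D = "\<lambda>q. frechet_derivative ?f (at q)"
      have TO: "\<Upsilon> \<epsilon> \<in> TO A" using \<Upsilon> elim unfolding admissible_nets_def by blast
      have "smooth_on (cimg c \<times> cimg c) ?f"
        using TO c unfolding TO_def f_def by blast
      then have Ck: "Ck_on (Suc 0) (cimg c \<times> cimg c) ?f" unfolding smooth_on_def by blast
      have der: "(?f has_derivative ?D q) (at q)" if "q \<in> S" for q
      proof -
        have "q \<in> cimg c \<times> cimg c" using that box N(3) by (auto simp: S_def)
        from Ck_on_SucD[OF Ck open_Times[OF open_cimg[OF c(1)] open_cimg[OF c(1)]] this] show ?thesis .
      qed
      have bound: "\<bar>?D q e\<bar> \<le> B" if q: "q \<in> S" and e: "e \<in> Basis" for q e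
      proof -
        obtain y z where yz: "y \<in> N0" "z \<in> N0" "q = (cmap c y, cmap c z)"
          using q box unfolding S_def N_def by blast
        have "(y, z) \<in> W" using yz N0(4) by blast
        have qI: "(e, i, j) \<in> I" using e by (simp add: I_def)
        then have "(y, z) \<in> fst (t (e, i, j))" using \<open>(y, z) \<in> W\<close> unfolding W_def by blast
        moreover have "P (e, i, j) (t (e, i, j))" using t qI by blast
        moreover have "\<epsilon> < snd (snd (t (e, i, j)))" using elim e0(2)[OF qI] by linarith
        ultimately have "\<bar>?D q e\<bar> \<le> fst (snd (t (e, i, j)))"
          using elim unfolding P_def yz(3) by (metis fst_conv snd_conv)
        then show ?thesis using B[OF qI] by linarith
      qed
      have "norm (?f (u, v) - ?f (u, u)) \<le> C * norm ((u, v) - (u, u))"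
      proof (rule differentiable_bound[where S=S and f'="?D"])
        show "convex S" unfolding S_def by (intro convex_Times convex_box)
        show "(?f has_derivative ?D q) (at q within S)" if "q \<in> S" for q
          by (rule has_derivative_at_withinI[OF der[OF that]])
        show "onorm (?D q) \<le> C" if q: "q \<in> S" for q
        proof (rule onorm_le)
          fix h :: "(real^'n) \<times> (real^'n)"
          have lin: "linear (?D q)" using der[OF q] has_derivative_linear by blast
          have "?D q h = ?D q (\<Sum>e\<in>Basis. (h \<bullet> e) *\<^sub>R e)" by (simp add: euclidean_representation)
          also have "\<dots> = (\<Sum>e\<in>Basis. (h \<bullet> e) *\<^sub>R ?D q e)" by (simp add: linear_sum[OF lin] linear_scale[OF lin])
          also have "norm \<dots> \<le> (\<Sum>e\<in>(Basis :: ((real^'n) \<times> (real^'n)) set). norm h * B)"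
            by (rule sum_norm_le) (auto simp: abs_mult intro!: mult_mono Basis_le_norm bound[OF q])
          finally show "norm (?D q h) \<le> C * norm h" by (simp add: C_def mult_ac)
        qed
      qed (use u v in \<open>auto simp: S_def\<close>)
      moreover have "?f (u, u) = mat 1 $ i $ j"
      proof -
        have "cinv c u \<in> cdom c" using cinv_in[OF c(1), of u] u box N(3) by blast
        then have "\<Upsilon> \<epsilon> c c (cinv c u) (cinv c u) i j = (if i = j then 1 else 0)"
          using \<Upsilon> elim c(1) unfolding admissible_nets_def by blast
        then show ?thesis by (simp add: f_def mat_def)
      qed
      ultimately show "\<bar>umat (\<Upsilon> \<epsilon>) c c (cinv c u) (cinv c v) $ i $ j - mat 1 $ i $ j\<bar> \<le> C * dist u v"
        by (simp add: f_def umat_def dist_norm norm_Pair norm_minus_commute)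
    qed
  qed
  with N C show ?thesis by (rule that)
qed

lemma abs_field_density:
  assumes "scalar_density K \<mu>" shows "scalar_density K (abs_field \<mu>)"
  unfolding scalar_density_def
proof (intro conjI allI impI ballI)
  fix d x assume "abs_field \<mu> d x [] [] \<noteq> 0"
  then have "\<mu> d x [] [] \<noteq> 0" by (simp add: abs_field_def)
  then show "d \<in> A" "x \<in> cdom d" "x \<in> K" using scalar_densityD(1)[OF assms] by blast+
next
  fix c d x assume "c \<in> A" "d \<in> A" "x \<in> cdom c \<inter> cdom d"
  then show "abs_field \<mu> d x [] [] = \<bar>det (jac d c x)\<bar> * abs_field \<mu> c x [] []"
    using scalar_densityD(2)[OF assms, of c d x] by (simp add: abs_field_def abs_mult)
next
  fix c assume "c \<in> A"
  from scalar_densityD(3)[OF assms this]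
  show "continuous_on (cimg c) (coord (abs_field \<mu>) c)"
    unfolding coord_def[abs_def] abs_field_def by (rule continuous_on_rabs)
qed

text \<open>
  The consequences of the axioms of delta nets that matter here, for the points \<open>u\<close> of a compact set of
  coordinates.  The bound of the absolute mass is the second axiom without Lie derivatives, the
  convergence of the mass is the third axiom for the constant function 1, and the shrinking of the
  supports is the first axiom, translated from Riemannian to coordinate balls.
\<close>

lemma delta_nets_local:
  assumes \<omega>: "\<omega> \<in> delta_nets A" and c: "c \<in> A" and B: "compact B" and L: "compact L" "L \<subseteq> cimg c"
    and r: "r > 0" "\<forall>u\<in>B. cball u r \<subseteq> L"
  shows "eventually (\<lambda>\<epsilon>. \<omega> \<epsilon> \<in> SK A) (at_right 0)"
    and "\<exists>C\<ge>0. eventually (\<lambda>\<epsilon>. \<forall>u\<in>B. dens_integral A (abs_field (\<omega> \<epsilon> (cinv c u))) \<le> C) (at_right 0)"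
    and "e > 0 \<Longrightarrow> eventually (\<lambda>\<epsilon>. \<forall>u\<in>B. \<bar>1 - dens_integral A (\<omega> \<epsilon> (cinv c u))\<bar> \<le> e) (at_right 0)"
    and "0 < \<eta> \<Longrightarrow> \<eta> \<le> r \<Longrightarrow> eventually (\<lambda>\<epsilon>. \<forall>u\<in>B. field_support (\<omega> \<epsilon> (cinv c u)) \<subseteq> cinv c ` ball u \<eta>) (at_right 0)"
proof -
  have SK: "\<forall>\<epsilon>\<in>{0<..1}. \<omega> \<epsilon> \<in> SK A" using \<omega>[unfolded delta_nets_def mem_Collect_eq, THEN conjunct1] .
  show "eventually (\<lambda>\<epsilon>. \<omega> \<epsilon> \<in> SK A) (at_right 0)"
    using eventually_small[OF zero_less_one] by eventually_elim (use SK in auto)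
  have Bc: "u \<in> cimg c" if "u \<in> B" for u
    using r(1) r(2)[rule_format, OF that] L(2) by (meson centre_in_cball less_imp_le subsetD)
  define K where "K = cinv c ` B"
  have K: "compact K" unfolding K_def by (rule compact_cinv_image[OF c B]) (use Bc in blast)
  obtain h where h: "riemannian_metric A h" and h2: "\<forall>K. compact K \<longrightarrow>
      (\<exists>C>0. \<exists>\<epsilon>\<^sub>0>0. \<forall>\<epsilon>\<in>{0<..1}. \<epsilon> < \<epsilon>\<^sub>0 \<longrightarrow>
        (\<forall>x\<in>K. field_support (\<omega> \<epsilon> x) \<subseteq> riem_ball A h (C * \<epsilon>) x)) \<and>
      (\<forall>Ys Xs. set Ys \<subseteq> vector_fields A \<and> set Xs \<subseteq> vector_fields A \<longrightarrow>
        (\<exists>C. \<exists>\<epsilon>\<^sub>0>0. \<forall>\<epsilon>\<in>{0<..1}. \<epsilon> < \<epsilon>\<^sub>0 \<longrightarrow>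
          (\<forall>x\<in>K. dens_integral A
             (abs_field (foldr (lie_Omega A) Ys (foldr (lie_SK A) Xs (\<omega> \<epsilon>)) x))
             \<le> C * (1 / \<epsilon>) ^ length Ys))) \<and>
      (\<forall>f\<in>smooth_functions A. \<forall>m :: nat.
        (\<exists>C. \<exists>\<epsilon>\<^sub>0>0. \<forall>\<epsilon>\<in>{0<..1}. \<epsilon> < \<epsilon>\<^sub>0 \<longrightarrow>
          (\<forall>x\<in>K. \<bar>f x - dens_integral A (fmult f (\<omega> \<epsilon> x))\<bar> \<le> C * \<epsilon> ^ m)))"
    using \<omega> unfolding delta_nets_def mem_Collect_eq by (elim conjE exE) (rule that)
  note hK = h2[rule_format, OF K]
  show "\<exists>C\<ge>0. eventually (\<lambda>\<epsilon>. \<forall>u\<in>B. dens_integral A (abs_field (\<omega> \<epsilon> (cinv c u))) \<le> C) (at_right 0)"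
  proof -
    obtain C \<epsilon>\<^sub>0 where C: "\<epsilon>\<^sub>0 > 0" "\<forall>\<epsilon>\<in>{0<..1}. \<epsilon> < \<epsilon>\<^sub>0 \<longrightarrow> (\<forall>x\<in>K. dens_integral A (abs_field (\<omega> \<epsilon> x)) \<le> C)"
      using hK[THEN conjunct2, THEN conjunct1, rule_format, of "[]" "[]"] by auto
    have "eventually (\<lambda>\<epsilon>. \<forall>u\<in>B. dens_integral A (abs_field (\<omega> \<epsilon> (cinv c u))) \<le> \<bar>C\<bar>) (at_right 0)"
      using eventually_small[OF C(1)]
    proof eventually_elim
      case (elim \<epsilon>)
      show ?case
      proof
        fix u assume "u \<in> B"
        then have "dens_integral A (abs_field (\<omega> \<epsilon> (cinv c u))) \<le> C" using C(2) elim unfolding K_def by blast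
        then show "dens_integral A (abs_field (\<omega> \<epsilon> (cinv c u))) \<le> \<bar>C\<bar>" by linarith
      qed
    qed
    then show ?thesis by (intro exI[of _ "\<bar>C\<bar>"]) simp
  qed
  show "eventually (\<lambda>\<epsilon>. \<forall>u\<in>B. \<bar>1 - dens_integral A (\<omega> \<epsilon> (cinv c u))\<bar> \<le> e) (at_right 0)" if "e > 0"
  proof -
    have one: "(\<lambda>_. 1) \<in> smooth_functions A" by (rule smooth_functionsI) (rule Ck_on_const)
    have fm: "fmult (\<lambda>_. 1) \<mu> = \<mu>" for \<mu> :: "('m, 'n) tfield" by (simp add: fmult_def)
    obtain C \<epsilon>\<^sub>0 where C: "\<epsilon>\<^sub>0 > 0" "\<forall>\<epsilon>\<in>{0<..1}. \<epsilon> < \<epsilon>\<^sub>0 \<longrightarrow> (\<forall>x\<in>K. \<bar>1 - dens_integral A (\<omega> \<epsilon> x)\<bar> \<le> C * \<epsilon>)"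
      using hK[THEN conjunct2, THEN conjunct2, rule_format, OF one, of 1] unfolding fm power_one_right by blast
    have "e / (\<bar>C\<bar> + 1) > 0" using \<open>e > 0\<close> by (intro divide_pos_pos) simp_all
    with C(1) have "min \<epsilon>\<^sub>0 (e / (\<bar>C\<bar> + 1)) > 0" by simp
    from eventually_small[OF this] show ?thesis
    proof eventually_elim
      case (elim \<epsilon>)
      have "C * \<epsilon> \<le> (\<bar>C\<bar> + 1) * \<epsilon>" using elim by (intro mult_right_mono) auto
      also have "\<dots> \<le> e" using elim by (simp add: field_simps pos_less_divide_eq)
      finally have Ce: "C * \<epsilon> \<le> e" .
      show ?case
      proof
        fix u assume "u \<in> B"
        then have "\<bar>1 - dens_integral A (\<omega> \<epsilon> (cinv c u))\<bar> \<le> C * \<epsilon>" using C(2) elim unfolding K_def by auto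
        with Ce show "\<bar>1 - dens_integral A (\<omega> \<epsilon> (cinv c u))\<bar> \<le> e" by linarith
      qed
    qed
  qed
  show "eventually (\<lambda>\<epsilon>. \<forall>u\<in>B. field_support (\<omega> \<epsilon> (cinv c u)) \<subseteq> cinv c ` ball u \<eta>) (at_right 0)" if \<eta>: "0 < \<eta>" "\<eta> \<le> r"
  proof -
    obtain C \<epsilon>\<^sub>0 where C: "C > 0" "\<epsilon>\<^sub>0 > 0" "\<forall>\<epsilon>\<in>{0<..1}. \<epsilon> < \<epsilon>\<^sub>0 \<longrightarrow> (\<forall>x\<in>K. field_support (\<omega> \<epsilon> x) \<subseteq> riem_ball A h (C * \<epsilon>) x)"
      using hK[THEN conjunct1] by blast
    obtain \<rho> where \<rho>: "\<rho> > 0" "\<forall>x\<in>cdom c. cball (cmap c x) \<eta> \<subseteq> L \<longrightarrow> riem_ball A h \<rho> x \<subseteq> cinv c ` ball (cmap c x) \<eta>"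
      using riem_ball_subset_chart_ball[OF h c L \<eta>(1)] by blast
    have "min \<epsilon>\<^sub>0 (\<rho> / C) > 0" using C \<rho> by simp
    from eventually_small[OF this] show ?thesis
    proof eventually_elim
      case (elim \<epsilon>)
      show ?case
      proof
        fix u assume u: "u \<in> B"
        have x: "cinv c u \<in> cdom c" "cmap c (cinv c u) = u" using cinv_in[OF c Bc[OF u]] cmap_cinv[OF c Bc[OF u]] .
        have "field_support (\<omega> \<epsilon> (cinv c u)) \<subseteq> riem_ball A h (C * \<epsilon>) (cinv c u)"
          using C(3) elim u unfolding K_def by auto
        also have "\<dots> \<subseteq> riem_ball A h \<rho> (cinv c u)"
        proof -
          have "C * \<epsilon> \<le> \<rho>" using elim C(1) by (simp add: field_simps)
          then have "ennreal (C * \<epsilon>) \<le> ennreal \<rho>" by (rule ennreal_leI)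
          then show ?thesis unfolding riem_ball_def by (auto intro: less_le_trans)
        qed
        also have "\<dots> \<subseteq> cinv c ` ball u \<eta>"
        proof -
          have "cball u \<eta> \<subseteq> L" using r(2)[rule_format, OF u] \<eta>(2) subset_cball order.trans by metis
          then show ?thesis using \<rho>(2) x by metis
        qed
        finally show "field_support (\<omega> \<epsilon> (cinv c u)) \<subseteq> cinv c ` ball u \<eta>" .
      qed
    qed
  qed
qed

text \<open>
  In the chart the embedding at \<open>u\<close> is \<open>\<integral> m v * w v\<close> with the kernel \<open>w\<close> and the transported values \<open>m v\<close> of
  the field.  On the support of \<open>w\<close> the latter are close to the value \<open>\<tau>\<close> of the field at \<open>u\<close>, so that the
  integral differs from \<open>\<tau> * \<integral> w\<close> by at most a small multiple of \<open>\<integral> \<bar>w\<bar>\<close>, and \<open>\<integral> w\<close> is close to 1.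
\<close>

lemma iota_uniformly_close:
  assumes T: "continuous_tensor r s T" and \<Upsilon>: "\<Upsilon> \<in> admissible_nets A" and \<omega>: "\<omega> \<in> delta_nets A" and c: "c \<in> A"
    and Q: "cbox a b \<subseteq> cimg c" and B: "compact B" and \<rho>: "\<rho> > 0" "\<forall>u\<in>B. cball u \<rho> \<subseteq> cbox a b"
    and C: "C \<ge> 0" "eventually (\<lambda>\<epsilon>. \<forall>u v i j. u \<in> cbox a b \<longrightarrow> v \<in> cbox a b \<longrightarrow>
      \<bar>umat (\<Upsilon> \<epsilon>) c c (cinv c u) (cinv c v) $ i $ j - mat 1 $ i $ j\<bar> \<le> C * dist u v) (at_right 0)"
    and len: "length is = r" "length js = s" and "e > 0"
  shows "eventually (\<lambda>\<epsilon>. \<forall>u\<in>B. \<bar>iota A r s (dist_of A r s T) (\<Upsilon> \<epsilon>) (\<omega> \<epsilon>) c (cinv c u) is js - T c (cinv c u) is js\<bar> \<le> e) (at_right 0)"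
proof -
  note loc = delta_nets_local[OF \<omega> c B compact_cbox Q \<rho>]
  have BQ: "u \<in> cbox a b" if "u \<in> B" for u
    using \<rho>(1) \<rho>(2)[rule_format, OF that] by (meson centre_in_cball less_imp_le subsetD)
  obtain D where D: "D \<ge> 0" "eventually (\<lambda>\<epsilon>. \<forall>u\<in>B. dens_integral A (abs_field (\<omega> \<epsilon> (cinv c u))) \<le> D) (at_right 0)"
    using loc(2) by blast
  have Tc: "continuous_on (cbox a b) (\<lambda>v. T c (cinv c v) ks ls)" if "length ks = r" "length ls = s" for ks ls
    by (rule continuous_on_subset[OF continuous_tensorD(2)[OF T c that] Q])
  obtain M where M: "\<And>u. u \<in> cbox a b \<Longrightarrow> \<bar>T c (cinv c u) is js\<bar> \<le> M"
    using compact_imp_bounded[OF compact_continuous_image[OF Tc[OF len] compact_cbox]] unfolding bounded_iff by auto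
  define e1 where "e1 = e / (2 * (D + 1))"
  define e2 where "e2 = e / (2 * (\<bar>M\<bar> + 1))"
  have e12: "e1 > 0" "e2 > 0" using \<open>e > 0\<close> D(1) by (simp_all add: e1_def e2_def)
  obtain d where d: "d > 0" "\<And>P R u v. u \<in> cbox a b \<Longrightarrow> v \<in> cbox a b \<Longrightarrow> dist u v < d \<Longrightarrow>
    (\<forall>i j. \<bar>P $ i $ j - mat 1 $ i $ j\<bar> < d) \<Longrightarrow> (\<forall>i j. \<bar>R $ i $ j - mat 1 $ i $ j\<bar> < d) \<Longrightarrow>
    \<bar>act r s P R (T c (cinv c v)) is js - T c (cinv c u) is js\<bar> < e1"
    using act_near_identity[where \<tau>="\<lambda>v. T c (cinv c v)", OF compact_cbox Tc len e12(1)] by blast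
  \<comment> \<open>for \<open>v\<close> in the ball of radius \<open>\<eta>\<close> both \<open>dist u v\<close> and the bound \<open>C * dist u v\<close> for the
    distance of the transport matrices from the identity are less than \<open>d\<close>\<close>
  define \<eta> where "\<eta> = min \<rho> (d / (2 * (C + 1)))"
  have \<eta>: "0 < \<eta>" "\<eta> \<le> \<rho>" using \<rho>(1) d(1) C(1) by (simp_all add: \<eta>_def)
  have "(C + 1) * \<eta> \<le> (C + 1) * (d / (2 * (C + 1)))" using C(1) by (intro mult_left_mono) (simp_all add: \<eta>_def)
  also have "\<dots> = d / 2" using C(1) by (simp add: field_simps)
  finally have C\<eta>: "(C + 1) * \<eta> < d" using d(1) by linarith
  have \<eta>d: "\<eta> < d" using C\<eta> C(1) \<eta>(1) mult_right_mono[of 1 "C + 1" \<eta>] by linarith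
  have "\<forall>\<epsilon>\<in>{0<..1}. \<Upsilon> \<epsilon> \<in> TO A"
    using \<Upsilon>[unfolded admissible_nets_def mem_Collect_eq, THEN conjunct1] .
  then have evTO: "eventually (\<lambda>\<epsilon>. \<Upsilon> \<epsilon> \<in> TO A) (at_right 0)"
    using eventually_small[OF zero_less_one] by (auto elim: eventually_mono)
  show ?thesis
    using evTO loc(1) D(2) loc(3)[OF e12(2)] loc(4)[OF \<eta>] C(2)
  proof eventually_elim
    case (elim \<epsilon>)
    show ?case
    proof
      fix u assume u: "u \<in> B"
      have uQ: "u \<in> cbox a b" "u \<in> cimg c" using BQ[OF u] Q by auto
      define x where "x = cinv c u"
      define w where "w = coord (\<omega> \<epsilon> x) c"
      define m where "m v = act r s (umat (\<Upsilon> \<epsilon>) c c x (cinv c v)) (umat (\<Upsilon> \<epsilon>) c c (cinv c v) x) (T c (cinv c v)) is js" for v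
      define \<tau> where "\<tau> = T c x is js"
      have td: "\<omega> \<epsilon> x \<in> test_densities A 0 0" using elim(2) SK_test_density by blast
      note sd = test_density_scalar[OF td]
      have supp: "field_support (\<omega> \<epsilon> x) \<subseteq> cinv c ` ball u \<eta>" using elim(5) u by (simp add: x_def)
      have ball_sub: "ball u \<eta> \<subseteq> cbox a b"
        using \<rho>(2)[rule_format, OF u] \<eta>(2) ball_subset_cball[of u \<eta>] subset_cball[of \<eta> \<rho> u] by blast
      have suppQ: "field_support (\<omega> \<epsilon> x) \<subseteq> cinv c ` cbox a b" using supp ball_sub by blast
      have wc: "continuous_on (cbox a b) w" unfolding w_def
        by (rule continuous_on_subset[OF scalar_densityD(3)[OF sd c] Q])
      have int_w: "dens_integral A (\<omega> \<epsilon> x) = integral (cbox a b) w"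
        unfolding w_def by (rule dens_integral_chart[OF sd c suppQ Q])
      have int_aw: "dens_integral A (abs_field (\<omega> \<epsilon> x)) = integral (cbox a b) (\<lambda>v. \<bar>w v\<bar>)"
        using dens_integral_chart[OF abs_field_density[OF sd] c suppQ Q] by (simp add: w_def coord_def[abs_def] abs_field_def)
      have x: "x \<in> cdom c" "cmap c x = u" unfolding x_def using cinv_in[OF c uQ(2)] cmap_cinv[OF c uQ(2)] .
      have iota: "iota A r s (dist_of A r s T) (\<Upsilon> \<epsilon>) (\<omega> \<epsilon>) c x is js = integral (cbox a b) (\<lambda>v. m v * w v)"
        unfolding m_def w_def x_def by (rule iota_in_chart[OF T elim(1,2) c Q uQ(2) suppQ[unfolded x_def] len])
      have mc: "continuous_on (cbox a b) (\<lambda>v. m v * w v)"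
      proof -
        have "continuous_on (cimg c) (coord (contraction r s T (Psi A (\<Upsilon> \<epsilon>) (\<omega> \<epsilon>) c x (axes is) (axes js))) c)"
          by (rule scalar_densityD(3)[OF embedding_density[where \<omega>="\<omega> \<epsilon>" and x=x, OF T elim(1) td c x(1) len] c])
        then have "continuous_on (cimg c) (\<lambda>v. m v * w v)"
          unfolding coord_def[abs_def] contraction_Psi[where \<omega>="\<omega> \<epsilon>" and x=x, OF td len] m_def w_def .
        then show ?thesis by (rule continuous_on_subset[OF _ Q])
      qed
      have pt: "\<bar>m v * w v - \<tau> * w v\<bar> \<le> e1 * \<bar>w v\<bar>" if v: "v \<in> cbox a b" for v
      proof (cases "w v = 0")
        case False
        have vc: "v \<in> cimg c" using v Q by blast
        have "cinv c v \<in> field_support (\<omega> \<epsilon> x)"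
          using scalar_densityD(1)[OF sd, of c "cinv c v"] False by (simp add: w_def coord_def)
        then obtain v' where "v' \<in> ball u \<eta>" "cinv c v = cinv c v'" using supp by blast
        moreover then have "v' \<in> cimg c" using ball_sub Q by blast
        ultimately have "v \<in> ball u \<eta>" using cmap_cinv[OF c vc] cmap_cinv[OF c, of v'] by metis
        then have duv: "dist u v < \<eta>" "dist v u < \<eta>" by (simp_all add: dist_commute)
        have cl: "C * dist u v < d" "C * dist v u < d"
        proof -
          have "C * dist u v \<le> (C + 1) * \<eta>" using duv C(1) by (intro mult_mono) auto
          then show "C * dist u v < d" using C\<eta> by linarith
          then show "C * dist v u < d" by (simp add: dist_commute)
        qed
        have "\<bar>m v - \<tau>\<bar> < e1" unfolding m_def \<tau>_def x_def
        proof (rule d(2)[OF uQ(1) v])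
          show "dist u v < d" using duv \<eta>d by linarith
          show "\<forall>i j. \<bar>umat (\<Upsilon> \<epsilon>) c c (cinv c u) (cinv c v) $ i $ j - mat 1 $ i $ j\<bar> < d"
            using elim(6) uQ(1) v cl(1) by (meson le_less_trans)
          show "\<forall>i j. \<bar>umat (\<Upsilon> \<epsilon>) c c (cinv c v) (cinv c u) $ i $ j - mat 1 $ i $ j\<bar> < d"
            using elim(6) uQ(1) v cl(2) by (meson le_less_trans)
        qed
        then have "\<bar>m v - \<tau>\<bar> * \<bar>w v\<bar> \<le> e1 * \<bar>w v\<bar>" by (intro mult_right_mono) auto
        then show ?thesis by (simp add: abs_mult[symmetric] left_diff_distrib)
      qed simp
      have i1: "(\<lambda>v. m v * w v) integrable_on cbox a b" "(\<lambda>v. \<tau> * w v) integrable_on cbox a b"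
        "(\<lambda>v. e1 * \<bar>w v\<bar>) integrable_on cbox a b" "w integrable_on cbox a b"
        by (intro integrable_continuous mc continuous_intros wc)+
      have "norm (integral (cbox a b) (\<lambda>v. m v * w v - \<tau> * w v)) \<le> integral (cbox a b) (\<lambda>v. e1 * \<bar>w v\<bar>)"
        by (rule integral_norm_bound_integral[OF integrable_diff[OF i1(1,2)] i1(3)]) (use pt in simp)
      also have "\<dots> = e1 * dens_integral A (abs_field (\<omega> \<epsilon> x))" unfolding int_aw by simp
      also have "\<dots> \<le> e1 * D" using elim(3) u e12(1) by (simp add: x_def)
      also have "\<dots> \<le> e / 2"
      proof -
        have "e1 * D \<le> e1 * (D + 1)" using e12(1) by simp
        also have "\<dots> = e / 2" using D(1) by (simp add: e1_def field_simps)
        finally show ?thesis .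
      qed
      finally have p1: "\<bar>integral (cbox a b) (\<lambda>v. m v * w v) - \<tau> * integral (cbox a b) w\<bar> \<le> e / 2"
        using integral_diff[OF i1(1,2)] by simp
      have "\<bar>\<tau> * (1 - integral (cbox a b) w)\<bar> \<le> \<bar>M\<bar> * e2"
        unfolding abs_mult
      proof (rule mult_mono)
        show "\<bar>\<tau>\<bar> \<le> \<bar>M\<bar>" using M[OF uQ(1)] by (simp add: \<tau>_def x_def)
        show "\<bar>1 - integral (cbox a b) w\<bar> \<le> e2" using elim(4)[rule_format, OF u] unfolding x_def[symmetric] int_w .
      qed simp_all
      also have "\<dots> \<le> (\<bar>M\<bar> + 1) * e2" using e12(2) by simp
      also have "\<dots> = e / 2" by (simp add: e2_def field_simps)
      finally have p2: "\<bar>\<tau> * integral (cbox a b) w - \<tau>\<bar> \<le> e / 2"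
        by (simp add: right_diff_distrib abs_minus_commute)
      show "\<bar>iota A r s (dist_of A r s T) (\<Upsilon> \<epsilon>) (\<omega> \<epsilon>) c (cinv c u) is js - T c (cinv c u) is js\<bar> \<le> e"
        using p1 p2 iota unfolding x_def[symmetric] \<tau>_def[symmetric] by linarith
    qed
  qed
qed

end

section \<open>Integration by parts\<close>

lemma Ck_on_extend_zero:
  assumes "open U" "closed L" "Ck_on k U h" "\<And>u. u \<in> U - L \<Longrightarrow> h u = 0" "L \<subseteq> U"
  shows "Ck_on k UNIV (\<lambda>u. if u \<in> U then h u else 0)"
proof (rule Ck_on_local)
  fix u
  show "\<exists>V. open V \<and> u \<in> V \<and> Ck_on k V (\<lambda>u. if u \<in> U then h u else 0)"
  proof (cases "u \<in> U")
    case True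
    have "Ck_on k U (\<lambda>u. if u \<in> U then h u else 0)"
      by (rule Ck_on_eqI[OF assms(1,3)]) simp
    then show ?thesis using True assms(1) by blast
  next
    case False
    have op: "open (- L)" using assms(2) by (rule open_Compl)
    have "Ck_on k (- L) (\<lambda>u. if u \<in> U then h u else 0)"
      by (rule Ck_on_eqI[OF op Ck_on_const[of k _ 0]]) (use assms(4) in auto)
    then show ?thesis using False assms(5) op by blast
  qed
qed

lemma integral_superset_zero:
  fixes g :: "'a::euclidean_space \<Rightarrow> real"
  assumes "continuous_on (cbox a b) g" "\<And>u. u \<notin> cbox a b \<Longrightarrow> g u = 0"
  shows "integral (cbox a b) g = integral UNIV g"
proof -
  have "(g has_integral integral (cbox a b) g) (cbox a b)"
    using integrable_continuous[OF assms(1)] by (rule integrable_integral)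
  from has_integral_on_superset[OF this assms(2), of UNIV] show ?thesis
    by (simp add: integral_unique)
qed

text \<open>
  The integral of \<open>f (u + t e)\<close> over a box that contains all translates of the support for \<open>\<bar>t\<bar> < 1\<close> does
  not depend on \<open>t\<close>, by the translation invariance of the Lebesgue measure.  Its derivative at \<open>t = 0\<close> is
  the integral in question.
\<close>

lemma integral_directional_derivative_eq_0:
  fixes f :: "'a::euclidean_space \<Rightarrow> real"
  assumes f: "Ck_on (Suc 0) UNIV f" and L: "compact L" "L \<subseteq> cbox a b" and zero: "\<And>u. u \<notin> L \<Longrightarrow> f u = 0"
    and e: "e \<in> Basis"
  shows "integral (cbox a b) (\<lambda>u. frechet_derivative f (at u) e) = 0"
proof -
  define D where "D u = frechet_derivative f (at u) e" for u
  have fc: "continuous_on S f" for S using Ck_on_continuous[OF f] continuous_on_subset by blast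
  have Dc: "continuous_on S D" for S
  proof -
    have "continuous_on UNIV D" using f e by (simp add: D_def[abs_def])
    then show ?thesis by (rule continuous_on_subset) simp
  qed
  have Dz: "D u = 0" if "u \<notin> L" for u
  proof -
    have "((\<lambda>u. 0) has_derivative (\<lambda>h. 0)) (at u)" by simp
    then have "(f has_derivative (\<lambda>h. 0)) (at u)"
      by (rule has_derivative_transform_within_open[of _ _ _ _ "- L"]) (use that zero compact_imp_closed[OF L(1)] in auto)
    then show ?thesis unfolding D_def by (simp add: frechet_derivative_at[symmetric])
  qed
  define M where "M = (\<lambda>(x, y). x + y) ` (L \<times> cball (0 :: 'a) 1)"
  have "bounded M" unfolding M_def
    by (intro compact_imp_bounded compact_continuous_image compact_Times L compact_cball)
      (auto simp: case_prod_unfold intro!: continuous_intros)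
  then obtain a' where a': "M \<subseteq> cbox (- a') a'" using bounded_subset_cbox_symmetric by blast
  have LM: "u \<in> cbox (- a') a'" if "u + t *\<^sub>R e \<in> L" "\<bar>t\<bar> < 1" for u t
  proof -
    have "u = (\<lambda>(x, y). x + y) (u + t *\<^sub>R e, - t *\<^sub>R e)" by simp
    moreover have "(u + t *\<^sub>R e, - t *\<^sub>R e) \<in> L \<times> cball 0 1" using that e by simp
    ultimately have "u \<in> M" unfolding M_def by blast
    then show ?thesis using a' by blast
  qed
  define h where "h t = integral (cbox (- a') a') (\<lambda>u. f (u + t *\<^sub>R e))" for t
  have "integrable lborel (\<lambda>u. indicator L u *\<^sub>R f u)" by (rule borel_integrable_compact[OF L(1) fc])
  moreover have "(\<lambda>u. indicator L u *\<^sub>R f u) = f" by (rule ext) (use zero in \<open>auto simp: indicator_def\<close>)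
  ultimately have fint: "integrable lborel f" by simp
  have ht: "h t = integral\<^sup>L lborel f" if "\<bar>t\<bar> < 1" for t
  proof -
    have "h t = integral UNIV (\<lambda>u. f (u + t *\<^sub>R e))" unfolding h_def
    proof (rule integral_superset_zero)
      show "continuous_on (cbox (- a') a') (\<lambda>u. f (u + t *\<^sub>R e))"
        by (rule continuous_on_compose2[OF fc[of UNIV]]) (auto intro!: continuous_intros)
      show "f (u + t *\<^sub>R e) = 0" if "u \<notin> cbox (- a') a'" for u
        using LM[OF _ \<open>\<bar>t\<bar> < 1\<close>] that zero by blast
    qed
    also have "\<dots> = integral\<^sup>L lborel (\<lambda>u. f (t *\<^sub>R e + u))"
    proof -
      have "integrable (distr lborel borel ((+) (t *\<^sub>R e))) f" using fint by (simp add: lborel_distr_plus)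
      then have "integrable lborel (\<lambda>u. f (t *\<^sub>R e + u))" by (rule integrable_distr[rotated]) simp
      then show ?thesis by (simp add: integral_lborel add.commute)
    qed
    also have "\<dots> = integral\<^sup>L (distr lborel borel ((+) (t *\<^sub>R e))) f"
      by (rule integral_distr[symmetric]) (use borel_measurable_integrable[OF fint] in simp_all)
    finally show ?thesis by (simp add: lborel_distr_plus)
  qed
  have "(h has_real_derivative integral (cbox (- a') a') (\<lambda>u. D (u + 0 *\<^sub>R e))) (at 0 within {- 1<..<1})"
    unfolding h_def
  proof (rule leibniz_rule_field_derivative)
    fix t :: real and u :: 'a
    have "((\<lambda>h. f (u + t *\<^sub>R e + h *\<^sub>R e)) has_real_derivative D (u + t *\<^sub>R e)) (at 0)"
      unfolding D_def by (rule has_derivative_along_line[OF Ck_on_SucD[OF f open_UNIV UNIV_I]])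
    then show "((\<lambda>t. f (u + t *\<^sub>R e)) has_real_derivative D (u + t *\<^sub>R e)) (at t within {- 1<..<1})"
      by (rule has_field_derivative_at_within[OF has_real_derivative_line_shift[where f=f]])
  next
    show "(\<lambda>u. f (u + t *\<^sub>R e)) integrable_on cbox (- a') a'" for t
      by (rule integrable_continuous, rule continuous_on_compose2[OF fc[of UNIV]]) (auto intro!: continuous_intros)
  next
    have "continuous_on ({- 1<..<1} \<times> cbox (- a') a') (\<lambda>p. D (snd p + fst p *\<^sub>R e))"
      by (rule continuous_on_compose2[OF Dc[of UNIV]]) (auto intro!: continuous_intros)
    then show "continuous_on ({- 1<..<1} \<times> cbox (- a') a') (\<lambda>(t, u). D (u + t *\<^sub>R e))"
      by (simp add: case_prod_unfold)
  qed auto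
  then have "(h has_real_derivative integral (cbox (- a') a') D) (at 0)"
    using at_within_open[of "0 :: real" "{- 1<..<1}"] by simp
  moreover have "(h has_real_derivative 0) (at 0)"
  proof (rule DERIV_cong_ev[THEN iffD2, OF refl _ refl DERIV_const])
    show "eventually (\<lambda>t. h t = integral\<^sup>L lborel f) (nhds 0)"
      using eventually_nhds_in_open[of "{- 1<..<1}" "0 :: real"] by (auto elim!: eventually_mono intro!: ht)
  qed
  ultimately have "integral (cbox (- a') a') D = 0" by (rule DERIV_unique)
  moreover have "integral (cbox (- a') a') D = integral UNIV D"
    by (rule integral_superset_zero[OF Dc], rule Dz) (use LM[of _ 0] in auto)
  moreover have "integral (cbox a b) D = integral UNIV D"
    by (rule integral_superset_zero[OF Dc], rule Dz) (use L in auto)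
  ultimately show ?thesis by (simp add: D_def[abs_def])
qed

text \<open>
  The core of the argument.  With \<open>q i = \<psi> * z i\<close> the sum of the terms \<open>q i * \<partial>\<^sub>i R\<close> equals the divergence
  of the field \<open>q i * R\<close>, whose integral vanishes, minus the sum of the terms \<open>\<partial>\<^sub>i (q i) * R\<close>.  What is
  left contains \<open>R\<close> and \<open>H\<close> undifferentiated, and these tend to 0 uniformly on the support of \<open>\<psi>\<close>.
\<close>

lemma weak_derivative_limit:
  fixes z :: "real^'n \<Rightarrow> 'n \<Rightarrow> real" and \<psi> :: "real^'n \<Rightarrow> real"
    and R H f :: "real \<Rightarrow> real^'n \<Rightarrow> real"
  assumes U: "open U" and L: "compact L" "L \<subseteq> U" "L \<subseteq> cbox a b"
    and \<psi>: "Ck_on (Suc 0) U \<psi>" "\<And>u. u \<in> U - L \<Longrightarrow> \<psi> u = 0"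
    and z: "\<And>i. Ck_on (Suc 0) U (\<lambda>u. z u i)"
    and RH: "eventually (\<lambda>\<epsilon>. Ck_on (Suc 0) U (R \<epsilon>) \<and> continuous_on U (H \<epsilon>)) F"
    and small: "\<And>e. e > 0 \<Longrightarrow> eventually (\<lambda>\<epsilon>. \<forall>u\<in>L. \<bar>R \<epsilon> u\<bar> \<le> e \<and> \<bar>H \<epsilon> u\<bar> \<le> e) F"
    and f: "eventually (\<lambda>\<epsilon>. \<forall>u\<in>cbox a b. f \<epsilon> u = (if u \<in> U then
      ((\<Sum>i\<in>UNIV. z u i * frechet_derivative (R \<epsilon>) (at u) (axis i 1)) + H \<epsilon> u) * \<psi> u else 0)) F"
  shows "((\<lambda>\<epsilon>. integral (cbox a b) (f \<epsilon>)) \<longlongrightarrow> 0) F"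
proof -
  have Lc: "closed L" using L(1) by (rule compact_imp_closed)
  define q where "q i u = \<psi> u * z u i" for i u
  have q: "Ck_on (Suc 0) U (q i)" for i unfolding q_def[abs_def] by (intro Ck_on_mult U \<psi>(1) z)
  have qz: "q i u = 0" if "u \<in> U - L" for i u using \<psi>(2)[OF that] by (simp add: q_def)
  have opUL: "open (U - L)" using U Lc by (rule open_Diff)
  define dq where "dq i u = frechet_derivative (q i) (at u) (axis i 1)" for i u
  have dqc: "continuous_on U (dq i)" for i
    using q[of i] by (simp add: dq_def[abs_def] axis_in_Basis_iff)
  have dqz: "dq i u = 0" if "u \<in> U - L" for i u
  proof -
    have "((\<lambda>u. 0) has_derivative (\<lambda>h. 0)) (at u)" by simp
    then have "(q i has_derivative (\<lambda>h. 0)) (at u)"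
      by (rule has_derivative_transform_within_open[OF _ opUL that]) (simp add: qz)
    then show ?thesis unfolding dq_def by (simp add: frechet_derivative_at[symmetric])
  qed
  define m where "m u = (if u \<in> U then (\<Sum>i\<in>UNIV. \<bar>dq i u\<bar>) + \<bar>\<psi> u\<bar> else 0)" for u
  have ext: "continuous_on UNIV (\<lambda>u. if u \<in> U then h u else 0)"
    if "continuous_on U h" "\<And>u. u \<in> U - L \<Longrightarrow> h u = 0" for h :: "real^'n \<Rightarrow> real"
    using Ck_on_extend_zero[of U L 0 h] U Lc L(2) that by simp
  have \<psi>c: "continuous_on U \<psi>" by (rule Ck_on_continuous[OF \<psi>(1)])
  have mc: "continuous_on UNIV m" unfolding m_def[abs_def]
    by (rule ext) (auto intro!: continuous_intros dqc \<psi>c simp: dqz \<psi>(2))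
  define I where "I = integral (cbox a b) m"
  have "I \<ge> 0" unfolding I_def
    by (intro integral_nonneg integrable_continuous continuous_on_subset[OF mc]) (auto simp: m_def sum_nonneg)
  have bound: "eventually (\<lambda>\<epsilon>. \<bar>integral (cbox a b) (f \<epsilon>)\<bar> \<le> e * I) F" if e: "e > 0" for e
    using RH small[OF e] f
  proof eventually_elim
    case (elim \<epsilon>)
    have R: "Ck_on (Suc 0) U (R \<epsilon>)" and H: "continuous_on U (H \<epsilon>)" using elim(1) by auto
    have Rc: "continuous_on U (R \<epsilon>)" by (rule Ck_on_continuous[OF R])
    define p where "p i u = (if u \<in> U then q i u * R \<epsilon> u else 0)" for i u
    have p: "Ck_on (Suc 0) UNIV (p i)" for i unfolding p_def[abs_def]
      by (rule Ck_on_extend_zero[OF U Lc Ck_on_mult[OF U q R] _ L(2)]) (simp add: qz)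
    have pz: "p i u = 0" if "u \<notin> L" for i u using that qz by (auto simp: p_def)
    define dp where "dp i u = frechet_derivative (p i) (at u) (axis i 1)" for i u
    have dpc: "continuous_on UNIV (dp i)" for i using p[of i] by (simp add: dp_def[abs_def] axis_in_Basis_iff)
    have int_dp: "integral (cbox a b) (dp i) = 0" for i unfolding dp_def
      by (rule integral_directional_derivative_eq_0[OF p L(1,3) pz]) (simp_all add: axis_in_Basis_iff)
    have dpU: "dp i u = dq i u * R \<epsilon> u + q i u * frechet_derivative (R \<epsilon>) (at u) (axis i 1)" if u: "u \<in> U" for i u
    proof -
      have "((\<lambda>u. q i u * R \<epsilon> u) has_derivative (\<lambda>h. q i u * frechet_derivative (R \<epsilon>) (at u) h
          + frechet_derivative (q i) (at u) h * R \<epsilon> u)) (at u)"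
        by (rule has_derivative_mult[OF Ck_on_SucD[OF q U u] Ck_on_SucD[OF R U u]])
      then have "(p i has_derivative (\<lambda>h. q i u * frechet_derivative (R \<epsilon>) (at u) h
          + frechet_derivative (q i) (at u) h * R \<epsilon> u)) (at u)"
        by (rule has_derivative_transform_within_open[OF _ U u]) (simp add: p_def)
      then show ?thesis unfolding dp_def dq_def by (simp add: frechet_derivative_at[symmetric])
    qed
    have dpz: "dp i u = 0" if "u \<notin> U" for i u
    proof -
      have "u \<in> - L" "open (- L)" using that L(2) Lc by auto
      have "((\<lambda>u. 0) has_derivative (\<lambda>h. 0)) (at u)" by simp
      then have "(p i has_derivative (\<lambda>h. 0)) (at u)"
        by (rule has_derivative_transform_within_open[OF _ \<open>open (- L)\<close> \<open>u \<in> - L\<close>]) (simp add: pz)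
      then show ?thesis unfolding dp_def by (simp add: frechet_derivative_at[symmetric])
    qed
    define g where "g u = (if u \<in> U then H \<epsilon> u * \<psi> u - (\<Sum>i\<in>UNIV. dq i u) * R \<epsilon> u else 0)" for u
    have gc: "continuous_on UNIV g" unfolding g_def[abs_def]
      by (rule ext) (auto intro!: continuous_intros dqc \<psi>c Rc H simp: dqz \<psi>(2))
    have fg: "f \<epsilon> u = g u + (\<Sum>i\<in>UNIV. dp i u)" if "u \<in> cbox a b" for u
    proof (cases "u \<in> U")
      case True
      then show ?thesis using elim(3) that
        by (simp add: g_def dpU q_def sum.distrib sum_distrib_left sum_distrib_right algebra_simps)
    next
      case False
      then show ?thesis using elim(3) that by (simp add: g_def dpz)
    qed
    have "integral (cbox a b) (f \<epsilon>) = integral (cbox a b) (\<lambda>u. g u + (\<Sum>i\<in>UNIV. dp i u))"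
      by (rule integral_cong) (rule fg)
    also have "\<dots> = integral (cbox a b) g + integral (cbox a b) (\<lambda>u. \<Sum>i\<in>UNIV. dp i u)"
      by (intro integral_add integrable_continuous continuous_on_subset[OF gc] continuous_on_sum continuous_on_subset[OF dpc]) auto
    also have "integral (cbox a b) (\<lambda>u. \<Sum>i\<in>UNIV. dp i u) = (\<Sum>i\<in>UNIV. integral (cbox a b) (dp i))"
      by (intro integral_sum integrable_continuous continuous_on_subset[OF dpc]) auto
    finally have eq: "integral (cbox a b) (f \<epsilon>) = integral (cbox a b) g" by (simp add: int_dp)
    have "norm (integral (cbox a b) g) \<le> integral (cbox a b) (\<lambda>u. e * m u)"
    proof (rule integral_norm_bound_integral)
      show "g integrable_on cbox a b" "(\<lambda>u. e * m u) integrable_on cbox a b"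
        by (intro integrable_continuous continuous_on_subset[OF gc] continuous_intros continuous_on_subset[OF mc] subset_UNIV)+
      fix u assume "u \<in> cbox a b"
      consider "u \<in> L" | "u \<in> U - L" | "u \<notin> U" by blast
      then show "norm (g u) \<le> e * m u"
      proof cases
        case 1
        then have uU: "u \<in> U" and small: "\<bar>R \<epsilon> u\<bar> \<le> e" "\<bar>H \<epsilon> u\<bar> \<le> e" using L(2) elim(2) by auto
        have "\<bar>g u\<bar> \<le> \<bar>H \<epsilon> u\<bar> * \<bar>\<psi> u\<bar> + \<bar>\<Sum>i\<in>UNIV. dq i u\<bar> * \<bar>R \<epsilon> u\<bar>"
          using uU by (simp add: g_def abs_mult[symmetric] abs_triangle_ineq4)
        also have "\<dots> \<le> e * \<bar>\<psi> u\<bar> + (\<Sum>i\<in>UNIV. \<bar>dq i u\<bar>) * e"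
          by (intro add_mono mult_mono small sum_abs) (use e in \<open>auto simp: sum_nonneg\<close>)
        also have "\<dots> = e * m u" using uU by (simp add: m_def algebra_simps)
        finally show ?thesis by simp
      qed (simp_all add: g_def m_def dqz \<psi>(2))
    qed
    also have "\<dots> = e * I" by (simp add: I_def)
    finally show ?case by (simp add: eq)
  qed
  show ?thesis
  proof (rule tendstoI)
    fix e :: real assume "e > 0"
    have "e / (I + 1) > 0" using \<open>e > 0\<close> \<open>I \<ge> 0\<close> by simp
    from bound[OF this] show "eventually (\<lambda>\<epsilon>. dist (integral (cbox a b) (f \<epsilon>)) 0 < e) F"
    proof eventually_elim
      case (elim \<epsilon>)
      have "e / (I + 1) * I < e" using \<open>e > 0\<close> \<open>I \<ge> 0\<close> by (simp add: field_simps)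
      then show ?case using elim by simp
    qed
  qed
qed

section \<open>Weak convergence and localisation\<close>

context manifold begin

lemma pairing_cmult_right: "pairing r s t (\<lambda>js is. a * \<psi> js is) = a * pairing r s t \<psi>"
  by (simp add: pairing_def sum_distrib_left mult_ac)

text \<open>
  The fields that occur here are only known to be continuous, and to transform as tensors, on a
  neighbourhood \<open>V\<close> of the support of the test density; outside of \<open>V\<close> the contraction vanishes.
\<close>

lemma pairing_density:
  assumes \<Psi>: "\<Psi> \<in> test_densities A s r" and c: "c \<in> A" and V: "open V" "V \<subseteq> cdom c" and supp: "field_support \<Psi> \<subseteq> V"
    and E: "\<And>d y is js. d \<in> A \<Longrightarrow> y \<in> V \<Longrightarrow> y \<in> cdom d \<Longrightarrow> length is = r \<Longrightarrow> length js = s \<Longrightarrow>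
      E d y is js = act r s (jac c d y) (jac d c y) (E c y) is js"
    and Ec: "\<And>is js. length is = r \<Longrightarrow> length js = s \<Longrightarrow> continuous_on (cmap c ` V) (\<lambda>u. E c (cinv c u) is js)"
  shows "scalar_density (field_support \<Psi>) (contraction r s E \<Psi>)"
proof -
  define \<mu> where "\<mu> = contraction r s E \<Psi>"
  have \<mu>: "\<mu> d y [] [] = pairing r s (E d y) (\<Psi> d y)" for d y
    unfolding \<mu>_def by (rule contraction_pairing)
  note f = test_densitiesD(1)[OF \<Psi>]
  have nz: "d \<in> A \<and> y \<in> cdom d \<and> y \<in> field_support \<Psi>" if ne: "\<mu> d y [] [] \<noteq> 0" for d y
  proof -
    have "\<exists>is js. \<Psi> d y js is \<noteq> 0"
    proof (rule ccontr)
      assume "\<not> ?thesis"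
      then show False using ne by (simp add: \<mu> pairing_def)
    qed
    then obtain "is" js where nz: "\<Psi> d y js is \<noteq> 0" by blast
    then show ?thesis using is_field_zero[OF f, of d y js "is"] field_support_subset[of \<Psi> d y js "is", OF nz] by blast
  qed
  have tr: "\<mu> e y [] [] = \<bar>det (jac e d y)\<bar> * \<mu> d y [] []" if d: "d \<in> A" "e \<in> A" and y: "y \<in> cdom d" "y \<in> cdom e" for d e y
  proof (cases "y \<in> V")
    case False
    then have "y \<notin> field_support \<Psi>" using supp by blast
    then have "\<mu> e y [] [] = 0" "\<mu> d y [] [] = 0" using nz by blast+
    then show ?thesis by simp
  next
    case True
    have yc: "y \<in> cdom c" using True V(2) by blast
    have "E e y is js = act r s (jac d e y) (jac e d y) (E d y) is js" if len: "length is = r" "length js = s" for "is" js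
    proof -
      have "act r s (jac d e y) (jac e d y) (E d y) is js
          = act r s (jac d e y) (jac e d y) (act r s (jac c d y) (jac d c y) (E c y)) is js"
        by (rule act_cong) (rule E[OF d(1) True y(1)])
      also have "\<dots> = act r s (jac c e y) (jac e c y) (E c y) is js"
        unfolding act_act jac_comp[OF c d yc y] jac_comp[OF d(2,1) c y(2,1) yc] ..
      finally show ?thesis using E[OF d(2) True y(2) len] by simp
    qed
    moreover have "\<Psi> e y js is = \<bar>det (jac e d y)\<bar> * act s r (jac d e y) (jac e d y) (\<Psi> d y) js is"
      if "length is = r" "length js = s" for "is" js
      using is_field_act[OF f d y that(2,1)] by simp
    ultimately have "\<mu> e y [] [] = pairing r s (act r s (jac d e y) (jac e d y) (E d y))
        (\<lambda>js is. \<bar>det (jac e d y)\<bar> * act s r (jac d e y) (jac e d y) (\<Psi> d y) js is)"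
      unfolding \<mu> by (intro pairing_cong)
    also have "\<dots> = \<bar>det (jac e d y)\<bar> * \<mu> d y [] []"
      unfolding pairing_cmult_right \<mu> pairing_inverse_act[OF jac_inverse[OF d y]] ..
    finally show ?thesis .
  qed
  have cont_c: "continuous_on (cmap c ` V) (\<lambda>u. \<mu> c (cinv c u) [] [])"
    unfolding \<mu> pairing_def
  proof (intro continuous_on_sum continuous_on_mult)
    show "continuous_on (cmap c ` V) (\<lambda>u. \<Psi> c (cinv c u) js is)" for "is" js
      by (rule continuous_on_subset[OF Ck_on_continuous[OF test_densitiesD(2)[OF \<Psi> c]]]) (use V in \<open>auto simp: cimg_def\<close>)
  qed (use Ec in auto)
  have "Ck_on 0 (cimg d) (\<lambda>u. \<mu> d (cinv d u) [] [])" if d: "d \<in> A" for d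
  proof (rule Ck_on_chart_local[OF d])
    fix x assume x: "x \<in> cdom d"
    show "\<exists>c\<in>A. \<exists>W. open W \<and> x \<in> W \<and> W \<subseteq> cdom c \<and> Ck_on 0 (cmap c ` W) (\<lambda>u. \<mu> d (cinv c u) [] [])"
    proof (cases "x \<in> V")
      case True
      define W where "W = V \<inter> cdom d"
      have W: "open W" "x \<in> W" "W \<subseteq> cdom c" "W \<subseteq> cdom d" "W \<subseteq> V"
        using True V x open_cdom[OF d] by (auto simp: W_def)
      have "continuous_on (cmap c ` W) (\<lambda>u. jac d c (cinv c u) $ i $ j)" for i j
        by (rule Ck_on_continuous[OF Ck_on_jac'[OF d c c W(1), of 0]]) (use W in auto)
      then have "continuous_on (cmap c ` W) (\<lambda>u. \<bar>det (jac d c (cinv c u))\<bar> * \<mu> c (cinv c u) [] [])"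
        unfolding det_def
        by (intro continuous_on_mult continuous_on_rabs continuous_on_sum continuous_on_prod continuous_on_const
          continuous_on_subset[OF cont_c image_mono[OF W(5)]])
      moreover have "\<bar>det (jac d c (cinv c u))\<bar> * \<mu> c (cinv c u) [] [] = \<mu> d (cinv c u) [] []" if u: "u \<in> cmap c ` W" for u
      proof -
        obtain y where y: "y \<in> W" "u = cmap c y" using u by blast
        then have "y \<in> cdom c" "y \<in> cdom d" using W by auto
        then show ?thesis using tr[OF c d] y(2) by (simp add: cinv_cmap[OF c])
      qed
      ultimately have "Ck_on 0 (cmap c ` W) (\<lambda>u. \<mu> d (cinv c u) [] [])"
        by (simp cong: continuous_on_cong)
      then show ?thesis using c W by blast
    next
      case False
      define W where "W = cdom d - field_support \<Psi>"
      have W: "open W" "x \<in> W" "W \<subseteq> cdom d"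
        using False supp x open_cdom[OF d] by (auto simp: W_def field_support_def)
      have "\<mu> d (cinv d u) [] [] = 0" if u: "u \<in> cmap d ` W" for u
      proof -
        obtain y where y: "y \<in> W" "u = cmap d y" using u by blast
        then have "cinv d u \<notin> field_support \<Psi>" using cinv_cmap[OF d, of y] by (auto simp: W_def)
        then show ?thesis using nz by blast
      qed
      then have "Ck_on 0 (cmap d ` W) (\<lambda>u. \<mu> d (cinv d u) [] [])"
        by (simp cong: continuous_on_cong)
      then show ?thesis using d W by blast
    qed
  qed
  then have "continuous_on (cimg d) (coord \<mu> d)" if "d \<in> A" for d
    using that by (simp add: coord_def[abs_def])
  then have "scalar_density (field_support \<Psi>) \<mu>"
    unfolding scalar_density_def using nz tr by blast
  then show ?thesis by (simp add: \<mu>_def)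
qed

end

lemma contraction_add_right:
  "contraction r s E (\<lambda>c x js is. \<Psi> c x js is + \<Phi> c x js is) c x [] []
    = contraction r s E \<Psi> c x [] [] + contraction r s E \<Phi> c x [] []"
  by (simp add: contraction_def distrib_left sum.distrib)

context manifold begin

lemma scalar_density_mono: "scalar_density K \<mu> \<Longrightarrow> K \<subseteq> K' \<Longrightarrow> scalar_density K' \<mu>"
  unfolding scalar_density_def by blast

lemma test_densities_fmult:
  assumes \<Psi>: "\<Psi> \<in> test_densities A r s" and \<eta>: "\<eta> \<in> smooth_functions A"
  shows "fmult \<eta> \<Psi> \<in> test_densities A r s"
proof -
  note f = test_densitiesD(1)[OF \<Psi>]
  have "is_field A 1 r s (fmult \<eta> \<Psi>)"
  proof (rule is_fieldI)
    fix c x "is" js assume "fmult \<eta> \<Psi> c x is js \<noteq> 0"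
    then have "\<Psi> c x is js \<noteq> 0" by (auto simp: fmult_def)
    then show "c \<in> A \<and> x \<in> cdom c \<and> length is = r \<and> length js = s" using is_field_zero[OF f] by blast
  next
    fix c d x and "is" js :: "'n list"
    assume t: "c \<in> A" "d \<in> A" "x \<in> cdom c" "x \<in> cdom d" "length is = r" "length js = s"
    show "fmult \<eta> \<Psi> d x is js = \<bar>det (jac d c x)\<bar> ^ 1 * act r s (jac c d x) (jac d c x) (fmult \<eta> \<Psi> c x) is js"
      using is_field_act[OF f t] act_cmult[of r s "jac c d x" "jac d c x" "\<eta> x" "\<Psi> c x" "is" js]
      by (simp add: fmult_def)
  qed
  moreover have "Ck_on k (cimg c) (\<lambda>u. fmult \<eta> \<Psi> c (cinv c u) is js)" if "c \<in> A" for c k "is" js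
    unfolding fmult_def
    by (intro Ck_on_mult open_cimg that test_densitiesD(2)[OF \<Psi> that] smooth_functionsD[OF \<eta> that])
  moreover have "compact (field_support (fmult \<eta> \<Psi>))"
  proof -
    have "field_support (fmult \<eta> \<Psi>) \<subseteq> field_support \<Psi>"
      unfolding field_support_def by (rule closure_mono) (auto simp: fmult_def)
    moreover have "closed (field_support (fmult \<eta> \<Psi>))" by (simp add: field_support_def)
    ultimately show ?thesis using compact_Int_closed[OF test_densitiesD(3)[OF \<Psi>], of "field_support (fmult \<eta> \<Psi>)"]
      by (simp add: Int_absorb1)
  qed
  ultimately show ?thesis unfolding test_densities_def Ck_fields_def by blast
qed

lemma smooth_functions_one_minus: "\<eta> \<in> smooth_functions A \<Longrightarrow> (\<lambda>x. 1 - \<eta> x) \<in> smooth_functions A"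
  by (rule smooth_functionsI) (intro Ck_on_diff open_cimg Ck_on_const smooth_functionsD)

text \<open>
  Besides the convergence of the integrals this requires the integrands to be densities for small \<open>\<epsilon>\<close>.
  Otherwise the integrals of two parts of a test density could not be added.
\<close>

definition vanishes_weakly :: "nat \<Rightarrow> nat \<Rightarrow> (real \<Rightarrow> ('m, 'n) tfield) \<Rightarrow> ('m, 'n) tfield \<Rightarrow> bool"
  where "vanishes_weakly r s E \<Psi> \<longleftrightarrow>
    eventually (\<lambda>\<epsilon>. scalar_density (field_support \<Psi>) (contraction r s (E \<epsilon>) \<Psi>)) (at_right 0) \<and>
    ((\<lambda>\<epsilon>. dens_integral A (contraction r s (E \<epsilon>) \<Psi>)) \<longlongrightarrow> 0) (at_right 0)"

lemma vanishes_weakly_split: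
  assumes \<Psi>: "\<Psi> \<in> test_densities A s r" and \<eta>: "\<eta> \<in> smooth_functions A"
    and 1: "vanishes_weakly r s E (fmult \<eta> \<Psi>)" and 2: "vanishes_weakly r s E (fmult (\<lambda>x. 1 - \<eta> x) \<Psi>)"
  shows "vanishes_weakly r s E \<Psi>"
proof -
  define \<Phi> where "\<Phi> b = (if b then fmult \<eta> \<Psi> else fmult (\<lambda>x. 1 - \<eta> x) \<Psi>)" for b
  have sub: "field_support (\<Phi> b) \<subseteq> field_support \<Psi>" for b
    unfolding field_support_def by (rule closure_mono) (auto simp: \<Phi>_def fmult_def split: if_splits)
  have eq: "contraction r s T \<Psi> c x [] [] = (\<Sum>b\<in>UNIV. 1 * contraction r s T (\<Phi> b) c x [] [])" for T c x
  proof -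
    have "\<Psi> = (\<lambda>c x js is. \<Phi> True c x js is + \<Phi> False c x js is)"
      by (simp add: \<Phi>_def fmult_def fun_eq_iff algebra_simps)
    then show ?thesis
      using contraction_add_right[of r s T "\<Phi> True" "\<Phi> False" c x] by (simp add: UNIV_bool)
  qed
  have ev: "eventually (\<lambda>\<epsilon>. \<forall>b. scalar_density (field_support \<Psi>) (contraction r s (E \<epsilon>) (\<Phi> b))) (at_right 0)"
  proof -
    have "eventually (\<lambda>\<epsilon>. scalar_density (field_support (\<Phi> b)) (contraction r s (E \<epsilon>) (\<Phi> b))) (at_right 0)" for b
      using 1 2 unfolding vanishes_weakly_def \<Phi>_def by (cases b) auto
    then have "eventually (\<lambda>\<epsilon>. scalar_density (field_support \<Psi>) (contraction r s (E \<epsilon>) (\<Phi> b))) (at_right 0)" for b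
      by (rule eventually_mono) (rule scalar_density_mono[OF _ sub])
    from eventually_conj[OF this[of True] this[of False]] show ?thesis
      by (rule eventually_mono) (metis (full_types))
  qed
  have lim: "((\<lambda>\<epsilon>. \<Sum>b\<in>UNIV. 1 * dens_integral A (contraction r s (E \<epsilon>) (\<Phi> b))) \<longlongrightarrow> (\<Sum>b\<in>(UNIV :: bool set). 1 * 0)) (at_right 0)"
    by (intro tendsto_intros) (use 1 2 in \<open>auto simp: vanishes_weakly_def \<Phi>_def\<close>)
  show ?thesis unfolding vanishes_weakly_def
  proof
    show "eventually (\<lambda>\<epsilon>. scalar_density (field_support \<Psi>) (contraction r s (E \<epsilon>) \<Psi>)) (at_right 0)"
      using ev
    proof eventually_elim
      case (elim \<epsilon>)
      show ?case by (rule scalar_density_lincomb[where I = "UNIV :: bool set" and a = "\<lambda>_. 1"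
            and \<mu> = "\<lambda>b. contraction r s (E \<epsilon>) (\<Phi> b)" and \<nu> = "contraction r s (E \<epsilon>) \<Psi>", OF _ _ eq]) (use elim in auto)
    qed
    show "((\<lambda>\<epsilon>. dens_integral A (contraction r s (E \<epsilon>) \<Psi>)) \<longlongrightarrow> 0) (at_right 0)"
    proof (rule Lim_transform_eventually)
      show "((\<lambda>\<epsilon>. \<Sum>b\<in>UNIV. 1 * dens_integral A (contraction r s (E \<epsilon>) (\<Phi> b))) \<longlongrightarrow> 0) (at_right 0)"
        using lim by simp
      show "eventually (\<lambda>\<epsilon>. (\<Sum>b\<in>UNIV. 1 * dens_integral A (contraction r s (E \<epsilon>) (\<Phi> b)))
          = dens_integral A (contraction r s (E \<epsilon>) \<Psi>)) (at_right 0)"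
        using ev
      proof eventually_elim
        case (elim \<epsilon>)
        show ?case
          by (rule dens_integral_lincomb[where I = "UNIV :: bool set" and a = "\<lambda>_. 1"
            and \<mu> = "\<lambda>b. contraction r s (E \<epsilon>) (\<Phi> b)" and \<nu> = "contraction r s (E \<epsilon>) \<Psi>", OF _ test_densitiesD(3)[OF \<Psi>] _ eq, symmetric])
            (use elim in auto)
      qed
    qed
  qed
qed

text \<open>
  The compact support of \<open>\<Psi>\<close> is covered by finitely many open sets on each of which a bump function with
  small support equals 1.  Splitting off \<open>\<eta> \<Psi>\<close> for one of these bump functions \<open>\<eta>\<close> leaves \<open>(1 - \<eta>) \<Psi>\<close>,
  which vanishes where \<open>\<eta> = 1\<close>, so that one set of the cover can be dropped.  This takes the place of a
  partition of unity.
\<close>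

lemma vanishes_weakly_local_to_global:
  assumes loc: "\<And>x. \<exists>V. open V \<and> x \<in> V \<and> (\<forall>\<Psi>\<in>test_densities A s r.
      (\<forall>c y is js. \<Psi> c y is js \<noteq> 0 \<longrightarrow> y \<in> V) \<longrightarrow> vanishes_weakly r s E \<Psi>)"
    and \<Psi>: "\<Psi> \<in> test_densities A s r"
  shows "vanishes_weakly r s E \<Psi>"
proof -
  have "\<exists>p. fst p \<in> smooth_functions A \<and> open (snd p) \<and> x \<in> snd p \<and> (\<forall>y\<in>snd p. fst p y = 1) \<and>
      (\<forall>\<Psi>\<in>test_densities A s r. vanishes_weakly r s E (fmult (fst p) \<Psi>))" for x
  proof -
    obtain V where V: "open V" "x \<in> V" "\<And>\<Psi>. \<Psi> \<in> test_densities A s r \<Longrightarrow>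
      (\<forall>c y is js. \<Psi> c y is js \<noteq> 0 \<longrightarrow> y \<in> V) \<Longrightarrow> vanishes_weakly r s E \<Psi>" using loc[of x] by blast
    obtain \<eta> W L where \<eta>: "\<eta> \<in> smooth_functions A" "open W" "x \<in> W" "W \<subseteq> L" "closed L" "L \<subseteq> V"
      "\<And>y. y \<in> W \<Longrightarrow> \<eta> y = 1" "\<And>y. y \<notin> L \<Longrightarrow> \<eta> y = 0"
      using exists_bump_at[OF V(1,2)] by blast
    have "vanishes_weakly r s E (fmult \<eta> \<Psi>)" if "\<Psi> \<in> test_densities A s r" for \<Psi>
    proof (rule V(3)[OF test_densities_fmult[OF that \<eta>(1)]], intro allI impI)
      fix c y "is" js assume "fmult \<eta> \<Psi> c y is js \<noteq> 0"
      then have "\<eta> y \<noteq> 0" by (auto simp: fmult_def)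
      then show "y \<in> V" using \<eta>(6,8) by blast
    qed
    then show ?thesis using \<eta>(1-3,7) by (intro exI[of _ "(\<eta>, W)"]) auto
  qed
  then obtain p where p: "\<And>x. fst (p x) \<in> smooth_functions A" "\<And>x. open (snd (p x))" "\<And>x. x \<in> snd (p x)"
    "\<And>x y. y \<in> snd (p x) \<Longrightarrow> fst (p x) y = 1"
    "\<And>x \<Psi>. \<Psi> \<in> test_densities A s r \<Longrightarrow> vanishes_weakly r s E (fmult (fst (p x)) \<Psi>)"
    using choice[of "\<lambda>x p. fst p \<in> smooth_functions A \<and> open (snd p) \<and> x \<in> snd p \<and> (\<forall>y\<in>snd p. fst p y = 1) \<and>
      (\<forall>\<Psi>\<in>test_densities A s r. vanishes_weakly r s E (fmult (fst p) \<Psi>))"] by blast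
  have main: "vanishes_weakly r s E \<Psi>"
    if "\<Psi> \<in> test_densities A s r" "\<And>c y is js. \<Psi> c y is js \<noteq> 0 \<Longrightarrow> y \<in> (\<Union>x\<in>set xs. snd (p x))" for xs \<Psi>
    using that
  proof (induction xs arbitrary: \<Psi>)
    case Nil
    then have z: "\<Psi> c y is js = 0" for c y "is" js by fastforce
    have con: "contraction r s T \<Psi> c y [] [] = (\<Sum>b\<in>({} :: bool set). 1 * (\<lambda>_. \<Psi>) b c y [] [])" for T c y
      by (simp add: contraction_def z)
    have sd: "scalar_density (field_support \<Psi>) (contraction r s T \<Psi>)" for T
      by (rule scalar_density_lincomb[where I = "{} :: bool set" and a = "\<lambda>_. 1" and \<mu> = "\<lambda>_. \<Psi>"
          and \<nu> = "contraction r s T \<Psi>", OF _ _ con]) auto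
    have di: "dens_integral A (contraction r s T \<Psi>) = 0" for T
      using dens_integral_lincomb[where I = "{} :: bool set" and a = "\<lambda>_. 1" and \<mu> = "\<lambda>_. \<Psi>" and \<nu> = "contraction r s T \<Psi>",
        OF _ test_densitiesD(3)[OF Nil(1)] _ con] by simp
    show ?case by (simp add: vanishes_weakly_def sd di)
  next
    case (Cons x xs)
    let ?\<eta> = "fst (p x)"
    show ?case
    proof (rule vanishes_weakly_split[OF Cons.prems(1) p(1)])
      show "vanishes_weakly r s E (fmult ?\<eta> \<Psi>)" by (rule p(5)[OF Cons.prems(1)])
      show "vanishes_weakly r s E (fmult (\<lambda>y. 1 - ?\<eta> y) \<Psi>)"
      proof (rule Cons.IH[OF test_densities_fmult[OF Cons.prems(1) smooth_functions_one_minus[OF p(1)]]])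
        fix c y "is" js assume "fmult (\<lambda>y. 1 - ?\<eta> y) \<Psi> c y is js \<noteq> 0"
        then have "?\<eta> y \<noteq> 1" "\<Psi> c y is js \<noteq> 0" by (auto simp: fmult_def)
        then show "y \<in> (\<Union>x\<in>set xs. snd (p x))" using Cons.prems(2)[of c y "is" js] p(4)[of y x] by auto
      qed
    qed
  qed
  have "field_support \<Psi> \<subseteq> \<Union> (range (\<lambda>x. snd (p x)))" using p(3) by blast
  then obtain \<V> where \<V>: "\<V> \<subseteq> range (\<lambda>x. snd (p x))" "finite \<V>" "field_support \<Psi> \<subseteq> \<Union> \<V>"
    using compactE[OF test_densitiesD(3)[OF \<Psi>]] p(2) by (metis (no_types, lifting) rangeE)
  obtain X where X: "finite X" "\<V> = (\<lambda>x. snd (p x)) ` X" using finite_subset_image[OF \<V>(2,1)] by blast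
  obtain xs where xs: "set xs = X" using finite_list[OF X(1)] by blast
  show ?thesis
  proof (rule main[OF \<Psi>])
    fix c y "is" js assume "\<Psi> c y is js \<noteq> 0"
    then have "y \<in> field_support \<Psi>" by (rule field_support_subset[of \<Psi> c y "is" js])
    then show "y \<in> (\<Union>x\<in>set xs. snd (p x))" using \<V>(3) X(2) xs by blast
  qed
qed

end

section \<open>Association of the covariant derivatives\<close>

context connection begin

text \<open>
  The reduction of the theorem to \<open>weak_derivative_limit\<close> in a coordinate box around \<open>x\<close>, separately for
  each pair of multiindices.
\<close>

lemma nabla_iota_vanishes_locally:
  assumes S: "S \<in> Ck_tensor_fields A 1 r s" and Z: "Z \<in> vector_fields A"
    and \<omega>: "\<omega> \<in> delta_nets A" and \<Upsilon>: "\<Upsilon> \<in> admissible_nets A"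
  defines "E \<equiv> \<lambda>\<epsilon>. nabla A D Z (iota A r s (dist_of A r s S) (\<Upsilon> \<epsilon>) (\<omega> \<epsilon>))
      - iota A r s (dist_of A r s (nabla A D Z S)) (\<Upsilon> \<epsilon>) (\<omega> \<epsilon>)"
  shows "\<exists>V. open V \<and> x \<in> V \<and> (\<forall>\<Psi>\<in>test_densities A s r.
      (\<forall>c y is js. \<Psi> c y is js \<noteq> 0 \<longrightarrow> y \<in> V) \<longrightarrow> vanishes_weakly r s E \<Psi>)"
proof -
  have St: "continuous_tensor r s S" by (rule Ck_fields_continuous_tensor[OF S])
  have Nt: "continuous_tensor r s (nabla A D Z S)" by (rule nabla_continuous_tensor[OF Z S])
  have SCk: "Ck_on (Suc 0) (cimg c) (\<lambda>u. S c (cinv c u) is js)" if "c \<in> A" for c "is" js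
    using S that unfolding Ck_fields_def by simp
  define T where "T \<epsilon> = iota A r s (dist_of A r s S) (\<Upsilon> \<epsilon>) (\<omega> \<epsilon>)" for \<epsilon>
  define N where "N \<epsilon> = iota A r s (dist_of A r s (nabla A D Z S)) (\<Upsilon> \<epsilon>) (\<omega> \<epsilon>)" for \<epsilon>
  have Eapp: "E \<epsilon> c y is js = nabla A D Z (T \<epsilon>) c y is js - N \<epsilon> c y is js" for \<epsilon> c y "is" js
    by (simp add: E_def T_def N_def)
  obtain c where c: "c \<in> A" "x \<in> cdom c" using ex_chart by blast
  define u0 where "u0 = cmap c x"
  obtain M C where M: "open M" "u0 \<in> M" "M \<subseteq> cimg c" "C \<ge> 0"
    "eventually (\<lambda>\<epsilon>. \<forall>a b u v i j. cbox a b \<subseteq> M \<longrightarrow> u \<in> cbox a b \<longrightarrow> v \<in> cbox a b \<longrightarrow>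
      \<bar>umat (\<Upsilon> \<epsilon>) c c (cinv c u) (cinv c v) $ i $ j - mat 1 $ i $ j\<bar> \<le> C * dist u v) (at_right 0)"
    unfolding u0_def by (rule transport_near_diagonal[OF \<Upsilon> c])
  obtain a b where ab: "cbox a b \<subseteq> M" "u0 \<in> box a b" by (rule open_contains_cbox[OF M(1,2)]) (rule that)
  obtain \<rho> where \<rho>: "\<rho> > 0" "cball u0 (2 * \<rho>) \<subseteq> cbox a b"
  proof -
    obtain d where "d > 0" "cball u0 d \<subseteq> box a b" using open_contains_cball[THEN iffD1, OF open_box] ab(2) by blast
    then show ?thesis using that[of "d / 2"] box_subset_cbox[of a b] by auto
  qed
  have Q: "cbox a b \<subseteq> cimg c" using ab(1) M(3) by blast
  define B where "B = cball u0 \<rho>"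
  define U where "U = ball u0 \<rho>"
  define L where "L = cball u0 (\<rho> / 2)"
  have B: "compact B" "\<forall>u\<in>B. cball u \<rho> \<subseteq> cbox a b"
  proof -
    show "compact B" by (simp add: B_def)
    have "cball u \<rho> \<subseteq> cball u0 (2 * \<rho>)" if "u \<in> B" for u
    proof
      fix v assume "v \<in> cball u \<rho>"
      then show "v \<in> cball u0 (2 * \<rho>)" using that dist_triangle[of u0 v u] by (simp add: B_def)
    qed
    then show "\<forall>u\<in>B. cball u \<rho> \<subseteq> cbox a b" using \<rho>(2) by blast
  qed
  have U: "open U" "U \<subseteq> B" "L \<subseteq> U" "compact L" "u0 \<in> ball u0 (\<rho> / 2)"
    using \<rho>(1) by (auto simp: U_def B_def L_def)
  have BQ: "B \<subseteq> cbox a b"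
  proof
    fix u assume "u \<in> B"
    then show "u \<in> cbox a b" using B(2) \<rho>(1) by (meson centre_in_cball less_imp_le subsetD)
  qed
  have sub: "U \<subseteq> cimg c" "L \<subseteq> cbox a b" "U \<subseteq> cbox a b" "L \<subseteq> cimg c" "B \<subseteq> cimg c" using U BQ Q by blast+
  have evC: "eventually (\<lambda>\<epsilon>. \<forall>u v i j. u \<in> cbox a b \<longrightarrow> v \<in> cbox a b \<longrightarrow>
      \<bar>umat (\<Upsilon> \<epsilon>) c c (cinv c u) (cinv c v) $ i $ j - mat 1 $ i $ j\<bar> \<le> C * dist u v) (at_right 0)"
    using M(5) by (rule eventually_mono) (use ab(1) in blast)
  note close = iota_uniformly_close[OF _ \<Upsilon> \<omega> c(1) Q B(1) \<rho>(1) B(2) M(4) evC]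
  have "\<forall>\<epsilon>\<in>{0<..1}. \<Upsilon> \<epsilon> \<in> TO A"
    using \<Upsilon>[unfolded admissible_nets_def mem_Collect_eq, THEN conjunct1] .
  then have evTO: "eventually (\<lambda>\<epsilon>. \<Upsilon> \<epsilon> \<in> TO A) (at_right 0)"
    using eventually_small[OF zero_less_one] by (auto elim: eventually_mono)
  note evSK = delta_nets_local(1)[OF \<omega> c(1) B(1) compact_cbox Q \<rho>(1) B(2)]
  note evsupp = delta_nets_local(4)[OF \<omega> c(1) B(1) compact_cbox Q \<rho>(1) B(2) \<rho>(1) order.refl]
  \<comment> \<open>for these \<open>\<epsilon>\<close> the embeddings are given on \<open>U\<close> by integrals over the box\<close>
  define good where "good \<epsilon> \<longleftrightarrow> \<Upsilon> \<epsilon> \<in> TO A \<and> \<omega> \<epsilon> \<in> SK A \<and> (\<forall>u\<in>U. field_support (\<omega> \<epsilon> (cinv c u)) \<subseteq> cinv c ` cbox a b)" for \<epsilon>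
  have evgood: "eventually good (at_right 0)"
    using evTO evSK evsupp
  proof eventually_elim
    case (elim \<epsilon>)
    have "field_support (\<omega> \<epsilon> (cinv c u)) \<subseteq> cinv c ` cbox a b" if "u \<in> U" for u
    proof -
      have "u \<in> B" using that U(2) by blast
      then have "field_support (\<omega> \<epsilon> (cinv c u)) \<subseteq> cinv c ` ball u \<rho>" "ball u \<rho> \<subseteq> cbox a b"
        using elim(3) B(2) ball_subset_cball[of u \<rho>] by blast+
      then show ?thesis by blast
    qed
    then show ?case using elim by (simp add: good_def)
  qed
  have TC1: "Ck_on (Suc 0) U (\<lambda>u. T \<epsilon> c (cinv c u) is js)" and NC1: "Ck_on (Suc 0) U (\<lambda>u. N \<epsilon> c (cinv c u) is js)"
    if "good \<epsilon>" "length is = r" "length js = s" for \<epsilon> "is" js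
    using that unfolding T_def N_def good_def
    by (intro iota_C1[OF St _ _ c(1) Q U(1) sub(1)] iota_C1[OF Nt _ _ c(1) Q U(1) sub(1)]; blast)+
  have Tf: "is_field A 0 r s (T \<epsilon>)" and Nf: "is_field A 0 r s (N \<epsilon>)" if "good \<epsilon>" for \<epsilon>
    using that SK_test_density unfolding T_def N_def good_def
    by (intro iota_is_field St Nt; blast)+
  define V where "V = cinv c ` U"
  have cV: "cmap c ` V = U" unfolding V_def by (rule cmap_image_cinv[OF c(1) sub(1)])
  have V: "open V" "V \<subseteq> cdom c"
    unfolding V_def using open_cinv_image[OF c(1) U(1) sub(1)] cinv_in[OF c(1)] sub(1) by blast+
  have Etr: "E \<epsilon> d y is js = act r s (jac c d y) (jac d c y) (E \<epsilon> c y) is js"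
    if g: "good \<epsilon>" and d: "d \<in> A" "y \<in> V" "y \<in> cdom d" and len: "length is = r" "length js = s" for \<epsilon> d y "is" js
  proof -
    have yc: "y \<in> cdom c" using d V by blast
    have yU: "cmap c y \<in> U" using d(2) cV by blast
    have "nabla A D Z (T \<epsilon>) d y is js = act r s (jac c d y) (jac d c y) (nabla A D Z (T \<epsilon>) c y) is js"
      by (rule nabla_transform[OF Z Tf[OF g] c(1) d(1) yc d(3) differentiableI[OF Ck_on_SucD[OF TC1[OF g] U(1) yU]] len])
    moreover have "N \<epsilon> d y is js = act r s (jac c d y) (jac d c y) (N \<epsilon> c y) is js"
      using is_field_act[OF Nf[OF g] c(1) d(1) yc d(3) len] by simp
    moreover have "E \<epsilon> c y = (\<lambda>ks ls. nabla A D Z (T \<epsilon>) c y ks ls - N \<epsilon> c y ks ls)"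
      by (simp add: fun_eq_iff Eapp)
    ultimately show ?thesis by (simp add: Eapp act_diff)
  qed
  have Econt: "continuous_on U (\<lambda>u. E \<epsilon> c (cinv c u) is js)"
    if g: "good \<epsilon>" and len: "length is = r" "length js = s" for \<epsilon> "is" js
    unfolding Eapp
    by (intro continuous_on_diff Ck_on_continuous[OF NC1[OF g len]]
      nabla_continuous_on[where T="T \<epsilon>", OF Z c(1) U(1) sub(1) TC1[OF g] len])
  show ?thesis
  proof (intro exI[of _ "cinv c ` ball u0 (\<rho> / 2)"] conjI ballI impI)
    have bL: "ball u0 (\<rho> / 2) \<subseteq> L" unfolding L_def by (rule ball_subset_cball)
    then have bc: "ball u0 (\<rho> / 2) \<subseteq> cimg c" using sub(4) by (rule order.trans)
    show "open (cinv c ` ball u0 (\<rho> / 2))" by (rule open_cinv_image[OF c(1) open_ball bc])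
    show "x \<in> cinv c ` ball u0 (\<rho> / 2)"
      by (rule image_eqI[OF _ U(5)]) (simp add: u0_def cinv_cmap[OF c])
    fix \<Psi> assume \<Psi>: "\<Psi> \<in> test_densities A s r"
      and nz: "\<forall>c' y is js. \<Psi> c' y is js \<noteq> 0 \<longrightarrow> y \<in> cinv c ` ball u0 (\<rho> / 2)"
    have supp: "field_support \<Psi> \<subseteq> cinv c ` L"
      unfolding field_support_def
    proof (rule closure_minimal)
      show "{x. \<exists>c is js. \<Psi> c x is js \<noteq> 0} \<subseteq> cinv c ` L" using nz bL by blast
      show "closed (cinv c ` L)" by (intro compact_imp_closed compact_cinv_image c U(4) sub)
    qed
    have suppV: "field_support \<Psi> \<subseteq> V" using supp U(3) unfolding V_def by blast
    have suppQ: "field_support \<Psi> \<subseteq> cinv c ` cbox a b" using supp sub(2) by blast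
    have sd: "scalar_density (field_support \<Psi>) (contraction r s (E \<epsilon>) \<Psi>)" if g: "good \<epsilon>" for \<epsilon>
      by (rule pairing_density[OF \<Psi> c(1) V suppV Etr[OF g]]) (use Econt[OF g] cV in simp_all)
    define \<psi> where "\<psi> js is u = \<Psi> c (cinv c u) js is" for js "is" u
    have \<psi>C: "Ck_on (Suc 0) U (\<psi> js is)" for "is" js
      unfolding \<psi>_def[abs_def] by (rule Ck_on_subset[OF test_densitiesD(2)[OF \<Psi> c(1)] sub(1)])
    have \<psi>z: "\<psi> js is u = 0" if u: "u \<in> cimg c" "u \<notin> L" for u "is" js
    proof (rule ccontr)
      assume "\<psi> js is u \<noteq> 0"
      then have "cinv c u \<in> field_support \<Psi>" unfolding \<psi>_def by (rule field_support_subset[of \<Psi> c "cinv c u" js "is"])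
      then obtain v where v: "v \<in> L" "cinv c u = cinv c v" using supp by blast
      then have "u = v" using cmap_cinv[OF c(1) u(1)] cmap_cinv[OF c(1), of v] sub(4) by auto
      then show False using v u by simp
    qed
    define I where "I = {is :: 'n list. length is = r}"
    define J where "J = {js :: 'n list. length js = s}"
    have fin: "finite I" "finite J" by (simp_all add: I_def J_def)
    define f where "f is js \<epsilon> u = (if u \<in> U then E \<epsilon> c (cinv c u) is js * \<psi> js is u else 0)" for "is" js \<epsilon> u
    have int_eq: "dens_integral A (contraction r s (E \<epsilon>) \<Psi>) = (\<Sum>is\<in>I. \<Sum>js\<in>J. integral (cbox a b) (f is js \<epsilon>))"
      if g: "good \<epsilon>" for \<epsilon>
    proof -
      have fc: "continuous_on UNIV (f is js \<epsilon>)" if "is \<in> I" "js \<in> J" for "is" js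
      proof -
        have "Ck_on 0 UNIV (f is js \<epsilon>)" unfolding f_def[abs_def]
          by (rule Ck_on_extend_zero[OF U(1) compact_imp_closed[OF U(4)] _ _ U(3)])
            (use Econt[OF g] that \<psi>C[THEN Ck_on_continuous] sub(1) \<psi>z in \<open>auto simp: I_def J_def intro!: continuous_on_mult\<close>)
        then show ?thesis by simp
      qed
      have "dens_integral A (contraction r s (E \<epsilon>) \<Psi>) = integral (cbox a b) (coord (contraction r s (E \<epsilon>) \<Psi>) c)"
        by (rule dens_integral_chart[OF sd[OF g] c(1) suppQ Q])
      also have "\<dots> = integral (cbox a b) (\<lambda>u. \<Sum>is\<in>I. \<Sum>js\<in>J. f is js \<epsilon> u)"
      proof (rule integral_cong)
        fix u assume u: "u \<in> cbox a b"
        have "f is js \<epsilon> u = E \<epsilon> c (cinv c u) is js * \<psi> js is u" for "is" js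
        proof (cases "u \<in> U")
          case False
          then have "\<psi> js is u = 0" using \<psi>z u Q U(3) by blast
          then show ?thesis by (simp add: f_def)
        qed (simp add: f_def)
        then show "coord (contraction r s (E \<epsilon>) \<Psi>) c u = (\<Sum>is\<in>I. \<Sum>js\<in>J. f is js \<epsilon> u)"
          by (simp add: coord_def contraction_pairing pairing_def \<psi>_def I_def J_def)
      qed
      also have "\<dots> = (\<Sum>is\<in>I. \<Sum>js\<in>J. integral (cbox a b) (f is js \<epsilon>))"
        using fc by (simp add: integral_sum fin integrable_sum integrable_continuous continuous_on_subset[OF fc subset_UNIV])
      finally show ?thesis .
    qed
    have lim: "((\<lambda>\<epsilon>. integral (cbox a b) (f is js \<epsilon>)) \<longlongrightarrow> 0) (at_right 0)" if "is": "is \<in> I" "js \<in> J" for "is" js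
    proof -
      have len: "length is = r" "length js = s" using "is" by (simp_all add: I_def J_def)
      define G where "G u = conn Z c (cinv c u)" for u
      define R where "R ks ls \<epsilon> u = T \<epsilon> c (cinv c u) ks ls - S c (cinv c u) ks ls" for ks ls \<epsilon> u
      \<comment> \<open>the part of \<open>\<nabla>\<^sub>Z R + (\<nabla>\<^sub>Z S - N)\<close> that does not contain derivatives of \<open>R\<close>\<close>
      define H where "H \<epsilon> u = (\<Sum>i<r. \<Sum>m\<in>UNIV. G u $ (is ! i) $ m * R (is[i := m]) js \<epsilon> u)
        - (\<Sum>i<s. \<Sum>m\<in>UNIV. G u $ m $ (js ! i) * R is (js[i := m]) \<epsilon> u)
        + (nabla A D Z S c (cinv c u) is js - N \<epsilon> c (cinv c u) is js)" for \<epsilon> u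
      have Gc: "continuous_on B (\<lambda>u. G u $ i $ j)" for i j
        unfolding G_def by (rule continuous_on_subset[OF Ck_on_continuous[OF Ck_on_conn[OF Z c(1), of 0]] sub(5)])
      have RC: "Ck_on (Suc 0) U (R ks ls \<epsilon>)" if "good \<epsilon>" "length ks = r" "length ls = s" for ks ls \<epsilon>
        unfolding R_def[abs_def] by (intro Ck_on_diff U(1) TC1 that Ck_on_subset[OF SCk[OF c(1)] sub(1)])
      have HC: "continuous_on U (H \<epsilon>)" if g: "good \<epsilon>" for \<epsilon>
        unfolding H_def[abs_def]
        by (intro continuous_on_add continuous_on_diff continuous_on_sum continuous_on_mult
          continuous_on_subset[OF Gc U(2)] Ck_on_continuous[OF RC[OF g]] Ck_on_continuous[OF NC1[OF g]]
          continuous_on_subset[OF continuous_tensorD(2)[OF Nt c(1)] sub(1)]) (simp_all add: len)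
      have "\<exists>g. \<forall>u\<in>B. \<bar>G u $ i $ j\<bar> \<le> g" for i j
        using compact_imp_bounded[OF compact_continuous_image[OF Gc B(1)]] unfolding bounded_iff by auto
      then obtain g0 where g0: "\<And>i j u. u \<in> B \<Longrightarrow> \<bar>G u $ i $ j\<bar> \<le> g0 i j" by metis
      define g where "g = (\<Sum>i\<in>UNIV. \<Sum>j\<in>UNIV. \<bar>g0 i j\<bar>)"
      have g: "\<bar>G u $ i $ j\<bar> \<le> g" if "u \<in> B" for u i j
      proof -
        have "\<bar>G u $ i $ j\<bar> \<le> \<bar>g0 i j\<bar>" using g0[OF that, of i j] by linarith
        also have "\<dots> \<le> (\<Sum>j\<in>UNIV. \<bar>g0 i j\<bar>)" by (rule member_le_sum) auto
        also have "\<dots> \<le> g" unfolding g_def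
          by (rule member_le_sum[where f="\<lambda>i. \<Sum>j\<in>UNIV. \<bar>g0 i j\<bar>"]) (auto simp: sum_nonneg)
        finally show ?thesis .
      qed
      have "g \<ge> 0" unfolding g_def by (intro sum_nonneg) simp
      \<comment> \<open>\<open>k\<close> counts the terms of \<open>H\<close>, weighted with the bound \<open>g\<close> of the connection matrix; the summand 1
        stands for \<open>\<nabla>\<^sub>Z S - N\<close>\<close>
      define k where "k = (real r + real s) * (real (CARD('n)) * g) + 1"
      have k: "k \<ge> 1" using \<open>g \<ge> 0\<close> by (simp add: k_def)
      have small: "eventually (\<lambda>\<epsilon>. \<forall>u\<in>L. \<bar>R is js \<epsilon> u\<bar> \<le> e \<and> \<bar>H \<epsilon> u\<bar> \<le> e) (at_right 0)" if e: "e > 0" for e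
      proof -
        define e' where "e' = e / k"
        have e': "e' > 0" "k * e' = e" "e' \<le> e" using e k by (simp_all add: e'_def field_simps)
        have "eventually (\<lambda>\<epsilon>. \<forall>u\<in>B. \<bar>R ks ls \<epsilon> u\<bar> \<le> e') (at_right 0)" if "ks \<in> I" "ls \<in> J" for ks ls
          using close[OF St _ _ e'(1), of ks ls] that by (simp add: R_def T_def I_def J_def)
        then have "eventually (\<lambda>\<epsilon>. \<forall>ks\<in>I. \<forall>ls\<in>J. \<forall>u\<in>B. \<bar>R ks ls \<epsilon> u\<bar> \<le> e') (at_right 0)"
          by (intro eventually_ball_finite[OF fin(1)] eventually_ball_finite[OF fin(2)] ballI)
        moreover have "eventually (\<lambda>\<epsilon>. \<forall>u\<in>B. \<bar>N \<epsilon> c (cinv c u) is js - nabla A D Z S c (cinv c u) is js\<bar> \<le> e') (at_right 0)"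
          using close[OF Nt len e'(1)] by (simp add: N_def)
        ultimately show ?thesis
        proof eventually_elim
          case (elim \<epsilon>)
          show ?case
          proof
            fix u assume "u \<in> L"
            then have u: "u \<in> B" using U by blast
            have Rb: "\<bar>R ks ls \<epsilon> u\<bar> \<le> e'" if "length ks = r" "length ls = s" for ks ls
              using elim(1) u that by (simp add: I_def J_def)
            have prod: "\<bar>G u $ i $ j * R ks ls \<epsilon> u\<bar> \<le> g * e'" if "length ks = r" "length ls = s" for i j ks ls
              unfolding abs_mult by (rule mult_mono[OF g[OF u] Rb[OF that] \<open>g \<ge> 0\<close>]) simp
            have s1: "\<bar>\<Sum>i<r. \<Sum>m\<in>UNIV. G u $ (is ! i) $ m * R (is[i := m]) js \<epsilon> u\<bar> \<le> (\<Sum>i<r. \<Sum>m\<in>(UNIV :: 'n set). g * e')"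
              by (intro order.trans[OF sum_abs] sum_mono prod) (simp_all add: len)
            have s2: "\<bar>\<Sum>i<s. \<Sum>m\<in>UNIV. G u $ m $ (js ! i) * R is (js[i := m]) \<epsilon> u\<bar> \<le> (\<Sum>i<s. \<Sum>m\<in>(UNIV :: 'n set). g * e')"
              by (intro order.trans[OF sum_abs] sum_mono prod) (simp_all add: len)
            have s3: "\<bar>nabla A D Z S c (cinv c u) is js - N \<epsilon> c (cinv c u) is js\<bar> \<le> e'"
              using elim(2) u by (simp add: abs_minus_commute)
            have "\<bar>H \<epsilon> u\<bar> \<le> (\<Sum>i<r. \<Sum>m\<in>(UNIV :: 'n set). g * e') + (\<Sum>i<s. \<Sum>m\<in>(UNIV :: 'n set). g * e') + e'"
              unfolding H_def using s1 s2 s3 by linarith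
            also have "\<dots> = k * e'" by (simp add: k_def algebra_simps)
            finally have "\<bar>H \<epsilon> u\<bar> \<le> e" using e'(2) by simp
            moreover have "\<bar>R is js \<epsilon> u\<bar> \<le> e" using Rb[OF len] e'(3) by linarith
            ultimately show "\<bar>R is js \<epsilon> u\<bar> \<le> e \<and> \<bar>H \<epsilon> u\<bar> \<le> e" by simp
          qed
        qed
      qed
      show ?thesis
      proof (rule weak_derivative_limit[where U=U and L=L and \<psi>="\<psi> js is" and z="\<lambda>u i. Z c (cinv c u) [i] []" and R="R is js" and H=H,
          OF U(1,4,3) sub(2) \<psi>C _ _ _ small])
        show "\<psi> js is u = 0" if "u \<in> U - L" for u using that sub(1) \<psi>z by blast
        show "Ck_on (Suc 0) U (\<lambda>u. Z c (cinv c u) [i] [])" for i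
          by (rule Ck_on_subset[OF vector_fieldsD(2)[OF Z c(1)] sub(1)])
        show "eventually (\<lambda>\<epsilon>. Ck_on (Suc 0) U (R is js \<epsilon>) \<and> continuous_on U (H \<epsilon>)) (at_right 0)"
          using evgood by (rule eventually_mono) (use RC[OF _ len] HC in blast)
        show "eventually (\<lambda>\<epsilon>. \<forall>u\<in>cbox a b. f is js \<epsilon> u = (if u \<in> U then
            ((\<Sum>i\<in>UNIV. Z c (cinv c u) [i] [] * frechet_derivative (R is js \<epsilon>) (at u) (axis i 1)) + H \<epsilon> u) * \<psi> js is u
            else 0)) (at_right 0)"
          using evgood
        proof eventually_elim
          case (elim \<epsilon>)
          have "E \<epsilon> c (cinv c u) is js = (\<Sum>i\<in>UNIV. Z c (cinv c u) [i] [] * frechet_derivative (R is js \<epsilon>) (at u) (axis i 1)) + H \<epsilon> u"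
            if u: "u \<in> U" for u
          proof -
            have uc: "u \<in> cimg c" using u sub(1) by blast
            have y: "cinv c u \<in> cdom c" "cmap c (cinv c u) = u" using cinv_in[OF c(1) uc] cmap_cinv[OF c(1) uc] .
            have dT: "((\<lambda>u. T \<epsilon> c (cinv c u) is js) has_derivative frechet_derivative (\<lambda>u. T \<epsilon> c (cinv c u) is js) (at u)) (at u)"
              by (rule Ck_on_SucD[OF TC1[OF elim len] U(1) u])
            have dS: "((\<lambda>u. S c (cinv c u) is js) has_derivative frechet_derivative (\<lambda>u. S c (cinv c u) is js) (at u)) (at u)"
              by (rule Ck_on_SucD[OF SCk[OF c(1)] open_cimg[OF c(1)] uc])
            have dR: "(R is js \<epsilon> has_derivative (\<lambda>h. frechet_derivative (\<lambda>u. T \<epsilon> c (cinv c u) is js) (at u) h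
                - frechet_derivative (\<lambda>u. S c (cinv c u) is js) (at u) h)) (at u)"
              unfolding R_def[abs_def] by (rule has_derivative_diff[OF dT dS])
            have eT: "nabla A D Z (T \<epsilon>) c (cinv c u) is js = frechet_derivative (\<lambda>u. T \<epsilon> c (cinv c u) is js) (at u) (vcomp Z c (cinv c u))
              + (\<Sum>i<r. \<Sum>m\<in>UNIV. G u $ (is ! i) $ m * T \<epsilon> c (cinv c u) (is[i := m]) js)
              - (\<Sum>i<s. \<Sum>m\<in>UNIV. G u $ m $ (js ! i) * T \<epsilon> c (cinv c u) is (js[i := m]))"
              unfolding G_def by (rule nabla_expand[where T="T \<epsilon>", OF c(1) y(1) len, unfolded y(2), OF dT])
            have eS: "nabla A D Z S c (cinv c u) is js = frechet_derivative (\<lambda>u. S c (cinv c u) is js) (at u) (vcomp Z c (cinv c u))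
              + (\<Sum>i<r. \<Sum>m\<in>UNIV. G u $ (is ! i) $ m * S c (cinv c u) (is[i := m]) js)
              - (\<Sum>i<s. \<Sum>m\<in>UNIV. G u $ m $ (js ! i) * S c (cinv c u) is (js[i := m]))"
              unfolding G_def by (rule nabla_expand[where T=S, OF c(1) y(1) len, unfolded y(2), OF dS])
            have "(\<Sum>i\<in>UNIV. Z c (cinv c u) [i] [] * frechet_derivative (R is js \<epsilon>) (at u) (axis i 1))
              = frechet_derivative (\<lambda>u. T \<epsilon> c (cinv c u) is js) (at u) (vcomp Z c (cinv c u))
                - frechet_derivative (\<lambda>u. S c (cinv c u) is js) (at u) (vcomp Z c (cinv c u))"
              using linear_vec_expand[OF has_derivative_linear[OF dR], of "vcomp Z c (cinv c u)"]
              by (simp add: vcomp_def frechet_derivative_at[OF dR, symmetric])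
            then show ?thesis
              unfolding Eapp H_def using eT eS
              by (simp add: R_def right_diff_distrib sum_subtractf)
          qed
          then show ?case by (simp add: f_def)
        qed
      qed
    qed
    show "vanishes_weakly r s E \<Psi>"
      unfolding vanishes_weakly_def
    proof
      show "eventually (\<lambda>\<epsilon>. scalar_density (field_support \<Psi>) (contraction r s (E \<epsilon>) \<Psi>)) (at_right 0)"
        using evgood by (rule eventually_mono) (rule sd)
      have "((\<lambda>\<epsilon>. \<Sum>is\<in>I. \<Sum>js\<in>J. integral (cbox a b) (f is js \<epsilon>)) \<longlongrightarrow> (\<Sum>is\<in>I. \<Sum>js\<in>J. 0)) (at_right 0)"
        by (intro tendsto_sum lim)
      then have "((\<lambda>\<epsilon>. \<Sum>is\<in>I. \<Sum>js\<in>J. integral (cbox a b) (f is js \<epsilon>)) \<longlongrightarrow> 0) (at_right 0)" by simp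
      then show "((\<lambda>\<epsilon>. dens_integral A (contraction r s (E \<epsilon>) \<Psi>)) \<longlongrightarrow> 0) (at_right 0)"
        by (rule Lim_transform_eventually) (use evgood int_eq in \<open>auto elim!: eventually_mono\<close>)
    qed
  qed
qed

end

theorem proposition24:
  fixes A :: "('m::t2_space, 'n::finite) chart set"
    and D :: "('m, 'n) tfield \<Rightarrow> ('m, 'n) tfield \<Rightarrow> ('m, 'n) tfield"
    and r s :: nat
    and S Z :: "('m, 'n) tfield"
  assumes "smooth_manifold A"
    and "S \<in> Ck_tensor_fields A 1 r s"
    and "Z \<in> vector_fields A"
    and "covariant_derivative A D"
  shows "assoc A r s
           (gen_nabla A D Z (iota A r s (dist_of A r s S)))
           (iota A r s (dist_of A r s (nabla A D Z S)))"
proof -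
  interpret connection A D
    by unfold_locales (rule assms)+
  show ?thesis
    unfolding assoc_def assoc_zero_def
  proof (intro ballI)
    fix \<Psi> \<omega> \<Upsilon> assume \<Psi>: "\<Psi> \<in> test_densities A s r" and \<omega>: "\<omega> \<in> delta_nets A" and \<Upsilon>: "\<Upsilon> \<in> admissible_nets A"
    from vanishes_weakly_local_to_global[OF nabla_iota_vanishes_locally[OF assms(2,3) \<omega> \<Upsilon>] \<Psi>]
    show "((\<lambda>\<epsilon>. dens_integral A (contraction r s ((gen_nabla A D Z (iota A r s (dist_of A r s S))
        - iota A r s (dist_of A r s (nabla A D Z S))) (\<Upsilon> \<epsilon>) (\<omega> \<epsilon>)) \<Psi>)) \<longlongrightarrow> 0) (at_right 0)"
      by (simp add: vanishes_weakly_def gen_nabla_def)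
  qed
qed

end
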